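(* Let $\mathcal G$ be a metric graph as in the context. The free Schrödinger semigroup (heat semigroup) $(T_{C_0}(t))_{t\ge0}$ on $C_0(\mathcal G)$, generated by the Kirchhoff Laplacian $\Delta_{C_0}$, is a Feller semigroup. It also has the strong Feller property.
   Context: **Metric graph.** $\mathcal G$ is the metric graph over a countable, oriented, connected graph with vertex set $\mathcal V$ and edge set $\mathcal E$, without self-loops, uniformly locally finite: writing $\mathcal E_{\mathsf v}$ for the set of edges incident to $\mathsf v$, $\sup_{\mathsf v}|\mathcal E_{\mathsf v}|<\infty$. Every edge $\mathsf e$ has an initial vertex $i(\mathsf e)$, a terminal vertex $t(\mathsf e)$ and a length with $0<\ell_\downarrow\le|\mathsf e|\le\ell_\uparrow<\infty$, and is identified with $(0,|\mathsf e|)$ ($0\leftrightarrow i(\mathsf e)$, $|\mathsf e|\leftrightarrow t(\mathsf e)$). $\mathcal G$ carries the natural path metric. Each edge has a conductivity $c(\mathsf e)>0$. **Operator.** $C_0(\mathcal G)$ is the space of continuous functions on $\mathcal G$ vanishing at infinity with the sup-norm. Normal derivative: $\frac{\partial u_{\mathsf e}}{\partial n_{\mathsf e}}(\mathsf v)=c(\mathsf e)u'_{\mathsf e}(0^+)$ if $\mathsf v=i(\mathsf e)$, and $-c(\mathsf e)u'_{\mathsf e}(|\mathsf e|^-)$ if $\mathsf v=t(\mathsf e)$. $(\Delta_{C_0}u)_{\mathsf e}=u''_{\mathsf e}$ with domain $\{u\in C_0(\mathcal G):(u''_{\mathsf e})_{\mathsf e}\in C_0(\mathcal G),\ \sum_{\mathsf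 e\in\mathcal E_{\mathsf v}}\frac{\partial u_{\mathsf e}}{\partial n_{\mathsf e}}(\mathsf v)=0\ \forall\mathsf v\in\mathcal V\}$. **Terminology.** Feller semigroup: a positive, contractive $C_0$-semigroup on $C_0(\mathcal G)$. The semigroup acts through an integral kernel and so extends to bounded Borel functions; strong Feller property: for $t>0$ this extension maps bounded Borel measurable functions to bounded continuous functions. *)

theory Defs
  imports "HOL-Analysis.Analysis" "Graph_Theory.Digraph_Component"
begin

text \<open>
  Points of the metric graph: \<open>Inner e x\<close> is the point at coordinate \<open>x\<close> in the open
  interval \<open>(0, len e)\<close>; the endpoints of the intervals are glued to \<open>Vertex v\<close>.
\<close>

datatype ('v, 'e) point = Vertex 'v | Inner 'e real

locale metric_graph = loopfree_digraph G
  for G :: "('v, 'e) pre_digraph" +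
  fixes len :: "'e \<Rightarrow> real" and cond :: "'e \<Rightarrow> real"
  assumes countable_verts: "countable (verts G)"
    and countable_arcs: "countable (arcs G)"
    and connected: "Digraph_Component.connected G"
    and uniformly_locally_finite:
      "\<exists>N. \<forall>v\<in>verts G. finite {e \<in> arcs G. tail G e = v \<or> head G e = v}
                     \<and> card {e \<in> arcs G. tail G e = v \<or> head G e = v} \<le> N"
    and len_bounds: "\<exists>l u. 0 < l \<and> (\<forall>e\<in>arcs G. l \<le> len e \<and> len e \<le> u)"
    and cond_pos: "e \<in> arcs G \<Longrightarrow> 0 < cond e"
begin

definition incident :: "'v \<Rightarrow> 'e set" where
  "incident v = {e \<in> arcs G. tail G e = v \<or> head G e = v}"

definition chart :: "'e \<Rightarrow> real \<Rightarrow> ('v, 'e) point" where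
  "chart e x = (if x = 0 then Vertex (tail G e)
                else if x = len e then Vertex (head G e)
                else Inner e x)"

definition points :: "('v, 'e) point set" where
  "points = {chart e x | e x. e \<in> arcs G \<and> x \<in> {0..len e}}"


text \<open>
  \<open>path_length p L q\<close>: some piecewise linear path from \<open>p\<close> to \<open>q\<close>, each piece of which
  stays in one closed edge, has length \<open>L\<close>. The natural path metric is the infimum of these
  lengths. The value \<open>0\<close> outside \<open>points\<close> only serves the conventions of
  the locale \<open>Metric_space\<close>.
\<close>

inductive path_length :: "('v, 'e) point \<Rightarrow> real \<Rightarrow> ('v, 'e) point \<Rightarrow> bool" where
  path_length_refl: "p \<in> points \<Longrightarrow> path_length p 0 p"
| path_length_step:
    "\<lbrakk>e \<in> arcs G; x \<in> {0..len e}; y \<in> {0..len e}; path_length (chart e y) L q\<rbrakk>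
      \<Longrightarrow> path_length (chart e x) (\<bar>x - y\<bar> + L) q"

definition path_dist :: "('v, 'e) point \<Rightarrow> ('v, 'e) point \<Rightarrow> real" where
  "path_dist p q = (if p \<in> points \<and> q \<in> points then Inf {L. path_length p L q} else 0)"

abbreviation graph_topology :: "('v, 'e) point topology" where
  "graph_topology \<equiv> Metric_space.mtopology points path_dist"

definition graph_borel :: "('v, 'e) point measure" where
  "graph_borel = sigma points {U. openin graph_topology U}"

text \<open>Lebesgue measure on the metric graph; vertices are null sets.\<close>

definition volume :: "('v, 'e) point measure" where
  "volume = distr
     (restrict_space (count_space (arcs G) \<Otimes>\<^sub>M lborel) {(e, x). e \<in> arcs G \<and> 0 < x \<and> x < len e})
     graph_borel (\<lambda>(e, x). chart e x)"


text \<open>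
  A function on the graph is represented by a function on the type \<open>point\<close> that is \<open>0\<close>
  outside \<open>points\<close>; the supremum over the type is then the supremum over the graph.
\<close>

definition C0 :: "(('v, 'e) point \<Rightarrow> real) set" where
  "C0 = {f. continuous_map graph_topology euclideanreal f
          \<and> (\<forall>\<epsilon>>0. \<exists>K. compactin graph_topology K \<and> (\<forall>p\<in>points - K. \<bar>f p\<bar> < \<epsilon>))
          \<and> (\<forall>p. p \<notin> points \<longrightarrow> f p = 0)}"

definition sup_norm :: "(('v, 'e) point \<Rightarrow> real) \<Rightarrow> real" where
  "sup_norm f = (SUP p. \<bar>f p\<bar>)"

definition edge_fun :: "(('v, 'e) point \<Rightarrow> real) \<Rightarrow> 'e \<Rightarrow> real \<Rightarrow> real" where
  "edge_fun u e x = u (chart e x)"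

text \<open>
  The one-sided limits exist for every \<open>u\<close> in the domain of the Laplacian, since there the
  second derivative of \<open>edge_fun u e\<close> is bounded.
\<close>

definition normal_deriv :: "(('v, 'e) point \<Rightarrow> real) \<Rightarrow> 'e \<Rightarrow> 'v \<Rightarrow> real" where
  "normal_deriv u e v =
     (if v = tail G e then cond e * Lim (at_right 0) (deriv (edge_fun u e))
      else - cond e * Lim (at_left (len e)) (deriv (edge_fun u e)))"

text \<open>
  The Kirchhoff Laplacian as the graph of an operator in \<open>C0\<close>. Since \<open>w\<close> is continuous and the
  open edges are dense, \<open>w\<close> is determined by the second derivatives on the open edges.
\<close>

definition kirchhoff_laplacian ::
    "((('v, 'e) point \<Rightarrow> real) \<times> (('v, 'e) point \<Rightarrow> real)) set" where
  "kirchhoff_laplacian = {(u, w). u \<in> C0 \<and> w \<in> C0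
     \<and> (\<forall>e\<in>arcs G. \<forall>x\<in>{0<..<len e}.
           (edge_fun u e has_real_derivative deriv (edge_fun u e) x) (at x)
         \<and> (deriv (edge_fun u e) has_real_derivative edge_fun w e x) (at x))
     \<and> (\<forall>v\<in>verts G. (\<Sum>e\<in>incident v. normal_deriv u e v) = 0)}"

text \<open>
  Operators on \<open>C0\<close> are total functions of which only the restrictions to \<open>C0\<close>, at
  times \<open>t \<ge> 0\<close>, are meaningful.
\<close>

definition bounded_operator :: "((('v, 'e) point \<Rightarrow> real) \<Rightarrow> ('v, 'e) point \<Rightarrow> real) \<Rightarrow> bool" where
  "bounded_operator S \<longleftrightarrow>
     (\<forall>f\<in>C0. S f \<in> C0)
   \<and> (\<forall>f\<in>C0. \<forall>g\<in>C0. \<forall>a b. S (\<lambda>p. a * f p + b * g p) = (\<lambda>p. a * S f p + b * S g p))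
   \<and> (\<exists>M. \<forall>f\<in>C0. sup_norm (S f) \<le> M * sup_norm f)"

definition C0_semigroup ::
    "(real \<Rightarrow> (('v, 'e) point \<Rightarrow> real) \<Rightarrow> ('v, 'e) point \<Rightarrow> real) \<Rightarrow> bool" where
  "C0_semigroup T \<longleftrightarrow>
     (\<forall>t\<ge>0. bounded_operator (T t))
   \<and> (\<forall>f\<in>C0. T 0 f = f)
   \<and> (\<forall>s\<ge>0. \<forall>t\<ge>0. \<forall>f\<in>C0. T (s + t) f = T s (T t f))
   \<and> (\<forall>f\<in>C0. ((\<lambda>t. sup_norm (\<lambda>p. T t f p - f p)) \<longlongrightarrow> 0) (at_right 0))"

definition generator ::
    "(real \<Rightarrow> (('v, 'e) point \<Rightarrow> real) \<Rightarrow> ('v, 'e) point \<Rightarrow> real)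
      \<Rightarrow> ((('v, 'e) point \<Rightarrow> real) \<times> (('v, 'e) point \<Rightarrow> real)) set" where
  "generator T = {(f, g). f \<in> C0 \<and> g \<in> C0
     \<and> ((\<lambda>h. sup_norm (\<lambda>p. (T h f p - f p) / h - g p)) \<longlongrightarrow> 0) (at_right 0)}"

definition heat_semigroup ::
    "(real \<Rightarrow> (('v, 'e) point \<Rightarrow> real) \<Rightarrow> ('v, 'e) point \<Rightarrow> real) \<Rightarrow> bool" where
  "heat_semigroup T \<longleftrightarrow> C0_semigroup T \<and> generator T = kirchhoff_laplacian"

definition feller_semigroup ::
    "(real \<Rightarrow> (('v, 'e) point \<Rightarrow> real) \<Rightarrow> ('v, 'e) point \<Rightarrow> real) \<Rightarrow> bool" where
  "feller_semigroup T \<longleftrightarrow> C0_semigroup T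
   \<and> (\<forall>t\<ge>0. \<forall>f\<in>C0. (\<forall>p. 0 \<le> f p) \<longrightarrow> (\<forall>p. 0 \<le> T t f p))
   \<and> (\<forall>t\<ge>0. \<forall>f\<in>C0. sup_norm (T t f) \<le> sup_norm f)"

definition integral_kernel ::
    "(real \<Rightarrow> (('v, 'e) point \<Rightarrow> real) \<Rightarrow> ('v, 'e) point \<Rightarrow> real)
      \<Rightarrow> (real \<Rightarrow> ('v, 'e) point \<Rightarrow> ('v, 'e) point \<Rightarrow> real) \<Rightarrow> bool" where
  "integral_kernel T k \<longleftrightarrow> (\<forall>t>0.
     (\<lambda>(p, q). k t p q) \<in> borel_measurable (graph_borel \<Otimes>\<^sub>M graph_borel)
   \<and> (\<forall>p\<in>points. integrable volume (k t p))
   \<and> (\<forall>f\<in>C0. \<forall>p\<in>points. T t f p = (\<integral>q. k t p q * f q \<partial>volume)))"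

text \<open>
  The kernel is unique up to null sets, so the extension of the semigroup to bounded Borel
  functions does not depend on the choice of \<open>k\<close>.
\<close>

definition strong_feller ::
    "(real \<Rightarrow> (('v, 'e) point \<Rightarrow> real) \<Rightarrow> ('v, 'e) point \<Rightarrow> real) \<Rightarrow> bool" where
  "strong_feller T \<longleftrightarrow> (\<exists>k. integral_kernel T k \<and>
     (\<forall>t>0. \<forall>f\<in>borel_measurable graph_borel. bounded (f ` points) \<longrightarrow>
        continuous_map graph_topology euclideanreal (\<lambda>p. \<integral>q. k t p q * f q \<partial>volume)
      \<and> bounded ((\<lambda>p. \<integral>q. k t p q * f q \<partial>volume) ` points)))"

end

end

theory Submission
  imports Defs "HOL-Probability.Probability"
begin

text \<open>
  Follow the paths that leave an oriented edge, weighting the edges beyond each vertex by their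
  transmission and reflection coefficients. A function \<open>f\<close> on the graph thereby unfolds into a
  family of functions on the line, one for each oriented edge, and continuity together with the
  Kirchhoff condition becomes a linear symmetry of the family that convolution with an even
  measure preserves. Hence convolution with Gaussians, carried back to the graph, is a semigroup
  whose generator is the Kirchhoff Laplacian, the resolvent being convolution with a Laplace
  kernel. Positivity and contractivity follow from the minimum principle. In its parabolic form,
  combined with the uniform boundedness of the semigroup near time \<open>0\<close>, this principle also shows
  that the generator determines the semigroup. The integral kernel is obtained by transposing the
  unfolding. On bounded Borel functions the extension is again a Gaussian convolution of an
  unfolding, which is continuous.
\<close>

text \<open>The reflection coefficient \<open>2 c / \<Sum> c - 1\<close> can be negative. Positivity
  and contractivity of the heat operators therefore cannot be read off from the Gaussian, and a
  minimum principle on the graph itself has to supply them. In sup-norm a passage through a vertex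
  costs a factor of at most 3, whatever the degree and the conductivities, while vertices are at
  least \<open>min_len\<close> apart; hence unfoldings grow at most like
  \<open>exp (rate * s)\<close>. All analysis on the line takes place in this exponentially weighted
  class, with kernels that have enough exponential moments. Moreover every estimate must be uniform
  over infinitely many edges. To this end errors are put in the form \<epsilon> + K y^2 exp (rate
  \<bar>y\<bar>), where y is the displacement along the line; integrated against a kernel with small
  second moment, such an error is small.\<close>

context metric_graph
begin

section \<open>Edge lengths and the points of the graph\<close>

definition min_len :: real where
  "min_len = (SOME l. 0 < l \<and> (\<forall>e\<in>arcs G. l \<le> len e))"

lemma min_len_pos: "0 < min_len" and min_len_le: "e \<in> arcs G \<Longrightarrow> min_len \<le> len e"
proof -
  have "\<exists>l. 0 < l \<and> (\<forall>e\<in>arcs G. l \<le> len e)" using len_bounds by blast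
  from someI_ex[OF this] show "0 < min_len" "e \<in> arcs G \<Longrightarrow> min_len \<le> len e"
    by (auto simp: min_len_def)
qed

lemma len_pos: "e \<in> arcs G \<Longrightarrow> 0 < len e"
  using min_len_le min_len_pos by fastforce

lemma chart_in_points: "e \<in> arcs G \<Longrightarrow> 0 \<le> x \<Longrightarrow> x \<le> len e \<Longrightarrow> chart e x \<in> points"
  by (auto simp: points_def)

lemma points_cases:
  assumes "p \<in> points"
  obtains (vertex) e x where "e \<in> arcs G" "x = 0 \<or> x = len e" "p = chart e x"
      "p = Vertex (tail G e) \<or> p = Vertex (head G e)"
  | (inner) e x where "e \<in> arcs G" "0 < x" "x < len e" "p = Inner e x"
  using assms by (force simp: points_def chart_def split: if_splits)

lemma chart_simps [simp]:
  "chart e 0 = Vertex (tail G e)"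
  "chart e (len e) = Vertex (if len e = 0 then tail G e else head G e)"
  by (auto simp: chart_def)

lemma chart_inner: "0 < x \<Longrightarrow> x < len e \<Longrightarrow> chart e x = Inner e x"
  by (auto simp: chart_def)

subsection \<open>The path metric\<close>

lemma path_length_nonneg: "path_length p L q \<Longrightarrow> 0 \<le> L"
  by (induction rule: path_length.induct) auto

lemma path_length_trans:
  "path_length p L q \<Longrightarrow> path_length q L' r \<Longrightarrow> path_length p (L + L') r"
proof (induction arbitrary: r L' rule: path_length.induct)
  case (path_length_step e x y L q)
  from path_length.path_length_step[OF this(1-3) path_length_step.IH[OF path_length_step.prems]]
  show ?case by (simp add: add.assoc)
qed auto

lemma path_length_edge:
  assumes "e \<in> arcs G" "x \<in> {0..len e}" "y \<in> {0..len e}"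
  shows "path_length (chart e x) \<bar>x - y\<bar> (chart e y)"
  using path_length_step[OF assms path_length_refl] assms chart_in_points by fastforce

lemma path_length_sym: "path_length p L q \<Longrightarrow> path_length q L p"
proof (induction rule: path_length.induct)
  case (path_length_step e x y L q)
  from path_length_trans[OF this(5) path_length_edge[OF this(1,3,2)]]
  show ?case by (simp add: abs_minus_commute add.commute)
qed (rule path_length_refl)

lemma Vertex_points: "Vertex v \<in> points \<longleftrightarrow> incident v \<noteq> {}"
proof
  assume "Vertex v \<in> points"
  then show "incident v \<noteq> {}"
    by (auto simp: points_def chart_def incident_def split: if_splits)
next
  assume "incident v \<noteq> {}"
  then obtain e where e: "e \<in> arcs G" "tail G e = v \<or> head G e = v" by (auto simp: incident_def)
  have "chart e 0 \<in> points" "chart e (len e) \<in> points" using e(1) len_pos[OF e(1)]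
    by (auto simp del: chart_simps intro!: chart_in_points)
  then show "Vertex v \<in> points" using e len_pos[OF e(1)] by auto
qed

text \<open>Connectedness enters here, so that the infimum in \<open>path_dist\<close> runs over a
  nonempty set. Each point first moves along its edge to a tail, and tails are joined by a chain of
  edges run through in either direction.\<close>

lemma path_length_exists:
  assumes "p \<in> points" "q \<in> points"
  shows "\<exists>L. path_length p L q"
proof -
  have to_tail: "\<exists>e\<in>arcs G. \<exists>L. path_length p L (Vertex (tail G e))" if "p \<in> points" for p
  proof -
    from that obtain e x where "e \<in> arcs G" "x \<in> {0..len e}" "p = chart e x"
      by (auto simp: points_def)
    then show ?thesis using path_length_edge[of e x 0] by force
  qed
  obtain e L where e: "e \<in> arcs G" "path_length p L (Vertex (tail G e))" using to_tail assms by blast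
  obtain e' L' where e': "e' \<in> arcs G" "path_length q L' (Vertex (tail G e'))"
    using to_tail assms by blast
  have "(tail G e, tail G e') \<in> rtrancl_on (verts G) (parcs (mk_symmetric G))"
    using connected e(1) e'(1)
    by (auto simp: Digraph_Component.connected_def strongly_connected_def reachable_def)
  then have "\<exists>L. path_length (Vertex (tail G e)) L (Vertex (tail G e'))"
  proof (induction rule: rtrancl_on_induct)
    case base
    have "Vertex (tail G e) \<in> points" using e(1) by (auto simp: Vertex_points incident_def)
    then show ?case using path_length_refl by blast
  next
    case (step y z)
    then obtain L where L: "path_length (Vertex (tail G e)) L (Vertex y)" by blast
    from step obtain f where f: "f \<in> arcs G" "(y, z) = (tail G f, head G f) \<or> (y, z) = (head G f, tail G f)"
      by (auto simp: parcs_mk_symmetric)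
    have "\<exists>L. path_length (Vertex y) L (Vertex z)"
      using f path_length_edge[of f 0 "len f"] path_length_edge[of f "len f" 0] len_pos[of f] by auto
    then show ?case using L path_length_trans by blast
  qed
  then show ?thesis using e(2) path_length_sym[OF e'(2)] path_length_trans by blast
qed

section \<open>Bounds for the path metric\<close>

lemma path_dist_le: "path_length p L q \<Longrightarrow> path_dist p q \<le> L"
  unfolding path_dist_def
  by (auto intro!: cInf_lower bdd_belowI[of _ 0] path_length_nonneg)

lemma path_dist_ge:
  assumes "p \<in> points" "q \<in> points" "\<And>L. path_length p L q \<Longrightarrow> c \<le> L"
  shows "c \<le> path_dist p q"
  using assms path_length_exists by (auto simp: path_dist_def intro!: cInf_greatest)

lemma path_dist_edge:
  "e \<in> arcs G \<Longrightarrow> x \<in> {0..len e} \<Longrightarrow> y \<in> {0..len e} \<Longrightarrow> path_dist (chart e x) (chart e y) \<le> \<bar>x - y\<bar>"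
  by (rule path_dist_le[OF path_length_edge])

text \<open>Lower bounds for the infimum over paths come from test functions: increments of a
  function that is 1-Lipschitz along every closed edge telescope along any path.\<close>

lemma Lipschitz_path_dist:
  fixes F :: "('v, 'e) point \<Rightarrow> real"
  assumes F: "\<And>e x y. e \<in> arcs G \<Longrightarrow> x \<in> {0..len e} \<Longrightarrow> y \<in> {0..len e} \<Longrightarrow>
      \<bar>F (chart e x) - F (chart e y)\<bar> \<le> \<bar>x - y\<bar>"
    and "p \<in> points" "q \<in> points"
  shows "\<bar>F p - F q\<bar> \<le> path_dist p q"
proof (rule path_dist_ge)
  fix L assume "path_length p L q"
  then show "\<bar>F p - F q\<bar> \<le> L"
  proof induction
    case (path_length_step e x y L q)
    then show ?case using F[of e x y] by linarith
  qed auto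
qed (use assms in auto)

text \<open>A tent around the point x of e. Its height is the distance to the nearer endpoint, so it
  vanishes at both ends and extends by 0 to a function that is 1-Lipschitz along all edges.\<close>

definition inner_bump :: "'e \<Rightarrow> real \<Rightarrow> ('v, 'e) point \<Rightarrow> real" where
  "inner_bump e x q = (case q of Vertex v \<Rightarrow> 0
     | Inner e' y \<Rightarrow> if e' = e then max 0 (min x (len e - x) - \<bar>x - y\<bar>) else 0)"

lemma inner_bump_le:
  assumes "e \<in> arcs G" "0 < x" "x < len e" "q \<in> points"
  shows "min x (len e - x) - inner_bump e x q \<le> path_dist (Inner e x) q"
proof -
  have "\<bar>inner_bump e x (Inner e x) - inner_bump e x q\<bar> \<le> path_dist (Inner e x) q"
  proof (rule Lipschitz_path_dist)
    show "Inner e x \<in> points"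
      using assms chart_in_points[of e x] by (simp add: chart_inner)
    fix e' y z assume yz: "e' \<in> arcs G" "y \<in> {0..len e'}" "z \<in> {0..len e'}"
    show "\<bar>inner_bump e x (chart e' y) - inner_bump e x (chart e' z)\<bar> \<le> \<bar>y - z\<bar>"
    proof (cases "e' = e")
      case True
      have "inner_bump e x (chart e' y) = max 0 (min x (len e - x) - \<bar>x - y\<bar>)"
        if "y \<in> {0..len e}" for y
        using that True assms by (auto simp: inner_bump_def chart_def)
      moreover have "\<bar>max 0 (m - a) - max 0 (m - b)\<bar> \<le> \<bar>a - b\<bar>" for m a b :: real
        by (auto simp: max_def)
      ultimately have "\<bar>inner_bump e x (chart e' y) - inner_bump e x (chart e' z)\<bar>
          \<le> \<bar>\<bar>x - y\<bar> - \<bar>x - z\<bar>\<bar>"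
        using yz True by metis
      then show ?thesis by linarith
    qed (auto simp: inner_bump_def chart_def)
  qed fact
  moreover have "inner_bump e x (Inner e x) = min x (len e - x)"
    using assms by (auto simp: inner_bump_def)
  ultimately show ?thesis by linarith
qed

text \<open>On edges that do not meet v, the value \<open>min_len\<close> makes
  \<open>vertex_bump\<close> vanish.\<close>

definition vertex_dist :: "'v \<Rightarrow> 'e \<Rightarrow> real \<Rightarrow> real" where
  "vertex_dist v e x = (if tail G e = v then x else if head G e = v then len e - x else min_len)"

text \<open>A tent of height \<open>min_len\<close> at v. No edge is shorter, so it has dropped to 0
  at the far ends of the edges at v.\<close>

definition vertex_bump :: "'v \<Rightarrow> ('v, 'e) point \<Rightarrow> real" where
  "vertex_bump v q = (case q of Vertex w \<Rightarrow> if w = v then min_len else 0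
     | Inner e y \<Rightarrow> max 0 (min_len - vertex_dist v e y))"

lemma vertex_bump_le:
  assumes "Vertex v \<in> points" "q \<in> points"
  shows "min_len - vertex_bump v q \<le> path_dist (Vertex v) q"
proof -
  have "\<bar>vertex_bump v (Vertex v) - vertex_bump v q\<bar> \<le> path_dist (Vertex v) q"
  proof (rule Lipschitz_path_dist)
    fix e x y assume e: "e \<in> arcs G" and xy: "x \<in> {0..len e}" "y \<in> {0..len e}"
    have "vertex_bump v (chart e x) = max 0 (min_len - vertex_dist v e x)"
        if "x \<in> {0..len e}" for x
      using that no_loops[OF e] min_len_le[OF e] min_len_pos
      by (auto simp: vertex_bump_def chart_def vertex_dist_def)
    then have "vertex_bump v (chart e x) = max 0 (min_len - vertex_dist v e x)"
      "vertex_bump v (chart e y) = max 0 (min_len - vertex_dist v e y)" using xy by auto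
    then show "\<bar>vertex_bump v (chart e x) - vertex_bump v (chart e y)\<bar> \<le> \<bar>x - y\<bar>"
      by (auto simp: vertex_dist_def)
  qed fact+
  then show ?thesis by (auto simp: vertex_bump_def)
qed

text \<open>Small balls are intervals around inner points and, by \<open>near_vertex\<close>, stars
  around vertices: where a bump is positive, it tells on which edge the point lies.\<close>

lemma near_inner:
  assumes e: "e \<in> arcs G" "0 < x" "x < len e" and q: "q \<in> points"
    and d: "path_dist (Inner e x) q < r" "r \<le> min x (len e - x)"
  obtains y where "q = Inner e y" "\<bar>x - y\<bar> < r"
proof -
  have "0 < inner_bump e x q" "min x (len e - x) - inner_bump e x q < r"
    using inner_bump_le[OF e q] d by auto
  then show ?thesis using that d(2)
    by (auto simp: inner_bump_def split: point.splits if_splits)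
qed

lemma near_vertex:
  assumes v: "Vertex v \<in> points" and q: "q \<in> points"
    and d: "path_dist (Vertex v) q < r" "r \<le> min_len"
  shows "q = Vertex v \<or> (\<exists>e\<in>incident v. \<exists>y. 0 < y \<and> y < len e \<and> q = Inner e y \<and> vertex_dist v e y < r)"
proof -
  have *: "0 < vertex_bump v q" "min_len - vertex_bump v q < r"
    using vertex_bump_le[OF v q] d by auto
  from q show ?thesis
  proof (cases rule: points_cases)
    case vertex
    then show ?thesis using * by (auto simp: vertex_bump_def split: if_splits)
  next
    case (inner e x)
    then show ?thesis using * d(2)
      by (auto simp: vertex_bump_def incident_def vertex_dist_def split: if_splits)
  qed
qed

sublocale gm: Metric_space points path_dist
proof
  show nonneg: "0 \<le> path_dist p q" for p q
  proof (cases "p \<in> points \<and> q \<in> points")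
    case True
    then show ?thesis using path_dist_ge[of p q 0] path_length_nonneg by auto
  qed (auto simp: path_dist_def)
  show sym: "path_dist p q = path_dist q p" for p q
  proof -
    have "path_length p L q \<longleftrightarrow> path_length q L p" for L using path_length_sym by blast
    then show ?thesis by (auto simp: path_dist_def)
  qed
  show "path_dist p q = 0 \<longleftrightarrow> p = q" if "p \<in> points" "q \<in> points" for p q
  proof
    assume "p = q"
    then show "path_dist p q = 0"
      using path_dist_le[OF path_length_refl[OF that(1)]] nonneg[of p q] by auto
  next
    assume 0: "path_dist p q = 0"
    from that(1) show "p = q"
    proof (cases rule: points_cases)
      case (inner e x)
      from that(2) obtain e' y where "e' \<in> arcs G" "y \<in> {0..len e'}" "q = chart e' y"
        by (auto simp: points_def)
      have "\<bar>inner_bump e x p - inner_bump e x q\<bar> \<le> 0"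
        using inner_bump_le[OF inner(1-3) that(2)] 0 inner
        by (auto simp: inner_bump_def split: point.splits)
      then show ?thesis using inner
        by (auto simp: inner_bump_def split: point.splits if_splits)
    next
      case (vertex e x)
      then obtain v where v: "p = Vertex v" by auto
      show ?thesis
      proof (rule ccontr)
        assume "p \<noteq> q"
        from that(2) show False
        proof (cases rule: points_cases)
          case (vertex e x)
          then show False using vertex_bump_le[of v q] v that 0 \<open>p \<noteq> q\<close> min_len_pos
            by (auto simp: vertex_bump_def split: if_splits)
        next
          case (inner e x)
          then show False using vertex_bump_le[of v q] v that 0 min_len_pos
            by (auto simp: vertex_bump_def vertex_dist_def max_def split: if_splits)
        qed
      qed
    qed
  qed
  show "path_dist p r \<le> path_dist p q + path_dist q r"
    if "p \<in> points" "q \<in> points" "r \<in> points" for p q r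
  proof -
    have *: "path_dist p r - L \<le> path_dist q r" if L: "path_length p L q" for L
      using path_dist_ge[OF \<open>q \<in> points\<close> \<open>r \<in> points\<close>, of "path_dist p r - L"]
        path_dist_le[OF path_length_trans[OF L]] by (simp add: algebra_simps)
    have "path_dist p r - path_dist q r \<le> path_dist p q"
      using path_dist_ge[OF \<open>p \<in> points\<close> \<open>q \<in> points\<close>, of "path_dist p r - path_dist q r"] *
      by (simp add: algebra_simps)
    then show ?thesis by simp
  qed
qed

subsection \<open>Continuity and compactness in charts\<close>

lemma finite_incident: "v \<in> verts G \<Longrightarrow> finite (incident v)"
  using uniformly_locally_finite by (auto simp: incident_def)

lemma incident_verts: "e \<in> incident v \<Longrightarrow> v \<in> verts G"
  by (auto simp: incident_def)

lemma finite_incident': "finite (incident v)"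
  using finite_incident incident_verts by (cases "incident v = {}") auto

lemma continuous_map_chart:
  assumes e: "e \<in> arcs G"
  shows "continuous_map (top_of_set {0..len e}) graph_topology (chart e)"
  unfolding gm.continuous_map_to_metric
proof (intro ballI allI impI)
  fix x and \<epsilon> :: real
  assume x: "x \<in> topspace (top_of_set {0..len e})" and \<epsilon>: "0 < \<epsilon>"
  let ?U = "{0..len e} \<inter> ball x \<epsilon>"
  have "openin (top_of_set {0..len e}) ?U" by (simp add: openin_open_Int)
  moreover have "chart e y \<in> gm.mball (chart e x) \<epsilon>" if "y \<in> ?U" for y
    using that x path_dist_edge[OF e, of x y] chart_in_points[OF e]
    by (auto simp: gm.mball_def dist_real_def)
  ultimately show "\<exists>U. openin (top_of_set {0..len e}) U \<and> x \<in> U \<and> (\<forall>y\<in>U. chart e y \<in> gm.mball (chart e x) \<epsilon>)"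
    using x \<epsilon> by (intro exI[of _ ?U]) auto
qed

text \<open>The path metric thus induces the topology glued from the closed edges. The direction
  from edges to graph uses local finiteness: at a vertex, the radius is a minimum over the finitely
  many incident edges.\<close>

lemma graph_continuous_iff:
  fixes f :: "('v, 'e) point \<Rightarrow> real"
  shows "continuous_map graph_topology euclideanreal f
     \<longleftrightarrow> (\<forall>e\<in>arcs G. continuous_on {0..len e} (\<lambda>x. f (chart e x)))" (is "?L \<longleftrightarrow> ?R")
proof
  assume ?L
  show ?R
  proof
    fix e assume "e \<in> arcs G"
    from continuous_map_compose[OF continuous_map_chart[OF this] \<open>?L\<close>]
    show "continuous_on {0..len e} (\<lambda>x. f (chart e x))" by (simp add: comp_def)
  qed
next
  assume R: ?R
  show ?L
    unfolding gm.continuous_map_from_metric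
  proof (intro conjI ballI allI impI)
    fix p and U :: "real set"
    assume p: "p \<in> points" and U: "openin euclideanreal U \<and> f p \<in> U"
    then obtain \<epsilon> where \<epsilon>: "0 < \<epsilon>" "ball (f p) \<epsilon> \<subseteq> U" by (auto simp: open_contains_ball)
    have edge: "\<exists>\<delta>>0. \<forall>y\<in>{0..len e}. \<bar>x - y\<bar> < \<delta> \<longrightarrow> \<bar>f (chart e x) - f (chart e y)\<bar> < \<epsilon>"
      if "e \<in> arcs G" "x \<in> {0..len e}" for e x
    proof -
      from R that(1) have "continuous_on {0..len e} (\<lambda>x. f (chart e x))" by blast
      from this[unfolded continuous_on_iff, rule_format, OF that(2) \<open>0 < \<epsilon>\<close>]
      obtain \<delta> where "\<delta> > 0" "\<And>y. y \<in> {0..len e} \<Longrightarrow> dist y x < \<delta> \<Longrightarrow> dist (f (chart e y)) (f (chart e x)) < \<epsilon>" 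
        by blast
      then show ?thesis by (intro exI[of _ \<delta>]) (auto simp: dist_real_def abs_minus_commute)
    qed
    have "\<exists>r>0. \<forall>q. q \<in> points \<and> path_dist p q < r \<longrightarrow> \<bar>f p - f q\<bar> < \<epsilon>"
      using p
    proof (cases rule: points_cases)
      case (inner e x)
      from edge[OF inner(1), of x] inner obtain \<delta> where \<delta>: "\<delta> > 0"
        "\<And>y. y \<in> {0..len e} \<Longrightarrow> \<bar>x - y\<bar> < \<delta> \<Longrightarrow> \<bar>f (chart e x) - f (chart e y)\<bar> < \<epsilon>" by auto
      let ?r = "min \<delta> (min x (len e - x))"
      show ?thesis
      proof (intro exI[of _ ?r] conjI allI impI)
        fix q assume q: "q \<in> points \<and> path_dist p q < ?r"
        then have "q \<in> points" "path_dist (Inner e x) q < ?r" using inner(4) by auto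
        from near_inner[OF inner(1-3) this min.cobounded2]
        obtain y where y: "q = Inner e y" "\<bar>x - y\<bar> < ?r" .
        then have y': "0 < y" "y < len e" by auto
        show "\<bar>f p - f q\<bar> < \<epsilon>" using \<delta>(2)[of y] y y' inner by (auto simp: chart_inner)
      qed (use \<delta> inner in auto)
    next
      case (vertex e0 x0)
      then obtain v where v: "p = Vertex v" by auto
      have "\<exists>\<delta>>0. \<forall>y. 0 < y \<and> y < len e \<and> vertex_dist v e y < \<delta> \<longrightarrow> \<bar>f p - f (Inner e y)\<bar> < \<epsilon>"
        if e: "e \<in> incident v" for e
      proof -
        have ea: "e \<in> arcs G" using e by (auto simp: incident_def)
        define x where "x = (if tail G e = v then 0 else len e)"
        have x: "x \<in> {0..len e}" "chart e x = p"
          using e v len_pos[OF ea] by (auto simp: x_def incident_def)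
        obtain \<delta> where \<delta>: "\<delta> > 0" "\<And>y. y \<in> {0..len e} \<Longrightarrow> \<bar>x - y\<bar> < \<delta> \<Longrightarrow> \<bar>f (chart e x) - f (chart e y)\<bar> < \<epsilon>"
          using edge[OF ea x(1)] by auto
        have "\<bar>f p - f (Inner e y)\<bar> < \<epsilon>" if y: "0 < y" "y < len e" "vertex_dist v e y < \<delta>" for y
        proof -
          have "\<bar>x - y\<bar> < \<delta>" using y e by (auto simp: x_def vertex_dist_def incident_def split: if_splits)
          then show ?thesis using \<delta>(2)[of y] x(2) y by (simp add: chart_inner)
        qed
        then show ?thesis using \<delta>(1) by blast
      qed
      then obtain \<delta> where \<delta>: "\<And>e. e \<in> incident v \<Longrightarrow> \<delta> e > 0"
        "\<And>e y. e \<in> incident v \<Longrightarrow> 0 < y \<Longrightarrow> y < len e \<Longrightarrow> vertex_dist v e y < \<delta> e \<Longrightarrow> \<bar>f p - f (Inner e y)\<bar> < \<epsilon>"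
        by metis
      define r where "r = Min (insert min_len (\<delta> ` incident v))"
      have r: "0 < r" "r \<le> min_len" "\<And>e. e \<in> incident v \<Longrightarrow> r \<le> \<delta> e"
        using \<delta>(1) min_len_pos finite_incident'[of v] by (auto simp: r_def)
      show ?thesis
      proof (intro exI[of _ r] conjI allI impI)
        fix q assume q: "q \<in> points \<and> path_dist p q < r"
        then show "\<bar>f p - f q\<bar> < \<epsilon>"
          using near_vertex[of v q r] p v r \<delta>(2) \<epsilon>(1) by force
      qed fact
    qed
    then obtain r where r: "r > 0" "\<And>q. q \<in> points \<Longrightarrow> path_dist p q < r \<Longrightarrow> \<bar>f p - f q\<bar> < \<epsilon>" by blast
    have "f q \<in> U" if "q \<in> points" "path_dist p q < r" for q
      using r(2)[OF that] \<epsilon>(2) by (auto simp: dist_real_def)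
    then show "\<exists>r>0. \<forall>x. x \<in> points \<and> path_dist p x < r \<longrightarrow> f x \<in> U" using r(1) by blast
  qed auto
qed

text \<open>Local finiteness in metric form. With a finite subcover it shows that a compact set
  meets finitely many closed edges.\<close>

lemma finite_arcs_near:
  assumes p: "p \<in> points"
  obtains r where "r > 0" "finite {e \<in> arcs G. \<exists>x\<in>{0..len e}. chart e x \<in> gm.mball p r}"
  using p
proof (cases rule: points_cases)
  case (inner e x)
  let ?r = "min x (len e - x)"
  have "e' = e" if "e' \<in> arcs G" "y\<in>{0..len e'}" "chart e' y \<in> gm.mball p ?r" for e' y
  proof -
    from that(3) have "chart e' y \<in> points" "path_dist (Inner e x) (chart e' y) < ?r"
      using inner(4) by (auto simp: gm.mball_def)
    from near_inner[OF inner(1-3) this order_refl] obtain z where "chart e' y = Inner e z" .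
    then show ?thesis by (auto simp: chart_def split: if_splits)
  qed
  then have "finite {e' \<in> arcs G. \<exists>y\<in>{0..len e'}. chart e' y \<in> gm.mball p ?r}"
    by (intro finite_subset[OF _ finite.insertI[OF finite.emptyI, of e]]) auto
  then show ?thesis using that[of ?r] inner by auto
next
  case (vertex e0 x0)
  then obtain v where v: "p = Vertex v" by auto
  have "e' \<in> incident v" if "e' \<in> arcs G" "y\<in>{0..len e'}" "chart e' y \<in> gm.mball p min_len" for e' y
  proof -
    from that(3) have "chart e' y \<in> points" "path_dist (Vertex v) (chart e' y) < min_len"
      using v by (auto simp: gm.mball_def)
    from near_vertex[OF p[unfolded v] this order_refl]
    have "chart e' y = Vertex v \<or> (\<exists>e\<in>incident v. \<exists>z. chart e' y = Inner e z)" by blast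
    then show ?thesis using that(1) by (auto simp: chart_def incident_def split: if_splits)
  qed
  then have "{e \<in> arcs G. \<exists>x\<in>{0..len e}. chart e x \<in> gm.mball p min_len} \<subseteq> incident v"
    by auto
  from that[OF min_len_pos finite_subset[OF this finite_incident']] show ?thesis .
qed

lemma compactin_finite_arcs:
  assumes "compactin graph_topology K"
  shows "finite {e \<in> arcs G. \<exists>x\<in>{0..len e}. chart e x \<in> K}"
proof -
  have K: "K \<subseteq> points" using compactin_subset_topspace[OF assms] by simp
  have "\<exists>r. \<forall>p\<in>K. r p > 0 \<and> finite {e \<in> arcs G. \<exists>x\<in>{0..len e}. chart e x \<in> gm.mball p (r p)}"
    using K finite_arcs_near by (intro bchoice) blast
  then obtain r where r: "\<And>p. p \<in> K \<Longrightarrow> r p > 0 \<and> finite {e \<in> arcs G. \<exists>x\<in>{0..len e}. chart e x \<in> gm.mball p (r p)}"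
    by blast
  have "K \<subseteq> \<Union>((\<lambda>p. gm.mball p (r p)) ` K)" using r K by force
  moreover have "\<forall>U\<in>(\<lambda>p. gm.mball p (r p)) ` K. openin graph_topology U" by auto
  ultimately obtain \<F> where \<F>: "finite \<F>" "\<F> \<subseteq> (\<lambda>p. gm.mball p (r p)) ` K" "K \<subseteq> \<Union>\<F>"
    using assms unfolding compactin_def by meson
  obtain K0 where K0': "K0 \<subseteq> K" "finite K0" "\<F> = (\<lambda>p. gm.mball p (r p)) ` K0"
    using finite_subset_image[OF \<F>(1,2)] by blast
  then have K0: "finite K0" "K0 \<subseteq> K" "K \<subseteq> (\<Union>p\<in>K0. gm.mball p (r p))"
    using \<F>(3) by simp_all
  have "{e \<in> arcs G. \<exists>x\<in>{0..len e}. chart e x \<in> K}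
     \<subseteq> (\<Union>p\<in>K0. {e \<in> arcs G. \<exists>x\<in>{0..len e}. chart e x \<in> gm.mball p (r p)})"
  proof
    fix e assume "e \<in> {e \<in> arcs G. \<exists>x\<in>{0..len e}. chart e x \<in> K}"
    then obtain x where e: "e \<in> arcs G" "x \<in> {0..len e}" "chart e x \<in> K" by blast
    then obtain p where "p \<in> K0" "chart e x \<in> gm.mball p (r p)" using K0(3) by blast
    from this(2) e(2) have "\<exists>x\<in>{0..len e}. chart e x \<in> gm.mball p (r p)" by (rule bexI)
    with e(1) \<open>p \<in> K0\<close> show "e \<in> (\<Union>p\<in>K0. {e \<in> arcs G. \<exists>x\<in>{0..len e}. chart e x \<in> gm.mball p (r p)})"
      by (intro UN_I CollectI conjI)
  qed
  moreover have "finite (\<Union>p\<in>K0. {e \<in> arcs G. \<exists>x\<in>{0..len e}. chart e x \<in> gm.mball p (r p)})"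
    using K0 r by blast
  ultimately show ?thesis by (rule finite_subset)
qed

text \<open>Vanishing at infinity becomes a statement about edges: a compact set meets finitely many
  closed edges, and a finite union of closed edges is compact, being made of chart images of compact
  intervals.\<close>

lemma C0_iff:
  "f \<in> C0 \<longleftrightarrow> (\<forall>e\<in>arcs G. continuous_on {0..len e} (\<lambda>x. f (chart e x)))
     \<and> (\<forall>\<epsilon>>0. finite {e\<in>arcs G. \<exists>x\<in>{0..len e}. \<epsilon> \<le> \<bar>f (chart e x)\<bar>})
     \<and> (\<forall>p. p \<notin> points \<longrightarrow> f p = 0)"
proof -
  have "(\<forall>\<epsilon>>0. \<exists>K. compactin graph_topology K \<and> (\<forall>p\<in>points - K. \<bar>f p\<bar> < \<epsilon>))
    \<longleftrightarrow> (\<forall>\<epsilon>>0. finite {e\<in>arcs G. \<exists>x\<in>{0..len e}. \<epsilon> \<le> \<bar>f (chart e x)\<bar>})"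
  proof (intro all_cong iffI)
    fix \<epsilon> :: real assume "0 < \<epsilon>"
    assume "\<exists>K. compactin graph_topology K \<and> (\<forall>p\<in>points - K. \<bar>f p\<bar> < \<epsilon>)"
    then obtain K where K: "compactin graph_topology K" "\<And>p. p\<in>points - K \<Longrightarrow> \<bar>f p\<bar> < \<epsilon>" by blast
    have "chart e x \<in> K" if "e \<in> arcs G" "x \<in> {0..len e}" "\<epsilon> \<le> \<bar>f (chart e x)\<bar>" for e x
      using K(2)[of "chart e x"] that chart_in_points[of e x] by force
    then have "{e\<in>arcs G. \<exists>x\<in>{0..len e}. \<epsilon> \<le> \<bar>f (chart e x)\<bar>} \<subseteq> {e \<in> arcs G. \<exists>x\<in>{0..len e}. chart e x \<in> K}"
      by blast
    then show "finite {e\<in>arcs G. \<exists>x\<in>{0..len e}. \<epsilon> \<le> \<bar>f (chart e x)\<bar>}"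
      using compactin_finite_arcs[OF K(1)] finite_subset by blast
  next
    fix \<epsilon> :: real assume "0 < \<epsilon>"
    assume fin: "finite {e\<in>arcs G. \<exists>x\<in>{0..len e}. \<epsilon> \<le> \<bar>f (chart e x)\<bar>}" (is "finite ?E")
    let ?K = "\<Union>e\<in>?E. chart e ` {0..len e}"
    have "compactin graph_topology ?K"
    proof (rule compactin_Union)
      show "finite ((\<lambda>e. chart e ` {0..len e}) ` ?E)" using fin by blast
      show "compactin graph_topology S" if "S \<in> (\<lambda>e. chart e ` {0..len e}) ` ?E" for S
        using that image_compactin[OF _ continuous_map_chart]
        by (auto simp: compactin_subtopology)
    qed
    moreover have "\<bar>f p\<bar> < \<epsilon>" if "p\<in>points - ?K" for p
    proof (rule ccontr)
      assume "\<not> \<bar>f p\<bar> < \<epsilon>"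
      moreover from that have "p \<in> points" by blast
      then obtain e x where "e \<in> arcs G" "x \<in> {0..len e}" "p = chart e x"
        unfolding points_def by blast
      ultimately have "e \<in> ?E" by (intro CollectI conjI bexI[of _ x]) auto
      then have "p \<in> ?K" using \<open>x \<in> {0..len e}\<close> \<open>p = chart e x\<close> by (intro UN_I imageI) auto
      then show False using that by blast
    qed
    ultimately show "\<exists>K. compactin graph_topology K \<and> (\<forall>p\<in>points - K. \<bar>f p\<bar> < \<epsilon>)" by blast
  qed
  then show ?thesis unfolding C0_def graph_continuous_iff by auto
qed

end

subsection \<open>Convolution on the line\<close>

text \<open>The growth class of the unfoldings; convolution with a \<open>sym_kernel\<close> stays
  inside it.\<close>

definition exp_bounded :: "real \<Rightarrow> (real \<Rightarrow> real) \<Rightarrow> bool" where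
  "exp_bounded a \<phi> \<longleftrightarrow> \<phi> \<in> borel_measurable borel \<and> (\<exists>C. \<forall>x. \<bar>\<phi> x\<bar> \<le> C * exp (a * \<bar>x\<bar>))"

text \<open>The \<open>+ 1\<close> in the exponent leaves room for a factor y^2, see
  \<open>power2_exp_le\<close>.\<close>

definition sym_kernel :: "real \<Rightarrow> real measure \<Rightarrow> bool" where
  "sym_kernel a M \<longleftrightarrow> prob_space M \<and> sets M = sets borel \<and> distr M borel uminus = M
     \<and> integrable M (\<lambda>y. exp ((a + 1) * \<bar>y\<bar>))"

text \<open>The sign convention \<open>x + y\<close> is harmless because the kernels are
  even.\<close>

definition convol :: "real measure \<Rightarrow> (real \<Rightarrow> real) \<Rightarrow> real \<Rightarrow> real" where
  "convol M \<phi> x = (\<integral>y. \<phi> (x + y) \<partial>M)"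

lemma exp_boundedE:
  assumes "exp_bounded a \<phi>"
  obtains C where "0 \<le> C" "\<And>x. \<bar>\<phi> x\<bar> \<le> C * exp (a * \<bar>x\<bar>)"
proof -
  obtain C where C: "\<And>x. \<bar>\<phi> x\<bar> \<le> C * exp (a * \<bar>x\<bar>)" using assms by (auto simp: exp_bounded_def)
  have "0 \<le> C" using C[of 0] abs_ge_zero[of "\<phi> 0"] by simp
  then show ?thesis using C that by blast
qed

lemma exp_bounded_measurable: "exp_bounded a \<phi> \<Longrightarrow> \<phi> \<in> borel_measurable borel"
  by (auto simp: exp_bounded_def)

lemma exp_abs_add:
  fixes a x y :: real
  assumes "0 \<le> a" shows "exp (a * \<bar>x + y\<bar>) \<le> exp (a * \<bar>x\<bar>) * exp (a * \<bar>y\<bar>)"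
  using assms mult_left_mono[OF abs_triangle_ineq[of x y], of a]
  by (simp add: exp_add[symmetric] algebra_simps)

lemma exp_bounded_shift:
  assumes "0 \<le> a" "exp_bounded a \<phi>"
  shows "exp_bounded a (\<lambda>y. \<phi> (x + y))"
proof -
  obtain C where C: "0 \<le> C" "\<And>x. \<bar>\<phi> x\<bar> \<le> C * exp (a * \<bar>x\<bar>)" by (rule exp_boundedE[OF assms(2)]) blast
  have "\<bar>\<phi> (x + y)\<bar> \<le> C * exp (a * \<bar>x\<bar>) * exp (a * \<bar>y\<bar>)" for y
    using C(2)[of "x + y"] mult_left_mono[OF exp_abs_add[OF assms(1), of x y] C(1)]
    by (simp add: mult.assoc)
  moreover have [measurable]: "\<phi> \<in> borel_measurable borel" using assms by (auto simp: exp_bounded_def)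
  ultimately show ?thesis by (auto simp: exp_bounded_def)
qed

lemma sym_kernel_integrable_exp:
  assumes M: "sym_kernel a M" and b: "b \<le> a + 1"
  shows "integrable M (\<lambda>y. exp (b * \<bar>y\<bar>))"
proof (rule Bochner_Integration.integrable_bound)
  show "integrable M (\<lambda>y. exp ((a + 1) * \<bar>y\<bar>))" using M by (simp add: sym_kernel_def)
  have [measurable_cong]: "sets M = sets borel" using M by (simp add: sym_kernel_def)
  show "(\<lambda>y. exp (b * \<bar>y\<bar>)) \<in> borel_measurable M" by measurable
qed (use b in \<open>auto intro!: mult_right_mono\<close>)

lemma sym_kernel_integrable:
  assumes M: "sym_kernel a M" and \<phi>: "exp_bounded a \<phi>"
  shows "integrable M \<phi>"
proof -
  obtain C where C: "0 \<le> C" "\<And>x. \<bar>\<phi> x\<bar> \<le> C * exp (a * \<bar>x\<bar>)" by (rule exp_boundedE[OF \<phi>]) blast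
  have [measurable_cong]: "sets M = sets borel" using M by (simp add: sym_kernel_def)
  have [measurable]: "\<phi> \<in> borel_measurable borel" using \<phi> by (auto simp: exp_bounded_def)
  have "integrable M (\<lambda>y. C * exp (a * \<bar>y\<bar>))"
    using sym_kernel_integrable_exp[OF M, of a] by auto
  then show ?thesis
    by (rule Bochner_Integration.integrable_bound)
      (use C in \<open>auto intro: order_trans[OF _ abs_ge_self]\<close>)
qed

lemma power2_exp_le:
  fixes a y :: real
  shows "y\<^sup>2 * exp (a * \<bar>y\<bar>) \<le> 2 * exp ((a + 1) * \<bar>y\<bar>)"
proof -
  have "\<bar>y\<bar>\<^sup>2 / 2 \<le> exp \<bar>y\<bar>" using exp_lower_Taylor_quadratic[of "\<bar>y\<bar>"] by (simp add: power2_eq_square)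
  then have "y\<^sup>2 * exp (a * \<bar>y\<bar>) \<le> 2 * exp \<bar>y\<bar> * exp (a * \<bar>y\<bar>)" by (intro mult_right_mono) auto
  then show ?thesis by (simp add: exp_add[symmetric] algebra_simps)
qed

lemma sym_kernel_integrable_power2_exp:
  assumes M: "sym_kernel a M"
  shows "integrable M (\<lambda>y. y\<^sup>2 * exp (a * \<bar>y\<bar>))"
proof (rule Bochner_Integration.integrable_bound)
  have [measurable_cong]: "sets M = sets borel" using M by (simp add: sym_kernel_def)
  show "integrable M (\<lambda>y. 2 * exp ((a + 1) * \<bar>y\<bar>))" using M by (auto simp: sym_kernel_def)
  show "(\<lambda>y. y\<^sup>2 * exp (a * \<bar>y\<bar>)) \<in> borel_measurable M" by measurable
qed (use power2_exp_le in auto)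

lemma sym_kernel_reflect:
  fixes \<phi> :: "real \<Rightarrow> real"
  assumes M: "sym_kernel a M" and [measurable]: "\<phi> \<in> borel_measurable borel"
  shows "(\<integral>y. \<phi> (- y) \<partial>M) = (\<integral>y. \<phi> y \<partial>M)"
proof -
  have [measurable_cong]: "sets M = sets borel" using M by (simp add: sym_kernel_def)
  have "(\<integral>y. \<phi> y \<partial>M) = (\<integral>y. \<phi> y \<partial>distr M borel uminus)" using M by (simp add: sym_kernel_def)
  also have "\<dots> = (\<integral>y. \<phi> (- y) \<partial>M)" by (simp add: integral_distr)
  finally show ?thesis by simp
qed

text \<open>This is where evenness of the kernel pays: convolution commutes with the reflections of
  the line, which represent the reversal of edges.\<close>

lemma convol_reflect:
  assumes M: "sym_kernel a M" and [measurable]: "\<phi> \<in> borel_measurable borel"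
  shows "convol M (\<lambda>x. \<phi> (c - x)) x = convol M \<phi> (c - x)"
  using sym_kernel_reflect[OF M, of "\<lambda>y. \<phi> (c - x + y)"]
  by (simp add: convol_def algebra_simps)

lemma convol_bound:
  assumes a: "0 \<le> a" and M: "sym_kernel a M" and \<phi>: "exp_bounded a \<phi>"
    and C: "\<And>y. \<bar>\<phi> (x + y)\<bar> \<le> C * exp (a * \<bar>y\<bar>)"
  shows "\<bar>convol M \<phi> x\<bar> \<le> C * (\<integral>y. exp (a * \<bar>y\<bar>) \<partial>M)"
proof -
  have "\<bar>convol M \<phi> x\<bar> \<le> (\<integral>y. \<bar>\<phi> (x + y)\<bar> \<partial>M)" by (auto simp: convol_def intro: integral_abs_bound)
  also have "\<dots> \<le> (\<integral>y. C * exp (a * \<bar>y\<bar>) \<partial>M)"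
    using sym_kernel_integrable[OF M exp_bounded_shift[OF a \<phi>]] sym_kernel_integrable_exp[OF M, of a] C
    by (intro integral_mono) auto
  finally show ?thesis by simp
qed

lemma exp_bounded_convol:
  assumes a: "0 \<le> a" and M: "sym_kernel a M" and \<phi>: "exp_bounded a \<phi>"
  shows "exp_bounded a (convol M \<phi>)"
proof -
  obtain C where C: "0 \<le> C" "\<And>x. \<bar>\<phi> x\<bar> \<le> C * exp (a * \<bar>x\<bar>)" by (rule exp_boundedE[OF \<phi>]) blast
  have "\<bar>\<phi> (x + y)\<bar> \<le> (C * exp (a * \<bar>x\<bar>)) * exp (a * \<bar>y\<bar>)" for x y
    using C(2)[of "x + y"] mult_left_mono[OF exp_abs_add[OF a, of x y] C(1)]
    by (simp add: mult.assoc)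
  from convol_bound[OF a M \<phi> this]
  have "\<bar>convol M \<phi> x\<bar> \<le> (C * (\<integral>y. exp (a * \<bar>y\<bar>) \<partial>M)) * exp (a * \<bar>x\<bar>)" for x
    by (simp add: mult_ac)
  moreover have "convol M \<phi> \<in> borel_measurable borel"
  proof -
    have [measurable_cong]: "sets M = sets borel" using M by (simp add: sym_kernel_def)
    interpret prob_space M using M by (simp add: sym_kernel_def)
    have [measurable]: "\<phi> \<in> borel_measurable borel" using \<phi> by (auto simp: exp_bounded_def)
    show ?thesis unfolding convol_def[abs_def] by measurable
  qed
  ultimately show ?thesis by (auto simp: exp_bounded_def)
qed

lemma isCont_convol:
  assumes a: "0 \<le> a" and M: "sym_kernel a M" and \<phi>: "exp_bounded a \<phi>" and cont: "\<And>x. isCont \<phi> x"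
  shows "isCont (convol M \<phi>) x"
  unfolding continuous_at_sequentially comp_def
proof (intro allI impI)
  fix u assume u: "u \<longlonglongrightarrow> x"
  obtain C where C: "0 \<le> C" "\<And>x. \<bar>\<phi> x\<bar> \<le> C * exp (a * \<bar>x\<bar>)" by (rule exp_boundedE[OF \<phi>]) blast
  obtain B where B: "\<And>n. \<bar>u n\<bar> \<le> B" using convergent_imp_Bseq[OF convergentI[OF u]] by (auto simp: Bseq_def)
  have [measurable_cong]: "sets M = sets borel" using M by (simp add: sym_kernel_def)
  have [measurable]: "\<phi> \<in> borel_measurable borel" using \<phi> by (auto simp: exp_bounded_def)
  show "(\<lambda>n. convol M \<phi> (u n)) \<longlonglongrightarrow> convol M \<phi> x"
    unfolding convol_def
  proof (rule integral_dominated_convergence)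
    show "integrable M (\<lambda>y. C * exp (a * B) * exp (a * \<bar>y\<bar>))"
      using sym_kernel_integrable_exp[OF M, of a] by auto
    show "AE y in M. (\<lambda>n. \<phi> (u n + y)) \<longlonglongrightarrow> \<phi> (x + y)"
      by (intro AE_I2 isCont_tendsto_compose[OF cont] tendsto_add u tendsto_const)
    fix n
    have "\<bar>\<phi> (u n + y)\<bar> \<le> C * exp (a * B) * exp (a * \<bar>y\<bar>)" for y
    proof -
      have "exp (a * \<bar>u n + y\<bar>) \<le> exp (a * B) * exp (a * \<bar>y\<bar>)"
        by (rule order_trans[OF exp_abs_add[OF a]]) (use B a in \<open>auto intro!: mult_left_mono\<close>)
      then show ?thesis using C(2)[of "u n + y"] mult_left_mono[OF _ C(1)] by (fastforce simp: mult.assoc)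
    qed
    then show "AE y in M. norm (\<phi> (u n + y)) \<le> C * exp (a * B) * exp (a * \<bar>y\<bar>)" by simp
  qed measurable
qed

text \<open>Fubini, with the submultiplicative weight \<open>exp (a * \<bar>x\<bar>)\<close> as
  majorant.\<close>

lemma convol_convolution:
  assumes a: "0 \<le> a" and M: "sym_kernel a M" and N: "sym_kernel a N" and \<phi>: "exp_bounded a \<phi>"
  shows "convol M (convol N \<phi>) x = convol (M \<star> N) \<phi> x"
proof -
  have [measurable_cong]: "sets M = sets borel" "sets N = sets borel"
    using M N by (simp_all add: sym_kernel_def)
  interpret M: prob_space M using M by (simp add: sym_kernel_def)
  interpret N: prob_space N using N by (simp add: sym_kernel_def)
  interpret pair_sigma_finite M N ..
  have [measurable]: "\<phi> \<in> borel_measurable borel" using \<phi> by (auto simp: exp_bounded_def)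
  obtain C where C: "0 \<le> C" "\<And>x. \<bar>\<phi> x\<bar> \<le> C * exp (a * \<bar>x\<bar>)" by (rule exp_boundedE[OF \<phi>]) blast
  have bnd: "\<bar>\<phi> (x + (y + z))\<bar> \<le> C * exp (a * \<bar>x\<bar>) * (exp (a * \<bar>y\<bar>) * exp (a * \<bar>z\<bar>))" for y z
  proof -
    have "exp (a * \<bar>x + (y + z)\<bar>) \<le> exp (a * \<bar>x\<bar>) * (exp (a * \<bar>y\<bar>) * exp (a * \<bar>z\<bar>))"
      by (rule order_trans[OF exp_abs_add[OF a]]) (intro mult_left_mono exp_abs_add a, simp)
    from mult_left_mono[OF this C(1)] show ?thesis
      using C(2)[of "x + (y + z)"] by (simp add: mult.assoc)
  qed
  have int: "integrable (M \<Otimes>\<^sub>M N) (\<lambda>(y, z). C * exp (a * \<bar>x\<bar>) * (exp (a * \<bar>y\<bar>) * exp (a * \<bar>z\<bar>)))"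
  proof (rule Fubini_integrable)
    show "integrable M (\<lambda>y. \<integral>z. norm (case (y, z) of (y, z) \<Rightarrow>
        C * exp (a * \<bar>x\<bar>) * (exp (a * \<bar>y\<bar>) * exp (a * \<bar>z\<bar>))) \<partial>N)"
      using sym_kernel_integrable_exp[OF M, of a] C(1) by (auto simp: abs_mult)
  qed (use sym_kernel_integrable_exp[OF N, of a] in auto)
  have "integrable (M \<Otimes>\<^sub>M N) (\<lambda>p. \<phi> (x + (case p of (y, z) \<Rightarrow> y + z)))"
    by (rule Bochner_Integration.integrable_bound[OF int])
      (auto simp: split_beta intro: order_trans[OF bnd] order_trans[OF _ abs_ge_self])
  from integral_fst'[OF this] show ?thesis
    unfolding convol_def convolution_def
    by (subst integral_distr) (auto simp: add.assoc)
qed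

text \<open>For the Gaussian and the Laplace kernel this makes heat operators and resolvent commute,
  so that the heat operators preserve the domain of the Laplacian.\<close>

lemma convol_commute:
  assumes a: "0 \<le> a" and M: "sym_kernel a M" and N: "sym_kernel a N" and \<phi>: "exp_bounded a \<phi>"
  shows "convol M (convol N \<phi>) x = convol N (convol M \<phi>) x"
proof -
  have "finite_measure M" "finite_measure N" "sets M = sets borel" "sets N = sets borel"
    using M N by (auto simp: sym_kernel_def prob_space_def)
  then show ?thesis
    using convol_convolution[OF a M N \<phi>] convol_convolution[OF a N M \<phi>]
      convolution_commutative[of M N] by simp
qed

subsection \<open>The Gaussian kernel\<close>

text \<open>The heat kernel of the second derivative, with variance 2 t. As an image of the standard
  normal law it also makes sense at t = 0, where it is the Dirac measure at 0.\<close>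

definition gauss :: "real \<Rightarrow> real measure" where
  "gauss t = distr (density lborel std_normal_density) borel (\<lambda>z. sqrt (2 * t) * z)"

lemma sets_gauss [simp]: "sets (gauss t) = sets borel"
  by (simp add: gauss_def)

lemma integral_gauss:
  fixes h :: "real \<Rightarrow> real"
  assumes [measurable]: "h \<in> borel_measurable borel"
  shows "(\<integral>y. h y \<partial>gauss t) = (\<integral>z. std_normal_density z * h (sqrt (2 * t) * z) \<partial>lborel)"
    and "integrable (gauss t) h \<longleftrightarrow> integrable lborel (\<lambda>z. std_normal_density z * h (sqrt (2 * t) * z))"
  by (simp_all add: gauss_def integral_distr integrable_distr_eq integral_density integrable_density)

text \<open>Completing the square turns the factor \<open>exp (c * z)\<close> into a shift of the
  mean by c.\<close>

lemma std_normal_exp_integrable: "integrable lborel (\<lambda>z. std_normal_density z * exp (b * \<bar>z\<bar>))"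
proof (rule Bochner_Integration.integrable_bound)
  have shift: "std_normal_density z * exp (c * z) = exp (c\<^sup>2 / 2) * normal_density c 1 z" for c z
  proof -
    have "- z\<^sup>2 / 2 + c * z = c\<^sup>2 / 2 + - (z - c)\<^sup>2 / 2" by (simp add: power2_eq_square field_simps)
    then have "exp (- z\<^sup>2 / 2) * exp (c * z) = exp (c\<^sup>2 / 2) * exp (- (z - c)\<^sup>2 / 2)"
      by (simp only: exp_add[symmetric])
    then show ?thesis by (simp add: normal_density_def)
  qed
  show "integrable lborel (\<lambda>z. std_normal_density z * exp (b * z) + std_normal_density z * exp (- b * z))"
    unfolding shift by (intro Bochner_Integration.integrable_add integrable_mult_right) auto
  have "exp (b * \<bar>z\<bar>) \<le> exp (b * z) + exp (- b * z)" for z by (cases "0 \<le> z") auto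
  then have "std_normal_density z * exp (b * \<bar>z\<bar>) \<le> std_normal_density z * (exp (b * z) + exp (- b * z))" for z
    by (intro mult_left_mono) auto
  then show "AE z in lborel. norm (std_normal_density z * exp (b * \<bar>z\<bar>))
      \<le> norm (std_normal_density z * exp (b * z) + std_normal_density z * exp (- b * z))"
    by (intro AE_I2) (simp add: distrib_left abs_mult order_trans[OF _ abs_ge_self])
qed measurable

lemma prob_space_gauss: "prob_space (gauss t)"
  unfolding gauss_def by (rule prob_space.prob_space_distr[OF prob_space_normal_density]) auto

lemma gauss_exp_integrable: "0 \<le> t \<Longrightarrow> integrable (gauss t) (\<lambda>y. exp (b * \<bar>y\<bar>))"
  using std_normal_exp_integrable[of "b * sqrt (2 * t)"]
  by (simp add: integral_gauss abs_mult mult.assoc)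

lemma sym_kernel_gauss:
  assumes "0 \<le> t"
  shows "sym_kernel a (gauss t)"
proof -
  have refl_std: "distr (density lborel std_normal_density) borel uminus = density lborel std_normal_density"
  proof (rule measure_eqI)
    fix A assume "A \<in> sets (distr (density lborel std_normal_density) borel uminus)"
    then have [measurable]: "A \<in> sets borel" by simp
    have "emeasure (distr (density lborel std_normal_density) borel uminus) A
        = (\<integral>\<^sup>+z. ennreal (std_normal_density z) * indicator A (- z) \<partial>lborel)"
    proof -
      have "uminus -` A \<in> sets borel" using measurable_sets_borel[of uminus borel A] by simp
      then show ?thesis by (simp add: emeasure_distr emeasure_density indicator_def)
    qed
    also have "\<dots> = (\<integral>\<^sup>+z. ennreal (std_normal_density z) * indicator A z \<partial>lborel)"
      by (subst nn_integral_real_affine[where c = "-1" and t = 0]) (simp_all add: std_normal_density_def)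
    finally show "emeasure (distr (density lborel std_normal_density) borel uminus) A
        = emeasure (density lborel std_normal_density) A" by (simp add: emeasure_density)
  qed simp
  have "distr (gauss t) borel uminus = distr (distr (density lborel std_normal_density) borel uminus) borel (\<lambda>z. sqrt (2 * t) * z)"
    by (simp add: gauss_def distr_distr comp_def)
  also have "\<dots> = gauss t" by (simp only: gauss_def refl_std)
  finally show ?thesis using assms by (simp add: sym_kernel_def prob_space_gauss gauss_exp_integrable)
qed

lemma gauss_density:
  assumes "0 < t"
  shows "gauss t = density lborel (normal_density 0 (sqrt (2 * t)))"
proof -
  interpret prob_space "density lborel std_normal_density" by (rule prob_space_normal_density) auto
  have "distributed (density lborel std_normal_density) lborel (\<lambda>x. x) std_normal_density"
    by (auto simp: distributed_def distr_id2)
  from normal_density_affine[OF this, of "sqrt (2 * t)" 0] assms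
  have "distributed (density lborel std_normal_density) lborel (\<lambda>x. sqrt (2 * t) * x)
     (normal_density 0 (sqrt (2 * t)))" by simp
  then show ?thesis unfolding gauss_def distributed_def
    by (metis distr_cong sets_lborel)
qed

lemma convol_gauss_0: "exp_bounded a \<phi> \<Longrightarrow> convol (gauss 0) \<phi> x = \<phi> x"
  using measurable_compose[OF borel_measurable_add[OF borel_measurable_const measurable_ident] exp_bounded_measurable[of a \<phi>], of x]
  by (simp add: convol_def integral_gauss(1))

lemma convol_gauss_add:
  assumes a: "0 \<le> a" and st: "0 \<le> s" "0 \<le> t" and \<phi>: "exp_bounded a \<phi>"
  shows "convol (gauss s) (convol (gauss t) \<phi>) x = convol (gauss (s + t)) \<phi> x"
proof -
  \<comment> \<open>The Gaussian has a density for positive times only; at time 0 convolution is the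
    identity.\<close>
  consider "s = 0" | "t = 0" | "0 < s" "0 < t" using st by linarith
  then show ?thesis
  proof cases
    case 1
    then show ?thesis
      using convol_gauss_0[OF exp_bounded_convol[OF a sym_kernel_gauss \<phi>]] st by simp
  next
    case 2
    then show ?thesis using convol_gauss_0[OF \<phi>] by (simp add: convol_def)
  next
    case 3
    have "gauss s \<star> gauss t = density lborel (\<lambda>x. \<integral>\<^sup>+y. ennreal (normal_density 0 (sqrt (2 * s)) (x - y))
        * ennreal (normal_density 0 (sqrt (2 * t)) y) \<partial>lborel)"
      using 3 prob_space_gauss unfolding gauss_density[OF 3(1)] gauss_density[OF 3(2)]
      by (intro convolution_density)
        (auto simp: gauss_density[symmetric] intro: prob_space.finite_measure)
    also have "\<dots> = density lborel (normal_density 0 (sqrt ((sqrt (2 * s))\<^sup>2 + (sqrt (2 * t))\<^sup>2)))"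
      using 3 by (subst conv_normal_density_zero_mean[symmetric]) (auto simp: ennreal_mult)
    also have "(sqrt (2 * s))\<^sup>2 + (sqrt (2 * t))\<^sup>2 = 2 * (s + t)" using 3 by simp
    finally show ?thesis
      using convol_convolution[OF a sym_kernel_gauss[OF st(1)] sym_kernel_gauss[OF st(2)] \<phi>] 3
      by (simp add: gauss_density)
  qed
qed

lemma gauss_power2: "0 \<le> t \<Longrightarrow> (\<integral>y. y\<^sup>2 \<partial>gauss t) = 2 * t"
  and gauss_power2_integrable: "integrable (gauss t) (\<lambda>y. y\<^sup>2)"
proof -
  have *: "std_normal_density z * (sqrt (2 * t) * z)\<^sup>2 = (sqrt (2 * t))\<^sup>2 * (std_normal_density z * z\<^sup>2)" for z
    by (simp only: power_mult_distrib mult_ac)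
  have m: "has_bochner_integral lborel (\<lambda>x. std_normal_density x * x\<^sup>2) 1"
    using std_normal_moment_even[of 1] by simp
  show "integrable (gauss t) (\<lambda>y. y\<^sup>2)"
    unfolding integral_gauss(2)[OF borel_measurable_power[OF measurable_ident_sets[OF refl]]] *
    using m by (intro integrable_mult_right) (auto simp: has_bochner_integral_iff)
  show "(\<integral>y. y\<^sup>2 \<partial>gauss t) = 2 * t" if "0 \<le> t"
    unfolding integral_gauss(1)[OF borel_measurable_power[OF measurable_ident_sets[OF refl]]] *
    using m that by (simp add: has_bochner_integral_iff)
qed

lemma gauss_identity: "(\<integral>y. y \<partial>gauss t) = 0"
  and gauss_identity_integrable: "integrable (gauss t) (\<lambda>y. y)"
proof -
  have *: "std_normal_density z * (sqrt (2 * t) * z) = sqrt (2 * t) * (std_normal_density z * z)" for z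
    by (simp only: mult_ac)
  have m: "has_bochner_integral lborel (\<lambda>x. std_normal_density x * x) 0"
    using std_normal_moment_odd[of 0] by simp
  show "integrable (gauss t) (\<lambda>y. y)"
    unfolding integral_gauss(2)[OF measurable_ident_sets[OF refl]] *
    using m by (intro integrable_mult_right) (auto simp: has_bochner_integral_iff)
  show "(\<integral>y. y \<partial>gauss t) = 0"
    unfolding integral_gauss(1)[OF measurable_ident_sets[OF refl]] *
    using m by (simp add: has_bochner_integral_iff)
qed

text \<open>The integrand \<open>4 * exp ((a + 2) * \<bar>z\<bar>)\<close> dominates both z^2 and
  z^4 times \<open>exp (a * \<bar>z\<bar>)\<close>, so one constant serves for the weighted moments
  of order 2 and 4.\<close>

definition gauss_const :: "real \<Rightarrow> real" where
  "gauss_const a = (\<integral>z. std_normal_density z * (4 * exp ((a + 2) * \<bar>z\<bar>)) \<partial>lborel)"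

lemma gauss_const_nonneg: "0 \<le> gauss_const a"
  by (auto simp: gauss_const_def intro!: integral_nonneg_AE)

text \<open>The substitution y = sqrt (2 t) z pulls out the factors 2 t and 4 t^2. For t \<le> 1/2
  one has sqrt (2 t) \<le> 1, so the remaining weight is at most
  \<open>exp (a * \<bar>z\<bar>)\<close>.\<close>

lemma gauss_power2_exp:
  assumes a: "0 \<le> a" and t: "0 \<le> t" "t \<le> 1/2"
  shows "(\<integral>y. y\<^sup>2 * exp (a * \<bar>y\<bar>) \<partial>gauss t) \<le> 2 * t * gauss_const a"
    and "(\<integral>y. y^4 * exp (a * \<bar>y\<bar>) \<partial>gauss t) \<le> 4 * t\<^sup>2 * gauss_const a"
    and "integrable (gauss t) (\<lambda>y. y^4 * exp (a * \<bar>y\<bar>))"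
proof -
  have s: "sqrt (2 * t) \<le> 1" using t by simp
  have e: "exp (a * (sqrt (2 * t) * \<bar>z\<bar>)) \<le> exp (a * \<bar>z\<bar>)" for z
    using a s mult_right_mono[OF s, of "\<bar>z\<bar>"] by (auto intro!: mult_left_mono)
  have e2: "z\<^sup>2 * exp (a * \<bar>z\<bar>) \<le> 4 * exp ((a + 2) * \<bar>z\<bar>)" for z
  proof -
    have "exp ((a + 1) * \<bar>z\<bar>) \<le> exp ((a + 2) * \<bar>z\<bar>)" by (auto intro!: mult_right_mono)
    then show ?thesis using power2_exp_le[of z a] exp_ge_zero[of "(a + 2) * \<bar>z\<bar>"] by linarith
  qed
  have e4: "z^4 * exp (a * \<bar>z\<bar>) \<le> 4 * exp ((a + 2) * \<bar>z\<bar>)" for z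
  proof -
    have "z^4 * exp (a * \<bar>z\<bar>) = z\<^sup>2 * (z\<^sup>2 * exp (a * \<bar>z\<bar>))" by (simp add: power_numeral_reduce mult_ac)
    also have "\<dots> \<le> z\<^sup>2 * (2 * exp ((a + 1) * \<bar>z\<bar>))" by (intro mult_left_mono power2_exp_le) auto
    also have "\<dots> \<le> 2 * (2 * exp ((a + 1 + 1) * \<bar>z\<bar>))" using power2_exp_le[of z "a + 1"] by linarith
    finally show ?thesis by (simp add: add.assoc)
  qed
  have i: "integrable lborel (\<lambda>z. std_normal_density z * (4 * exp ((a + 2) * \<bar>z\<bar>)))"
    using integrable_mult_right[OF std_normal_exp_integrable[of "a + 2"], of 4] by (simp add: mult_ac)
  show "(\<integral>y. y\<^sup>2 * exp (a * \<bar>y\<bar>) \<partial>gauss t) \<le> 2 * t * gauss_const a"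
  proof -
    have "(\<integral>y. y\<^sup>2 * exp (a * \<bar>y\<bar>) \<partial>gauss t)
      \<le> (\<integral>z. 2 * t * (std_normal_density z * (4 * exp ((a + 2) * \<bar>z\<bar>))) \<partial>lborel)"
    proof (subst integral_gauss(1), simp, rule integral_mono')
      show "integrable lborel (\<lambda>z. 2 * t * (std_normal_density z * (4 * exp ((a + 2) * \<bar>z\<bar>))))"
        by (rule integrable_mult_right[OF i])
      fix z :: real
      have "z\<^sup>2 * exp (a * (sqrt (2 * t) * \<bar>z\<bar>)) \<le> 4 * exp ((a + 2) * \<bar>z\<bar>)"
        by (rule order_trans[OF mult_left_mono[OF e] e2]) simp
      then have "2 * t * (std_normal_density z * (z\<^sup>2 * exp (a * (sqrt (2 * t) * \<bar>z\<bar>))))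
          \<le> 2 * t * (std_normal_density z * (4 * exp ((a + 2) * \<bar>z\<bar>)))"
        using t by (intro mult_left_mono) auto
      then show "std_normal_density z * ((sqrt (2 * t) * z)\<^sup>2 * exp (a * \<bar>sqrt (2 * t) * z\<bar>))
          \<le> 2 * t * (std_normal_density z * (4 * exp ((a + 2) * \<bar>z\<bar>)))"
        using t by (simp add: abs_mult power_mult_distrib mult_ac)
    qed (use t in auto)
    then show ?thesis by (simp only: gauss_const_def integral_mult_right_zero)
  qed
  have le4: "std_normal_density z * ((sqrt (2 * t) * z)^4 * exp (a * \<bar>sqrt (2 * t) * z\<bar>))
          \<le> 4 * t\<^sup>2 * (std_normal_density z * (4 * exp ((a + 2) * \<bar>z\<bar>)))" for z
  proof -
    have "sqrt (2 * t) ^ 4 = (2 * t)\<^sup>2" using t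
      by (simp add: power4_eq_xxxx power2_eq_square)
    then have s4: "sqrt (2 * t) ^ 4 = 4 * t\<^sup>2" by (simp add: power_mult_distrib)
    have "z^4 * exp (a * (sqrt (2 * t) * \<bar>z\<bar>)) \<le> 4 * exp ((a + 2) * \<bar>z\<bar>)"
      by (rule order_trans[OF mult_left_mono[OF e] e4]) simp
    then have "4 * t\<^sup>2 * (std_normal_density z * (z^4 * exp (a * (sqrt (2 * t) * \<bar>z\<bar>))))
        \<le> 4 * t\<^sup>2 * (std_normal_density z * (4 * exp ((a + 2) * \<bar>z\<bar>)))"
      using t by (intro mult_left_mono) auto
    moreover have "\<bar>sqrt (2 * t) * z\<bar> = sqrt (2 * t) * \<bar>z\<bar>" using t by (simp add: abs_mult)
    ultimately show ?thesis by (simp only: power_mult_distrib s4) (simp only: mult_ac)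
  qed
  show "integrable (gauss t) (\<lambda>y. y^4 * exp (a * \<bar>y\<bar>))"
  proof (subst integral_gauss(2), simp, rule Bochner_Integration.integrable_bound)
    show "integrable lborel (\<lambda>z. 4 * t\<^sup>2 * (std_normal_density z * (4 * exp ((a + 2) * \<bar>z\<bar>))))"
      by (rule integrable_mult_right[OF i])
    show "AE z in lborel. norm (std_normal_density z * ((sqrt (2 * t) * z)^4 * exp (a * \<bar>sqrt (2 * t) * z\<bar>)))
      \<le> norm (4 * t\<^sup>2 * (std_normal_density z * (4 * exp ((a + 2) * \<bar>z\<bar>))))"
      using order_trans[OF le4 abs_ge_self] by (intro AE_I2) (simp add: abs_mult)
  qed measurable
  show "(\<integral>y. y^4 * exp (a * \<bar>y\<bar>) \<partial>gauss t) \<le> 4 * t\<^sup>2 * gauss_const a"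
  proof -
    have "(\<integral>y. y^4 * exp (a * \<bar>y\<bar>) \<partial>gauss t)
      \<le> (\<integral>z. 4 * t\<^sup>2 * (std_normal_density z * (4 * exp ((a + 2) * \<bar>z\<bar>))) \<partial>lborel)"
    proof (subst integral_gauss(1), simp, rule integral_mono')
      show "integrable lborel (\<lambda>z. 4 * t\<^sup>2 * (std_normal_density z * (4 * exp ((a + 2) * \<bar>z\<bar>))))"
        by (rule integrable_mult_right[OF i])
    qed (use t le4 in auto)
    then show ?thesis by (simp only: gauss_const_def integral_mult_right_zero)
  qed
qed

text \<open>Here \<phi> is merely measurable, as the strong Feller property demands. The variable x
  is moved out of \<phi> into the Gaussian density, which depends continuously on it.\<close>

lemma isCont_convol_gauss:
  assumes a: "0 \<le> a" and t: "0 < t" and \<phi>: "exp_bounded a \<phi>"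
  shows "isCont (convol (gauss t) \<phi>) x"
proof -
  obtain C where C: "0 \<le> C" "\<And>x. \<bar>\<phi> x\<bar> \<le> C * exp (a * \<bar>x\<bar>)"
    by (rule exp_boundedE[OF \<phi>]) blast
  define \<sigma> where "\<sigma> = sqrt (2 * t)"
  have \<sigma>: "0 < \<sigma>" using t by (simp add: \<sigma>_def)
  have [measurable]: "\<phi> \<in> borel_measurable borel" using \<phi> by (auto simp: exp_bounded_def)
  have eq: "convol (gauss t) \<phi> x = (\<integral>s. normal_density x \<sigma> s * \<phi> s \<partial>lborel)" for x
  proof -
    have "convol (gauss t) \<phi> x = (\<integral>y. normal_density 0 \<sigma> y * \<phi> (x + y) \<partial>lborel)"
      unfolding convol_def gauss_density[OF t] \<sigma>_def by (subst integral_density) auto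
    also have "\<dots> = (\<integral>s. normal_density x \<sigma> s * \<phi> s \<partial>lborel)"
      by (subst lborel_integral_real_affine[where c = 1 and t = x])
        (simp_all add: normal_density_def)
    finally show ?thesis .
  qed
  show ?thesis
    unfolding continuous_at_sequentially comp_def
  proof (intro allI impI)
    fix u assume u: "u \<longlonglongrightarrow> x"
    obtain B where B: "\<And>n. \<bar>u n\<bar> \<le> B" using convergent_imp_Bseq[OF convergentI[OF u]] by (auto simp: Bseq_def)
    have B0: "0 \<le> B" using B[of 0] by linarith
    define D where "D = exp (B\<^sup>2 / (2 * \<sigma>\<^sup>2)) * sqrt 2"
    \<comment> \<open>Since \<open>(s - u)\<^sup>2 \<ge> s\<^sup>2 / 2 - u\<^sup>2\<close>, all the Gaussians centred in a bounded set are dominated by one of larger variance.\<close>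
    have dom: "normal_density (u n) \<sigma> s \<le> D * normal_density 0 (sqrt 2 * \<sigma>) s" for n s
    proof -
      have "s\<^sup>2 / 2 - (u n)\<^sup>2 \<le> (s - u n)\<^sup>2"
        using zero_le_power2[of "s - 2 * u n"] by (simp add: power2_eq_square algebra_simps)
      moreover have "(u n)\<^sup>2 \<le> B\<^sup>2" using B[of n] by (simp add: abs_le_square_iff[symmetric] B0)
      ultimately have "s\<^sup>2 / 2 - B\<^sup>2 \<le> (s - u n)\<^sup>2" by linarith
      then have "- (s - u n)\<^sup>2 / (2 * \<sigma>\<^sup>2) \<le> (B\<^sup>2 - s\<^sup>2 / 2) / (2 * \<sigma>\<^sup>2)"
        using \<sigma> by (intro divide_right_mono) auto
      then have "exp (- (s - u n)\<^sup>2 / (2 * \<sigma>\<^sup>2)) \<le> exp (B\<^sup>2 / (2 * \<sigma>\<^sup>2)) * exp (- s\<^sup>2 / (2 * (sqrt 2 * \<sigma>)\<^sup>2))"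
        by (simp add: exp_add[symmetric] power_mult_distrib diff_divide_distrib)
      then have "1 / sqrt (2 * pi * \<sigma>\<^sup>2) * exp (- (s - u n)\<^sup>2 / (2 * \<sigma>\<^sup>2))
         \<le> 1 / sqrt (2 * pi * \<sigma>\<^sup>2) * (exp (B\<^sup>2 / (2 * \<sigma>\<^sup>2)) * exp (- s\<^sup>2 / (2 * (sqrt 2 * \<sigma>)\<^sup>2)))"
        by (intro mult_left_mono) auto
      moreover have "1 / sqrt (2 * pi * \<sigma>\<^sup>2) = sqrt 2 * (1 / sqrt (2 * pi * (sqrt 2 * \<sigma>)\<^sup>2))"
        using \<sigma> by (simp add: power_mult_distrib real_sqrt_mult field_simps)
      moreover from this have "D * normal_density 0 (sqrt 2 * \<sigma>) s = 1 / sqrt (2 * pi * \<sigma>\<^sup>2)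
          * (exp (B\<^sup>2 / (2 * \<sigma>\<^sup>2)) * exp (- s\<^sup>2 / (2 * (sqrt 2 * \<sigma>)\<^sup>2)))"
        unfolding normal_density_def D_def by simp
      ultimately show ?thesis by (simp only: normal_density_def)
    qed
    have "normal_density 0 (sqrt 2 * \<sigma>) s * exp (a * \<bar>s\<bar>) =
         normal_density 0 (sqrt (2 * (2 * t))) s * exp (a * \<bar>s\<bar>)" for s
      by (simp add: \<sigma>_def real_sqrt_mult[symmetric])
    moreover have "integrable lborel (\<lambda>s. normal_density 0 (sqrt (2 * (2 * t))) s * exp (a * \<bar>s\<bar>))"
    proof -
      have "integrable (gauss (2 * t)) (\<lambda>s. exp (a * \<bar>s\<bar>))" using gauss_exp_integrable t by simp
      moreover have "0 < 2 * t" using t by simp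
      ultimately show ?thesis by (simp add: gauss_density integrable_density)
    qed
    ultimately have i: "integrable lborel (\<lambda>s. normal_density 0 (sqrt 2 * \<sigma>) s * exp (a * \<bar>s\<bar>))" by simp
    show "(\<lambda>n. convol (gauss t) \<phi> (u n)) \<longlonglongrightarrow> convol (gauss t) \<phi> x"
      unfolding eq
    proof (rule integral_dominated_convergence)
      show "integrable lborel (\<lambda>s. (D * C) * (normal_density 0 (sqrt 2 * \<sigma>) s * exp (a * \<bar>s\<bar>)))"
        using i by (rule integrable_mult_right)
      show "AE s in lborel. (\<lambda>n. normal_density (u n) \<sigma> s * \<phi> s) \<longlonglongrightarrow> normal_density x \<sigma> s * \<phi> s"
        unfolding normal_density_def using \<sigma> by (intro AE_I2 tendsto_intros u) auto
      fix n
      have "normal_density (u n) \<sigma> s * \<bar>\<phi> s\<bar>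
          \<le> (D * normal_density 0 (sqrt 2 * \<sigma>) s) * (C * exp (a * \<bar>s\<bar>))" for s
        by (intro mult_mono dom C(2)) (auto simp: D_def)
      then show "AE s in lborel. norm (normal_density (u n) \<sigma> s * \<phi> s)
          \<le> (D * C) * (normal_density 0 (sqrt 2 * \<sigma>) s * exp (a * \<bar>s\<bar>))"
        by (intro AE_I2) (simp add: abs_mult mult_ac)
    qed measurable
  qed
qed

text \<open>The first moment of the Gaussian vanishes and the second is 2 t, so the Taylor
  polynomial of degree 2 contributes exactly \<psi> x + t \<gamma> x. The oscillation of \<gamma> is
  assumed in the shape that \<open>unfold_osc\<close> supplies; its y^2 meets the y^2 of the Taylor
  remainder and costs a fourth moment, of order t^2.\<close>

lemma convol_gauss_taylor:
  assumes a: "0 \<le> a" and t: "0 \<le> t" "t \<le> 1/2" and \<psi>: "exp_bounded a \<psi>"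
    and d1: "\<And>y. (\<psi> has_real_derivative \<psi>' y) (at y)"
    and d2: "\<And>y. (\<psi>' has_real_derivative \<gamma> y) (at y)"
    and K: "0 \<le> K" and \<epsilon>: "0 \<le> \<epsilon>"
    and osc: "\<And>y. \<bar>\<gamma> (x + y) - \<gamma> x\<bar> \<le> \<epsilon> + K * (y\<^sup>2 * exp (a * \<bar>y\<bar>))"
  shows "\<bar>convol (gauss t) \<psi> x - \<psi> x - t * \<gamma> x\<bar> \<le> t * \<epsilon> + 2 * K * gauss_const a * t\<^sup>2"
proof -
  interpret prob_space "gauss t" by (rule prob_space_gauss)
  have taylor: "\<bar>\<psi> (x + y) - \<psi> x - y * \<psi>' x - y\<^sup>2 / 2 * \<gamma> x\<bar> \<le> y\<^sup>2 / 2 * \<epsilon> + K / 2 * (y^4 * exp (a * \<bar>y\<bar>))" for y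
  proof (cases "y = 0")
    case False
    define df where "df n = (if n = 0 then \<psi> else if n = Suc 0 then \<psi>' else \<gamma>)" for n :: nat
    have "\<exists>s. (if x + y < x then x + y < s \<and> s < x else x < s \<and> s < x + y) \<and>
        \<psi> (x + y) = (\<Sum>m<2. (df m x / fact m) * (x + y - x)^m) + (df 2 s / fact 2) * (x + y - x)^2"
      by (rule Taylor[where a = "min x (x + y)" and b = "max x (x + y)"])
        (use False d1 d2 in \<open>auto simp: df_def less_Suc_eq numeral_2_eq_2\<close>)
    then obtain s where s0: "if x + y < x then x + y < s \<and> s < x else x < s \<and> s < x + y"
      and s1: "\<psi> (x + y) = (\<Sum>m<2. (df m x / fact m) * (x + y - x)^m) + (df 2 s / fact 2) * (x + y - x)^2"
      by blast
    have s: "\<bar>s - x\<bar> \<le> \<bar>y\<bar>" "\<psi> (x + y) = \<psi> x + \<psi>' x * y + \<gamma> s / 2 * y\<^sup>2"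
      using s0 s1 by (auto simp: df_def numeral_2_eq_2 split: if_splits)
    have "\<bar>\<gamma> s - \<gamma> x\<bar> \<le> \<epsilon> + K * ((s - x)\<^sup>2 * exp (a * \<bar>s - x\<bar>))" using osc[of "s - x"] by simp
    also have "\<dots> \<le> \<epsilon> + K * (y\<^sup>2 * exp (a * \<bar>y\<bar>))"
      using s(1) a K by (intro add_left_mono mult_left_mono mult_mono) (auto simp: abs_le_square_iff[symmetric] intro: mult_left_mono)
    finally have "y\<^sup>2 / 2 * \<bar>\<gamma> s - \<gamma> x\<bar> \<le> y\<^sup>2 / 2 * (\<epsilon> + K * (y\<^sup>2 * exp (a * \<bar>y\<bar>)))"
      by (intro mult_left_mono) auto
    moreover have "y\<^sup>2 / 2 * (\<epsilon> + K * (y\<^sup>2 * exp (a * \<bar>y\<bar>))) = y\<^sup>2 / 2 * \<epsilon> + K / 2 * (y^4 * exp (a * \<bar>y\<bar>))"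
      by (simp add: power2_eq_square power4_eq_xxxx algebra_simps)
    moreover have "\<psi> (x + y) - \<psi> x - y * \<psi>' x - y\<^sup>2 / 2 * \<gamma> x = y\<^sup>2 / 2 * (\<gamma> s - \<gamma> x)"
      using s(2) by (simp add: algebra_simps)
    moreover have "\<bar>y\<^sup>2 / 2 * (\<gamma> s - \<gamma> x)\<bar> = y\<^sup>2 / 2 * \<bar>\<gamma> s - \<gamma> x\<bar>" by (simp add: abs_mult)
    ultimately show ?thesis by (simp only:)
  qed simp
  note i = sym_kernel_integrable[OF sym_kernel_gauss[OF t(1)] exp_bounded_shift[OF a \<psi>], of x]
    gauss_identity_integrable gauss_power2_integrable gauss_power2_exp(3)[OF a t]
  have "(\<integral>y. \<psi> (x + y) - \<psi> x - y * \<psi>' x - y\<^sup>2 / 2 * \<gamma> x \<partial>gauss t)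
    = (\<integral>y. \<psi> (x + y) \<partial>gauss t) - (\<integral>y. \<psi> x \<partial>gauss t) - (\<integral>y. y * \<psi>' x \<partial>gauss t) - (\<integral>y. y\<^sup>2 / 2 * \<gamma> x \<partial>gauss t)"
    using i by (subst Bochner_Integration.integral_diff; simp)+
  also have "\<dots> = convol (gauss t) \<psi> x - \<psi> x - t * \<gamma> x"
    using t by (simp add: gauss_identity gauss_power2 convol_def prob_space)
  finally have eq: "(\<integral>y. \<psi> (x + y) - \<psi> x - y * \<psi>' x - y\<^sup>2 / 2 * \<gamma> x \<partial>gauss t) = convol (gauss t) \<psi> x - \<psi> x - t * \<gamma> x" .
  have "\<bar>convol (gauss t) \<psi> x - \<psi> x - t * \<gamma> x\<bar> \<le> (\<integral>y. \<bar>\<psi> (x + y) - \<psi> x - y * \<psi>' x - y\<^sup>2 / 2 * \<gamma> x\<bar> \<partial>gauss t)"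
    unfolding eq[symmetric] by (intro integral_abs_bound)
  also have "\<dots> \<le> (\<integral>y. y\<^sup>2 / 2 * \<epsilon> + K / 2 * (y^4 * exp (a * \<bar>y\<bar>)) \<partial>gauss t)"
    using i by (intro integral_mono taylor) auto
  also have "\<dots> = t * \<epsilon> + K / 2 * (\<integral>y. y^4 * exp (a * \<bar>y\<bar>) \<partial>gauss t)"
    using i t by (simp add: gauss_power2)
  also have "\<dots> \<le> t * \<epsilon> + K / 2 * (4 * t\<^sup>2 * gauss_const a)"
    using gauss_power2_exp(2)[OF a t] K by (intro add_left_mono mult_left_mono) auto
  finally show ?thesis by (simp add: mult_ac)
qed

text \<open>The number c is left free: c = \<phi> x yields approximation of the identity, c = 0
  yields decay at infinity.\<close>

lemma convol_near:
  assumes a: "0 \<le> a" and M: "sym_kernel a M" and \<phi>: "exp_bounded a \<phi>"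
    and osc: "\<And>y. \<bar>\<phi> (x + y) - c\<bar> \<le> \<epsilon> + K * (y\<^sup>2 * exp (a * \<bar>y\<bar>))"
  shows "\<bar>convol M \<phi> x - c\<bar> \<le> \<epsilon> + K * (\<integral>y. y\<^sup>2 * exp (a * \<bar>y\<bar>) \<partial>M)"
proof -
  interpret prob_space M using M by (simp add: sym_kernel_def)
  note i = sym_kernel_integrable[OF M exp_bounded_shift[OF a \<phi>], of x]
    sym_kernel_integrable_power2_exp[OF M]
  have eq: "convol M \<phi> x - c = (\<integral>y. \<phi> (x + y) - c \<partial>M)"
    using i by (simp add: convol_def prob_space)
  have "\<bar>convol M \<phi> x - c\<bar> \<le> (\<integral>y. \<bar>\<phi> (x + y) - c\<bar> \<partial>M)" unfolding eq by (rule integral_abs_bound)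
  also have "\<dots> \<le> (\<integral>y. \<epsilon> + K * (y\<^sup>2 * exp (a * \<bar>y\<bar>)) \<partial>M)"
    using i by (intro integral_mono osc) auto
  also have "\<dots> = \<epsilon> + K * (\<integral>y. y\<^sup>2 * exp (a * \<bar>y\<bar>) \<partial>M)"
    using i by (simp add: prob_space)
  finally show ?thesis .
qed

subsection \<open>The Laplace kernel\<close>

text \<open>The density is m^2 times the Green function of m^2 - d^2/dx^2.\<close>

definition lapl :: "real \<Rightarrow> real measure" where
  "lapl m = density lborel (\<lambda>y. m / 2 * exp (- m * \<bar>y\<bar>))"

lemma has_integral_exp_abs:
  fixes k :: real
  assumes "0 < k"
  shows "has_bochner_integral lborel (\<lambda>y. exp (- k * \<bar>y\<bar>)) (2 / k)"
proof -
  interpret prob_space "density lborel (exponential_density k)"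
    by (rule prob_space_exponential_density[OF assms])
  have "(\<integral>\<^sup>+y. exponential_density k y \<partial>lborel) = 1"
    using emeasure_space_1 by (simp add: emeasure_density)
  then have e: "has_bochner_integral lborel (exponential_density k) 1"
    using assms by (intro has_bochner_integral_nn_integral) (auto simp: exponential_density_nonneg)
  have e': "has_bochner_integral lborel (\<lambda>y. exponential_density k (- y)) 1"
    using lborel_has_bochner_integral_real_affine_iff[of "-1" "exponential_density k" 1 0] e by simp
  have "has_bochner_integral lborel (\<lambda>y. (exponential_density k y + exponential_density k (- y)) / k) (2 / k)"
    using has_bochner_integral_divide_zero[OF has_bochner_integral_add[OF e e'], of k] by simp
  \<comment> \<open>At 0 both one-sided densities count, so the identity holds off 0 only.\<close>
  moreover have "AE y in lborel. (exponential_density k y + exponential_density k (- y)) / k = exp (- k * \<bar>y\<bar>)"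
    using AE_lborel_singleton[of 0]
    by eventually_elim (use assms in \<open>auto simp: exponential_density_def mult.commute\<close>)
  ultimately show ?thesis
    by (subst (asm) has_bochner_integral_cong_AE) (auto simp: exponential_density_def[abs_def])
qed

lemma integral_lapl:
  fixes h :: "real \<Rightarrow> real"
  assumes "0 < m" and [measurable]: "h \<in> borel_measurable borel"
  shows "(\<integral>y. h y \<partial>lapl m) = (\<integral>y. m / 2 * exp (- m * \<bar>y\<bar>) * h y \<partial>lborel)"
    and "integrable (lapl m) h \<longleftrightarrow> integrable lborel (\<lambda>y. m / 2 * exp (- m * \<bar>y\<bar>) * h y)"
  using assms(1) by (simp_all add: lapl_def integral_density integrable_density)

lemma lapl_exp:
  assumes "0 < m" "b < m"
  shows "integrable (lapl m) (\<lambda>y. exp (b * \<bar>y\<bar>))"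
    and "(\<integral>y. exp (b * \<bar>y\<bar>) \<partial>lapl m) = m / (m - b)"
proof -
  have *: "m / 2 * exp (- m * \<bar>y\<bar>) * exp (b * \<bar>y\<bar>) = m / 2 * exp (- (m - b) * \<bar>y\<bar>)" for y
    by (simp add: mult.assoc exp_add[symmetric] algebra_simps)
  have h: "has_bochner_integral lborel (\<lambda>y. m / 2 * exp (- (m - b) * \<bar>y\<bar>)) (m / 2 * (2 / (m - b)))"
    using has_integral_exp_abs[of "m - b"] assms by (intro has_bochner_integral_mult_right) auto
  show "integrable (lapl m) (\<lambda>y. exp (b * \<bar>y\<bar>))"
    using h assms by (subst integral_lapl(2)) (auto simp only: * has_bochner_integral_iff, auto)
  show "(\<integral>y. exp (b * \<bar>y\<bar>) \<partial>lapl m) = m / (m - b)"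
    using h assms by (subst integral_lapl(1)) (auto simp only: * has_bochner_integral_iff, auto)
qed

lemma sym_kernel_lapl:
  assumes a: "0 \<le> a" "a + 1 < m"
  shows "sym_kernel a (lapl m)"
proof -
  have m: "0 < m" using a by simp
  have "prob_space (lapl m)"
  proof
    have "(\<integral>\<^sup>+y. ennreal (m / 2 * exp (- m * \<bar>y\<bar>)) \<partial>lborel) = ennreal (m / 2 * (2 / m))"
      using has_integral_exp_abs[OF m] m
      by (intro nn_integral_eq_integrable[THEN iffD2] conjI)
        (auto simp: has_bochner_integral_iff)
    then show "emeasure (lapl m) (space (lapl m)) = 1"
      using m by (simp add: lapl_def emeasure_density)
  qed
  moreover have "distr (lapl m) borel uminus = lapl m"
  proof (rule measure_eqI)
    fix A assume "A \<in> sets (distr (lapl m) borel uminus)"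
    then have [measurable]: "A \<in> sets borel" by simp
    have "uminus -` A \<in> sets borel" using measurable_sets_borel[of uminus borel A] by simp
    then have "emeasure (distr (lapl m) borel uminus) A
        = (\<integral>\<^sup>+y. ennreal (m / 2 * exp (- m * \<bar>y\<bar>)) * indicator A (- y) \<partial>lborel)"
      by (simp add: lapl_def emeasure_distr emeasure_density indicator_def)
    also have "\<dots> = (\<integral>\<^sup>+y. ennreal (m / 2 * exp (- m * \<bar>y\<bar>)) * indicator A y \<partial>lborel)"
      by (subst nn_integral_real_affine[where c = "-1" and t = 0]) simp_all
    finally show "emeasure (distr (lapl m) borel uminus) A = emeasure (lapl m) A"
      by (simp add: lapl_def emeasure_density)
  qed (simp add: lapl_def)
  ultimately show ?thesis
    using lapl_exp(1)[OF m a(2)] by (simp add: sym_kernel_def) (simp add: lapl_def)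
qed

text \<open>The factor y^2 is at most 8 / m^2 times \<open>exp (m / 2 * \<bar>y\<bar>)\<close>; with
  this half of the decay spent, the remaining integral is m / (m / 2 - a) \<le> 4. The bound tends
  to 0 as m grows, so the kernels approximate the identity.\<close>

lemma lapl_power2_exp:
  assumes a: "0 \<le> a" "a + 1 < m" "4 * a \<le> m"
  shows "(\<integral>y. y\<^sup>2 * exp (a * \<bar>y\<bar>) \<partial>lapl m) \<le> 32 / m\<^sup>2"
proof -
  have m: "0 < m" using a by simp
  have "y\<^sup>2 * exp (a * \<bar>y\<bar>) \<le> 8 / m\<^sup>2 * exp ((m / 2 + a) * \<bar>y\<bar>)" for y
  proof -
    define z where "z = m / 2 * \<bar>y\<bar>"
    have "0 \<le> z" using m by (simp add: z_def)
    then have "z\<^sup>2 \<le> 2 * exp z" using exp_lower_Taylor_quadratic[of z] by linarith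
    then have "4 / m\<^sup>2 * z\<^sup>2 \<le> 4 / m\<^sup>2 * (2 * exp z)" by (intro mult_left_mono) auto
    moreover have "4 / m\<^sup>2 * z\<^sup>2 = y\<^sup>2" using m by (simp add: z_def power_mult_distrib field_simps)
    ultimately have "y\<^sup>2 \<le> 8 / m\<^sup>2 * exp (m / 2 * \<bar>y\<bar>)" by (simp add: z_def)
    then have "y\<^sup>2 * exp (a * \<bar>y\<bar>) \<le> 8 / m\<^sup>2 * exp (m / 2 * \<bar>y\<bar>) * exp (a * \<bar>y\<bar>)"
      by (intro mult_right_mono) auto
    then show ?thesis by (simp only: mult.assoc exp_add[symmetric] distrib_right)
  qed
  then have "(\<integral>y. y\<^sup>2 * exp (a * \<bar>y\<bar>) \<partial>lapl m) \<le> (\<integral>y. 8 / m\<^sup>2 * exp ((m / 2 + a) * \<bar>y\<bar>) \<partial>lapl m)"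
    using sym_kernel_integrable_power2_exp[OF sym_kernel_lapl[OF a(1,2)]] lapl_exp(1)[OF m, of "m / 2 + a"] a m
    by (intro integral_mono) auto
  also have "\<dots> = 8 / m\<^sup>2 * (m / (m / 2 - a))"
    using lapl_exp(2)[OF m, of "m / 2 + a"] a m by simp
  also have "\<dots> \<le> 8 / m\<^sup>2 * 4"
    using a m by (intro mult_left_mono) (auto simp: field_simps)
  finally show ?thesis by simp
qed

lemma DERIV_integral_Iic:
  fixes h :: "real \<Rightarrow> real"
  assumes cont: "\<And>x. isCont h x" and int: "\<And>x. integrable lborel (\<lambda>s. indicator {..x} s * h s)"
  shows "((\<lambda>x. \<integral>s. indicator {..x} s * h s \<partial>lborel) has_real_derivative h x) (at x)"
proof -
  let ?J = "\<lambda>x. \<integral>s. indicator {..x} s * h s \<partial>lborel"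
  have con: "continuous_on S h" for S using cont by (simp add: continuous_at_imp_continuous_on)
  have [measurable]: "h \<in> borel_measurable borel" by (rule borel_measurable_continuous_onI[OF con])
  have J: "?J y = ?J (x - 1) + integral {x - 1..y} h" if "x - 1 \<le> y" for y
  proof -
    have i: "set_integrable lborel {x - 1..y} h" using con by (rule borel_integrable_atLeastAtMost')
    have "?J y - ?J (x - 1) = (\<integral>s. indicator {..y} s * h s - indicator {..x - 1} s * h s \<partial>lborel)"
      by (rule Bochner_Integration.integral_diff[symmetric]) (rule int)+
    also have "\<dots> = (\<integral>s. indicator {x - 1<..y} s * h s \<partial>lborel)"
      using that by (intro Bochner_Integration.integral_cong) (auto simp: indicator_def)
    also have "\<dots> = (\<integral>s. indicator {x - 1..y} s * h s \<partial>lborel)"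
    proof (rule integral_cong_AE)
      show "AE s in lborel. indicator {x - 1<..y} s * h s = indicator {x - 1..y} s * h s"
        using AE_lborel_singleton[of "x - 1"] by eventually_elim (auto simp: indicator_def)
    qed measurable
    also have "\<dots> = integral {x - 1..y} h"
      using set_borel_integral_eq_integral(2)[OF i] by (simp add: set_lebesgue_integral_def)
    finally show ?thesis by simp
  qed
  have "((\<lambda>y. integral {x - 1..y} h) has_real_derivative h x) (at x within {x - 1..x + 1})"
    using con by (intro integral_has_real_derivative) auto
  then have "((\<lambda>y. integral {x - 1..y} h) has_real_derivative h x) (at x)"
    by (simp add: at_within_Icc_at)
  from DERIV_add[OF DERIV_const this, of "?J (x - 1)"]
  have "((\<lambda>y. ?J (x - 1) + integral {x - 1..y} h) has_real_derivative h x) (at x)" by simp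
  then show ?thesis
    by (rule has_field_derivative_transform_within_open[of _ _ _ "{x - 1<..}"]) (auto intro: J[symmetric])
qed

text \<open>The convolution with the Laplace kernel is the resolvent of \<open>\<phi> \<mapsto> \<phi>''\<close> on the line.\<close>

lemma convol_lapl_DERIV:
  assumes a: "0 \<le> a" "a + 1 < m" and \<phi>: "exp_bounded a \<phi>" and cont: "\<And>x. isCont \<phi> x"
  obtains \<psi>' where "\<And>x. (convol (lapl m) \<phi> has_real_derivative \<psi>' x) (at x)"
    "\<And>x. (\<psi>' has_real_derivative m\<^sup>2 * (convol (lapl m) \<phi> x - \<phi> x)) (at x)"
proof -
  have m: "0 < m" "a < m" using a by auto
  have [measurable]: "\<phi> \<in> borel_measurable borel" using \<phi> by (auto simp: exp_bounded_def)
  obtain C where C: "0 \<le> C" "\<And>x. \<bar>\<phi> x\<bar> \<le> C * exp (a * \<bar>x\<bar>)"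
    by (rule exp_boundedE[OF \<phi>]) blast
  \<comment> \<open>On either side of x the factor \<open>exp (- m * \<bar>s - x\<bar>)\<close>
    splits into a function of x times a function of s. \<open>J\<close> is the integral over s \<le>
    x; the other half is \<open>J\<close> of the reflected function, taken at -x.\<close>
  define J where "J \<phi> x = (\<integral>s. indicator {..x} s * (exp (m * s) * \<phi> s) \<partial>lborel)" for \<phi> and x :: real
  have intJ: "integrable lborel (\<lambda>s. indicator {..x} s * (exp (m * s) * \<phi> s))"
    if [measurable]: "\<phi> \<in> borel_measurable borel" and C: "0 \<le> C" "\<And>x. \<bar>\<phi> x\<bar> \<le> C * exp (a * \<bar>x\<bar>)"
    for \<phi> :: "real \<Rightarrow> real" and C x
  proof (rule Bochner_Integration.integrable_bound)
    show "integrable lborel (\<lambda>s. C * exp (2 * m * \<bar>x\<bar>) * exp (- (m - a) * \<bar>s\<bar>))"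
      using has_integral_exp_abs[of "m - a"] m by (auto simp: has_bochner_integral_iff)
    have "indicator {..x} s * (exp (m * s) * \<bar>\<phi> s\<bar>) \<le> C * exp (2 * m * \<bar>x\<bar>) * exp (- (m - a) * \<bar>s\<bar>)" for s
    proof (cases "s \<le> x")
      case True
      have "s \<le> 2 * \<bar>x\<bar> - \<bar>s\<bar>" using True by linarith
      from mult_left_mono[OF this, of m] m have "exp (m * s) \<le> exp (m * (2 * \<bar>x\<bar> - \<bar>s\<bar>))" by simp
      then have "exp (m * s) * \<bar>\<phi> s\<bar> \<le> exp (m * (2 * \<bar>x\<bar> - \<bar>s\<bar>)) * (C * exp (a * \<bar>s\<bar>))"
        by (intro mult_mono C) auto
      also have "\<dots> = C * (exp (m * (2 * \<bar>x\<bar> - \<bar>s\<bar>)) * exp (a * \<bar>s\<bar>))" by simp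
      also have "\<dots> = C * exp (2 * m * \<bar>x\<bar>) * exp (- (m - a) * \<bar>s\<bar>)"
        by (simp add: exp_add[symmetric] algebra_simps)
      finally show ?thesis using True by simp
    qed (use C in auto)
    then show "AE s in lborel. norm (indicator {..x} s * (exp (m * s) * \<phi> s))
      \<le> norm (C * exp (2 * m * \<bar>x\<bar>) * exp (- (m - a) * \<bar>s\<bar>))"
      using C(1) by (intro AE_I2) (auto simp: abs_mult)
  qed measurable
  have dJ: "(J \<phi> has_real_derivative exp (m * x) * \<phi> x) (at x)"
    if "\<phi> \<in> borel_measurable borel" and "0 \<le> C" "\<And>x. \<bar>\<phi> x\<bar> \<le> C * exp (a * \<bar>x\<bar>)" "\<And>x. isCont \<phi> x"
    for \<phi> :: "real \<Rightarrow> real" and C x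
    unfolding J_def[abs_def]
  proof (rule DERIV_integral_Iic)
    show "isCont (\<lambda>x. exp (m * x) * \<phi> x) y" for y
      by (intro isCont_mult isCont_exp continuous_ident continuous_const that(4) continuous_intros)
  qed (rule intJ[OF that(1-3)])
  let ?\<rho> = "\<lambda>s. \<phi> (- s)"
  have d1: "(J \<phi> has_real_derivative exp (m * x) * \<phi> x) (at x)" for x
    using C cont by (intro dJ[of _ C]) auto
  have "(J ?\<rho> has_real_derivative exp (m * x) * \<phi> (- x)) (at x)" for x
    proof (rule dJ[of _ C])
    show "(\<lambda>s. \<phi> (- s)) \<in> borel_measurable borel" by measurable
    show "\<bar>\<phi> (- y)\<bar> \<le> C * exp (a * \<bar>y\<bar>)" for y using C(2)[of "- y"] by simp
    show "isCont (\<lambda>s. \<phi> (- s)) y" for y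
      by (rule isCont_o2[OF isCont_minus[OF continuous_ident] cont])
  qed (rule C)
  from DERIV_chain2[OF this[of "- _"] DERIV_minus[OF DERIV_ident]]
  have d2: "((\<lambda>x. J ?\<rho> (- x)) has_real_derivative - (exp (- m * x) * \<phi> x)) (at x)" for x by simp
  have eq: "convol (lapl m) \<phi> x = m / 2 * (exp (- m * x) * J \<phi> x + exp (m * x) * J ?\<rho> (- x))" for x
  proof -
    have i1: "integrable lborel (\<lambda>s. indicator {..x} s * (exp (m * s) * \<phi> s))"
      by (rule intJ) (use C in auto)
    have "integrable lborel (\<lambda>s. indicator {..- x} s * (exp (m * s) * \<phi> (- s)))"
    proof (rule intJ)
      show "\<bar>\<phi> (- y)\<bar> \<le> C * exp (a * \<bar>y\<bar>)" for y using C(2)[of "- y"] by simp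
    qed (use C in auto)
    from lborel_integrable_real_affine[OF this, of "-1" 0]
    have i2: "integrable lborel (\<lambda>s. indicator {..- x} (- s) * (exp (m * - s) * \<phi> s))" by simp
    have J2: "J ?\<rho> (- x) = (\<integral>s. indicator {..- x} (- s) * (exp (m * - s) * \<phi> s) \<partial>lborel)"
      unfolding J_def by (subst lborel_integral_real_affine[where c = "-1" and t = 0]) auto
    have "convol (lapl m) \<phi> x = (\<integral>y. m / 2 * exp (- m * \<bar>y\<bar>) * \<phi> (x + y) \<partial>lborel)"
      unfolding convol_def by (rule integral_lapl) (use m in auto)
    also have "\<dots> = (\<integral>s. m / 2 * exp (- m * \<bar>s - x\<bar>) * \<phi> s \<partial>lborel)"
      by (subst lborel_integral_real_affine[where c = 1 and t = "- x"]) auto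
    also have "\<dots> = (\<integral>s. m / 2 * (exp (- m * x) * (indicator {..x} s * (exp (m * s) * \<phi> s))
        + exp (m * x) * (indicator {..- x} (- s) * (exp (m * - s) * \<phi> s))) \<partial>lborel)"
    proof (rule integral_cong_AE)
      show "AE s in lborel. m / 2 * exp (- m * \<bar>s - x\<bar>) * \<phi> s =
          m / 2 * (exp (- m * x) * (indicator {..x} s * (exp (m * s) * \<phi> s))
        + exp (m * x) * (indicator {..- x} (- s) * (exp (m * - s) * \<phi> s)))"
        using AE_lborel_singleton[of x]
      proof eventually_elim
        case (elim s)
        have e: "exp (- m * x) * (exp (m * s) * \<phi> s) = exp (- m * (x - s)) * \<phi> s"
          "exp (m * x) * (exp (m * - s) * \<phi> s) = exp (- m * (s - x)) * \<phi> s"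
          by (simp_all only: mult.assoc[symmetric] exp_add[symmetric]) (simp_all add: algebra_simps)
        show ?case
        proof (cases "s < x")
          case True
          then show ?thesis using e(1) by (auto simp: mult.assoc)
        next
          case False
          then show ?thesis using e(2) elim by (auto simp: mult.assoc)
        qed
      qed
    qed measurable
    also have "\<dots> = m / 2 * (exp (- m * x) * J \<phi> x + exp (m * x) * J ?\<rho> (- x))"
      unfolding J2 unfolding J_def using i1 i2 by simp
    finally show ?thesis .
  qed
  \<comment> \<open>The boundary terms from differentiating the two integrals cancel in the first
    derivative and add up to - m^2 \<phi> x in the second.\<close>
  define \<psi>' where "\<psi>' x = m / 2 * (- m * (exp (- m * x) * J \<phi> x) + m * (exp (m * x) * J ?\<rho> (- x)))" for x
  have ee: "exp (- m * x) * (exp (m * x) * y) = y" for x y :: real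
    by (simp only: mult.assoc[symmetric] exp_add[symmetric]) simp
  have E: "((\<lambda>x. exp (c * x)) has_real_derivative exp (c * x) * c) (at x)" for c x :: real
    by (auto intro!: derivative_eq_intros)
  have "(convol (lapl m) \<phi> has_real_derivative \<psi>' x) (at x)" for x
  proof -
    have "((\<lambda>x. m / 2 * (exp (- m * x) * J \<phi> x + exp (m * x) * J ?\<rho> (- x))) has_real_derivative
      m / 2 * ((exp (- m * x) * (- m)) * J \<phi> x + (exp (m * x) * \<phi> x) * exp (- m * x)
       + ((exp (m * x) * m) * J ?\<rho> (- x) + (- (exp (- m * x) * \<phi> x)) * exp (m * x)))) (at x)"
      by (intro DERIV_cmult DERIV_add DERIV_mult E d1 d2)
    then show ?thesis unfolding eq[abs_def] \<psi>'_def by (simp add: algebra_simps)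
  qed
  moreover have "(\<psi>' has_real_derivative m\<^sup>2 * (convol (lapl m) \<phi> x - \<phi> x)) (at x)" for x
  proof -
    have "(\<psi>' has_real_derivative
      m / 2 * (- m * ((exp (- m * x) * (- m)) * J \<phi> x + (exp (m * x) * \<phi> x) * exp (- m * x))
       + m * ((exp (m * x) * m) * J ?\<rho> (- x) + (- (exp (- m * x) * \<phi> x)) * exp (m * x)))) (at x)"
      unfolding \<psi>'_def[abs_def] by (intro DERIV_cmult DERIV_add DERIV_mult E d1 d2)
    moreover have "m / 2 * (- m * ((exp (- m * x) * (- m)) * J \<phi> x + (exp (m * x) * \<phi> x) * exp (- m * x))
       + m * ((exp (m * x) * m) * J ?\<rho> (- x) + (- (exp (- m * x) * \<phi> x)) * exp (m * x)))
      = m\<^sup>2 * (convol (lapl m) \<phi> x - \<phi> x)"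
      using ee[of x "\<phi> x"] unfolding eq by (simp add: algebra_simps power2_eq_square)
    ultimately show ?thesis by simp
  qed
  ultimately show ?thesis using that by blast
qed

subsection \<open>Oriented edges\<close>

context metric_graph
begin

text \<open>An oriented edge is a pair \<open>(e, d)\<close>, where \<open>d\<close> tells whether \<open>e\<close> is run through from its
  tail to its head; \<open>bpt b s\<close> is the point at distance \<open>s\<close> from the origin of \<open>b\<close>.\<close>

definition bonds :: "('e \<times> bool) set" where "bonds = arcs G \<times> UNIV"

definition flip :: "'e \<times> bool \<Rightarrow> 'e \<times> bool" where "flip b = (fst b, \<not> snd b)"

definition org :: "'e \<times> bool \<Rightarrow> 'v" where
  "org b = (if snd b then tail G (fst b) else head G (fst b))"

definition blen :: "'e \<times> bool \<Rightarrow> real" where "blen b = len (fst b)"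

definition bpt :: "'e \<times> bool \<Rightarrow> real \<Rightarrow> ('v, 'e) point" where
  "bpt b s = chart (fst b) (if snd b then s else len (fst b) - s)"

definition out :: "'v \<Rightarrow> ('e \<times> bool) set" where "out v = {b \<in> bonds. org b = v}"

definition avg :: "'v \<Rightarrow> ('e \<times> bool \<Rightarrow> real) \<Rightarrow> real" where
  "avg v X = (\<Sum>b\<in>out v. cond (fst b) * X b) / (\<Sum>b\<in>out v. cond (fst b))"

text \<open>What continues the incoming oriented edge \<open>b\<close>, given the values \<open>X\<close> on the edges
  leaving its endpoint: the transmission coefficients are \<open>2 c / \<Sum> c\<close>, the reflection
  coefficient is smaller by \<open>1\<close>.\<close>

definition scatter :: "'e \<times> bool \<Rightarrow> ('e \<times> bool \<Rightarrow> real) \<Rightarrow> real" where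
  "scatter b X = 2 * avg (org (flip b)) X - X (flip b)"

lemma flip_flip [simp]: "flip (flip b) = b"
  by (simp add: flip_def)

lemma flip_bonds [simp]: "flip b \<in> bonds \<longleftrightarrow> b \<in> bonds"
  by (cases b) (auto simp: flip_def bonds_def)

lemma blen_flip [simp]: "blen (flip b) = blen b"
  by (simp add: flip_def blen_def)

lemma bond_arc: "b \<in> bonds \<Longrightarrow> fst b \<in> arcs G"
  by (auto simp: bonds_def)

lemma blen_ge: "b \<in> bonds \<Longrightarrow> min_len \<le> blen b"
  by (auto simp: blen_def bond_arc min_len_le)

lemma blen_pos: "b \<in> bonds \<Longrightarrow> 0 < blen b"
  using blen_ge min_len_pos by fastforce

lemma bpt_flip: "bpt (flip b) s = bpt b (blen b - s)"
  by (simp add: bpt_def flip_def blen_def)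

lemma bpt_0: "b \<in> bonds \<Longrightarrow> bpt b 0 = Vertex (org b)"
  using blen_pos[of b] by (simp add: bpt_def org_def blen_def)

lemma bpt_blen: "b \<in> bonds \<Longrightarrow> bpt b (blen b) = Vertex (org (flip b))"
  using bpt_0[of "flip b"] by (simp add: bpt_flip)

lemma bpt_points: "b \<in> bonds \<Longrightarrow> 0 \<le> s \<Longrightarrow> s \<le> blen b \<Longrightarrow> bpt b s \<in> points"
  by (auto simp: bpt_def blen_def bond_arc intro!: chart_in_points)

lemma out_bonds: "b \<in> out v \<Longrightarrow> b \<in> bonds"
  by (simp add: out_def)

lemma in_out: "b \<in> bonds \<Longrightarrow> b \<in> out (org b)"
  by (simp add: out_def)

lemma finite_out: "finite (out v)"
proof (rule finite_subset)
  show "out v \<subseteq> incident v \<times> UNIV" by (auto simp: out_def bonds_def incident_def org_def)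
qed (simp add: finite_incident')

lemma cond_out: "b \<in> out v \<Longrightarrow> 0 < cond (fst b)"
  by (auto simp: out_def bond_arc cond_pos)

lemma cond_sum_pos: "out v \<noteq> {} \<Longrightarrow> 0 < (\<Sum>b\<in>out v. cond (fst b))"
  using finite_out cond_out by (intro sum_pos) auto

lemma avg_cong: "(\<And>b. b \<in> out v \<Longrightarrow> X b = Y b) \<Longrightarrow> avg v X = avg v Y"
  by (simp add: avg_def)

lemma avg_add: "avg v (\<lambda>b. X b + Y b) = avg v X + avg v Y"
  by (simp add: avg_def distrib_left sum.distrib add_divide_distrib)

lemma avg_diff: "avg v (\<lambda>b. X b - Y b) = avg v X - avg v Y"
  by (simp add: avg_def right_diff_distrib sum_subtractf diff_divide_distrib)

lemma avg_cmult: "avg v (\<lambda>b. c * X b) = c * avg v X"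
  by (simp add: avg_def sum_distrib_left mult.left_commute)

lemma avg_const:
  assumes "out v \<noteq> {}" "\<And>b. b \<in> out v \<Longrightarrow> X b = c"
  shows "avg v X = c"
proof -
  have "avg v X = (\<Sum>b\<in>out v. cond (fst b)) * c / (\<Sum>b\<in>out v. cond (fst b))"
    using assms(2) by (simp add: avg_def sum_distrib_right)
  then show ?thesis using cond_sum_pos[OF assms(1)] by simp
qed

lemma avg_bound:
  assumes "0 \<le> B" "\<And>b. b \<in> out v \<Longrightarrow> \<bar>X b\<bar> \<le> B"
  shows "\<bar>avg v X\<bar> \<le> B"
proof (cases "out v = {}")
  case False
  have "\<bar>\<Sum>b\<in>out v. cond (fst b) * X b\<bar> \<le> (\<Sum>b\<in>out v. cond (fst b) * B)"
    using cond_out assms(2)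
    by (intro order_trans[OF sum_abs] sum_mono) (auto simp: abs_mult less_imp_le intro!: mult_left_mono)
  then have "\<bar>\<Sum>b\<in>out v. cond (fst b) * X b\<bar> \<le> B * (\<Sum>b\<in>out v. cond (fst b))"
    by (simp add: sum_distrib_left mult.commute)
  then show ?thesis using cond_sum_pos[OF False]
    by (simp add: avg_def abs_divide pos_divide_le_eq)
qed (use assms in \<open>simp add: avg_def\<close>)

lemma avg_sums:
  assumes "\<And>b. b \<in> out v \<Longrightarrow> (\<lambda>n. X n b) sums Y b"
  shows "(\<lambda>n. avg v (X n)) sums avg v Y"
  unfolding avg_def by (intro sums_divide sums_sum sums_mult assms)

lemma tendsto_avg:
  assumes "\<And>b. b \<in> out v \<Longrightarrow> (X b \<longlongrightarrow> Y b) F"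
  shows "((\<lambda>x. avg v (\<lambda>b. X b x)) \<longlongrightarrow> avg v Y) F"
proof (cases "out v = {}")
  case False
  then show ?thesis unfolding avg_def using cond_sum_pos[OF False]
    by (intro tendsto_divide tendsto_sum tendsto_mult tendsto_const assms) auto
qed (simp add: avg_def)

lemma measurable_avg:
  assumes "\<And>b. b \<in> out v \<Longrightarrow> X b \<in> borel_measurable M"
  shows "(\<lambda>x. avg v (\<lambda>b. X b x)) \<in> borel_measurable M"
  unfolding avg_def
  by (intro borel_measurable_divide borel_measurable_sum borel_measurable_times borel_measurable_const assms)

lemma flip_out: "b \<in> bonds \<Longrightarrow> flip b \<in> out (org (flip b))"
  by (simp add: in_out)

lemma scatter_cong:
  assumes "b \<in> bonds" "\<And>b'. b' \<in> out (org (flip b)) \<Longrightarrow> X b' = Y b'"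
  shows "scatter b X = scatter b Y"
  using assms avg_cong[of "org (flip b)" X Y] flip_out[of b] by (simp add: scatter_def)

lemma scatter_diff: "scatter b (\<lambda>b'. X b' - Y b') = scatter b X - scatter b Y"
  by (simp add: scatter_def avg_diff)

text \<open>The coefficients at a vertex add up to 2 - 1 = 1, so a value shared by all outgoing
  edges is passed on unchanged.\<close>

lemma scatter_const:
  assumes "b \<in> bonds" "\<And>b'. b' \<in> out (org (flip b)) \<Longrightarrow> X b' = c"
  shows "scatter b X = c"
  using assms avg_const[of "org (flip b)" X c] flip_out[of b] by (auto simp: scatter_def)

text \<open>Twice the mean plus the reflected term: 2 + 1 = 3. The bound is independent of degree
  and conductivities; it determines \<open>rate\<close> and, with an extra factor 2,
  \<open>rate6\<close>.\<close>

lemma scatter_bound: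
  assumes "b \<in> bonds" "0 \<le> B" "\<And>b'. b' \<in> out (org (flip b)) \<Longrightarrow> \<bar>X b'\<bar> \<le> B"
  shows "\<bar>scatter b X\<bar> \<le> 3 * B"
proof -
  have "\<bar>avg (org (flip b)) X\<bar> \<le> B" "\<bar>X (flip b)\<bar> \<le> B"
    using assms avg_bound[of B "org (flip b)" X] flip_out[of b] by auto
  then show ?thesis unfolding scatter_def by linarith
qed

lemma scatter_sums:
  assumes "b \<in> bonds" "\<And>b'. b' \<in> out (org (flip b)) \<Longrightarrow> (\<lambda>n. X n b') sums Y b'"
  shows "(\<lambda>n. scatter b (X n)) sums scatter b Y"
  unfolding scatter_def
  by (intro sums_diff sums_mult avg_sums assms flip_out)

lemma measurable_scatter:
  assumes "b \<in> bonds" "\<And>b'. b' \<in> out (org (flip b)) \<Longrightarrow> X b' \<in> borel_measurable M"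
  shows "(\<lambda>x. scatter b (\<lambda>b'. X b' x)) \<in> borel_measurable M"
  unfolding scatter_def
  by (intro borel_measurable_diff borel_measurable_times borel_measurable_const measurable_avg assms flip_out)

subsection \<open>Unfolding a function along the paths leaving an edge\<close>

text \<open>\<open>piece n f b s\<close> collects the values of \<open>f\<close> at the endpoints of the paths of length \<open>s\<close>
  that start at the origin of \<open>b\<close> along \<open>b\<close> and pass through exactly \<open>n\<close> vertices, weighted
  with the product of the scattering coefficients.\<close>

primrec piece :: "nat \<Rightarrow> (('v, 'e) point \<Rightarrow> real) \<Rightarrow> 'e \<times> bool \<Rightarrow> real \<Rightarrow> real" where
  "piece 0 f b s = (if 0 \<le> s \<and> s < blen b then f (bpt b s) else 0)"
| "piece (Suc n) f b s = scatter b (\<lambda>b'. piece n f b' (s - blen b))"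

definition forward :: "(('v, 'e) point \<Rightarrow> real) \<Rightarrow> 'e \<times> bool \<Rightarrow> real \<Rightarrow> real" where
  "forward f b s = (\<Sum>n. piece n f b s)"

text \<open>A coordinate s < 0 lies behind the origin of b. It is reached by running through the
  reversed edge, from whose origin it has distance \<open>blen b - s\<close>.\<close>

definition unfold :: "(('v, 'e) point \<Rightarrow> real) \<Rightarrow> 'e \<times> bool \<Rightarrow> real \<Rightarrow> real" where
  "unfold f b s = (if 0 \<le> s then forward f b s else forward f (flip b) (blen b - s))"

text \<open>Every vertex passed costs length at least \<open>min_len\<close>. Hence at a given
  distance only finitely many terms of \<open>forward\<close> are nonzero, and the series never
  poses a convergence problem.\<close>

lemma piece_zero: "b \<in> bonds \<Longrightarrow> s < real n * min_len \<Longrightarrow> piece n f b s = 0"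
proof (induction n arbitrary: b s)
  case (Suc n)
  have "s - blen b < real n * min_len" using Suc.prems blen_ge[OF Suc.prems(1)]
    by (simp add: algebra_simps)
  then have "piece n f b' (s - blen b) = 0" if "b' \<in> out (org (flip b))" for b'
    using Suc.IH out_bonds[OF that] by blast
  then show ?case using scatter_const[OF Suc.prems(1)] by simp
qed auto

lemma forward_finite_sum:
  assumes "b \<in> bonds" "s < real N * min_len"
  shows "(\<lambda>n. piece n f b s) sums (\<Sum>n<N. piece n f b s)"
proof (rule sums_finite)
  fix n assume "n \<notin> {..<N}"
  then have "real N * min_len \<le> real n * min_len" using min_len_pos by simp
  then show "piece n f b s = 0" using assms by (intro piece_zero) auto
qed simp

lemma ex_less_min_len: "\<exists>N. s < real N * min_len"
  using reals_Archimedean3[OF min_len_pos] by blast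

lemma forward_sums: "b \<in> bonds \<Longrightarrow> (\<lambda>n. piece n f b s) sums forward f b s"
  using forward_finite_sum ex_less_min_len unfolding forward_def
  by (meson sums_summable summable_sums)

lemma forward_eq_sum: "b \<in> bonds \<Longrightarrow> s < real N * min_len \<Longrightarrow> forward f b s = (\<Sum>n<N. piece n f b s)"
  using forward_finite_sum forward_sums sums_unique2 by blast

lemma forward_neg: "b \<in> bonds \<Longrightarrow> s < 0 \<Longrightarrow> forward f b s = 0"
  using forward_eq_sum[of b s 0] by simp

lemma forward_rec:
  assumes "b \<in> bonds"
  shows "forward f b s = piece 0 f b s + scatter b (\<lambda>b'. forward f b' (s - blen b))"
proof -
  have "(\<lambda>n. piece (Suc n) f b s) sums (forward f b s - piece 0 f b s)"
    using forward_sums[OF assms]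
      sums_Suc_iff[of "\<lambda>n. piece n f b s" "forward f b s - piece 0 f b s"] by simp
  moreover have "(\<lambda>n. piece (Suc n) f b s) sums scatter b (\<lambda>b'. forward f b' (s - blen b))"
    unfolding piece.simps by (intro scatter_sums assms forward_sums out_bonds)
  ultimately show ?thesis using sums_unique2 by fastforce
qed

lemma forward_step: "b \<in> bonds \<Longrightarrow> blen b \<le> s \<Longrightarrow> forward f b s = scatter b (\<lambda>b'. forward f b' (s - blen b))"
  by (subst forward_rec) auto

text \<open>At the endpoint \<open>s = blen b\<close> the term \<open>piece 0\<close> is 0, its
  interval being half open. The value there comes from the next edges, all of which start with the
  value of f at that vertex.\<close>

lemma forward_on_edge:
  assumes b: "b \<in> bonds" and s: "0 \<le> s" "s \<le> blen b"
  shows "forward f b s = f (bpt b s)"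
proof -
  have *: "forward f b s = f (bpt b s)" if "b \<in> bonds" "0 \<le> s" "s < blen b" for b s
  proof -
    have "scatter b (\<lambda>b'. forward f b' (s - blen b)) = 0"
      using that by (intro scatter_const) (auto intro: forward_neg out_bonds)
    then show ?thesis using that by (subst forward_rec) auto
  qed
  show ?thesis
  proof (cases "s = blen b")
    case True
    have "scatter b (\<lambda>b'. forward f b' 0) = f (Vertex (org (flip b)))"
      using *[of _ 0] by (intro scatter_const b) (auto simp: out_def bpt_0 blen_pos)
    then show ?thesis using True forward_step[OF b, of s f] by (simp add: bpt_blen[OF b])
  qed (use * b s in auto)
qed

lemma unfold_on_edge: "b \<in> bonds \<Longrightarrow> 0 \<le> s \<Longrightarrow> s \<le> blen b \<Longrightarrow> unfold f b s = f (bpt b s)"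
  by (simp add: unfold_def forward_on_edge)

text \<open>A family of functions on the line comes from a function on the graph if and only if it is
  invariant under reversal of edges and, at every vertex, the even parts of the functions on
  the outgoing edges agree with their weighted mean. This condition is preserved by every
  even convolution kernel, and it contains both continuity and the Kirchhoff condition.\<close>

definition compatible :: "('e \<times> bool \<Rightarrow> real \<Rightarrow> real) \<Rightarrow> bool" where
  "compatible \<phi> \<longleftrightarrow> (\<forall>b\<in>bonds. \<forall>s. \<phi> (flip b) s = \<phi> b (blen b - s))
     \<and> (\<forall>b\<in>bonds. \<forall>s. \<phi> b s + \<phi> b (- s) = 2 * avg (org b) (\<lambda>b'. \<phi> b' s))"

lemma compatible_flip: "compatible \<phi> \<Longrightarrow> b \<in> bonds \<Longrightarrow> \<phi> (flip b) s = \<phi> b (blen b - s)"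
  by (simp add: compatible_def)

lemma compatible_even:
  "compatible \<phi> \<Longrightarrow> b \<in> bonds \<Longrightarrow> \<phi> b s + \<phi> b (- s) = 2 * avg (org b) (\<lambda>b'. \<phi> b' s)"
  by (simp add: compatible_def)

text \<open>For s > 0 the value at -s is the one on the reversed edge at \<open>blen b + s\<close>,
  beyond the origin of b. There \<open>forward\<close> obeys the scattering rule, which is exactly
  the condition on the even parts.\<close>

lemma compatible_unfold: "compatible (unfold f)"
  unfolding compatible_def
proof (intro conjI ballI allI)
  fix b s assume b: "b \<in> bonds"
  show "unfold f (flip b) s = unfold f b (blen b - s)"
  proof (cases "0 \<le> s \<and> s \<le> blen b")
    case True
    then show ?thesis using b by (simp add: unfold_on_edge bpt_flip)
  qed (use blen_pos[OF b] in \<open>auto simp: unfold_def\<close>)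
  have right: "unfold f b s + unfold f b (- s) = 2 * avg (org b) (\<lambda>b'. unfold f b' s)"
    if b: "b \<in> bonds" and s: "0 \<le> s" for b s
  proof (cases "s = 0")
    case True
    have "avg (org b) (\<lambda>b'. unfold f b' 0) = unfold f b 0"
    proof (rule avg_const)
      show "out (org b) \<noteq> {}" using in_out[OF b] by auto
    qed (use b in \<open>auto simp: unfold_on_edge out_def blen_pos less_imp_le bpt_0\<close>)
    then show ?thesis using True by simp
  next
    case False
    with s have "unfold f b (- s) = forward f (flip b) (blen b + s)" by (simp add: unfold_def)
    also have "\<dots> = scatter (flip b) (\<lambda>b'. unfold f b' s)"
      using b s by (subst forward_step) (auto simp: unfold_def)
    also have "\<dots> = 2 * avg (org b) (\<lambda>b'. unfold f b' s) - unfold f b s" by (simp add: scatter_def)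
    finally show ?thesis by simp
  qed
  show "unfold f b s + unfold f b (- s) = 2 * avg (org b) (\<lambda>b'. unfold f b' s)"
  proof (cases "0 \<le> s")
    case False
    \<comment> \<open>For s < 0 the identity at -s is averaged over the outgoing edges; this shows
      that the means at s and at -s agree.\<close>
    let ?M = "avg (org b) (\<lambda>b'. unfold f b' (- s))"
    have "avg (org b) (\<lambda>b'. unfold f b' (- s) + unfold f b' s) = 2 * ?M"
    proof (rule avg_const)
      show "out (org b) \<noteq> {}" using in_out[OF b] by auto
      fix b' assume "b' \<in> out (org b)"
      then show "unfold f b' (- s) + unfold f b' s = 2 * ?M"
        using right[of b' "- s"] False by (auto simp: out_def)
    qed
    then have "avg (org b) (\<lambda>b'. unfold f b' s) = ?M" by (simp add: avg_add)
    then show ?thesis using right[OF b, of "- s"] False by simp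
  qed (rule right[OF b])
qed

section \<open>Folding a compatible family back to the graph\<close>

lemma compatible_step:
  assumes "compatible \<phi>" "b \<in> bonds"
  shows "\<phi> b (blen b + s) = scatter b (\<lambda>b'. \<phi> b' s)"
  using compatible_flip[OF assms, of "- s"] compatible_even[OF assms(1), of "flip b" s] assms(2)
  by (simp add: scatter_def)

lemma compatible_vertex: "compatible \<phi> \<Longrightarrow> b \<in> bonds \<Longrightarrow> \<phi> b 0 = avg (org b) (\<lambda>b'. \<phi> b' 0)"
  using compatible_even[of \<phi> b 0] by simp

text \<open>Representatives are fixed once so that \<open>fold\<close> is a function. At a vertex
  the choice of the outgoing edge is arbitrary; by \<open>compatible_vertex\<close> it does not
  affect the value.\<close>

definition bond :: "('v, 'e) point \<Rightarrow> 'e \<times> bool" where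
  "bond p = (case p of Vertex v \<Rightarrow> SOME b. b \<in> out v | Inner e x \<Rightarrow> (e, True))"

definition pos :: "('v, 'e) point \<Rightarrow> real" where
  "pos p = (case p of Vertex v \<Rightarrow> 0 | Inner e x \<Rightarrow> x)"

definition fold :: "('e \<times> bool \<Rightarrow> real \<Rightarrow> real) \<Rightarrow> ('v, 'e) point \<Rightarrow> real" where
  "fold \<phi> p = (if p \<in> points then \<phi> (bond p) (pos p) else 0)"

lemma bond_Vertex:
  assumes "b \<in> bonds" shows "bond (Vertex (org b)) \<in> out (org b)"
  using someI[of "\<lambda>b'. b' \<in> out (org b)", OF in_out[OF assms]] by (simp add: bond_def)

lemma bond_pos:
  assumes "p \<in> points"
  shows "bond p \<in> bonds" "0 \<le> pos p" "pos p \<le> blen (bond p)" "bpt (bond p) (pos p) = p"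
proof -
  have "bond p \<in> bonds \<and> 0 \<le> pos p \<and> pos p \<le> blen (bond p) \<and> bpt (bond p) (pos p) = p"
    using assms
  proof (cases rule: points_cases)
    case (inner e x)
    then show ?thesis by (auto simp: bond_def pos_def bonds_def blen_def bpt_def chart_inner)
  next
    case (vertex e x)
    then obtain b where b: "b \<in> bonds" "p = Vertex (org b)"
      using that[of "(e, True)"] that[of "(e, False)"] by (auto simp: bonds_def org_def)
    then have "bond p \<in> bonds" "org (bond p) = org b" using bond_Vertex[OF b(1)] by (auto simp: out_def)
    then show ?thesis using b blen_pos[of "bond p"] by (auto simp: pos_def bpt_0)
  qed
  then show "bond p \<in> bonds" "0 \<le> pos p" "pos p \<le> blen (bond p)" "bpt (bond p) (pos p) = p"
    by blast+
qed

lemma fold_bpt: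
  assumes \<phi>: "compatible \<phi>" and b: "b \<in> bonds" and s: "0 \<le> s" "s \<le> blen b"
  shows "fold \<phi> (bpt b s) = \<phi> b s"
proof -
  have p: "bpt b s \<in> points" using bpt_points b s by blast
  have vertex: "fold \<phi> (Vertex (org b)) = \<phi> b 0" if b: "b \<in> bonds" for b
  proof -
    have "\<phi> (bond (Vertex (org b))) 0 = \<phi> b 0"
      using bond_Vertex[OF b] compatible_vertex[OF \<phi>] b by (auto simp: out_def)
    moreover have "Vertex (org b) \<in> points" using bpt_points[OF b, of 0] blen_pos[OF b] by (simp add: bpt_0 b)
    ultimately show ?thesis by (simp add: fold_def pos_def)
  qed
  consider "s = 0" | "s = blen b" | "0 < s" "s < blen b" using s by linarith
  then show ?thesis
  proof cases
    case 1
    then show ?thesis using vertex[OF b] by (simp add: bpt_0 b)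
  next
    case 2
    then show ?thesis using vertex[of "flip b"] compatible_flip[OF \<phi> b, of 0] b by (simp add: bpt_blen)
  next
    case 3
    obtain e d where bd: "b = (e, d)" by (cases b)
    show ?thesis
    proof (cases d)
      case True
      then show ?thesis using 3 p bd by (auto simp: fold_def bpt_def blen_def chart_inner bond_def pos_def)
    next
      case False
      have "\<phi> (e, True) (len e - s) = \<phi> b s"
        using compatible_flip[OF \<phi>, of "(e, True)" s] b bd False by (simp add: flip_def blen_def bonds_def)
      then show ?thesis using 3 p bd False by (auto simp: fold_def bpt_def blen_def chart_inner bond_def pos_def)
    qed
  qed
qed

text \<open>By \<open>compatible_step\<close> a compatible family is continued beyond an edge by the
  same rule as an unfolding. Agreement on the edges therefore propagates, at least
  \<open>min_len\<close> at a time; negative coordinates follow by reversing the edge.\<close>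

lemma unfold_fold:
  assumes \<phi>: "compatible \<phi>" and b: "b \<in> bonds"
  shows "unfold (fold \<phi>) b s = \<phi> b s"
proof -
  have *: "\<forall>b\<in>bonds. \<forall>s. 0 \<le> s \<and> s < real n * min_len \<longrightarrow> unfold (fold \<phi>) b s = \<phi> b s" for n
  proof (induction n)
    case (Suc n)
    show ?case
    proof (intro ballI allI impI)
      fix b s assume b: "b \<in> bonds" and s: "0 \<le> s \<and> s < real (Suc n) * min_len"
      show "unfold (fold \<phi>) b s = \<phi> b s"
      proof (cases "s \<le> blen b")
        case True
        then show ?thesis using b s by (simp add: unfold_on_edge fold_bpt[OF \<phi>])
      next
        case False
        have r: "0 \<le> s - blen b \<and> s - blen b < real n * min_len"
          using False s blen_ge[OF b] by (simp add: algebra_simps)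
        have "scatter b (\<lambda>b'. unfold (fold \<phi>) b' (s - blen b)) = scatter b (\<lambda>b'. \<phi> b' (s - blen b))"
          using Suc r by (intro scatter_cong b) (auto simp: out_def)
        then show ?thesis
          using compatible_step[OF compatible_unfold b, of "fold \<phi>" "s - blen b"]
            compatible_step[OF \<phi> b, of "s - blen b"] by simp
      qed
    qed
  qed (simp add: not_less)
  have right: "unfold (fold \<phi>) b s = \<phi> b s" if "b \<in> bonds" "0 \<le> s" for b s
    using * ex_less_min_len[of s] that by blast
  show ?thesis
  proof (cases "0 \<le> s")
    case False
    then show ?thesis
      using right[of "flip b" "blen b - s"] blen_pos[OF b] b
        compatible_flip[OF compatible_unfold b, of "fold \<phi>" "blen b - s"] compatible_flip[OF \<phi> b, of "blen b - s"]
      by simp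
  qed (rule right[OF b])
qed

lemma fold_unfold: "p \<in> points \<Longrightarrow> fold (unfold f) p = f p"
  using bond_pos[of p] by (simp add: fold_def unfold_on_edge)

subsection \<open>Growth, continuity and decay of the unfolding\<close>

text \<open>The growth exponent of unfoldings: a factor of at most 3 for each vertex, and at least
  \<open>min_len\<close> between vertices.\<close>

definition rate :: real where "rate = ln 3 / min_len"

lemma rate_nonneg: "0 \<le> rate"
  using min_len_pos by (simp add: rate_def)

lemma three_le_exp: "b \<in> bonds \<Longrightarrow> 3 \<le> exp (rate * blen b)"
proof -
  assume "b \<in> bonds"
  then have "ln 3 \<le> rate * blen b"
    using mult_left_mono[OF blen_ge rate_nonneg] min_len_pos by (fastforce simp: rate_def)
  then show ?thesis using exp_le_cancel_iff[of "ln 3" "rate * blen b"] by (simp del: exp_le_cancel_iff)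
qed

lemma forward_bound:
  assumes B: "\<And>p. p \<in> points \<Longrightarrow> \<bar>f p\<bar> \<le> B" and b: "b \<in> bonds" and s: "0 \<le> s"
  shows "\<bar>forward f b s\<bar> \<le> B * exp (rate * s)"
proof -
  have B0: "0 \<le> B" using B[OF bpt_points[OF b, of 0]] blen_pos[OF b] by auto
  have "\<forall>b\<in>bonds. \<forall>s. 0 \<le> s \<and> s < real n * min_len \<longrightarrow> \<bar>forward f b s\<bar> \<le> B * exp (rate * s)" for n
  proof (induction n)
    case (Suc n)
    show ?case
    proof (intro ballI allI impI)
      fix b s assume b: "b \<in> bonds" and s: "0 \<le> s \<and> s < real (Suc n) * min_len"
      show "\<bar>forward f b s\<bar> \<le> B * exp (rate * s)"
      proof (cases "s \<le> blen b")
        case True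
        have "B * 1 \<le> B * exp (rate * s)" using s rate_nonneg B0 by (intro mult_left_mono) auto
        then show ?thesis using True b s B[OF bpt_points[OF b, of s]] by (simp add: forward_on_edge)
      next
        case False
        have r: "0 \<le> s - blen b \<and> s - blen b < real n * min_len"
          using False s blen_ge[OF b] by (simp add: algebra_simps)
        have "\<bar>scatter b (\<lambda>b'. forward f b' (s - blen b))\<bar> \<le> 3 * (B * exp (rate * (s - blen b)))"
          using Suc r B0 by (intro scatter_bound b) (auto simp: out_def)
        also have "\<dots> \<le> exp (rate * blen b) * (B * exp (rate * (s - blen b)))"
          using three_le_exp[OF b] B0 by (intro mult_right_mono) auto
        also have "\<dots> = B * exp (rate * s)" by (simp add: exp_add[symmetric] algebra_simps)
        finally show ?thesis using forward_step[OF b] False by simp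
      qed
    qed
  qed (simp add: not_less)
  then show ?thesis using ex_less_min_len[of s] b s by blast
qed

text \<open>Moving away from an edge by \<open>y\<close> costs a factor depending on \<open>y\<close> only, whatever
  the position on the edge; this is what makes all the later estimates uniform.\<close>

lemma unfold_reflect_cases:
  assumes "b \<in> bonds" "0 \<le> x" "x \<le> blen b"
  obtains "0 \<le> x + y" "x + y \<le> blen b"
  | b' s where "b' \<in> bonds" "0 \<le> s" "s \<le> \<bar>y\<bar>" "\<And>f. unfold f b (x + y) = scatter b' (\<lambda>b''. forward f b'' s)"
     "b' = b \<and> s + blen b - x = y \<or> b' = flip b \<and> s + x = - y"
proof -
  consider "0 \<le> x + y \<and> x + y \<le> blen b" | "blen b < x + y" | "x + y < 0" by linarith
  then show ?thesis
  proof cases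
    case 2
    have "unfold f b (x + y) = scatter b (\<lambda>b''. forward f b'' (x + y - blen b))" for f
      using 2 assms blen_pos[of b] forward_step[of b "x + y" f] by (simp add: unfold_def)
    then show ?thesis using that(2)[of b "x + y - blen b"] 2 assms by auto
  next
    case 3
    have "unfold f b (x + y) = scatter (flip b) (\<lambda>b''. forward f b'' (- (x + y)))" for f
      using 3 assms forward_step[of "flip b" "blen b - (x + y)" f] by (simp add: unfold_def)
    then show ?thesis using that(2)[of "flip b" "- (x + y)"] 3 assms by auto
  qed (use that(1) in blast)
qed

text \<open>The additional 3 is for the first vertex, which may lie arbitrarily close to x.\<close>

lemma unfold_bound:
  assumes B: "\<And>p. p \<in> points \<Longrightarrow> \<bar>f p\<bar> \<le> B" and b: "b \<in> bonds" and x: "0 \<le> x" "x \<le> blen b"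
  shows "\<bar>unfold f b (x + y)\<bar> \<le> 3 * B * exp (rate * \<bar>y\<bar>)"
proof -
  have B0: "0 \<le> B" using B[OF bpt_points[OF b, of 0]] blen_pos[OF b] by auto
  from b x show ?thesis
  proof (cases rule: unfold_reflect_cases[where y = y])
    case 1
    have "B * 1 \<le> 3 * B * exp (rate * \<bar>y\<bar>)" using B0 rate_nonneg by (intro mult_mono) auto
    then show ?thesis using 1 b B[OF bpt_points[OF b 1]] by (simp add: unfold_on_edge)
  next
    case (2 b' s)
    have "\<bar>scatter b' (\<lambda>b''. forward f b'' s)\<bar> \<le> 3 * (B * exp (rate * s))"
      using 2 B0 forward_bound[OF B] by (intro scatter_bound) (auto simp: out_def)
    also have "\<dots> \<le> 3 * (B * exp (rate * \<bar>y\<bar>))"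
      using 2(3) B0 rate_nonneg by (intro mult_left_mono) (auto intro: mult_left_mono)
    finally show ?thesis using 2(4) by simp
  qed
qed

text \<open>The regularity that makes unfoldings measurable. It covers both \<open>C0\<close> and
  the Borel functions of the strong Feller property.\<close>

definition edge_measurable :: "(('v, 'e) point \<Rightarrow> real) \<Rightarrow> bool" where
  "edge_measurable f \<longleftrightarrow> (\<forall>b\<in>bonds. (\<lambda>s. if 0 \<le> s \<and> s < blen b then f (bpt b s) else 0) \<in> borel_measurable borel)"

lemma measurable_piece: "edge_measurable f \<Longrightarrow> b \<in> bonds \<Longrightarrow> piece n f b \<in> borel_measurable borel"
proof (induction n arbitrary: b)
  case 0
  then show ?case by (simp add: edge_measurable_def)
next
  case (Suc n)
  have "(\<lambda>s. scatter b (\<lambda>b'. piece n f b' (s - blen b))) \<in> borel_measurable borel"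
  proof (intro measurable_scatter Suc.prems)
    fix b' assume "b' \<in> out (org (flip b))"
    then have [measurable]: "piece n f b' \<in> borel_measurable borel" using Suc by (auto simp: out_def)
    show "(\<lambda>s. piece n f b' (s - blen b)) \<in> borel_measurable borel" by measurable
  qed
  then show ?case by (simp cong: measurable_cong)
qed

lemma measurable_forward:
  assumes "edge_measurable f" "b \<in> bonds"
  shows "forward f b \<in> borel_measurable borel"
  unfolding forward_def[abs_def]
  by (intro borel_measurable_suminf measurable_piece assms)

lemma measurable_unfold:
  assumes "edge_measurable f" "b \<in> bonds"
  shows "unfold f b \<in> borel_measurable borel"
proof -
  have [measurable]: "forward f b \<in> borel_measurable borel" "forward f (flip b) \<in> borel_measurable borel"
    using assms by (auto intro: measurable_forward)
  show ?thesis unfolding unfold_def[abs_def] by measurable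
qed

lemma exp_bounded_unfold:
  assumes f: "edge_measurable f" and B: "\<And>p. p \<in> points \<Longrightarrow> \<bar>f p\<bar> \<le> B" and b: "b \<in> bonds"
  shows "exp_bounded rate (unfold f b)"
proof -
  have "\<bar>unfold f b (0 + y)\<bar> \<le> 3 * B * exp (rate * \<bar>y\<bar>)" for y
    by (rule unfold_bound[OF B b]) (use blen_pos[OF b] in auto)
  then show ?thesis using measurable_unfold[OF f b] by (auto simp: exp_bounded_def)
qed


section \<open>The space \<open>C0\<close> in terms of oriented edges\<close>

lemma C0_iff_bonds:
  "f \<in> C0 \<longleftrightarrow> (\<forall>b\<in>bonds. continuous_on {0..blen b} (\<lambda>s. f (bpt b s)))
     \<and> (\<forall>\<epsilon>>0. finite {b\<in>bonds. \<exists>s\<in>{0..blen b}. \<epsilon> \<le> \<bar>f (bpt b s)\<bar>})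
     \<and> (\<forall>p. p \<notin> points \<longrightarrow> f p = 0)"
proof -
  have "(\<forall>e\<in>arcs G. continuous_on {0..len e} (\<lambda>x. f (chart e x)))
      \<longleftrightarrow> (\<forall>b\<in>bonds. continuous_on {0..blen b} (\<lambda>s. f (bpt b s)))" (is "?L \<longleftrightarrow> ?R")
  proof
    assume ?L
    show ?R
    proof
      fix b assume "b \<in> bonds"
      then have c: "continuous_on {0..len (fst b)} (\<lambda>x. f (chart (fst b) x))"
        using \<open>?L\<close> bond_arc by blast
      show "continuous_on {0..blen b} (\<lambda>s. f (bpt b s))"
        using c continuous_on_compose2[OF c, of "{0..blen b}" "\<lambda>s. len (fst b) - s"]
        by (cases "snd b") (auto simp: bpt_def blen_def continuous_on_op_minus)
    qed
  next
    assume ?R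
    show ?L
    proof
      fix e assume "e \<in> arcs G"
      then have "(e, True) \<in> bonds" by (simp add: bonds_def)
      from \<open>?R\<close>[rule_format, OF this] show "continuous_on {0..len e} (\<lambda>x. f (chart e x))"
        by (simp add: blen_def bpt_def)
    qed
  qed
  moreover have "finite {e\<in>arcs G. \<exists>x\<in>{0..len e}. \<epsilon> \<le> \<bar>f (chart e x)\<bar>}
      \<longleftrightarrow> finite {b\<in>bonds. \<exists>s\<in>{0..blen b}. \<epsilon> \<le> \<bar>f (bpt b s)\<bar>}" (is "finite ?A \<longleftrightarrow> finite ?B") for \<epsilon>
  proof
    assume A: "finite ?A"
    have "?B \<subseteq> ?A \<times> UNIV"
    proof
      fix b assume "b \<in> ?B"
      then obtain s where "b \<in> bonds" "s \<in> {0..blen b}" "\<epsilon> \<le> \<bar>f (bpt b s)\<bar>" by blast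
      then have "fst b \<in> ?A"
        by (intro CollectI conjI bexI[of _ "if snd b then s else len (fst b) - s"])
          (auto simp: bpt_def blen_def bond_arc)
      then show "b \<in> ?A \<times> UNIV" by (cases b) auto
    qed
    then show "finite ?B" by (rule finite_subset) (rule finite_cartesian_product[OF A finite])
  next
    assume B: "finite ?B"
    have "?A \<subseteq> fst ` ?B"
    proof
      fix e assume "e \<in> ?A"
      then obtain x where "e \<in> arcs G" "x \<in> {0..len e}" "\<epsilon> \<le> \<bar>f (chart e x)\<bar>" by blast
      then have "(e, True) \<in> ?B"
        by (intro CollectI conjI bexI[of _ x]) (auto simp: bpt_def blen_def bonds_def)
      then show "e \<in> fst ` ?B" by (rule image_eqI[rotated]) simp
    qed
    then show "finite ?A" by (rule finite_subset) (rule finite_imageI[OF B])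
  qed
  ultimately show ?thesis unfolding C0_iff by simp
qed

lemma C0_edge_continuous: "f \<in> C0 \<Longrightarrow> b \<in> bonds \<Longrightarrow> continuous_on {0..blen b} (\<lambda>s. f (bpt b s))"
  by (simp add: C0_iff_bonds)

lemma C0_finite_large:
  assumes "f \<in> C0" "0 < \<epsilon>"
  shows "finite {b\<in>bonds. \<exists>s\<in>{0..blen b}. \<epsilon> \<le> \<bar>f (bpt b s)\<bar>}"
  using assms unfolding C0_iff_bonds by blast

lemma C0_outside: "f \<in> C0 \<Longrightarrow> p \<notin> points \<Longrightarrow> f p = 0"
  by (simp add: C0_iff_bonds)

lemma C0_bounded:
  assumes f: "f \<in> C0"
  obtains B where "0 \<le> B" "\<And>p. \<bar>f p\<bar> \<le> B"
proof -
  let ?F = "{b\<in>bonds. \<exists>s\<in>{0..blen b}. 1 \<le> \<bar>f (bpt b s)\<bar>}"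
  have fin: "finite ?F" by (rule C0_finite_large[OF f]) simp
  have "\<exists>B. \<forall>b\<in>?F. \<forall>s\<in>{0..blen b}. \<bar>f (bpt b s)\<bar> \<le> B b"
  proof (intro bchoice ballI)
    fix b assume "b \<in> ?F"
    then have "compact ((\<lambda>s. f (bpt b s)) ` {0..blen b})"
      using C0_edge_continuous[OF f] by (intro compact_continuous_image) auto
    then show "\<exists>B. \<forall>s\<in>{0..blen b}. \<bar>f (bpt b s)\<bar> \<le> B"
      using compact_imp_bounded bounded_iff by (metis imageI real_norm_def)
  qed
  then obtain B where B: "\<And>b s. b \<in> ?F \<Longrightarrow> s \<in> {0..blen b} \<Longrightarrow> \<bar>f (bpt b s)\<bar> \<le> B b" by blast
  let ?C = "Max (insert 1 (B ` ?F))"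
  have C: "1 \<le> ?C" "\<And>b. b \<in> ?F \<Longrightarrow> B b \<le> ?C" using fin by (auto intro: Max_ge)
  have "\<bar>f p\<bar> \<le> ?C" for p
  proof (cases "p \<in> points")
    case True
    have bp: "bond p \<in> bonds" "pos p \<in> {0..blen (bond p)}" "bpt (bond p) (pos p) = p"
      using bond_pos[OF True] by auto
    show ?thesis
    proof (cases "bond p \<in> ?F")
      case True
      then show ?thesis using B[OF True bp(2)] C(2)[OF True] bp(3) by simp
    next
      case False
      then have "\<bar>f (bpt (bond p) (pos p))\<bar> < 1" using bp by force
      then show ?thesis using C(1) bp(3) by simp
    qed
  qed (use C(1) C0_outside[OF f] in auto)
  then show ?thesis using that[of ?C] C(1) by simp
qed

lemma C0_bdd_above:
  assumes "f \<in> C0" shows "bdd_above (range (\<lambda>p. \<bar>f p\<bar>))"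
proof -
  obtain B where "\<And>p. \<bar>f p\<bar> \<le> B" using C0_bounded[OF assms] by blast
  then show ?thesis by (intro bdd_aboveI2)
qed

lemma sup_norm_ge: "f \<in> C0 \<Longrightarrow> \<bar>f p\<bar> \<le> sup_norm f"
  unfolding sup_norm_def by (rule cSUP_upper[OF _ C0_bdd_above]) auto

lemma sup_norm_le: "(\<And>p. \<bar>f p\<bar> \<le> B) \<Longrightarrow> sup_norm f \<le> B"
  unfolding sup_norm_def by (rule cSUP_least) auto

text \<open>One \<delta> serves all edges: only finitely many edges carry values of size \<epsilon>
  / 2 or more, and on the others any two values differ by less than \<epsilon>.\<close>

lemma C0_modulus:
  assumes f: "f \<in> C0" and \<epsilon>: "0 < \<epsilon>"
  obtains \<delta> where "0 < \<delta>" "\<And>b x x'. b \<in> bonds \<Longrightarrow> x \<in> {0..blen b} \<Longrightarrow> x' \<in> {0..blen b} \<Longrightarrow> \<bar>x - x'\<bar> < \<delta>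
     \<Longrightarrow> \<bar>f (bpt b x) - f (bpt b x')\<bar> \<le> \<epsilon>"
proof -
  let ?F = "{b\<in>bonds. \<exists>s\<in>{0..blen b}. \<epsilon> / 2 \<le> \<bar>f (bpt b s)\<bar>}"
  have fin: "finite ?F" by (rule C0_finite_large[OF f]) (use \<epsilon> in simp)
  have "\<exists>\<delta>. \<forall>b\<in>?F. 0 < \<delta> b \<and> (\<forall>x\<in>{0..blen b}. \<forall>x'\<in>{0..blen b}. \<bar>x - x'\<bar> < \<delta> b
     \<longrightarrow> \<bar>f (bpt b x) - f (bpt b x')\<bar> \<le> \<epsilon>)"
  proof (intro bchoice ballI)
    fix b assume "b \<in> ?F"
    then have "uniformly_continuous_on {0..blen b} (\<lambda>s. f (bpt b s))"
      using C0_edge_continuous[OF f] by (intro compact_uniformly_continuous) auto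
    from this[unfolded uniformly_continuous_on_def, rule_format, OF \<epsilon>]
    show "\<exists>\<delta>>0. \<forall>x\<in>{0..blen b}. \<forall>x'\<in>{0..blen b}. \<bar>x - x'\<bar> < \<delta> \<longrightarrow> \<bar>f (bpt b x) - f (bpt b x')\<bar> \<le> \<epsilon>"
      unfolding dist_real_def by (meson less_imp_le)
  qed
  then obtain \<delta> where \<delta>0: "\<forall>b\<in>?F. 0 < \<delta> b \<and> (\<forall>x\<in>{0..blen b}. \<forall>x'\<in>{0..blen b}. \<bar>x - x'\<bar> < \<delta> b
     \<longrightarrow> \<bar>f (bpt b x) - f (bpt b x')\<bar> \<le> \<epsilon>)" ..
  have \<delta>: "0 < \<delta> b" "\<And>x x'. x\<in>{0..blen b} \<Longrightarrow> x'\<in>{0..blen b} \<Longrightarrow> \<bar>x - x'\<bar> < \<delta> b \<Longrightarrow> \<bar>f (bpt b x) - f (bpt b x')\<bar> \<le> \<epsilon>"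
    if "b \<in> ?F" for b
    using bspec[OF \<delta>0 that] by blast+
  let ?d = "Min (insert 1 (\<delta> ` ?F))"
  have d: "0 < ?d" "\<And>b. b \<in> ?F \<Longrightarrow> ?d \<le> \<delta> b" using fin \<delta>(1) by (simp_all)
  show ?thesis
  proof (rule that[OF d(1)])
    fix b x x' assume b: "b \<in> bonds" and x: "x \<in> {0..blen b}" "x' \<in> {0..blen b}" "\<bar>x - x'\<bar> < ?d"
    show "\<bar>f (bpt b x) - f (bpt b x')\<bar> \<le> \<epsilon>"
    proof (cases "b \<in> ?F")
      case True
      show ?thesis using \<delta>(2)[OF True x(1,2)] x(3) d(2)[OF True] by linarith
    next
      case False
      then have "\<bar>f (bpt b x)\<bar> < \<epsilon> / 2" "\<bar>f (bpt b x')\<bar> < \<epsilon> / 2" using b x by force+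
      then show ?thesis by linarith
    qed
  qed
qed

lemma edge_measurable_C0:
  assumes "f \<in> C0" shows "edge_measurable f"
  unfolding edge_measurable_def
proof
  fix b assume "b \<in> bonds"
  then have "continuous_on {0..<blen b} (\<lambda>s. f (bpt b s))"
    by (rule continuous_on_subset[OF C0_edge_continuous[OF assms]]) auto
  from borel_measurable_continuous_on_indicator[OF _ this]
  have "(\<lambda>s. indicator {0..<blen b} s *\<^sub>R f (bpt b s)) \<in> borel_measurable borel" by simp
  moreover have "(\<lambda>s. indicator {0..<blen b} s *\<^sub>R f (bpt b s)) = (\<lambda>s. if 0 \<le> s \<and> s < blen b then f (bpt b s) else 0)"
    by (auto simp: indicator_def)
  ultimately show "(\<lambda>s. if 0 \<le> s \<and> s < blen b then f (bpt b s) else 0) \<in> borel_measurable borel" by simp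
qed

lemma C0_exp_bounded: "f \<in> C0 \<Longrightarrow> b \<in> bonds \<Longrightarrow> exp_bounded rate (unfold f b)"
  by (meson C0_bounded edge_measurable_C0 exp_bounded_unfold)

text \<open>At the origin of b, \<open>compatible_even\<close> expresses the left limit by the right
  limits on the outgoing edges, and all of these are the value of f at the vertex. Farther to the
  right the scattering rule propagates continuity from edge to edge.\<close>

lemma isCont_unfold:
  assumes f: "f \<in> C0" and b: "b \<in> bonds"
  shows "isCont (unfold f b) s"
proof -
  have lim0: "(unfold f b \<longlongrightarrow> f (Vertex (org b))) (at_right 0)" if b: "b \<in> bonds" for b
  proof -
    have "((\<lambda>s. f (bpt b s)) \<longlongrightarrow> f (bpt b 0)) (at 0 within {0..blen b})"
      using C0_edge_continuous[OF f b] blen_pos[OF b] by (auto simp: continuous_on_def)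
    then have "((\<lambda>s. f (bpt b s)) \<longlongrightarrow> f (Vertex (org b))) (at_right 0)"
      using blen_pos[OF b] by (simp add: at_within_Icc_at_right bpt_0[OF b])
    moreover have "\<forall>\<^sub>F s in at_right 0. f (bpt b s) = unfold f b s"
      using eventually_at_right_less[of 0 ] eventually_at_rightI[of 0 "blen b" "\<lambda>s. s < blen b"] blen_pos[OF b] b
      by (auto elim!: eventually_elim2 simp: unfold_on_edge eventually_at_right_field)
    ultimately show ?thesis by (rule Lim_transform_eventually)
  qed
  have lim0': "(unfold f b \<longlongrightarrow> f (Vertex v)) (at_right 0)" if "b \<in> out v" for b v
    using lim0[of b] that by (simp add: out_def)
  have base: "isCont (unfold f b) s" if b: "b \<in> bonds" and s: "0 \<le> s" "s < blen b" for b s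
  proof (cases "s = 0")
    case False
    have "continuous_on {0<..<blen b} (unfold f b)"
    proof (rule continuous_on_eq)
      show "continuous_on {0<..<blen b} (\<lambda>s. f (bpt b s))"
        by (rule continuous_on_subset[OF C0_edge_continuous[OF f b]]) auto
    qed (use b in \<open>auto simp: unfold_on_edge\<close>)
    then show ?thesis using s False by (auto simp: continuous_on_eq_continuous_at)
  next
    case True
    let ?c = "f (Vertex (org b))"
    have "((\<lambda>s. 2 * avg (org b) (\<lambda>b'. unfold f b' s) - unfold f b s) \<longlongrightarrow> 2 * avg (org b) (\<lambda>_. ?c) - ?c) (at_right 0)"
      by (intro tendsto_diff tendsto_mult tendsto_const tendsto_avg lim0' lim0 b)
    moreover have "avg (org b) (\<lambda>_. ?c) = ?c" using in_out[OF b] by (intro avg_const) auto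
    moreover have "2 * avg (org b) (\<lambda>b'. unfold f b' s) - unfold f b s = unfold f b (- s)" for s
      using compatible_even[OF compatible_unfold b, of f s] by simp
    ultimately have "(unfold f b \<longlongrightarrow> ?c) (at_left 0)" by (simp add: filterlim_at_left_to_right[of _ _ 0])
    then have "(unfold f b \<longlongrightarrow> ?c) (at 0)" using lim0[OF b] by (simp add: filterlim_split_at)
    moreover have "unfold f b 0 = ?c" using b blen_pos[OF b] by (simp add: unfold_on_edge bpt_0)
    ultimately show ?thesis using True by (simp add: isCont_def)
  qed
  have "\<forall>b\<in>bonds. \<forall>s. 0 \<le> s \<and> s < real n * min_len \<longrightarrow> isCont (unfold f b) s" for n
  proof (induction n)
    case (Suc n)
    show ?case
    proof (intro ballI allI impI)
      fix b s assume b: "b \<in> bonds" and s: "0 \<le> s \<and> s < real (Suc n) * min_len"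
      show "isCont (unfold f b) s"
      proof (cases "s < blen b")
        case False
        then have r: "0 \<le> s - blen b \<and> s - blen b < real n * min_len"
          using s blen_ge[OF b] by (simp add: algebra_simps)
        have c: "isCont (\<lambda>x. unfold f b' (x - blen b)) s" if "b' \<in> out (org (flip b))" for b'
        proof -
          have "isCont (unfold f b') (s - blen b)" using Suc.IH r out_bonds[OF that] by blast
          from isCont_o2[OF isCont_diff[OF continuous_ident continuous_const] this] show ?thesis .
        qed
        have "isCont (\<lambda>x. scatter b (\<lambda>b'. unfold f b' (x - blen b))) s"
          using c flip_out[OF b] unfolding scatter_def isCont_def
          by (intro tendsto_diff tendsto_mult tendsto_const tendsto_avg) auto
        moreover have "scatter b (\<lambda>b'. unfold f b' (x - blen b)) = unfold f b x" for x
          using compatible_step[OF compatible_unfold b, of f "x - blen b"] by simp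
        ultimately show ?thesis by simp
      qed (use base b s in auto)
    qed
  next
    case 0
    have "False" if "0 \<le> s \<and> s < real 0 * min_len" for s using that by auto
    then show ?case by blast
  qed
  then have right: "isCont (unfold f b) s" if "b \<in> bonds" "0 \<le> s" for b s
    using ex_less_min_len[of s] that by blast
  show ?thesis
  proof (cases "0 \<le> s")
    case False
    have "isCont (\<lambda>x. unfold f (flip b) (blen b - x)) s"
    proof -
      have "isCont (unfold f (flip b)) (blen b - s)"
        using False blen_pos[OF b] b by (intro right) auto
      from isCont_o2[OF isCont_diff[OF continuous_const continuous_ident] this] show ?thesis .
    qed
    moreover have "unfold f (flip b) (blen b - x) = unfold f b x" for x
      using compatible_flip[OF compatible_unfold b, of f "blen b - x"] by simp
    ultimately show ?thesis by simp
  qed (rule right[OF b])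
qed

text \<open>The basic uniform estimate. Small displacements are controlled by uniform continuity;
  for large ones the exponential growth bound is multiplied by y^2 / \<delta>^2 \<ge> 1. In this
  form the error becomes small after integration against a kernel with small second moment.\<close>

lemma unfold_osc:
  assumes f: "f \<in> C0" and \<epsilon>: "0 < \<epsilon>"
  obtains K where "0 \<le> K" "\<And>b x y. b \<in> bonds \<Longrightarrow> 0 \<le> x \<Longrightarrow> x \<le> blen b \<Longrightarrow>
    \<bar>unfold f b (x + y) - f (bpt b x)\<bar> \<le> \<epsilon> + K * (y\<^sup>2 * exp (rate * \<bar>y\<bar>))"
proof -
  obtain B where B: "0 \<le> B" "\<And>p. \<bar>f p\<bar> \<le> B" using C0_bounded[OF f] by blast
  \<comment> \<open>One quarter is spent on the way to the vertex, three quarters on the factor 3 of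
    \<open>scatter_bound\<close> behind it.\<close>
  have "0 < \<epsilon> / 4" using \<epsilon> by simp
  from C0_modulus[OF f this] obtain \<delta>0 where \<delta>0: "0 < \<delta>0" "\<And>b x x'. b \<in> bonds \<Longrightarrow> x \<in> {0..blen b} \<Longrightarrow> x' \<in> {0..blen b} \<Longrightarrow> \<bar>x - x'\<bar> < \<delta>0
     \<Longrightarrow> \<bar>f (bpt b x) - f (bpt b x')\<bar> \<le> \<epsilon> / 4" by blast
  \<comment> \<open>A displacement below \<open>min_len\<close> ends at the latest on the edge
    behind the first vertex.\<close>
  define \<delta> where "\<delta> = min \<delta>0 min_len"
  have \<delta>: "0 < \<delta>" "\<delta> \<le> min_len" "\<And>b x x'. b \<in> bonds \<Longrightarrow> x \<in> {0..blen b} \<Longrightarrow> x' \<in> {0..blen b} \<Longrightarrow> \<bar>x - x'\<bar> < \<delta>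
     \<Longrightarrow> \<bar>f (bpt b x) - f (bpt b x')\<bar> \<le> \<epsilon> / 4"
  proof -
    show "0 < \<delta>" "\<delta> \<le> min_len" using \<delta>0(1) min_len_pos by (simp_all add: \<delta>_def)
    show "\<bar>f (bpt b x) - f (bpt b x')\<bar> \<le> \<epsilon> / 4"
      if "b \<in> bonds" "x \<in> {0..blen b}" "x' \<in> {0..blen b}" "\<bar>x - x'\<bar> < \<delta>" for b x x'
      using \<delta>0(2)[OF that(1-3)] that(4) by (simp add: \<delta>_def)
  qed
  have small: "\<bar>unfold f b (x + y) - f (bpt b x)\<bar> \<le> \<epsilon>"
    if b: "b \<in> bonds" "0 \<le> x" "x \<le> blen b" and y: "\<bar>y\<bar> < \<delta>" for b x y
    using b
  proof (cases rule: unfold_reflect_cases[where y = y])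
    case 1
    then show ?thesis using \<delta>(3)[OF b(1), of "x + y" x] b y \<epsilon> by (simp add: unfold_on_edge)
  next
    case (2 b' s)
    let ?V = "f (Vertex (org (flip b')))"
    have near: "\<bar>?V - f (bpt b x)\<bar> \<le> \<epsilon> / 4"
    proof (cases "b' = b")
      case True
      then have "\<bar>blen b - x\<bar> < \<delta>" using 2 y b blen_pos[OF b(1)] by (auto simp: flip_def prod_eq_iff)
      then have "\<bar>f (bpt b (blen b)) - f (bpt b x)\<bar> \<le> \<epsilon> / 4" using b by (intro \<delta>(3)) auto
      then show ?thesis using True b by (simp add: bpt_blen)
    next
      case False
      then have *: "b' = flip b" "\<bar>0 - x\<bar> < \<delta>" using 2 y b by auto
      then have "\<bar>f (bpt b 0) - f (bpt b x)\<bar> \<le> \<epsilon> / 4" using b blen_pos[OF b(1)] by (intro \<delta>(3)) auto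
      then show ?thesis using *(1) b by (simp add: bpt_0)
    qed
    have "\<bar>scatter b' (\<lambda>b''. forward f b'' s - ?V)\<bar> \<le> 3 * (\<epsilon> / 4)"
    proof (rule scatter_bound[OF 2(1)])
      fix b'' assume "b'' \<in> out (org (flip b'))"
      then have b'': "b'' \<in> bonds" "org b'' = org (flip b')" by (auto simp: out_def)
      have "s < \<delta>" using 2(3) y by simp
      then have "s \<le> blen b''" using \<delta>(2) blen_ge[OF b''(1)] by simp
      then have "\<bar>f (bpt b'' s) - f (bpt b'' 0)\<bar> \<le> \<epsilon> / 4"
        using \<open>s < \<delta>\<close> 2(2) b'' by (intro \<delta>(3)) auto
      then show "\<bar>forward f b'' s - ?V\<bar> \<le> \<epsilon> / 4"
        using b'' 2(2) \<open>s \<le> blen b''\<close> by (simp add: forward_on_edge bpt_0)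
    qed (use \<epsilon> in simp)
    moreover have "scatter b' (\<lambda>b''. forward f b'' s - ?V) = unfold f b (x + y) - ?V"
      using scatter_const[OF 2(1), of "\<lambda>_. ?V" ?V] 2(4)[of f] by (simp add: scatter_diff)
    ultimately show ?thesis using near by linarith
  qed
  have large: "\<bar>unfold f b (x + y) - f (bpt b x)\<bar> \<le> 4 * B / \<delta>\<^sup>2 * (y\<^sup>2 * exp (rate * \<bar>y\<bar>))"
    if b: "b \<in> bonds" "0 \<le> x" "x \<le> blen b" and y: "\<not> \<bar>y\<bar> < \<delta>" for b x y
  proof -
    have "\<bar>unfold f b (x + y)\<bar> \<le> 3 * B * exp (rate * \<bar>y\<bar>)" using B(2) b by (rule unfold_bound)
    moreover have "B * 1 \<le> B * exp (rate * \<bar>y\<bar>)" using B(1) rate_nonneg by (intro mult_left_mono) auto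
    ultimately have "\<bar>unfold f b (x + y) - f (bpt b x)\<bar> \<le> 4 * B * exp (rate * \<bar>y\<bar>)"
      using B(2)[of "bpt b x"] by linarith
    also have "\<dots> \<le> (4 * B * exp (rate * \<bar>y\<bar>)) * (y\<^sup>2 / \<delta>\<^sup>2)"
    proof -
      have "\<delta>\<^sup>2 \<le> y\<^sup>2" using y \<delta>(1) by (simp add: abs_le_square_iff[symmetric])
      then have "1 \<le> y\<^sup>2 / \<delta>\<^sup>2" using \<delta>(1) by simp
      then show ?thesis using B(1) mult_left_mono[of 1 "y\<^sup>2 / \<delta>\<^sup>2" "4 * B * exp (rate * \<bar>y\<bar>)"] by simp
    qed
    finally show ?thesis by (simp add: mult_ac)
  qed
  show ?thesis
  proof (rule that[of "4 * B / \<delta>\<^sup>2"])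
    fix b x y assume b: "b \<in> bonds" "0 \<le> x" "x \<le> blen b"
    have "0 \<le> 4 * B / \<delta>\<^sup>2 * (y\<^sup>2 * exp (rate * \<bar>y\<bar>))" using B(1) by simp
    then show "\<bar>unfold f b (x + y) - f (bpt b x)\<bar> \<le> \<epsilon> + 4 * B / \<delta>\<^sup>2 * (y\<^sup>2 * exp (rate * \<bar>y\<bar>))"
      using small[OF b, of y] large[OF b, of y] \<epsilon> by linarith
  qed (use B(1) in simp)
qed

text \<open>If \<open>piece (Suc n) f b\<close> is large somewhere, so is
  \<open>piece n f b'\<close> for some b' leaving the endpoint of b. By local finiteness each b' has
  only finitely many such predecessors b.\<close>

lemma piece_null:
  assumes f: "f \<in> C0"
  shows "0 < \<epsilon> \<Longrightarrow> finite {b\<in>bonds. \<exists>s. \<epsilon> \<le> \<bar>piece n f b s\<bar>}"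
proof (induction n arbitrary: \<epsilon>)
  case 0
  have "{b\<in>bonds. \<exists>s. \<epsilon> \<le> \<bar>piece 0 f b s\<bar>} \<subseteq> {b\<in>bonds. \<exists>s\<in>{0..blen b}. \<epsilon> \<le> \<bar>f (bpt b s)\<bar>}"
    using 0 by (auto split: if_splits)
  then show ?case by (rule finite_subset) (rule C0_finite_large[OF f 0])
next
  case (Suc n)
  \<comment> \<open>The 3 compensates \<open>scatter_bound\<close>; the extra 2 makes the
    contradiction strict.\<close>
  let ?F = "{b\<in>bonds. \<exists>s. \<epsilon> / 3 / 2 \<le> \<bar>piece n f b s\<bar>}"
  have fin: "finite ?F" by (rule Suc.IH) (use Suc.prems in simp)
  have "{b\<in>bonds. \<exists>s. \<epsilon> \<le> \<bar>piece (Suc n) f b s\<bar>} \<subseteq> (\<Union>b'\<in>?F. flip ` out (org b'))"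
  proof
    fix b assume "b \<in> {b\<in>bonds. \<exists>s. \<epsilon> \<le> \<bar>piece (Suc n) f b s\<bar>}"
    then obtain s where b: "b \<in> bonds" and s: "\<epsilon> \<le> \<bar>scatter b (\<lambda>b'. piece n f b' (s - blen b))\<bar>" by auto
    have "\<exists>b'\<in>out (org (flip b)). \<epsilon> / 3 / 2 < \<bar>piece n f b' (s - blen b)\<bar>"
    proof (rule ccontr)
      assume neg: "\<not> ?thesis"
      have "\<bar>scatter b (\<lambda>b'. piece n f b' (s - blen b))\<bar> \<le> 3 * (\<epsilon> / 3 / 2)"
      proof (rule scatter_bound[OF b])
        fix b' assume "b' \<in> out (org (flip b))"
        with neg have "\<not> \<epsilon> / 3 / 2 < \<bar>piece n f b' (s - blen b)\<bar>" by blast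
        then show "\<bar>piece n f b' (s - blen b)\<bar> \<le> \<epsilon> / 3 / 2" by simp
      qed (use Suc.prems in simp)
      then show False using s Suc.prems by simp
    qed
    then obtain b' where b': "b' \<in> out (org (flip b))" "\<epsilon> / 3 / 2 < \<bar>piece n f b' (s - blen b)\<bar>" by blast
    then have "b' \<in> ?F" by (auto simp: out_def intro: less_imp_le)
    moreover have "flip b \<in> out (org b')" using b b' by (auto simp: out_def)
    ultimately show "b \<in> (\<Union>b'\<in>?F. flip ` out (org b'))" by (intro UN_I image_eqI[of b flip "flip b"]) simp_all
  qed
  moreover have "finite (\<Union>b'\<in>?F. flip ` out (org b'))" using fin finite_out by blast
  ultimately show ?case by (rule finite_subset)
qed

lemma forward_null:
  assumes f: "f \<in> C0" and \<epsilon>: "0 < \<epsilon>"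
  shows "finite {b\<in>bonds. \<exists>s\<le>R. \<epsilon> \<le> \<bar>forward f b s\<bar>}"
proof -
  obtain N where N: "R < real N * min_len" using ex_less_min_len by blast
  let ?F = "\<lambda>n. {b\<in>bonds. \<exists>s. \<epsilon> / (real N + 1) \<le> \<bar>piece n f b s\<bar>}"
  have "{b\<in>bonds. \<exists>s\<le>R. \<epsilon> \<le> \<bar>forward f b s\<bar>} \<subseteq> (\<Union>n<N. ?F n)"
  proof
    fix b assume "b \<in> {b\<in>bonds. \<exists>s\<le>R. \<epsilon> \<le> \<bar>forward f b s\<bar>}"
    then obtain s where b: "b \<in> bonds" and s: "s \<le> R" "\<epsilon> \<le> \<bar>forward f b s\<bar>" by blast
    have "\<exists>n<N. \<epsilon> / (real N + 1) < \<bar>piece n f b s\<bar>"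
    proof (rule ccontr)
      assume neg: "\<not> ?thesis"
      have "\<bar>forward f b s\<bar> \<le> (\<Sum>n<N. \<bar>piece n f b s\<bar>)"
        using forward_eq_sum[OF b, of s N] s N by (simp add: sum_abs)
      also have "\<dots> \<le> (\<Sum>n<N. \<epsilon> / (real N + 1))"
      proof (rule sum_mono)
        fix n assume "n \<in> {..<N}"
        with neg have "\<not> \<epsilon> / (real N + 1) < \<bar>piece n f b s\<bar>" by blast
        then show "\<bar>piece n f b s\<bar> \<le> \<epsilon> / (real N + 1)" by simp
      qed
      also have "\<dots> < \<epsilon>" using \<epsilon> by (simp add: field_simps)
      finally show False using s by simp
    qed
    then obtain n where "n < N" "\<epsilon> / (real N + 1) \<le> \<bar>piece n f b s\<bar>" by (auto intro: less_imp_le)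
    then show "b \<in> (\<Union>n<N. ?F n)" using b by blast
  qed
  moreover have "finite (\<Union>n<N. ?F n)" using piece_null[OF f] \<epsilon> by simp
  ultimately show ?thesis by (rule finite_subset)
qed

text \<open>For displacements up to R, \<open>forward_null\<close> leaves finitely many exceptional
  edges; the upper bound U on the lengths keeps all arguments of \<open>forward\<close> below U + R.
  For larger displacements the y^2 term absorbs the growth bound.\<close>

lemma unfold_decay:
  assumes f: "f \<in> C0" and \<epsilon>: "0 < \<epsilon>"
  obtains F where "finite F" "\<And>b x y. b \<in> bonds - F \<Longrightarrow> 0 \<le> x \<Longrightarrow> x \<le> blen b \<Longrightarrow>
    \<bar>unfold f b (x + y)\<bar> \<le> \<epsilon> + \<epsilon> * (y\<^sup>2 * exp (rate * \<bar>y\<bar>))"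
proof -
  obtain B where B: "0 \<le> B" "\<And>p. \<bar>f p\<bar> \<le> B" using C0_bounded[OF f] by blast
  obtain U where U: "\<And>b. b \<in> bonds \<Longrightarrow> blen b \<le> U"
    using len_bounds bond_arc unfolding blen_def by blast
  \<comment> \<open>Beyond this R, the constant 3 B of \<open>unfold_bound\<close> is at most
    \<epsilon> y^2.\<close>
  define R where "R = sqrt (3 * B / \<epsilon>)"
  have R: "0 \<le> R" "3 * B = \<epsilon> * R\<^sup>2" using B(1) \<epsilon> by (auto simp: R_def)
  let ?F = "{b\<in>bonds. \<exists>s\<le>U + R. \<epsilon> \<le> \<bar>forward f b s\<bar>}"
  \<comment> \<open>The reversed edges are excluded as well, because negative coordinates are
    evaluated on them.\<close>
  have fin: "finite (?F \<union> flip ` ?F)" using forward_null[OF f \<epsilon>] by simp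
  show ?thesis
  proof (rule that[OF fin])
    fix b x y assume b: "b \<in> bonds - (?F \<union> flip ` ?F)" and x: "0 \<le> x" "x \<le> blen b"
    have pos: "0 \<le> \<epsilon> * (y\<^sup>2 * exp (rate * \<bar>y\<bar>))" using \<epsilon> by simp
    show "\<bar>unfold f b (x + y)\<bar> \<le> \<epsilon> + \<epsilon> * (y\<^sup>2 * exp (rate * \<bar>y\<bar>))"
    proof (cases "\<bar>y\<bar> \<le> R")
      case True
      have "b \<notin> ?F" using b by blast
      have "flip b \<notin> ?F"
      proof
        assume "flip b \<in> ?F"
        then have "flip (flip b) \<in> flip ` ?F" by (rule imageI)
        then have "b \<in> flip ` ?F" by (simp only: flip_flip)
        then show False using b by blast
      qed
      have "x \<le> U" "blen b \<le> U" using x U[of b] b by auto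
      have "\<bar>unfold f b (x + y)\<bar> < \<epsilon>"
      proof (cases "0 \<le> x + y")
        case True
        have "x + y \<le> U + R" using \<open>\<bar>y\<bar> \<le> R\<close> \<open>x \<le> U\<close> by linarith
        then have "\<not> \<epsilon> \<le> \<bar>forward f b (x + y)\<bar>" using \<open>b \<notin> ?F\<close> b by blast
        then show ?thesis using True by (simp add: unfold_def)
      next
        case False
        have "flip b \<in> bonds" using b by simp
        moreover have "blen b - (x + y) \<le> U + R" using \<open>\<bar>y\<bar> \<le> R\<close> \<open>blen b \<le> U\<close> x by linarith
        ultimately have "\<not> \<epsilon> \<le> \<bar>forward f (flip b) (blen b - (x + y))\<bar>" using \<open>flip b \<notin> ?F\<close> by blast
        then show ?thesis using False by (simp add: unfold_def)
      qed
      then show ?thesis using pos by linarith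
    next
      case False
      have "\<bar>unfold f b (x + y)\<bar> \<le> 3 * B * exp (rate * \<bar>y\<bar>)"
        using B(2) b x by (intro unfold_bound) auto
      also have "\<dots> = \<epsilon> * (R\<^sup>2 * exp (rate * \<bar>y\<bar>))" using R(2) by simp
      also have "\<dots> \<le> \<epsilon> * (y\<^sup>2 * exp (rate * \<bar>y\<bar>))"
        using False R(1) \<epsilon> by (intro mult_left_mono mult_right_mono) (auto simp: abs_le_square_iff[symmetric])
      finally show ?thesis using \<epsilon> by simp
    qed
  qed
qed

lemma unfold_cong:
  assumes b: "b \<in> bonds" and fg: "\<And>p. p \<in> points \<Longrightarrow> f p = g p"
  shows "unfold f b s = unfold g b s"
proof -
  have "fold (unfold f) p = fold (unfold g) p" for p
    by (cases "p \<in> points") (simp_all add: fold_unfold fg, simp add: fold_def)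
  then have "fold (unfold f) = fold (unfold g)" by (rule ext)
  then show ?thesis
    using unfold_fold[OF compatible_unfold b, of f s] unfold_fold[OF compatible_unfold b, of g s] by simp
qed

text \<open>Unfoldings are identified by compatibility and their values on the edges, without
  following the recursion for \<open>piece\<close>.\<close>

lemma unfold_eqI:
  assumes \<phi>: "compatible \<phi>" and b: "b \<in> bonds"
    and f: "\<And>b s. b \<in> bonds \<Longrightarrow> 0 \<le> s \<Longrightarrow> s \<le> blen b \<Longrightarrow> f (bpt b s) = \<phi> b s"
  shows "unfold f b s = \<phi> b s"
proof -
  have "f p = fold \<phi> p" if "p \<in> points" for p
    using f[of "bond p" "pos p"] bond_pos[OF that] that by (simp add: fold_def)
  then show ?thesis using unfold_cong[OF b, of f "fold \<phi>"] unfold_fold[OF \<phi> b] by simp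
qed

lemma unfold_linear:
  assumes "b \<in> bonds"
  shows "unfold (\<lambda>p. a * f p + c * g p) b s = a * unfold f b s + c * unfold g b s"
proof (rule unfold_eqI[OF _ assms])
  show "compatible (\<lambda>b s. a * unfold f b s + c * unfold g b s)"
    unfolding compatible_def avg_add avg_cmult
  proof (intro conjI ballI allI)
    fix b s assume b: "b \<in> bonds"
    show "a * unfold f (flip b) s + c * unfold g (flip b) s
        = a * unfold f b (blen b - s) + c * unfold g b (blen b - s)"
      by (simp add: compatible_flip[OF compatible_unfold b])
    have "a * (unfold f b s + unfold f b (- s)) + c * (unfold g b s + unfold g b (- s))
      = a * (2 * avg (org b) (\<lambda>b'. unfold f b' s)) + c * (2 * avg (org b) (\<lambda>b'. unfold g b' s))"
      by (simp only: compatible_even[OF compatible_unfold b])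
    then show "a * unfold f b s + c * unfold g b s + (a * unfold f b (- s) + c * unfold g b (- s))
        = 2 * (a * avg (org b) (\<lambda>b'. unfold f b' s) + c * avg (org b) (\<lambda>b'. unfold g b' s))"
      by (simp add: algebra_simps)
  qed
qed (simp add: unfold_on_edge)

subsection \<open>Even convolution operators on the graph\<close>

text \<open>Both conditions involve only reflections of the line and finite linear combinations, and
  these commute with an even convolution.\<close>

lemma compatible_convol:
  assumes \<phi>: "compatible \<phi>" and eb: "\<And>b. b \<in> bonds \<Longrightarrow> exp_bounded rate (\<phi> b)" and M: "sym_kernel rate M"
  shows "compatible (\<lambda>b. convol M (\<phi> b))"
  unfolding compatible_def
proof (intro conjI ballI allI)
  fix b s assume b: "b \<in> bonds"
  have [measurable]: "\<phi> b \<in> borel_measurable borel" using eb[OF b] by (rule exp_bounded_measurable)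
  have "\<phi> (flip b) = (\<lambda>s. \<phi> b (blen b - s))" by (simp add: fun_eq_iff compatible_flip[OF \<phi> b])
  then show "convol M (\<phi> (flip b)) s = convol M (\<phi> b) (blen b - s)"
    using convol_reflect[OF M] by simp
  have int: "integrable M (\<lambda>y. \<phi> b (x + y))" if "b \<in> bonds" for b x
    using sym_kernel_integrable[OF M exp_bounded_shift[OF rate_nonneg eb[OF that]]] .
  have "convol M (\<phi> b) (- s) = (\<integral>y. \<phi> b (- (s + y)) \<partial>M)"
    using sym_kernel_reflect[OF M, of "\<lambda>y. \<phi> b (- s + y)"] by (simp add: convol_def)
  moreover have "integrable M (\<lambda>y. \<phi> b (- (s + y)))"
  proof -
    have "exp_bounded rate (\<lambda>y. \<phi> b (- (s + y)))"
    proof -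
      obtain C where "0 \<le> C" "\<And>y. \<bar>\<phi> b (- s + y)\<bar> \<le> C * exp (rate * \<bar>y\<bar>)"
        by (rule exp_boundedE[OF exp_bounded_shift[OF rate_nonneg eb[OF b], of "- s"]]) blast
      from this(2)[of "- _"] show ?thesis by (auto simp: exp_bounded_def)
    qed
    then show ?thesis by (rule sym_kernel_integrable[OF M])
  qed
  ultimately have "convol M (\<phi> b) s + convol M (\<phi> b) (- s) = (\<integral>y. \<phi> b (s + y) + \<phi> b (- (s + y)) \<partial>M)"
    using int[OF b] by (simp add: convol_def)
  also have "\<dots> = (\<integral>y. 2 * avg (org b) (\<lambda>b'. \<phi> b' (s + y)) \<partial>M)"
    by (simp only: compatible_even[OF \<phi> b])
  also have "\<dots> = 2 * avg (org b) (\<lambda>b'. convol M (\<phi> b') s)"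
    unfolding avg_def convol_def using int out_bonds by (simp add: Bochner_Integration.integral_sum)
  finally show "convol M (\<phi> b) s + convol M (\<phi> b) (- s) = 2 * avg (org b) (\<lambda>b'. convol M (\<phi> b') s)" .
qed

definition conv_op :: "real measure \<Rightarrow> (('v, 'e) point \<Rightarrow> real) \<Rightarrow> ('v, 'e) point \<Rightarrow> real" where
  "conv_op M f = fold (\<lambda>b. convol M (unfold f b))"

context
  fixes M f
  assumes M: "sym_kernel rate M" and f: "f \<in> C0"
begin

lemma compatible_conv_op: "compatible (\<lambda>b. convol M (unfold f b))"
  by (rule compatible_convol[OF compatible_unfold C0_exp_bounded[OF f] M])

lemma conv_op_bpt: "b \<in> bonds \<Longrightarrow> 0 \<le> s \<Longrightarrow> s \<le> blen b \<Longrightarrow> conv_op M f (bpt b s) = convol M (unfold f b) s"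
  unfolding conv_op_def by (rule fold_bpt[OF compatible_conv_op])

lemma unfold_conv_op: "b \<in> bonds \<Longrightarrow> unfold (conv_op M f) b s = convol M (unfold f b) s"
  unfolding conv_op_def by (rule unfold_fold[OF compatible_conv_op])

lemma conv_op_bound:
  assumes "0 \<le> B" "\<And>p. \<bar>f p\<bar> \<le> B"
  shows "\<bar>conv_op M f p\<bar> \<le> 3 * B * (\<integral>y. exp (rate * \<bar>y\<bar>) \<partial>M)"
proof (cases "p \<in> points")
  case True
  note bp = bond_pos[OF True]
  have "\<bar>convol M (unfold f (bond p)) (pos p)\<bar> \<le> 3 * B * (\<integral>y. exp (rate * \<bar>y\<bar>) \<partial>M)"
    by (rule convol_bound[OF rate_nonneg M C0_exp_bounded[OF f bp(1)]])
      (rule unfold_bound[OF assms(2) bp(1-3)])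
  then show ?thesis using True by (simp add: conv_op_def fold_def)
next
  case False
  have "0 \<le> 3 * B * (\<integral>y. exp (rate * \<bar>y\<bar>) \<partial>M)" using assms(1) by (intro mult_nonneg_nonneg Bochner_Integration.integral_nonneg) auto
  then show ?thesis using False by (simp add: conv_op_def fold_def)
qed

lemma conv_op_C0: "conv_op M f \<in> C0"
  unfolding C0_iff_bonds
proof (intro conjI ballI allI impI)
  fix b assume b: "b \<in> bonds"
  have "continuous_on {0..blen b} (convol M (unfold f b))"
    using isCont_convol[OF rate_nonneg M C0_exp_bounded[OF f b] isCont_unfold[OF f b]]
    by (simp add: continuous_at_imp_continuous_on)
  then show "continuous_on {0..blen b} (\<lambda>s. conv_op M f (bpt b s))"
    by (rule continuous_on_eq) (simp add: conv_op_bpt b)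
next
  fix \<epsilon> :: real assume \<epsilon>: "0 < \<epsilon>"
  let ?I = "\<integral>y. y\<^sup>2 * exp (rate * \<bar>y\<bar>) \<partial>M"
  define D where "D = 1 + ?I"
  have "0 \<le> ?I" by (intro Bochner_Integration.integral_nonneg) auto
  then have D: "0 < D" unfolding D_def by linarith
  \<comment> \<open>Integrating the bound of \<open>unfold_decay\<close> gives \<eta> (1 + ?I) =
    \<epsilon> / 2.\<close>
  define \<eta> where "\<eta> = \<epsilon> / 2 / D"
  have \<eta>: "0 < \<eta>" using \<epsilon> D by (simp add: \<eta>_def)
  from unfold_decay[OF f \<eta>] obtain F where F: "finite F" "\<And>b x y. b \<in> bonds - F \<Longrightarrow> 0 \<le> x \<Longrightarrow> x \<le> blen b \<Longrightarrow>
    \<bar>unfold f b (x + y)\<bar> \<le> \<eta> + \<eta> * (y\<^sup>2 * exp (rate * \<bar>y\<bar>))" by blast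
  have "\<bar>conv_op M f (bpt b s)\<bar> < \<epsilon>" if "b \<in> bonds - F" "s \<in> {0..blen b}" for b s
  proof -
    have "\<bar>convol M (unfold f b) s - 0\<bar> \<le> \<eta> + \<eta> * ?I"
      using that F(2)[of b s] by (intro convol_near[OF rate_nonneg M C0_exp_bounded[OF f]]) auto
    also have "\<dots> = \<eta> * D" by (simp add: algebra_simps D_def)
    also have "\<dots> = \<epsilon> / 2" using D by (simp add: \<eta>_def)
    finally show ?thesis using that \<epsilon> by (simp add: conv_op_bpt)
  qed
  then have "{b\<in>bonds. \<exists>s\<in>{0..blen b}. \<epsilon> \<le> \<bar>conv_op M f (bpt b s)\<bar>} \<subseteq> F" by force
  then show "finite {b\<in>bonds. \<exists>s\<in>{0..blen b}. \<epsilon> \<le> \<bar>conv_op M f (bpt b s)\<bar>}" using F(1) finite_subset by blast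
qed (simp add: conv_op_def fold_def)

end

lemma conv_op_linear:
  assumes M: "sym_kernel rate M" and f: "f \<in> C0" and g: "g \<in> C0"
  shows "conv_op M (\<lambda>p. a * f p + c * g p) = (\<lambda>p. a * conv_op M f p + c * conv_op M g p)"
proof
  fix p
  show "conv_op M (\<lambda>p. a * f p + c * g p) p = a * conv_op M f p + c * conv_op M g p"
  proof (cases "p \<in> points")
    case True
    note bp = bond_pos[OF True]
    have i: "integrable M (\<lambda>y. unfold h (bond p) (pos p + y))" if "h \<in> C0" for h
      by (rule sym_kernel_integrable[OF M exp_bounded_shift[OF rate_nonneg C0_exp_bounded[OF that bp(1)]]])
    show ?thesis using True i[OF f] i[OF g]
      by (simp add: conv_op_def fold_def convol_def unfold_linear[OF bp(1)])
  qed (simp add: conv_op_def fold_def)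
qed

lemma conv_op_commute:
  assumes M: "sym_kernel rate M" and N: "sym_kernel rate N" and f: "f \<in> C0"
  shows "conv_op M (conv_op N f) = conv_op N (conv_op M f)"
proof
  fix p
  show "conv_op M (conv_op N f) p = conv_op N (conv_op M f) p"
  proof (cases "p \<in> points")
    case True
    note bp = bond_pos[OF True]
    have "unfold (conv_op N f) (bond p) = convol N (unfold f (bond p))"
      "unfold (conv_op M f) (bond p) = convol M (unfold f (bond p))"
      using unfold_conv_op[OF N f bp(1)] unfold_conv_op[OF M f bp(1)] by auto
    then show ?thesis using True
      by (simp add: conv_op_def[of _ "conv_op _ f"] fold_def convol_commute[OF rate_nonneg M N C0_exp_bounded[OF f bp(1)]])
  qed (simp add: conv_op_def fold_def)
qed

lemma conv_op_near:
  assumes M: "sym_kernel rate M" and f: "f \<in> C0"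
    and osc: "\<And>b x y. b \<in> bonds \<Longrightarrow> 0 \<le> x \<Longrightarrow> x \<le> blen b \<Longrightarrow>
      \<bar>unfold f b (x + y) - f (bpt b x)\<bar> \<le> \<epsilon> + K * (y\<^sup>2 * exp (rate * \<bar>y\<bar>))"
    and nonneg: "0 \<le> \<epsilon>" "0 \<le> K"
  shows "\<bar>conv_op M f p - f p\<bar> \<le> \<epsilon> + K * (\<integral>y. y\<^sup>2 * exp (rate * \<bar>y\<bar>) \<partial>M)"
proof (cases "p \<in> points")
  case True
  note bp = bond_pos[OF True]
  have "\<bar>unfold f (bond p) (pos p + y) - f p\<bar> \<le> \<epsilon> + K * (y\<^sup>2 * exp (rate * \<bar>y\<bar>))" for y
    using osc[OF bp(1-3), of y] unfolding bp(4) .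
  then have "\<bar>convol M (unfold f (bond p)) (pos p) - f p\<bar> \<le> \<epsilon> + K * (\<integral>y. y\<^sup>2 * exp (rate * \<bar>y\<bar>) \<partial>M)"
    by (rule convol_near[OF rate_nonneg M C0_exp_bounded[OF f bp(1)]])
  then show ?thesis using True by (simp add: conv_op_def fold_def)
next
  case False
  have "0 \<le> K * (\<integral>y. y\<^sup>2 * exp (rate * \<bar>y\<bar>) \<partial>M)"
    using nonneg by (intro mult_nonneg_nonneg Bochner_Integration.integral_nonneg) auto
  then show ?thesis using False nonneg C0_outside[OF f False] by (simp add: conv_op_def fold_def)
qed

end

subsection \<open>The Kirchhoff Laplacian on oriented edges\<close>

context metric_graph
begin

text \<open>\<open>D\<close> is the first derivative extended continuously to the closed edge, so
  that the one-sided limits in \<open>normal_deriv\<close> become the value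
  \<open>D 0\<close>.\<close>

definition edge_deriv :: "(('v, 'e) point \<Rightarrow> real) \<Rightarrow> (('v, 'e) point \<Rightarrow> real) \<Rightarrow> (real \<Rightarrow> real) \<Rightarrow> 'e \<times> bool \<Rightarrow> bool" where
  "edge_deriv u w D b \<longleftrightarrow> continuous_on {0..blen b} D
     \<and> (\<forall>s\<in>{0<..<blen b}. ((\<lambda>s. u (bpt b s)) has_real_derivative D s) (at s)
          \<and> (D has_real_derivative w (bpt b s)) (at s))"

lemma bpt_forward: "snd b \<Longrightarrow> bpt b s = chart (fst b) s"
  and bpt_backward: "\<not> snd b \<Longrightarrow> bpt b (blen b - x) = chart (fst b) x"
  by (simp_all add: bpt_def blen_def)

lemma DERIV_reflect:
  fixes f :: "real \<Rightarrow> real"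
  assumes "(f has_real_derivative d) (at (c - x))"
  shows "((\<lambda>x. f (c - x)) has_real_derivative - d) (at x)"
  using DERIV_chain2[OF assms DERIV_diff[OF DERIV_const DERIV_ident]] by simp

text \<open>Reversing an edge changes the sign of the derivative, which absorbs the minus sign at
  terminal vertices: one formula serves both ends.\<close>

lemma normal_deriv_eq:
  assumes b: "b \<in> bonds" and D: "edge_deriv u w D b"
  shows "normal_deriv u (fst b) (org b) = cond (fst b) * D 0"
proof -
  let ?e = "fst b"
  have len: "0 < blen b" "len ?e = blen b" using blen_pos[OF b] by (auto simp: blen_def)
  have cont: "continuous_on {0..blen b} D" using D by (simp add: edge_deriv_def)
  show ?thesis
  proof (cases "snd b")
    case True
    have "(D \<longlongrightarrow> D 0) (at 0 within {0..blen b})" using cont len by (auto simp: continuous_on_def)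
    then have "(D \<longlongrightarrow> D 0) (at_right 0)" using len by (simp add: at_within_Icc_at_right)
    moreover have "edge_fun u ?e = (\<lambda>s. u (bpt b s))" using True by (simp add: edge_fun_def fun_eq_iff bpt_forward)
    then have "\<forall>\<^sub>F s in at_right 0. D s = deriv (edge_fun u ?e) s"
      using D len unfolding eventually_at_right_field edge_deriv_def
      by (intro exI[of _ "blen b"]) (auto intro!: DERIV_imp_deriv[symmetric])
    ultimately have "(deriv (edge_fun u ?e) \<longlongrightarrow> D 0) (at_right 0)" by (rule Lim_transform_eventually)
    then have "Lim (at_right 0) (deriv (edge_fun u ?e)) = D 0" by (intro tendsto_Lim) auto
    then show ?thesis using True by (simp add: normal_deriv_def org_def)
  next
    case False
    let ?D = "\<lambda>x. - D (blen b - x)"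
    have "continuous_on {0..blen b} ?D"
      by (intro continuous_on_minus continuous_on_compose2[OF cont] continuous_intros) auto
    then have "(?D \<longlongrightarrow> ?D (blen b)) (at (blen b) within {0..blen b})" unfolding continuous_on_def by (rule bspec) (use len in auto)
    then have "(?D \<longlongrightarrow> - D 0) (at_left (blen b))" using len by (simp add: at_within_Icc_at_left)
    moreover have eq: "edge_fun u ?e = (\<lambda>x. u (bpt b (blen b - x)))"
      using False by (simp add: edge_fun_def fun_eq_iff bpt_backward)
    have "\<forall>\<^sub>F x in at_left (blen b). ?D x = deriv (edge_fun u ?e) x"
      unfolding eventually_at_left_field
    proof (intro exI[of _ 0] conjI allI impI)
      fix x assume "0 < x" "x < blen b"
      then have "((\<lambda>s. u (bpt b s)) has_real_derivative D (blen b - x)) (at (blen b - x))"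
        using D by (simp add: edge_deriv_def)
      from DERIV_reflect[OF this] show "?D x = deriv (edge_fun u ?e) x"
        unfolding eq by (intro DERIV_imp_deriv[symmetric])
    qed (use len in auto)
    ultimately have "(deriv (edge_fun u ?e) \<longlongrightarrow> - D 0) (at_left (blen b))"
      using Lim_transform_eventually by blast
    then have "Lim (at_left (len ?e)) (deriv (edge_fun u ?e)) = - D 0" unfolding len by (intro tendsto_Lim) auto
    moreover have "org b \<noteq> tail G ?e" using False no_loops[OF bond_arc[OF b]] by (simp add: org_def)
    ultimately show ?thesis by (simp add: normal_deriv_def)
  qed
qed

text \<open>Without loops, an edge at v leaves v in exactly one of its two orientations.\<close>

lemma bij_out_incident: "bij_betw fst (out v) (incident v)"
proof (rule bij_betw_imageI)
  show "inj_on fst (out v)"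
  proof (rule inj_onI)
    fix b b' assume *: "b \<in> out v" "b' \<in> out v" "fst b = fst b'"
    then have "snd b = snd b'"
      using no_loops[OF bond_arc[OF out_bonds[OF *(1)]]] by (auto simp: out_def org_def split: if_splits)
    then show "b = b'" using *(3) by (simp add: prod_eq_iff)
  qed
  show "fst ` out v = incident v"
  proof
    show "fst ` out v \<subseteq> incident v" by (auto simp: out_def org_def incident_def bonds_def split: if_splits)
    show "incident v \<subseteq> fst ` out v"
    proof
      fix e assume "e \<in> incident v"
      then have "(e, tail G e = v) \<in> out v" by (auto simp: out_def org_def incident_def bonds_def)
      then show "e \<in> fst ` out v" by (rule image_eqI[rotated]) simp
    qed
  qed
qed

text \<open>On the open edge, the derivative of u differs by a constant from an antiderivative of w.
  Since w is continuous on the closed edge, the antiderivative exists up to the endpoints and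
  provides the extension.\<close>

lemma edge_deriv_kirchhoff:
  assumes uw: "(u, w) \<in> kirchhoff_laplacian" and b: "b \<in> bonds"
  shows "\<exists>D. edge_deriv u w D b"
proof -
  let ?e = "fst b" and ?l = "blen b"
  have e: "?e \<in> arcs G" and l: "0 < ?l" "len ?e = ?l" using bond_arc[OF b] blen_pos[OF b] by (auto simp: blen_def)
  have u: "\<And>x. x \<in> {0<..<?l} \<Longrightarrow> (edge_fun u ?e has_real_derivative deriv (edge_fun u ?e) x) (at x)"
    and u': "\<And>x. x \<in> {0<..<?l} \<Longrightarrow> (deriv (edge_fun u ?e) has_real_derivative edge_fun w ?e x) (at x)"
    and w: "w \<in> C0"
    using uw e l by (auto simp: kirchhoff_laplacian_def)
  have "continuous_on {0..?l} (edge_fun w ?e)"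
    using w e l unfolding C0_iff edge_fun_def by auto
  then obtain g where g: "\<And>x. x \<in> {0..?l} \<Longrightarrow> (g has_vector_derivative edge_fun w ?e x) (at x within {0..?l})"
    by (rule antiderivative_continuous) blast
  have contg: "continuous_on {0..?l} g"
    using g by (meson continuous_on_eq_continuous_within has_vector_derivative_continuous)
  have dg: "(g has_real_derivative edge_fun w ?e x) (at x)" if "x \<in> {0<..<?l}" for x
    using g[of x] that by (simp add: has_real_derivative_iff_has_vector_derivative at_within_Icc_at)
  have "\<exists>c. \<forall>x\<in>{0<..<?l}. deriv (edge_fun u ?e) x - g x = c"
  proof (rule has_field_derivative_zero_constant)
    fix x assume "x \<in> {0<..<?l}"
    from DERIV_diff[OF u'[OF this] dg[OF this]]
    show "((\<lambda>x. deriv (edge_fun u ?e) x - g x) has_real_derivative 0) (at x within {0<..<?l})"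
      by (auto intro: has_field_derivative_at_within)
  qed simp
  then obtain c where c: "\<And>x. x \<in> {0<..<?l} \<Longrightarrow> deriv (edge_fun u ?e) x = g x + c" by (auto simp: algebra_simps)
  define D where "D x = g x + c" for x
  have contD: "continuous_on {0..?l} D" unfolding D_def[abs_def] by (intro continuous_intros contg)
  have dD: "(D has_real_derivative edge_fun w ?e x) (at x)" if "x \<in> {0<..<?l}" for x
    using DERIV_add[OF dg[OF that] DERIV_const] by (simp add: D_def[abs_def])
  have du: "(edge_fun u ?e has_real_derivative D x) (at x)" if "x \<in> {0<..<?l}" for x
    using u[OF that] c[OF that] by (simp add: D_def)
  show ?thesis
  proof (cases "snd b")
    case True
    have "edge_fun h ?e = (\<lambda>s. h (bpt b s))" for h using True by (simp add: edge_fun_def fun_eq_iff bpt_forward)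
    then show ?thesis using contD dD du unfolding edge_deriv_def by (intro exI[of _ D]) simp
  next
    case False
    have eq: "h (bpt b s) = edge_fun h ?e (?l - s)" for h s
      using False bpt_backward[of b "?l - s"] by (simp add: edge_fun_def)
    have "continuous_on {0..?l} (\<lambda>s. - D (?l - s))"
      by (intro continuous_on_minus continuous_on_compose2[OF contD] continuous_intros) auto
    moreover have "((\<lambda>s. edge_fun u ?e (?l - s)) has_real_derivative - D (?l - s)) (at s)" if "s \<in> {0<..<?l}" for s
      using that by (intro DERIV_reflect du) auto
    moreover have "((\<lambda>s. - D (?l - s)) has_real_derivative edge_fun w ?e (?l - s)) (at s)" if "s \<in> {0<..<?l}" for s
      using DERIV_minus[OF DERIV_reflect[OF dD[of "?l - s"]]] that by auto
    ultimately show ?thesis unfolding edge_deriv_def eq by (intro exI[of _ "\<lambda>s. - D (?l - s)"]) auto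
  qed
qed

lemma kirchhoff_iff:
  "(u, w) \<in> kirchhoff_laplacian \<longleftrightarrow> u \<in> C0 \<and> w \<in> C0 \<and>
     (\<exists>D. (\<forall>b\<in>bonds. edge_deriv u w (D b) b) \<and> (\<forall>v. (\<Sum>b\<in>out v. cond (fst b) * D b 0) = 0))"
proof -
  have sum: "(\<Sum>e\<in>incident v. normal_deriv u e v) = (\<Sum>b\<in>out v. cond (fst b) * D b 0)"
    if "\<forall>b\<in>bonds. edge_deriv u w (D b) b" for v D
  proof -
    have "(\<Sum>e\<in>incident v. normal_deriv u e v) = (\<Sum>b\<in>out v. normal_deriv u (fst b) v)"
      using sum.reindex_bij_betw[OF bij_out_incident, of "\<lambda>e. normal_deriv u e v"] by simp
    also have "\<dots> = (\<Sum>b\<in>out v. cond (fst b) * D b 0)"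
      using that normal_deriv_eq by (intro sum.cong) (auto simp: out_def)
    finally show ?thesis .
  qed
  show ?thesis
  proof
    assume uw: "(u, w) \<in> kirchhoff_laplacian"
    have "\<exists>D. \<forall>b\<in>bonds. edge_deriv u w (D b) b" using edge_deriv_kirchhoff[OF uw] by (intro bchoice) blast
    then obtain D where D: "\<forall>b\<in>bonds. edge_deriv u w (D b) b" by blast
    have "(\<Sum>b\<in>out v. cond (fst b) * D b 0) = 0" for v
    proof (cases "v \<in> verts G")
      case True
      then show ?thesis using uw sum[OF D] by (auto simp: kirchhoff_laplacian_def)
    next
      case False
      then have "out v = {}" using bond_arc by (auto simp: out_def org_def bonds_def)
      then show ?thesis by simp
    qed
    then show "u \<in> C0 \<and> w \<in> C0 \<and>
     (\<exists>D. (\<forall>b\<in>bonds. edge_deriv u w (D b) b) \<and> (\<forall>v. (\<Sum>b\<in>out v. cond (fst b) * D b 0) = 0))"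
      using uw D by (auto simp: kirchhoff_laplacian_def)
  next
    assume "u \<in> C0 \<and> w \<in> C0 \<and>
     (\<exists>D. (\<forall>b\<in>bonds. edge_deriv u w (D b) b) \<and> (\<forall>v. (\<Sum>b\<in>out v. cond (fst b) * D b 0) = 0))"
    then obtain D where C: "u \<in> C0" "w \<in> C0" and D: "\<forall>b\<in>bonds. edge_deriv u w (D b) b"
      and K: "\<And>v. (\<Sum>b\<in>out v. cond (fst b) * D b 0) = 0" by blast
    have "(edge_fun u e has_real_derivative deriv (edge_fun u e) x) (at x)
         \<and> (deriv (edge_fun u e) has_real_derivative edge_fun w e x) (at x)"
      if e: "e \<in> arcs G" and x: "x \<in> {0<..<len e}" for e x
    proof -
      let ?b = "(e, True)"
      have eq: "edge_fun h e = (\<lambda>s. h (bpt ?b s))" for h by (simp add: edge_fun_def fun_eq_iff bpt_forward)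
      have "?b \<in> bonds" using e by (simp add: bonds_def)
      with D have Db: "(edge_fun u e has_real_derivative D ?b s) (at s)"
        "(D ?b has_real_derivative edge_fun w e s) (at s)" if "s \<in> {0<..<len e}" for s
        using that by (auto simp: edge_deriv_def eq blen_def)
      have d: "deriv (edge_fun u e) s = D ?b s" if "s \<in> {0<..<len e}" for s
        by (rule DERIV_imp_deriv[OF Db(1)[OF that]])
      have "(deriv (edge_fun u e) has_real_derivative edge_fun w e x) (at x)"
        by (rule has_field_derivative_transform_within_open[OF Db(2)[OF x], of "{0<..<len e}"]) (use x d in auto)
      then show ?thesis using Db(1)[OF x] d[OF x] by simp
    qed
    then show "(u, w) \<in> kirchhoff_laplacian"
      using C sum[OF D] K by (auto simp: kirchhoff_laplacian_def)
  qed
qed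

lemma C0_linear:
  assumes f: "f \<in> C0" and g: "g \<in> C0"
  shows "(\<lambda>p. a * f p + c * g p) \<in> C0"
  unfolding C0_iff_bonds
proof (intro conjI ballI allI impI)
  fix b assume "b \<in> bonds"
  then show "continuous_on {0..blen b} (\<lambda>s. a * f (bpt b s) + c * g (bpt b s))"
    using C0_edge_continuous f g by (intro continuous_intros) auto
next
  fix \<epsilon> :: real assume \<epsilon>: "0 < \<epsilon>"
  define k where "k = \<bar>a\<bar> + \<bar>c\<bar> + 1"
  have k: "0 < k" by (simp add: k_def add_nonneg_pos)
  let ?F = "\<lambda>h. {b\<in>bonds. \<exists>s\<in>{0..blen b}. \<epsilon> / k \<le> \<bar>h (bpt b s)\<bar>}"
  have "{b\<in>bonds. \<exists>s\<in>{0..blen b}. \<epsilon> \<le> \<bar>a * f (bpt b s) + c * g (bpt b s)\<bar>} \<subseteq> ?F f \<union> ?F g"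
  proof (rule subsetI, rule ccontr)
    fix b assume "b \<in> {b\<in>bonds. \<exists>s\<in>{0..blen b}. \<epsilon> \<le> \<bar>a * f (bpt b s) + c * g (bpt b s)\<bar>}"
    then obtain s where b: "b \<in> bonds" and s: "s \<in> {0..blen b}" "\<epsilon> \<le> \<bar>a * f (bpt b s) + c * g (bpt b s)\<bar>" by blast
    assume "b \<notin> ?F f \<union> ?F g"
    with b s(1) have "\<not> \<epsilon> / k \<le> \<bar>f (bpt b s)\<bar>" "\<not> \<epsilon> / k \<le> \<bar>g (bpt b s)\<bar>" by blast+
    then have "\<bar>a\<bar> * \<bar>f (bpt b s)\<bar> + \<bar>c\<bar> * \<bar>g (bpt b s)\<bar> \<le> \<bar>a\<bar> * (\<epsilon> / k) + \<bar>c\<bar> * (\<epsilon> / k)"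
      by (intro add_mono mult_left_mono) auto
    also have "\<dots> = (\<bar>a\<bar> + \<bar>c\<bar>) * (\<epsilon> / k)" by (rule distrib_right[symmetric])
    also have "\<dots> < k * (\<epsilon> / k)" using \<epsilon> k by (intro mult_strict_right_mono) (auto simp: k_def)
    also have "\<dots> = \<epsilon>" using k by simp
    finally show False using s(2) abs_triangle_ineq[of "a * f (bpt b s)" "c * g (bpt b s)"] by (simp add: abs_mult)
  qed
  moreover have "finite (?F f \<union> ?F g)"
    using C0_finite_large[OF f, of "\<epsilon> / k"] C0_finite_large[OF g, of "\<epsilon> / k"] \<epsilon> k by simp
  ultimately show "finite {b\<in>bonds. \<exists>s\<in>{0..blen b}. \<epsilon> \<le> \<bar>a * f (bpt b s) + c * g (bpt b s)\<bar>}"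
    by (rule finite_subset)
qed (simp add: C0_outside[OF f] C0_outside[OF g])

lemma C0_diff: "f \<in> C0 \<Longrightarrow> g \<in> C0 \<Longrightarrow> (\<lambda>p. f p - g p) \<in> C0"
  using C0_linear[of f g 1 "-1"] by simp

lemma C0_scale: "f \<in> C0 \<Longrightarrow> (\<lambda>p. a * f p) \<in> C0"
  using C0_linear[of f f a 0] by simp

lemma kirchhoff_linear:
  assumes "(u, w) \<in> kirchhoff_laplacian" "(u', w') \<in> kirchhoff_laplacian"
  shows "(\<lambda>p. a * u p + c * u' p, \<lambda>p. a * w p + c * w' p) \<in> kirchhoff_laplacian"
proof -
  obtain D D' where D: "\<And>b. b\<in>bonds \<Longrightarrow> edge_deriv u w (D b) b" "\<And>v. (\<Sum>b\<in>out v. cond (fst b) * D b 0) = 0"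
    and D': "\<And>b. b\<in>bonds \<Longrightarrow> edge_deriv u' w' (D' b) b" "\<And>v. (\<Sum>b\<in>out v. cond (fst b) * D' b 0) = 0"
    using assms unfolding kirchhoff_iff by blast
  let ?D = "\<lambda>b s. a * D b s + c * D' b s"
  have "edge_deriv (\<lambda>p. a * u p + c * u' p) (\<lambda>p. a * w p + c * w' p) (?D b) b" if "b \<in> bonds" for b
    using D(1)[OF that] D'(1)[OF that] unfolding edge_deriv_def
    by (auto intro!: continuous_intros DERIV_add DERIV_cmult)
  moreover have "(\<Sum>b\<in>out v. cond (fst b) * ?D b 0) = 0" for v
  proof -
    have "(\<Sum>b\<in>out v. cond (fst b) * ?D b 0) = a * (\<Sum>b\<in>out v. cond (fst b) * D b 0) + c * (\<Sum>b\<in>out v. cond (fst b) * D' b 0)"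
      by (simp add: sum_distrib_left distrib_left sum.distrib mult_ac)
    then show ?thesis using D(2) D'(2) by simp
  qed
  ultimately show ?thesis
    using assms C0_linear unfolding kirchhoff_iff by (intro conjI exI[of _ ?D]) auto
qed

subsection \<open>The resolvent\<close>

definition resolv :: "real \<Rightarrow> (('v, 'e) point \<Rightarrow> real) \<Rightarrow> ('v, 'e) point \<Rightarrow> real" where
  "resolv m = conv_op (lapl m)"

lemma resolv_unfold_DERIV:
  assumes m: "rate + 1 < m" and f: "f \<in> C0" and b: "b \<in> bonds"
  obtains \<psi>' where "\<And>x. (unfold (resolv m f) b has_real_derivative \<psi>' x) (at x)"
    "\<And>x. (\<psi>' has_real_derivative m\<^sup>2 * (unfold (resolv m f) b x - unfold f b x)) (at x)"
proof -
  have eq: "unfold (resolv m f) b = convol (lapl m) (unfold f b)"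
    unfolding resolv_def by (rule ext) (rule unfold_conv_op[OF sym_kernel_lapl[OF rate_nonneg m] f b])
  show ?thesis
  proof (rule convol_lapl_DERIV[OF rate_nonneg m C0_exp_bounded[OF f b] isCont_unfold[OF f b]])
    fix \<psi>'
    assume "\<And>x. (convol (lapl m) (unfold f b) has_real_derivative \<psi>' x) (at x)"
      "\<And>x. (\<psi>' has_real_derivative m\<^sup>2 * (convol (lapl m) (unfold f b) x - unfold f b x)) (at x)"
    then show thesis unfolding eq[symmetric] by (rule that)
  qed
qed

lemma resolv_C0: "rate + 1 < m \<Longrightarrow> f \<in> C0 \<Longrightarrow> resolv m f \<in> C0"
  unfolding resolv_def by (rule conv_op_C0[OF sym_kernel_lapl[OF rate_nonneg]])

text \<open>The differential equation is inherited from the line. The Kirchhoff condition results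
  from differentiating \<open>compatible_even\<close> at 0: the left side is even in s, so its
  derivative vanishes, while the right side gives twice the weighted mean of the outgoing
  derivatives.\<close>

lemma resolv_kirchhoff:
  assumes m: "rate + 1 < m" and f: "f \<in> C0"
  shows "(resolv m f, \<lambda>p. m\<^sup>2 * (resolv m f p - f p)) \<in> kirchhoff_laplacian"
proof -
  let ?u = "resolv m f"
  have u: "?u \<in> C0" by (rule resolv_C0[OF m f])
  have "\<exists>D. \<forall>b\<in>bonds. (\<forall>x. (unfold ?u b has_real_derivative D b x) (at x))
     \<and> (\<forall>x. (D b has_real_derivative m\<^sup>2 * (unfold ?u b x - unfold f b x)) (at x))"
  proof (intro bchoice ballI)
    fix b assume "b \<in> bonds"
    from resolv_unfold_DERIV[OF m f this] obtain \<psi>' where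
      "\<And>x. (unfold ?u b has_real_derivative \<psi>' x) (at x)"
      "\<And>x. (\<psi>' has_real_derivative m\<^sup>2 * (unfold ?u b x - unfold f b x)) (at x)" by blast
    then show "\<exists>y. (\<forall>x. (unfold ?u b has_real_derivative y x) (at x))
     \<and> (\<forall>x. (y has_real_derivative m\<^sup>2 * (unfold ?u b x - unfold f b x)) (at x))" by blast
  qed
  then obtain D where D: "\<And>b x. b\<in>bonds \<Longrightarrow> (unfold ?u b has_real_derivative D b x) (at x)"
    "\<And>b x. b \<in> bonds \<Longrightarrow> (D b has_real_derivative m\<^sup>2 * (unfold ?u b x - unfold f b x)) (at x)" by blast
  have "edge_deriv ?u (\<lambda>p. m\<^sup>2 * (?u p - f p)) (D b) b" if b: "b \<in> bonds" for b
    unfolding edge_deriv_def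
  proof (intro conjI ballI)
    show "continuous_on {0..blen b} (D b)"
      using D(2)[OF b] DERIV_isCont by (blast intro: continuous_at_imp_continuous_on)
    fix s assume s: "s \<in> {0<..<blen b}"
    show "((\<lambda>s. ?u (bpt b s)) has_real_derivative D b s) (at s)"
      by (rule has_field_derivative_transform_within_open[OF D(1)[OF b], of "{0<..<blen b}"])
        (use s b in \<open>auto simp: unfold_on_edge\<close>)
    show "(D b has_real_derivative m\<^sup>2 * (?u (bpt b s) - f (bpt b s))) (at s)"
      using D(2)[OF b, of s] s b by (simp add: unfold_on_edge)
  qed
  moreover have "(\<Sum>b\<in>out v. cond (fst b) * D b 0) = 0" for v
  proof (cases "out v = {}")
    case False
    then obtain b where b: "b \<in> bonds" "v = org b" by (auto simp: out_def)
    have "((\<lambda>s. unfold ?u b s + unfold ?u b (- s)) has_real_derivative D b 0 + - D b 0) (at 0)"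
      using D(1)[OF b(1), of 0] DERIV_reflect[of "unfold ?u b" "D b 0" 0 0] by (intro DERIV_add) auto
    then have "((\<lambda>s. 2 * avg v (\<lambda>b'. unfold ?u b' s)) has_real_derivative 0) (at 0)"
      using b by (simp add: compatible_even[OF compatible_unfold])
    moreover have "((\<lambda>s. 2 * avg v (\<lambda>b'. unfold ?u b' s)) has_real_derivative 2 * avg v (\<lambda>b'. D b' 0)) (at 0)"
      unfolding avg_def by (intro DERIV_cmult DERIV_cdivide DERIV_sum D(1) out_bonds)
    ultimately have "2 * avg v (\<lambda>b'. D b' 0) = 0" by (metis DERIV_unique)
    then show ?thesis using cond_sum_pos[OF False] by (simp add: avg_def)
  qed simp
  ultimately show ?thesis
    unfolding kirchhoff_iff using u C0_scale[OF C0_diff[OF u f], of "m\<^sup>2"] by blast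
qed

subsection \<open>The minimum principle\<close>

text \<open>A negative value reduces the minimum over the whole graph to finitely many compact
  edges; elsewhere f is closer to 0 than f p.\<close>

lemma C0_attains_min:
  assumes f: "f \<in> C0" and p: "f p < 0"
  obtains q where "q \<in> points" "\<And>p'. f q \<le> f p'" "f q \<le> f p"
proof -
  let ?F = "{b\<in>bonds. \<exists>s\<in>{0..blen b}. - f p \<le> \<bar>f (bpt b s)\<bar>}"
  have fin: "finite ?F" by (rule C0_finite_large[OF f]) (use p in simp)
  have "p \<in> points" using p C0_outside[OF f] by force
  note bp = bond_pos[OF this]
  have F: "bond p \<in> ?F" using bp p by force
  have "\<exists>m. \<forall>b\<in>?F. m b \<in> {0..blen b} \<and> (\<forall>s\<in>{0..blen b}. f (bpt b (m b)) \<le> f (bpt b s))"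
  proof (intro bchoice ballI)
    fix b assume "b \<in> ?F"
    then have b: "b \<in> bonds" by blast
    show "\<exists>m. m \<in> {0..blen b} \<and> (\<forall>s\<in>{0..blen b}. f (bpt b m) \<le> f (bpt b s))"
      using continuous_attains_inf[OF compact_Icc _ C0_edge_continuous[OF f b]] blen_pos[OF b] by fastforce
  qed
  then obtain m where m: "\<And>b. b \<in> ?F \<Longrightarrow> m b \<in> {0..blen b}"
    "\<And>b s. b \<in> ?F \<Longrightarrow> s\<in>{0..blen b} \<Longrightarrow> f (bpt b (m b)) \<le> f (bpt b s)" by blast
  define b0 where "b0 = arg_min_on (\<lambda>b. f (bpt b (m b))) ?F"
  have "?F \<noteq> {}" using F by (metis empty_iff)
  note am = arg_min_if_finite[OF fin this, of "\<lambda>b. f (bpt b (m b))", folded b0_def]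
  have b0: "b0 \<in> ?F" by (rule am(1))
  have b0_le: "f (bpt b0 (m b0)) \<le> f (bpt b (m b))" if "b \<in> ?F" for b
  proof (rule ccontr)
    assume "\<not> ?thesis"
    then have "\<exists>b\<in>?F. f (bpt b (m b)) < f (bpt b0 (m b0))" by (intro bexI[OF _ that]) simp
    with am(2) show False by contradiction
  qed
  let ?q = "bpt b0 (m b0)"
  have min: "f ?q \<le> f (bpt b s)" if "b \<in> ?F" "s \<in> {0..blen b}" for b s
    using b0_le[OF that(1)] m(2)[OF that] by linarith
  have "f ?q \<le> f p" using min[OF F, of "pos p"] bp by simp
  have "f ?q \<le> f p'" for p'
  proof (cases "p' \<in> points")
    case True
    note bp' = bond_pos[OF this]
    show ?thesis
    proof (cases "bond p' \<in> ?F")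
      case True
      then show ?thesis using min[OF True, of "pos p'"] bp' by simp
    next
      case False
      then have "\<not> - f p \<le> \<bar>f p'\<bar>" using bp' by force
      then show ?thesis using \<open>f ?q \<le> f p\<close> by linarith
    qed
  next
    case False
    then show ?thesis using \<open>f ?q \<le> f p\<close> p C0_outside[OF f] by simp
  qed
  moreover have "?q \<in> points" using b0 m(1)[OF b0] bpt_points by auto
  ultimately show ?thesis using that \<open>f ?q \<le> f p\<close> by blast
qed

text \<open>Strictness leaves room ahead of the point on its representing edge, which
  \<open>kirchhoff_min\<close> exploits.\<close>

lemma pos_less:
  assumes "p \<in> points" shows "pos p < blen (bond p)"
  using assms
proof (cases rule: points_cases)
  case (vertex e x)
  then have "pos p = 0" by (auto simp: pos_def)
  then show ?thesis using blen_pos[OF bond_pos(1)[OF assms]] by simp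
qed (auto simp: pos_def bond_def blen_def)

text \<open>The outgoing derivative at a minimum is 0. At a vertex this holds because no outgoing
  derivative is negative there, while their sum with positive weights vanishes. If w q were
  negative, the derivative would then be negative ahead of q, and u would fall below its
  minimum.\<close>

lemma kirchhoff_min:
  assumes uw: "(u, w) \<in> kirchhoff_laplacian" and q: "q \<in> points" and min: "\<And>p. u q \<le> u p"
  shows "0 \<le> w q"
proof (rule ccontr)
  assume neg: "\<not> 0 \<le> w q"
  obtain D where D: "\<And>b. b\<in>bonds \<Longrightarrow> edge_deriv u w (D b) b" and K: "\<And>v. (\<Sum>b\<in>out v. cond (fst b) * D b 0) = 0"
    and C: "u \<in> C0" "w \<in> C0"
    using uw unfolding kirchhoff_iff by blast
  define b s where "b = bond q" and "s = pos q"
  have b: "b \<in> bonds" and s: "0 \<le> s" "s < blen b" and bs: "bpt b s = q"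
    using bond_pos[OF q] pos_less[OF q] by (auto simp: b_def s_def)
  have decr: "h y < h x" if "continuous_on {0..blen b} h" "0 \<le> x" "x < y" "y \<le> blen b"
      "\<And>z. x < z \<Longrightarrow> z < y \<Longrightarrow> (h has_real_derivative h' z) (at z) \<and> h' z < 0" for b h h' x y
    using that by (intro DERIV_neg_imp_decreasing_open[of x y h]) (auto intro: continuous_on_subset)
  have near: "\<exists>y. x < y \<and> y < blen b \<and> (\<forall>z. x \<le> z \<and> z < y \<longrightarrow> h z < 0)"
    if h: "continuous_on {0..blen b} h" and x: "0 \<le> x" "x < blen b" and hx: "h x < 0" for b x and h :: "real \<Rightarrow> real"
  proof -
    have "x \<in> {0..blen b}" "0 < - h x" using x hx by auto
    from h[unfolded continuous_on_iff, rule_format, OF this]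
    obtain d where d: "d > 0" "\<And>z. z \<in> {0..blen b} \<Longrightarrow> dist z x < d \<Longrightarrow> dist (h z) (h x) < - h x" by auto
    define y where "y = min (x + d) ((x + blen b) / 2)"
    have y: "x < y" "y < blen b" "y \<le> x + d" using d(1) x by (auto simp: y_def min_def)
    have "h z < 0" if "x \<le> z \<and> z < y" for z
      using d(2)[of z] that x y by (auto simp: dist_real_def)
    then show ?thesis using y by blast
  qed
  have D0: "D b s = 0"
  proof (cases "s = 0")
    case False
    have "((\<lambda>s. u (bpt b s)) has_real_derivative D b s) (at s)"
      using D[OF b] s False by (simp add: edge_deriv_def)
    moreover have "\<forall>y. \<bar>s - y\<bar> < 1 \<longrightarrow> u (bpt b s) \<le> u (bpt b y)" using min bs by simp
    ultimately show ?thesis by (rule DERIV_local_min[OF _ zero_less_one])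
  next
    case True
    have nonneg: "0 \<le> D b' 0" if b': "b' \<in> out (org b)" for b'
    proof (rule ccontr)
      assume "\<not> 0 \<le> D b' 0"
      have bb: "b' \<in> bonds" "bpt b' 0 = q" using b' bs True b by (auto simp: out_def bpt_0)
      obtain y where y: "0 < y" "y < blen b'" "\<And>z. 0 \<le> z \<and> z < y \<Longrightarrow> D b' z < 0"
        using near[of b' "D b'" 0] D[OF bb(1)] blen_pos[OF bb(1)] \<open>\<not> 0 \<le> D b' 0\<close> by (auto simp: edge_deriv_def)
      have "u (bpt b' y) < u (bpt b' 0)"
        using y D[OF bb(1)]
        by (intro decr[OF C0_edge_continuous[OF C(1) bb(1)], of 0 y "D b'"]) (auto simp: edge_deriv_def)
      then show False using min[of "bpt b' y"] bb(2) by simp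
    qed
    have "\<And>b'. b' \<in> out (org b) \<Longrightarrow> 0 \<le> cond (fst b') * D b' 0"
      by (intro mult_nonneg_nonneg nonneg less_imp_le[OF cond_out])
    from sum_nonneg_eq_0_iff[OF finite_out this] K[of "org b"]
    have "\<forall>b'\<in>out (org b). cond (fst b') * D b' 0 = 0" by simp
    then have "cond (fst b) * D b 0 = 0" using in_out[OF b] by blast
    then show ?thesis using True cond_out[OF in_out[OF b]] by simp
  qed
  obtain y where y: "s < y" "y < blen b" "\<And>z. s \<le> z \<and> z < y \<Longrightarrow> w (bpt b z) < 0"
    using near[OF C0_edge_continuous[OF C(2) b], of s] s bs neg by auto
  have Dneg: "D b z < 0" if "s < z" "z \<le> y" for z
  proof -
    have "D b z < D b s"
      using that y s D[OF b] by (intro decr[of b "D b" s z "\<lambda>z. w (bpt b z)"]) (auto simp: edge_deriv_def)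
    then show ?thesis using D0 by simp
  qed
  have "u (bpt b y) < u (bpt b s)"
    using y s D[OF b] Dneg
    by (intro decr[OF C0_edge_continuous[OF C(1) b], of s y "D b"]) (auto simp: edge_deriv_def)
  then show False using min[of "bpt b y"] bs by simp
qed

text \<open>At a minimum w is nonnegative, so u is at least u - h w there. The condition 0 \<le> B
  takes care of infinity: a value below -B is negative, and then the minimum is attained.\<close>

lemma kirchhoff_dissipative:
  assumes uw: "(u, w) \<in> kirchhoff_laplacian" and h: "0 < h" and B: "0 \<le> B"
    and ge: "\<And>p. - B \<le> u p - h * w p"
  shows "- B \<le> u p"
proof (rule ccontr)
  assume "\<not> - B \<le> u p"
  moreover have "u \<in> C0" using uw by (simp add: kirchhoff_iff)
  ultimately obtain q where q: "q \<in> points" "\<And>p'. u q \<le> u p'" "u q \<le> u p"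
    using C0_attains_min[of u p] B by auto
  have "0 \<le> h * w q" using kirchhoff_min[OF uw q(1,2)] h by simp
  then show False using ge[of q] q(3) \<open>\<not> - B \<le> u p\<close> by linarith
qed

text \<open>The difference of u and the resolvent solves a homogeneous equation, and dissipativity
  for both signs makes it vanish. Hence every element of the domain is a Laplace convolution, which
  is later used to transport regularity across the vertices.\<close>

lemma resolv_unique:
  assumes m: "rate + 1 < m" and uw: "(u, w) \<in> kirchhoff_laplacian"
  shows "u = resolv m (\<lambda>p. u p - w p / m\<^sup>2)"
proof -
  have m0: "0 < m" using m rate_nonneg by simp
  have C: "u \<in> C0" "w \<in> C0" using uw by (auto simp: kirchhoff_iff)
  let ?f = "\<lambda>p. u p - w p / m\<^sup>2"
  have f: "?f \<in> C0" using C0_linear[OF C, of 1 "- 1 / m\<^sup>2"] by simp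
  let ?v = "resolv m ?f"
  note v = resolv_kirchhoff[OF m f]
  have "- 0 \<le> c * u p + - c * ?v p" for c p
  proof (rule kirchhoff_dissipative[OF kirchhoff_linear[OF uw v]])
    show "0 < 1 / m\<^sup>2" using m0 by simp
    show "- 0 \<le> c * u p + - c * ?v p - 1 / m\<^sup>2 * (c * w p + - c * (m\<^sup>2 * (?v p - ?f p)))" for p
      using m0 by (simp add: field_simps)
  qed simp
  from this[of 1] this[of "-1"] show ?thesis by (auto simp: fun_eq_iff intro: antisym)
qed

end

subsection \<open>Strongly continuous semigroups on the graph\<close>

context metric_graph
begin

text \<open>\<open>sup_norm\<close> is a real supremum and controls the values only of bounded
  functions; membership in \<open>C0\<close> guarantees boundedness.\<close>

lemma sup_norm_tendsto_0_iff:
  fixes F :: "real \<Rightarrow> ('v, 'e) point \<Rightarrow> real"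
  assumes F: "\<And>h. 0 < h \<Longrightarrow> F h \<in> C0"
  shows "((\<lambda>h. sup_norm (F h)) \<longlongrightarrow> 0) (at_right 0)
     \<longleftrightarrow> (\<forall>\<epsilon>>0. \<exists>d>0. \<forall>h. 0 < h \<and> h < d \<longrightarrow> (\<forall>p. \<bar>F h p\<bar> \<le> \<epsilon>))" (is "?L \<longleftrightarrow> ?R")
proof
  assume L: ?L
  show ?R
  proof (intro allI impI)
    fix \<epsilon> :: real assume \<epsilon>: "0 < \<epsilon>"
    obtain d where d: "0 < d" "\<And>h. 0 < h \<Longrightarrow> h < d \<Longrightarrow> \<bar>sup_norm (F h)\<bar> < \<epsilon>"
      using tendstoD[OF L \<epsilon>] unfolding eventually_at_right_field by auto
    have "\<bar>F h p\<bar> \<le> \<epsilon>" if "0 < h" "h < d" for h p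
      using sup_norm_ge[OF F[OF that(1)], of p] d(2)[OF that] by linarith
    then show "\<exists>d>0. \<forall>h. 0 < h \<and> h < d \<longrightarrow> (\<forall>p. \<bar>F h p\<bar> \<le> \<epsilon>)" using d(1) by blast
  qed
next
  assume R: ?R
  show ?L
  proof (rule tendstoI)
    fix \<epsilon> :: real assume \<epsilon>: "0 < \<epsilon>"
    then have "0 < \<epsilon> / 2" by simp
    with R have "\<exists>d>0. \<forall>h. 0 < h \<and> h < d \<longrightarrow> (\<forall>p. \<bar>F h p\<bar> \<le> \<epsilon> / 2)" by presburger
    then obtain d where d: "0 < d" "\<And>h p. 0 < h \<Longrightarrow> h < d \<Longrightarrow> \<bar>F h p\<bar> \<le> \<epsilon> / 2" by blast
    have "\<bar>sup_norm (F h)\<bar> < \<epsilon>" if "0 < h" "h < d" for h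
    proof -
      have "sup_norm (F h) \<le> \<epsilon> / 2" by (rule sup_norm_le) (rule d(2)[OF that])
      moreover have "0 \<le> sup_norm (F h)" using sup_norm_ge[OF F[OF that(1)]] abs_ge_zero order_trans by blast
      ultimately show ?thesis using \<epsilon> by linarith
    qed
    then show "\<forall>\<^sub>F h in at_right 0. dist (sup_norm (F h)) 0 < \<epsilon>"
      using d(1) unfolding eventually_at_right_field by auto
  qed
qed

lemma sup_norm_nonneg: "f \<in> C0 \<Longrightarrow> 0 \<le> sup_norm f"
  using sup_norm_ge[of f] abs_ge_zero order_trans by blast

context
  fixes T
  assumes T: "C0_semigroup T"
begin

lemma semigroup_C0: "0 \<le> t \<Longrightarrow> f \<in> C0 \<Longrightarrow> T t f \<in> C0"
  using T by (simp add: C0_semigroup_def bounded_operator_def)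

lemma semigroup_linear:
  "0 \<le> t \<Longrightarrow> f \<in> C0 \<Longrightarrow> g \<in> C0 \<Longrightarrow> T t (\<lambda>p. a * f p + c * g p) = (\<lambda>p. a * T t f p + c * T t g p)"
  using T by (simp add: C0_semigroup_def bounded_operator_def)

lemma semigroup_diff:
  "0 \<le> t \<Longrightarrow> f \<in> C0 \<Longrightarrow> g \<in> C0 \<Longrightarrow> T t (\<lambda>p. f p - g p) = (\<lambda>p. T t f p - T t g p)"
  using semigroup_linear[of t f g 1 "-1"] by simp

lemma semigroup_scale:
  "0 \<le> t \<Longrightarrow> f \<in> C0 \<Longrightarrow> T t (\<lambda>p. a * f p) = (\<lambda>p. a * T t f p)"
  using semigroup_linear[of t f f a 0] by simp

lemma semigroup_add: "0 \<le> s \<Longrightarrow> 0 \<le> t \<Longrightarrow> f \<in> C0 \<Longrightarrow> T (s + t) f = T s (T t f)"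
  using T by (simp add: C0_semigroup_def)

lemma semigroup_0: "f \<in> C0 \<Longrightarrow> T 0 f = f"
  using T by (simp add: C0_semigroup_def)

lemma semigroup_bound:
  assumes "0 \<le> t"
  obtains M where "0 \<le> M" "\<And>f B p. f \<in> C0 \<Longrightarrow> (\<And>p. \<bar>f p\<bar> \<le> B) \<Longrightarrow> \<bar>T t f p\<bar> \<le> M * B"
proof -
  obtain M where M: "\<And>f. f \<in> C0 \<Longrightarrow> sup_norm (T t f) \<le> M * sup_norm f"
    using T assms unfolding C0_semigroup_def bounded_operator_def by meson
  have "\<bar>T t f p\<bar> \<le> \<bar>M\<bar> * B" if f: "f \<in> C0" and B: "\<And>p. \<bar>f p\<bar> \<le> B" for f B p
  proof -
    have "\<bar>T t f p\<bar> \<le> M * sup_norm f" using sup_norm_ge[OF semigroup_C0[OF assms f]] M[OF f] order_trans by blast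
    also have "\<dots> \<le> \<bar>M\<bar> * sup_norm f" using sup_norm_nonneg[OF f] by (intro mult_right_mono) auto
    also have "\<dots> \<le> \<bar>M\<bar> * B" using sup_norm_le[OF B] by (intro mult_left_mono) auto
    finally show ?thesis .
  qed
  then show ?thesis using that[of "\<bar>M\<bar>"] by simp
qed

lemma semigroup_strong:
  assumes f: "f \<in> C0" and \<epsilon>: "0 < \<epsilon>"
  obtains d where "0 < d" "\<And>h p. 0 \<le> h \<Longrightarrow> h < d \<Longrightarrow> \<bar>T h f p - f p\<bar> \<le> \<epsilon>"
proof -
  have "((\<lambda>h. sup_norm (\<lambda>p. T h f p - f p)) \<longlongrightarrow> 0) (at_right 0)"
    using T f by (simp add: C0_semigroup_def)
  moreover have "(\<lambda>p. T h f p - f p) \<in> C0" if "0 < h" for h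
    using that by (intro C0_diff semigroup_C0 f) simp
  ultimately have "\<exists>d>0. \<forall>h. 0 < h \<and> h < d \<longrightarrow> (\<forall>p. \<bar>T h f p - f p\<bar> \<le> \<epsilon>)"
    using sup_norm_tendsto_0_iff[of "\<lambda>h p. T h f p - f p"] \<epsilon> by simp
  then obtain d where d: "0 < d" "\<And>h p. 0 < h \<Longrightarrow> h < d \<Longrightarrow> \<bar>T h f p - f p\<bar> \<le> \<epsilon>" by blast
  have "\<bar>T h f p - f p\<bar> \<le> \<epsilon>" if "0 \<le> h" "h < d" for h p
    using d(2)[of h p] that semigroup_0[OF f] \<epsilon> by (cases "h = 0") auto
  then show ?thesis using that d(1) by blast
qed

lemma generator_iff:
  "(f, g) \<in> generator T \<longleftrightarrow> f \<in> C0 \<and> g \<in> C0 \<and>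
     (\<forall>\<epsilon>>0. \<exists>d>0. \<forall>h. 0 < h \<and> h < d \<longrightarrow> (\<forall>p. \<bar>(T h f p - f p) / h - g p\<bar> \<le> \<epsilon>))"
proof (cases "f \<in> C0 \<and> g \<in> C0")
  case True
  have "(\<lambda>p. (T h f p - f p) / h - g p) \<in> C0" if "0 < h" for h
    using C0_diff[OF C0_scale[OF C0_diff[OF semigroup_C0[of h f]], of f "1 / h"], of g] True that by simp
  from sup_norm_tendsto_0_iff[of "\<lambda>h p. (T h f p - f p) / h - g p", OF this]
  show ?thesis using True by (simp add: generator_def)
qed (auto simp: generator_def)

lemma generatorE:
  assumes "(f, g) \<in> generator T" "0 < \<epsilon>"
  obtains d where "0 < d" "\<And>h p. 0 < h \<Longrightarrow> h < d \<Longrightarrow> \<bar>(T h f p - f p) / h - g p\<bar> \<le> \<epsilon>"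
proof -
  from assms(1) have "\<forall>\<epsilon>>0. \<exists>d>0. \<forall>h. 0 < h \<and> h < d \<longrightarrow> (\<forall>p. \<bar>(T h f p - f p) / h - g p\<bar> \<le> \<epsilon>)"
    unfolding generator_iff by (elim conjE)
  from this[rule_format, OF assms(2)] show ?thesis using that by blast
qed

lemma generator_linear:
  assumes fg: "(f, g) \<in> generator T" "(f', g') \<in> generator T"
  shows "(\<lambda>p. a * f p + c * f' p, \<lambda>p. a * g p + c * g' p) \<in> generator T"
  unfolding generator_iff
proof (intro conjI allI impI)
  have C: "f \<in> C0" "g \<in> C0" "f' \<in> C0" "g' \<in> C0" using fg by (auto simp: generator_iff)
  show "(\<lambda>p. a * f p + c * f' p) \<in> C0" "(\<lambda>p. a * g p + c * g' p) \<in> C0" using C0_linear C by auto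
  fix \<epsilon> :: real assume \<epsilon>: "0 < \<epsilon>"
  define k where "k = \<bar>a\<bar> + \<bar>c\<bar> + 1"
  have k: "0 < \<epsilon> / k" using \<epsilon> by (simp add: k_def add_nonneg_pos)
  obtain d where d: "0 < d" "\<And>h p. 0 < h \<Longrightarrow> h < d \<Longrightarrow> \<bar>(T h f p - f p) / h - g p\<bar> \<le> \<epsilon> / k"
    by (rule generatorE[OF fg(1) k]) blast
  obtain d' where d': "0 < d'" "\<And>h p. 0 < h \<Longrightarrow> h < d' \<Longrightarrow> \<bar>(T h f' p - f' p) / h - g' p\<bar> \<le> \<epsilon> / k"
    by (rule generatorE[OF fg(2) k]) blast
  have "\<bar>(T h (\<lambda>p. a * f p + c * f' p) p - (a * f p + c * f' p)) / h - (a * g p + c * g' p)\<bar> \<le> \<epsilon>"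
    if h: "0 < h" "h < min d d'" for h p
  proof -
    have eq: "(T h (\<lambda>p. a * f p + c * f' p) p - (a * f p + c * f' p)) / h - (a * g p + c * g' p)
      = a * ((T h f p - f p) / h - g p) + c * ((T h f' p - f' p) / h - g' p)"
      using h C by (simp add: semigroup_linear field_simps)
    have "\<bar>a * ((T h f p - f p) / h - g p)\<bar> \<le> \<bar>a\<bar> * (\<epsilon> / k)"
      unfolding abs_mult by (intro mult_left_mono d) (use h in auto)
    moreover have "\<bar>c * ((T h f' p - f' p) / h - g' p)\<bar> \<le> \<bar>c\<bar> * (\<epsilon> / k)"
      unfolding abs_mult by (intro mult_left_mono d') (use h in auto)
    moreover have "\<bar>a\<bar> * (\<epsilon> / k) + \<bar>c\<bar> * (\<epsilon> / k) \<le> k * (\<epsilon> / k)"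
      unfolding distrib_right[symmetric] using k by (intro mult_right_mono) (auto simp: k_def)
    moreover have "k * (\<epsilon> / k) = \<epsilon>" using k by auto
    ultimately show ?thesis unfolding eq by linarith
  qed
  then show "\<exists>d>0. \<forall>h. 0 < h \<and> h < d \<longrightarrow> (\<forall>p. \<bar>(T h (\<lambda>p. a * f p + c * f' p) p
      - (a * f p + c * f' p)) / h - (a * g p + c * g' p)\<bar> \<le> \<epsilon>)"
    using d(1) d'(1) by (intro exI[of _ "min d d'"]) auto
qed

lemma generator_invariant:
  assumes fg: "(f, g) \<in> generator T" and t: "0 \<le> t"
  shows "(T t f, T t g) \<in> generator T"
  unfolding generator_iff
proof (intro conjI allI impI)
  have C: "f \<in> C0" "g \<in> C0" using fg by (auto simp: generator_iff)
  show "T t f \<in> C0" "T t g \<in> C0" using C t semigroup_C0 by auto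
  obtain M where M: "0 \<le> M" "\<And>f B p. f \<in> C0 \<Longrightarrow> (\<And>p. \<bar>f p\<bar> \<le> B) \<Longrightarrow> \<bar>T t f p\<bar> \<le> M * B"
    by (rule semigroup_bound[OF t]) blast
  fix \<epsilon> :: real assume \<epsilon>: "0 < \<epsilon>"
  have \<epsilon>M: "0 < \<epsilon> / (M + 1)" using \<epsilon> M(1) by simp
  obtain d where d: "0 < d" "\<And>h p. 0 < h \<Longrightarrow> h < d \<Longrightarrow> \<bar>(T h f p - f p) / h - g p\<bar> \<le> \<epsilon> / (M + 1)"
    by (rule generatorE[OF fg \<epsilon>M]) blast
  have "\<bar>(T h (T t f) p - T t f p) / h - T t g p\<bar> \<le> \<epsilon>" if h: "0 < h" "h < d" for h p
  proof -
    have hf: "T h f \<in> C0" using h C semigroup_C0 by simp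
    have q: "(\<lambda>p. (1 / h) * (T h f p - f p)) \<in> C0" by (intro C0_scale C0_diff hf C)
    have "T h (T t f) = T t (T h f)"
      using semigroup_add[of h t f] semigroup_add[of t h f] h t C by (simp add: add.commute)
    then have "(T h (T t f) p - T t f p) / h - T t g p = T t (\<lambda>p. (1 / h) * (T h f p - f p) - g p) p"
      using semigroup_diff[OF t q C(2)] semigroup_scale[OF t C0_diff[OF hf C(1)], of "1 / h"]
        semigroup_diff[OF t hf C(1)] by simp
    also have "\<bar>\<dots>\<bar> \<le> M * (\<epsilon> / (M + 1))"
      using d(2)[OF h] by (intro M(2) C0_diff q C) simp
    also have "\<dots> \<le> (M + 1) * (\<epsilon> / (M + 1))" using \<epsilon> M(1) by (intro mult_right_mono) auto
    also have "\<dots> = \<epsilon>" using M(1) by simp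
    finally show ?thesis .
  qed
  then show "\<exists>d>0. \<forall>h. 0 < h \<and> h < d \<longrightarrow> (\<forall>p. \<bar>(T h (T t f) p - T t f p) / h - T t g p\<bar> \<le> \<epsilon>)"
    using d(1) by blast
qed

end

section \<open>Uniform bounds, continuity and left derivatives of orbits\<close>

lemma C0_uniform_limit:
  assumes f: "\<And>\<epsilon>. 0 < \<epsilon> \<Longrightarrow> \<exists>g\<in>C0. \<forall>p. \<bar>f p - g p\<bar> \<le> \<epsilon>"
  shows "f \<in> C0"
  unfolding C0_iff_bonds
proof (intro conjI ballI allI impI)
  fix b assume b: "b \<in> bonds"
  show "continuous_on {0..blen b} (\<lambda>s. f (bpt b s))"
    unfolding continuous_on_iff
  proof (intro ballI allI impI)
    fix x and \<epsilon> :: real assume x: "x \<in> {0..blen b}" and \<epsilon>: "0 < \<epsilon>"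
    obtain g where g: "g \<in> C0" "\<And>p. \<bar>f p - g p\<bar> \<le> \<epsilon> / 4" using f[of "\<epsilon> / 4"] \<epsilon> by auto
    have "0 < \<epsilon> / 4" using \<epsilon> by simp
    from C0_edge_continuous[OF g(1) b, unfolded continuous_on_iff, rule_format, OF x this]
    obtain d where d: "0 < d" "\<And>y. y \<in> {0..blen b} \<Longrightarrow> dist y x < d \<Longrightarrow> dist (g (bpt b y)) (g (bpt b x)) < \<epsilon> / 4" by blast
    have "dist (f (bpt b y)) (f (bpt b x)) < \<epsilon>" if "y \<in> {0..blen b}" "dist y x < d" for y
      using d(2)[OF that] g(2)[of "bpt b y"] g(2)[of "bpt b x"] unfolding dist_real_def by linarith
    then show "\<exists>d>0. \<forall>y\<in>{0..blen b}. dist y x < d \<longrightarrow> dist (f (bpt b y)) (f (bpt b x)) < \<epsilon>"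
      using d(1) by blast
  qed
next
  fix \<epsilon> :: real assume \<epsilon>: "0 < \<epsilon>"
  obtain g where g: "g \<in> C0" "\<And>p. \<bar>f p - g p\<bar> \<le> \<epsilon> / 2" using f[of "\<epsilon> / 2"] \<epsilon> by auto
  have "\<epsilon> / 2 \<le> \<bar>g p\<bar>" if "\<epsilon> \<le> \<bar>f p\<bar>" for p using g(2)[of p] that by linarith
  then have "{b\<in>bonds. \<exists>s\<in>{0..blen b}. \<epsilon> \<le> \<bar>f (bpt b s)\<bar>} \<subseteq> {b\<in>bonds. \<exists>s\<in>{0..blen b}. \<epsilon> / 2 \<le> \<bar>g (bpt b s)\<bar>}"
    by blast
  then show "finite {b\<in>bonds. \<exists>s\<in>{0..blen b}. \<epsilon> \<le> \<bar>f (bpt b s)\<bar>}"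
    by (rule finite_subset) (rule C0_finite_large[OF g(1)], use \<epsilon> in simp)
next
  fix p assume p: "p \<notin> points"
  show "f p = 0"
  proof (rule ccontr)
    assume "f p \<noteq> 0"
    then obtain g where "g \<in> C0" "\<bar>f p - g p\<bar> \<le> \<bar>f p\<bar> / 2" using f[of "\<bar>f p\<bar> / 2"] by auto
    then show False using C0_outside[OF _ p] \<open>f p \<noteq> 0\<close> by force
  qed
qed

text \<open>Uniform boundedness near \<open>0\<close>, by the gliding hump argument: if the norms at times
  \<open>t n \<rightarrow> 0\<close> exceed \<open>4\<^sup>n\<close>, then signed sums of almost norming functions, scaled by
  \<open>3\<^sup>-\<^sup>n\<close>, converge to a function whose orbit is unbounded near \<open>0\<close>.\<close>

lemma semigroup_locally_bounded:
  assumes T: "C0_semigroup T"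
  obtains M d where "1 \<le> M" "0 < d" "\<And>t f B p. 0 \<le> t \<Longrightarrow> t \<le> d \<Longrightarrow> f \<in> C0 \<Longrightarrow> (\<And>p. \<bar>f p\<bar> \<le> B) \<Longrightarrow> \<bar>T t f p\<bar> \<le> M * B"
proof (rule ccontr)
  assume "\<not> thesis"
  define U where "U t = {\<bar>T t f p\<bar> | f p. f \<in> C0 \<and> (\<forall>p. \<bar>f p\<bar> \<le> 1)}" for t
  have bdd: "bdd_above (U t)" if "0 \<le> t" for t
  proof -
    obtain M where M: "0 \<le> M" "\<And>f B p. f \<in> C0 \<Longrightarrow> (\<And>p. \<bar>f p\<bar> \<le> B) \<Longrightarrow> \<bar>T t f p\<bar> \<le> M * B"
      by (rule semigroup_bound[OF T \<open>0 \<le> t\<close>]) blast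
    have "x \<le> M * 1" if "x \<in> U t" for x
    proof -
      from that obtain f p where "f \<in> C0" "\<forall>p. \<bar>f p\<bar> \<le> 1" "x = \<bar>T t f p\<bar>" unfolding U_def by blast
      then show ?thesis using M(2)[of f 1 p] by simp
    qed
    then show ?thesis by (rule bdd_aboveI)
  qed
  have zero: "(\<lambda>p. 0) \<in> C0" by (auto simp: C0_iff_bonds)
  have U0: "U t \<noteq> {}" for t using zero by (auto simp: U_def intro!: exI[of _ "\<lambda>p. 0"])
  define N where "N t = Sup (U t)" for t
  have N0: "0 \<le> N t" if "0 \<le> t" for t
  proof -
    obtain x where "x \<in> U t" using U0 by blast
    then have "0 \<le> x" by (auto simp: U_def)
    then show ?thesis using cSup_upper[OF \<open>x \<in> U t\<close> bdd[OF that]] by (simp add: N_def)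
  qed
  have N: "\<bar>T t f p\<bar> \<le> N t * B" if t: "0 \<le> t" and f: "f \<in> C0" and B: "\<And>p. \<bar>f p\<bar> \<le> B" for t f B p
  proof (cases "B = 0")
    case True
    obtain M where M: "0 \<le> M" "\<And>f B p. f \<in> C0 \<Longrightarrow> (\<And>p. \<bar>f p\<bar> \<le> B) \<Longrightarrow> \<bar>T t f p\<bar> \<le> M * B"
      by (rule semigroup_bound[OF T t]) blast
    from M(2)[OF f B, of p] True show ?thesis by simp
  next
    case False
    then have B0: "0 < B" using B[of p] by (auto simp: less_le)
    have "\<bar>(1 / B) * f p\<bar> \<le> 1" for p using B[of p] B0 by (simp add: abs_mult)
    then have "\<bar>T t (\<lambda>p. (1 / B) * f p) p\<bar> \<in> U t" unfolding U_def using C0_scale[OF f] by blast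
    then have "\<bar>T t (\<lambda>p. (1 / B) * f p) p\<bar> \<le> N t" unfolding N_def by (rule cSup_upper[OF _ bdd[OF t]])
    then show ?thesis
      unfolding semigroup_scale[OF T t f] using B0 by (simp add: abs_mult field_simps)
  qed
  have "\<exists>t. 0 \<le> t \<and> t \<le> 1 / (real n + 1) \<and> 4 ^ n < N t" for n
  proof (rule ccontr)
    assume neg: "\<not> ?thesis"
    have "\<bar>T t f p\<bar> \<le> 4 ^ n * B" if "0 \<le> t" "t \<le> 1 / (real n + 1)" "f \<in> C0" "\<And>p. \<bar>f p\<bar> \<le> B" for t f B p
    proof -
      have "N t \<le> 4 ^ n" using neg that(1,2) by force
      moreover have "0 \<le> B" using that(4)[of p] by linarith
      ultimately show ?thesis using N[OF that(1,3,4), of p] mult_right_mono[of "N t" "4 ^ n" B] by linarith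
    qed
    then have thesis by (intro that[of "4 ^ n" "1 / (real n + 1)"]) auto
    with \<open>\<not> thesis\<close> show False by blast
  qed
  then obtain t where t: "\<And>n. 0 \<le> t n" "\<And>n. t n \<le> 1 / (real n + 1)" "\<And>n. 4 ^ n < N (t n)" by metis
  have "\<exists>f p. f \<in> C0 \<and> (\<forall>p. \<bar>f p\<bar> \<le> 1) \<and> 2 / 3 * N (t n) < \<bar>T (t n) f p\<bar>" for n
  proof -
    have "2 / 3 * N (t n) < N (t n)" using t(3)[of n] zero_less_power[of "4::real" n] by linarith
    then obtain x where "x \<in> U (t n)" "2 / 3 * N (t n) < x"
      unfolding N_def using less_cSup_iff[OF U0 bdd[OF t(1)]] by blast
    then show ?thesis by (auto simp: U_def)
  qed
  then obtain g q where g: "\<And>n. g n \<in> C0" "\<And>n p. \<bar>g n p\<bar> \<le> 1" "\<And>n. 2 / 3 * N (t n) < \<bar>T (t n) (g n) (q n)\<bar>"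
    by metis
  \<comment> \<open>Of T x + c T g and T x - c T g at least one has absolute value \<ge> c \<bar>T
    g\<bar>, since they differ by 2 c T g.\<close>
  define step where "step n x = (if \<bar>T (t n) (\<lambda>p. x p + (1/3) ^ n * g n p) (q n)\<bar> \<ge> (1/3) ^ n * \<bar>T (t n) (g n) (q n)\<bar>
     then (\<lambda>p. x p + (1/3) ^ n * g n p) else (\<lambda>p. x p - (1/3) ^ n * g n p))" for n x
  define x where "x = rec_nat (\<lambda>p. 0) step"
  have xS: "x (Suc n) = step n (x n)" for n by (simp add: x_def)
  have xC: "x n \<in> C0" for n
  proof (induction n)
    case 0
    then show ?case using zero by (simp add: x_def)
  next
    case (Suc n)
    then show ?case using C0_linear[OF Suc g(1)[of n], where a = 1 and c = "(1/3) ^ n"]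
        C0_linear[OF Suc g(1)[of n], where a = 1 and c = "- ((1/3) ^ n)"]
      by (simp add: xS step_def)
  qed
  have big: "(1/3) ^ n * \<bar>T (t n) (g n) (q n)\<bar> \<le> \<bar>T (t n) (x (Suc n)) (q n)\<bar>" for n
  proof -
    have "T (t n) (\<lambda>p. x n p + c * g n p) (q n) = T (t n) (x n) (q n) + c * T (t n) (g n) (q n)" for c
      using semigroup_linear[OF T t(1) xC g(1), of _ 1 _ c] by simp
    from this[of "(1/3) ^ n"] this[of "- ((1/3) ^ n)"] show ?thesis
      by (auto simp: xS step_def abs_mult abs_if mult_less_0_iff split: if_splits)
  qed
  have incr: "\<bar>x (Suc n) p - x n p\<bar> \<le> (1/3) ^ n" for n p
    using g(2)[of n p] by (auto simp: xS step_def abs_mult mult_le_cancel_left1)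
  have cauchy: "\<bar>x (n + k) p - x n p\<bar> \<le> 3/2 * ((1/3) ^ n - (1/3) ^ (n + k))" for n k p
  proof (induction k)
    case (Suc k)
    have "\<bar>x (n + Suc k) p - x n p\<bar> \<le> (1/3) ^ (n + k) + 3/2 * ((1/3) ^ n - (1/3) ^ (n + k))"
      using Suc incr[of "n + k" p] unfolding add_Suc_right by linarith
    also have "\<dots> = 3/2 * ((1/3) ^ n - (1/3)^(n + Suc k))" by (simp add: algebra_simps)
    finally show ?case .
  qed simp
  have cauchy': "\<bar>x (n + k) p - x n p\<bar> \<le> 3/2 * (1/3) ^ n" for n k p
  proof -
    have "0 \<le> (1/3::real)^(n + k)" by simp
    then show ?thesis using cauchy[of n k p] unfolding right_diff_distrib by linarith
  qed
  have "convergent (\<lambda>n. x n p)" for p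
  proof -
    have "Cauchy (\<lambda>n. x n p)"
    proof (rule CauchyI')
      fix e :: real assume "0 < e"
      then obtain n where n: "(1/3::real)^n < e / 2" using real_arch_pow_inv[of "e / 2" "1/3"] by auto
      have "dist (x m p) (x k p) < e" if "n \<le> m" "m < k" for m k
      proof -
        define j where "j = k - m"
        have k: "k = m + j" using that by (simp add: j_def)
        have "(1/3::real)^m \<le> (1/3) ^ n" using that by (intro power_decreasing) auto
        moreover note cauchy'[of m j p] n \<open>0 < e\<close>
        ultimately show ?thesis unfolding dist_real_def k by linarith
      qed
      then show "\<exists>M. \<forall>m\<ge>M. \<forall>n>m. dist (x m p) (x n p) < e" by blast
    qed
    then show ?thesis by (simp add: real_Cauchy_convergent)
  qed
  then obtain y where y: "\<And>p. (\<lambda>n. x n p) \<longlonglongrightarrow> y p" unfolding convergent_def by metis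
  \<comment> \<open>The increments from n on form a geometric tail of sum at most 3/2
    (1/3)^n.\<close>
  have lim: "\<bar>y p - x n p\<bar> \<le> 3/2 * (1/3) ^ n" for n p
  proof (rule LIMSEQ_le_const2)
    show "(\<lambda>k. \<bar>x (k + n) p - x n p\<bar>) \<longlonglongrightarrow> \<bar>y p - x n p\<bar>"
      by (intro tendsto_intros LIMSEQ_ignore_initial_segment y)
    show "\<exists>N. \<forall>k\<ge>N. \<bar>x (k + n) p - x n p\<bar> \<le> 3/2 * (1/3) ^ n" using cauchy'[of n _ p] by (simp add: add.commute)
  qed
  have yC: "y \<in> C0"
  proof (rule C0_uniform_limit)
    fix \<epsilon> :: real assume "0 < \<epsilon>"
    then obtain n where "(1/3::real)^n < \<epsilon> / 2" using real_arch_pow_inv[of "\<epsilon> / 2" "1/3"] by auto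
    then have "\<bar>y p - x n p\<bar> \<le> \<epsilon>" for p using lim[of p n] abs_ge_zero[of "y p - x n p"] by linarith
    then show "\<exists>g\<in>C0. \<forall>p. \<bar>y p - g p\<bar> \<le> \<epsilon>" using xC by blast
  qed
  \<comment> \<open>In units of c = N (t n) (1/3)^n, the partial sum including step n contributes at
    least 2/3 and all later steps at most 3/2 * 1/3 = 1/2, which leaves 1/6; and c exceeds
    (4/3)^n.\<close>
  have large: "(4/3)^n / 6 \<le> \<bar>T (t n) y (q n)\<bar>" for n
  proof -
    have "\<bar>T (t n) (\<lambda>p. y p - x (Suc n) p) (q n)\<bar> \<le> N (t n) * (3/2 * (1/3) ^ Suc n)"
      using lim by (intro N t C0_diff yC xC)
    moreover define c where "c = N (t n) * (1/3) ^ n"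
    ultimately have "\<bar>T (t n) y (q n) - T (t n) (x (Suc n)) (q n)\<bar> \<le> c / 2"
      by (simp add: semigroup_diff[OF T t(1) yC xC])
    moreover have "(1/3) ^ n * (2 / 3 * N (t n)) \<le> \<bar>T (t n) (x (Suc n)) (q n)\<bar>"
      by (rule order_trans[OF mult_left_mono big]) (use g(3)[of n] in auto)
    then have "2 / 3 * c \<le> \<bar>T (t n) (x (Suc n)) (q n)\<bar>" by (simp add: c_def mult_ac)
    ultimately have "c / 6 \<le> \<bar>T (t n) y (q n)\<bar>" by linarith
    then have "N (t n) * ((1/3) ^ n / 6) \<le> \<bar>T (t n) y (q n)\<bar>" by (simp add: c_def)
    moreover have "4 ^ n * ((1/3) ^ n / 6) \<le> N (t n) * ((1/3) ^ n / 6)"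
      using t(3)[of n] by (intro mult_right_mono) auto
    moreover have "(4/3::real)^n / 6 = 4 ^ n * ((1/3) ^ n / 6)" by (simp add: power_divide)
    ultimately show ?thesis by linarith
  qed
  obtain d where d: "0 < d" "\<And>h p. 0 \<le> h \<Longrightarrow> h < d \<Longrightarrow> \<bar>T h y p - y p\<bar> \<le> 1"
    by (rule semigroup_strong[OF T yC zero_less_one]) blast
  obtain B where B: "\<And>p. \<bar>y p\<bar> \<le> B" using C0_bounded[OF yC] by blast
  obtain n1 where n1: "1 / d < real n1" using reals_Archimedean2 by blast
  obtain n2 where n2: "6 * (B + 1) < (4/3::real)^n2" using real_arch_pow[of "4/3" "6 * (B + 1)"] by auto
  define n where "n = max n1 n2"
  have "t n < d"
  proof -
    have "real n1 \<le> real n" by (simp add: n_def)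
    with n1 have "1 / d < real n + 1" by linarith
    then have "1 / (real n + 1) < d" using d(1) by (simp add: field_simps)
    then show ?thesis using t(2)[of n] by linarith
  qed
  then have "\<bar>T (t n) y (q n)\<bar> \<le> B + 1" using d(2)[OF t(1), of n "q n"] B[of "q n"] by linarith
  moreover define E where "E = (4/3::real) ^ n"
  have "(4/3::real) ^ n2 \<le> E" unfolding E_def by (intro power_increasing) (auto simp: n_def)
  then have E: "6 * (B + 1) < E" by (rule less_le_trans[OF n2])
  ultimately have "E / 6 \<le> B + 1" using large[of n, folded E_def] by linarith
  then have "E \<le> 6 * (B + 1)" by (simp add: field_simps)
  with E show False by (meson not_le)
qed

lemma semigroup_bounded_on:
  assumes T: "C0_semigroup T"
  obtains M where "0 < M" "\<And>t f B p. 0 \<le> t \<Longrightarrow> t \<le> \<tau> \<Longrightarrow> f \<in> C0 \<Longrightarrow> (\<And>p. \<bar>f p\<bar> \<le> B) \<Longrightarrow> \<bar>T t f p\<bar> \<le> M * B"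
proof -
  obtain M d where M: "1 \<le> M" "0 < d"
    "\<And>t f B p. 0 \<le> t \<Longrightarrow> t \<le> d \<Longrightarrow> f \<in> C0 \<Longrightarrow> (\<And>p. \<bar>f p\<bar> \<le> B) \<Longrightarrow> \<bar>T t f p\<bar> \<le> M * B"
    by (rule semigroup_locally_bounded[OF T]) blast
  have *: "\<bar>T t f p\<bar> \<le> M ^ Suc n * B"
    if "0 \<le> t" "t \<le> real (Suc n) * d" "f \<in> C0" "\<And>p. \<bar>f p\<bar> \<le> B" for n t f B p
    using that(1,2)
  proof (induction n arbitrary: t p)
    case 0
    then show ?case using M(3)[of t f B p] that by simp
  next
    case (Suc n)
    show ?case
    proof (cases "t \<le> d")
      case True
      have "1 * M \<le> M ^ Suc n * M" using M(1) by (intro mult_right_mono one_le_power) auto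
      moreover have "0 \<le> B" using that(4)[of p] by linarith
      ultimately have "M * B \<le> M ^ Suc (Suc n) * B" by (intro mult_right_mono) (auto simp: mult.commute)
      then show ?thesis using M(3)[OF Suc.prems(1) True that(3,4), of p] by linarith
    next
      case False
      then have t': "0 \<le> t - d" "t - d \<le> real (Suc n) * d" using Suc.prems by (auto simp: algebra_simps)
      have "T t f = T d (T (t - d) f)" using semigroup_add[OF T _ t'(1) that(3), of d] M(2) by simp
      moreover have "\<bar>T d (T (t - d) f) p\<bar> \<le> M * (M ^ Suc n * B)"
        using Suc.IH[OF t'] M(2) semigroup_C0[OF T t'(1) that(3)] by (intro M(3)) auto
      ultimately show ?thesis by (simp add: mult.assoc)
    qed
  qed
  obtain n where "\<tau> < real n * d" using reals_Archimedean3[OF M(2)] by blast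
  then have "\<tau> \<le> real (Suc n) * d" using M(2) by (simp add: algebra_simps)
  then show ?thesis using that[of "M ^ Suc n"] * M(1) by (meson less_le_trans order_trans zero_less_one zero_less_power)
qed

text \<open>For s < t the difference is T s applied to T (t - s) f - f, with s varying. This takes a
  bound uniform on [0, t], not just one for each time.\<close>

lemma semigroup_continuous:
  assumes T: "C0_semigroup T" and f: "f \<in> C0" and t: "0 \<le> t" and \<epsilon>: "0 < \<epsilon>"
  obtains d where "0 < d" "\<And>s p. 0 \<le> s \<Longrightarrow> \<bar>s - t\<bar> < d \<Longrightarrow> \<bar>T s f p - T t f p\<bar> \<le> \<epsilon>"
proof -
  obtain M where M: "0 < M" "\<And>s f B p. 0 \<le> s \<Longrightarrow> s \<le> t \<Longrightarrow> f \<in> C0 \<Longrightarrow> (\<And>p. \<bar>f p\<bar> \<le> B) \<Longrightarrow> \<bar>T s f p\<bar> \<le> M * B"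
    by (rule semigroup_bounded_on[OF T, of t]) blast
  have "0 < \<epsilon> / M" using M(1) \<epsilon> by simp
  then obtain d where d: "0 < d" "\<And>h p. 0 \<le> h \<Longrightarrow> h < d \<Longrightarrow> \<bar>T h f p - f p\<bar> \<le> \<epsilon> / M"
    by (rule semigroup_strong[OF T f]) blast
  have shift: "\<bar>T (r + h) f p - T r f p\<bar> \<le> \<epsilon>" if "0 \<le> r" "r \<le> t" "0 \<le> h" "h < d" for r h p
  proof -
    have "T (r + h) f = T r (T h f)" using semigroup_add[OF T that(1,3) f] .
    then have "T (r + h) f p - T r f p = T r (\<lambda>p. T h f p - f p) p"
      using semigroup_diff[OF T that(1) semigroup_C0[OF T that(3) f] f] by simp
    moreover have "\<bar>T r (\<lambda>p. T h f p - f p) p\<bar> \<le> M * (\<epsilon> / M)"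
      using d(2)[OF that(3,4)] by (intro M(2) that C0_diff semigroup_C0[OF T] f)
    ultimately show ?thesis using M(1) by simp
  qed
  show ?thesis
  proof (rule that[OF d(1)])
    fix s p assume s: "0 \<le> s" "\<bar>s - t\<bar> < d"
    show "\<bar>T s f p - T t f p\<bar> \<le> \<epsilon>"
    proof (cases "t \<le> s")
      case True
      then show ?thesis using shift[of t "s - t" p] s t by simp
    next
      case False
      then show ?thesis using shift[of s "t - s" p] s by (simp add: abs_minus_commute)
    qed
  qed
qed

text \<open>The quotient is T (t - h) applied to (T h f - f) / h. It is close to T (t - h) g by the
  uniform bound, and then to T t g by continuity.\<close>

lemma semigroup_left_deriv:
  assumes T: "C0_semigroup T" and fg: "(f, g) \<in> generator T" and t: "0 < t" and \<epsilon>: "0 < \<epsilon>"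
  obtains d where "0 < d" "\<And>h p. 0 < h \<Longrightarrow> h < d \<Longrightarrow> h \<le> t \<Longrightarrow> \<bar>(T t f p - T (t - h) f p) / h - T t g p\<bar> \<le> \<epsilon>"
proof -
  have C: "f \<in> C0" "g \<in> C0" using fg by (auto simp: generator_iff[OF T])
  obtain M where M: "0 < M" "\<And>s f B p. 0 \<le> s \<Longrightarrow> s \<le> t \<Longrightarrow> f \<in> C0 \<Longrightarrow> (\<And>p. \<bar>f p\<bar> \<le> B) \<Longrightarrow> \<bar>T s f p\<bar> \<le> M * B"
    by (rule semigroup_bounded_on[OF T, of t]) blast
  have \<epsilon>M: "0 < \<epsilon> / 2 / M" using M(1) \<epsilon> by simp
  obtain d1 where d1: "0 < d1" "\<And>h p. 0 < h \<Longrightarrow> h < d1 \<Longrightarrow> \<bar>(T h f p - f p) / h - g p\<bar> \<le> \<epsilon> / 2 / M"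
    by (rule generatorE[OF T fg \<epsilon>M]) blast
  obtain d2 where d2: "0 < d2" "\<And>s p. 0 \<le> s \<Longrightarrow> \<bar>s - t\<bar> < d2 \<Longrightarrow> \<bar>T s g p - T t g p\<bar> \<le> \<epsilon> / 2"
    using semigroup_continuous[OF T C(2), of t "\<epsilon> / 2"] t \<epsilon> by auto
  show ?thesis
  proof (rule that[of "min d1 d2"])
    fix h p assume h: "0 < h" "h < min d1 d2" "h \<le> t"
    have r: "0 \<le> t - h" using h by simp
    have hf: "T h f \<in> C0" using h by (intro semigroup_C0[OF T] C) simp
    have q: "(\<lambda>p. (1 / h) * (T h f p - f p)) \<in> C0" by (intro C0_scale C0_diff hf C)
    have "T t f = T (t - h) (T h f)" using semigroup_add[OF T r _ C(1), of h] h by simp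
    then have "(T t f p - T (t - h) f p) / h - T (t - h) g p = T (t - h) (\<lambda>p. (1 / h) * (T h f p - f p) - g p) p"
      using semigroup_diff[OF T r q C(2)] semigroup_scale[OF T r C0_diff[OF hf C(1)], of "1 / h"]
        semigroup_diff[OF T r hf C(1)] by simp
    moreover have "\<bar>T (t - h) (\<lambda>p. (1 / h) * (T h f p - f p) - g p) p\<bar> \<le> M * (\<epsilon> / 2 / M)"
      using h d1(2)[of h] by (intro M(2) C0_diff q C r) auto
    moreover have "M * (\<epsilon> / 2 / M) = \<epsilon> / 2" using M(1) by simp
    moreover have "\<bar>T (t - h) g p - T t g p\<bar> \<le> \<epsilon> / 2" using h r by (intro d2(2)) auto
    ultimately show "\<bar>(T t f p - T (t - h) f p) / h - T t g p\<bar> \<le> \<epsilon>" by linarith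
  qed (use d1 d2 in auto)
qed

text \<open>The parabolic minimum principle. The left difference quotient turns the flow into an
  implicit Euler step, to which \<open>kirchhoff_dissipative\<close> applies.\<close>

lemma flow_min:
  assumes A: "\<And>t. 0 \<le> t \<Longrightarrow> (w t, v t) \<in> kirchhoff_laplacian"
    and cont: "\<And>t \<epsilon>. 0 \<le> t \<Longrightarrow> 0 < \<epsilon> \<Longrightarrow> \<exists>d>0. \<forall>s p. 0 \<le> s \<and> \<bar>s - t\<bar> < d \<longrightarrow> \<bar>w s p - w t p\<bar> \<le> \<epsilon>"
    and deriv: "\<And>t \<epsilon>. 0 < t \<Longrightarrow> 0 < \<epsilon> \<Longrightarrow>
       \<exists>d>0. \<forall>h p. 0 < h \<and> h < d \<and> h \<le> t \<longrightarrow> \<bar>(w t p - w (t - h) p) / h - v t p\<bar> \<le> \<epsilon>"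
    and B: "0 \<le> B" "\<And>p. - B \<le> w 0 p" and \<tau>: "0 \<le> \<tau>"
  shows "- B \<le> w \<tau> p"
proof (rule ccontr)
  assume neg: "\<not> - B \<le> w \<tau> p"
  have C: "w t \<in> C0" if "0 \<le> t" for t using A[OF that] by (simp add: kirchhoff_iff)
  \<comment> \<open>The sup-norm of the negative part; the claim amounts to N \<tau> \<le>
    B.\<close>
  define N where "N t = (SUP p. max 0 (- w t p))" for t
  have bdd: "bdd_above (range (\<lambda>p. max 0 (- w t p)))" if "0 \<le> t" for t
  proof -
    obtain B where B: "0 \<le> B" "\<And>p. \<bar>w t p\<bar> \<le> B" using C0_bounded[OF C[OF \<open>0 \<le> t\<close>]] by blast
    have "max 0 (- w t p) \<le> B" for p using B(1) B(2)[of p] by (simp add: abs_le_iff)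
    then show ?thesis by (rule bdd_aboveI2)
  qed
  have up: "- w t p \<le> N t" "0 \<le> N t" if "0 \<le> t" for t p
    using cSUP_upper[OF UNIV_I bdd[OF that], of p] by (auto simp: N_def)
  have least: "N t \<le> c" if "0 \<le> c" "\<And>p. - w t p \<le> c" for t c
    unfolding N_def using that by (intro cSUP_least) auto
  have \<tau>0: "0 < \<tau>" using \<tau> neg B(2)[of p] by (cases "\<tau> = 0") auto
  have contN: "continuous_on {0..\<tau>} N"
    unfolding continuous_on_iff
  proof (intro ballI allI impI)
    fix t and \<epsilon> :: real assume t: "t \<in> {0..\<tau>}" and \<epsilon>: "0 < \<epsilon>"
    from cont[of t "\<epsilon> / 2"] t \<epsilon> obtain d where d: "0 < d" "\<And>s p. 0 \<le> s \<Longrightarrow> \<bar>s - t\<bar> < d \<Longrightarrow> \<bar>w s p - w t p\<bar> \<le> \<epsilon> / 2"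
      by auto
    have "dist (N s) (N t) < \<epsilon>" if s: "s \<in> {0..\<tau>}" "dist s t < d" for s
    proof -
      have st: "0 \<le> s" "0 \<le> t" using s t by auto
      have w: "\<bar>w s p - w t p\<bar> \<le> \<epsilon> / 2" for p using d(2)[of s p] s by (simp add: dist_real_def)
      have "- w s p \<le> N t + \<epsilon> / 2" "- w t p \<le> N s + \<epsilon> / 2" for p
        using w[of p] up(1)[OF st(2), of p] up(1)[OF st(1), of p] by linarith+
      then have "N s \<le> N t + \<epsilon> / 2" "N t \<le> N s + \<epsilon> / 2"
        using up(2)[OF st(1)] up(2)[OF st(2)] \<epsilon> by (auto intro!: least)
      then show ?thesis using \<epsilon> unfolding dist_real_def by linarith
    qed
    then show "\<exists>d>0. \<forall>s\<in>{0..\<tau>}. dist s t < d \<longrightarrow> dist (N s) (N t) < \<epsilon>" using d(1) by blast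
  qed
  have N0: "N 0 \<le> B" using B by (intro least) (auto simp: minus_le_iff)
  have N\<tau>: "B < N \<tau>" using neg up(1)[OF \<tau>, of p] by linarith
  \<comment> \<open>Half the mean slope from B to N \<tau>. Then N t - \<epsilon> t is larger at
    \<tau> than at 0, so its maximum is attained at a positive time, where left quotients are
    available.\<close>
  define \<epsilon> where "\<epsilon> = (N \<tau> - B) / (2 * \<tau>)"
  have \<epsilon>: "0 < \<epsilon>" using N\<tau> \<tau>0 by (simp add: \<epsilon>_def)
  have \<epsilon>\<tau>: "2 * (\<epsilon> * \<tau>) = N \<tau> - B" using \<tau>0 by (simp add: \<epsilon>_def)
  have "continuous_on {0..\<tau>} (\<lambda>t. N t - \<epsilon> * t)" by (intro continuous_intros contN)
  then obtain t where t: "t \<in> {0..\<tau>}" "\<And>s. s \<in> {0..\<tau>} \<Longrightarrow> N s - \<epsilon> * s \<le> N t - \<epsilon> * t"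
    using continuous_attains_sup[of "{0..\<tau>}" "\<lambda>t. N t - \<epsilon> * t"] \<tau> by auto
  have "t \<noteq> 0"
  proof
    assume "t = 0"
    then have "N \<tau> - \<epsilon> * \<tau> \<le> N 0" using t(2)[of \<tau>] \<tau> by simp
    then have "2 * N \<tau> - 2 * (\<epsilon> * \<tau>) \<le> 2 * B" using N0 by linarith
    then show False using N\<tau> unfolding \<epsilon>\<tau> by linarith
  qed
  then have t0: "0 < t" using t(1) by simp
  obtain d where d: "0 < d" "\<And>h p. 0 < h \<Longrightarrow> h < d \<Longrightarrow> h \<le> t \<Longrightarrow> \<bar>(w t p - w (t - h) p) / h - v t p\<bar> \<le> \<epsilon> / 2"
    using deriv[OF t0, of "\<epsilon> / 2"] \<epsilon> by auto
  define h where "h = min (d / 2) t"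
  have h: "0 < h" "h < d" "h \<le> t" using d(1) t0 by (auto simp: h_def)
  have th: "0 \<le> t - h" "t - h \<in> {0..\<tau>}" using h t(1) by auto
  \<comment> \<open>Over the time h, the Euler step lets N grow by at most h \<epsilon> / 2, whereas
    maximality at t forces a growth of at least h \<epsilon>.\<close>
  let ?B = "N (t - h) + h * (\<epsilon> / 2)"
  have "- ?B \<le> w t p - h * v t p" for p
  proof -
    have "\<bar>(w t p - w (t - h) p) / h - v t p\<bar> \<le> \<epsilon> / 2" by (rule d(2)[OF h])
    then have "v t p - \<epsilon> / 2 \<le> (w t p - w (t - h) p) / h" by linarith
    then have "h * (v t p - \<epsilon> / 2) \<le> w t p - w (t - h) p" using h(1) by (simp add: pos_le_divide_eq mult.commute)
    then show ?thesis using up(1)[OF th(1), of p] unfolding right_diff_distrib by linarith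
  qed
  moreover have B0: "0 \<le> ?B" using up(2)[OF th(1)] h(1) \<epsilon> by simp
  ultimately have "- ?B \<le> w t p" for p
    using kirchhoff_dissipative[OF A[of t] h(1), of ?B p] t0 by simp
  then have "- w t p \<le> ?B" for p by (simp only: minus_le_iff)
  then have "N t \<le> ?B" by (rule least[OF B0])
  moreover have "N (t - h) - \<epsilon> * (t - h) \<le> N t - \<epsilon> * t" using t(2)[OF th(2)] .
  then have "N (t - h) \<le> N t - \<epsilon> * h" by (simp add: algebra_simps)
  moreover have "0 < \<epsilon> * h" using \<epsilon> h by simp
  ultimately show False by (simp add: mult.commute)
qed

end

subsection \<open>The heat semigroup\<close>

context metric_graph
begin

definition heat :: "real \<Rightarrow> (('v, 'e) point \<Rightarrow> real) \<Rightarrow> ('v, 'e) point \<Rightarrow> real" where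
  "heat t = conv_op (gauss t)"

lemma heat_C0: "0 \<le> t \<Longrightarrow> f \<in> C0 \<Longrightarrow> heat t f \<in> C0"
  unfolding heat_def by (rule conv_op_C0[OF sym_kernel_gauss])

lemma heat_0:
  assumes f: "f \<in> C0" shows "heat 0 f = f"
proof
  fix p
  show "heat 0 f p = f p"
  proof (cases "p \<in> points")
    case True
    note bp = bond_pos[OF True]
    show ?thesis
      using True fold_unfold[OF True, of f] convol_gauss_0[OF C0_exp_bounded[OF f bp(1)]]
      by (simp add: heat_def conv_op_def fold_def)
  qed (simp add: heat_def conv_op_def fold_def C0_outside[OF f])
qed

lemma heat_add:
  assumes st: "0 \<le> s" "0 \<le> t" and f: "f \<in> C0"
  shows "heat (s + t) f = heat s (heat t f)"
proof
  fix p
  show "heat (s + t) f p = heat s (heat t f) p"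
  proof (cases "p \<in> points")
    case True
    note bp = bond_pos[OF True]
    have "unfold (heat t f) (bond p) = convol (gauss t) (unfold f (bond p))"
      unfolding heat_def by (rule ext) (rule unfold_conv_op[OF sym_kernel_gauss[OF st(2)] f bp(1)])
    then show ?thesis
      using True convol_gauss_add[OF rate_nonneg st C0_exp_bounded[OF f bp(1)]]
      by (simp add: heat_def[of s] heat_def[of "s + t"] conv_op_def fold_def)
  qed (simp add: heat_def conv_op_def fold_def)
qed

lemma heat_strong:
  assumes f: "f \<in> C0" and \<epsilon>: "0 < \<epsilon>"
  shows "\<exists>d>0. \<forall>h. 0 < h \<and> h < d \<longrightarrow> (\<forall>p. \<bar>heat h f p - f p\<bar> \<le> \<epsilon>)"
proof -
  obtain K where K: "0 \<le> K" "\<And>b x y. b \<in> bonds \<Longrightarrow> 0 \<le> x \<Longrightarrow> x \<le> blen b \<Longrightarrow>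
    \<bar>unfold f b (x + y) - f (bpt b x)\<bar> \<le> \<epsilon> / 2 + K * (y\<^sup>2 * exp (rate * \<bar>y\<bar>))"
    by (rule unfold_osc[OF f half_gt_zero[OF \<epsilon>]]) blast
  define c where "c = 2 * K * gauss_const rate + 1"
  have c: "0 < c" using K(1) gauss_const_nonneg[of rate] by (simp add: c_def add_nonneg_pos)
  define d where "d = min (1/2) (\<epsilon> / 2 / c)"
  have d: "0 < d" using \<epsilon> c by (simp add: d_def)
  have "\<bar>heat h f p - f p\<bar> \<le> \<epsilon>" if h: "0 < h" "h < d" for h p
  proof -
    have h': "0 \<le> h" "h \<le> 1/2" "h * c \<le> \<epsilon> / 2" using h c by (auto simp: d_def field_simps)
    have "\<bar>heat h f p - f p\<bar> \<le> \<epsilon> / 2 + K * (\<integral>y. y\<^sup>2 * exp (rate * \<bar>y\<bar>) \<partial>gauss h)"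
      unfolding heat_def using \<epsilon> K(1)
      by (intro conv_op_near[OF sym_kernel_gauss[OF h'(1)] f K(2)]) auto
    also have "\<dots> \<le> \<epsilon> / 2 + K * (2 * h * gauss_const rate)"
      by (intro add_left_mono mult_left_mono gauss_power2_exp rate_nonneg h' K(1))
    also have "\<dots> \<le> \<epsilon> / 2 + h * c" using h'(1) by (simp add: c_def algebra_simps)
    finally show ?thesis using h'(3) by linarith
  qed
  then show ?thesis using d by blast
qed

lemma heat_C0_semigroup: "C0_semigroup heat"
  unfolding C0_semigroup_def
proof (intro conjI ballI allI impI)
  fix t :: real assume t: "0 \<le> t"
  note M = sym_kernel_gauss[OF t]
  show "bounded_operator (heat t)"
    unfolding bounded_operator_def
  proof (intro conjI ballI allI)
    fix f g a b assume fg: "f \<in> C0" "g \<in> C0"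
    show "heat t (\<lambda>p. a * f p + b * g p) = (\<lambda>p. a * heat t f p + b * heat t g p)"
      unfolding heat_def by (rule conv_op_linear[OF M fg])
  next
    have "sup_norm (heat t f) \<le> (3 * (\<integral>y. exp (rate * \<bar>y\<bar>) \<partial>gauss t)) * sup_norm f" if f: "f \<in> C0" for f
    proof (rule sup_norm_le)
      fix p
      show "\<bar>heat t f p\<bar> \<le> (3 * (\<integral>y. exp (rate * \<bar>y\<bar>) \<partial>gauss t)) * sup_norm f"
        using conv_op_bound[OF M f sup_norm_nonneg[OF f] sup_norm_ge[OF f], of p]
        by (simp add: heat_def mult_ac)
    qed
    then show "\<exists>M. \<forall>f\<in>C0. sup_norm (heat t f) \<le> M * sup_norm f" by blast
  qed (rule heat_C0[OF t])
next
  fix f assume f: "f \<in> C0"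
  have "(\<lambda>p. heat h f p - f p) \<in> C0" if "0 < h" for h using that by (intro C0_diff heat_C0 f) simp
  then show "((\<lambda>t. sup_norm (\<lambda>p. heat t f p - f p)) \<longlongrightarrow> 0) (at_right 0)"
    using sup_norm_tendsto_0_iff[of "\<lambda>h p. heat h f p - f p"] heat_strong[OF f] by simp
qed (use heat_0 heat_add in auto)

text \<open>The domain prescribes second derivatives on the open edges only. Writing u as a
  resolvent makes its unfolding twice differentiable across the vertices; any admissible m will
  do.\<close>

lemma kirchhoff_unfold_DERIV:
  assumes uw: "(u, w) \<in> kirchhoff_laplacian" and b: "b \<in> bonds"
  obtains \<psi>' where "\<And>x. (unfold u b has_real_derivative \<psi>' x) (at x)"
    "\<And>x. (\<psi>' has_real_derivative unfold w b x) (at x)"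
proof -
  define m where "m = rate + 2"
  have m: "rate + 1 < m" "m\<^sup>2 \<noteq> 0" using rate_nonneg by (auto simp: m_def)
  have C: "u \<in> C0" "w \<in> C0" using uw by (auto simp: kirchhoff_iff)
  let ?f = "\<lambda>p. u p - w p / m\<^sup>2"
  have f: "?f \<in> C0" using C0_linear[OF C, of 1 "- 1 / m\<^sup>2"] by simp
  have u: "resolv m ?f = u" using resolv_unique[OF m(1) uw] by simp
  have "unfold ?f b x = unfold u b x - unfold w b x / m\<^sup>2" for x
    using unfold_linear[OF b, of 1 u "- 1 / m\<^sup>2" w x] by simp
  then have eq: "m\<^sup>2 * (unfold u b x - unfold ?f b x) = unfold w b x" for x using m(2) by simp
  show ?thesis
  proof (rule resolv_unfold_DERIV[OF m(1) f b])
    fix \<psi>' assume "\<And>x. (unfold (resolv m ?f) b has_real_derivative \<psi>' x) (at x)"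
      "\<And>x. (\<psi>' has_real_derivative m\<^sup>2 * (unfold (resolv m ?f) b x - unfold ?f b x)) (at x)"
    then show thesis unfolding u eq by (rule that)
  qed
qed

text \<open>Taylor expansion of the unfolding of u, whose second derivative is the unfolding of w;
  \<open>unfold_osc\<close> makes the remainder uniform over the graph.\<close>

lemma kirchhoff_in_generator:
  assumes uw: "(u, w) \<in> kirchhoff_laplacian"
  shows "(u, w) \<in> generator heat"
  unfolding generator_iff[OF heat_C0_semigroup]
proof (intro conjI allI impI)
  show C: "u \<in> C0" "w \<in> C0" using uw by (auto simp: kirchhoff_iff)
  fix \<epsilon> :: real assume \<epsilon>: "0 < \<epsilon>"
  obtain K where K: "0 \<le> K" "\<And>b x y. b \<in> bonds \<Longrightarrow> 0 \<le> x \<Longrightarrow> x \<le> blen b \<Longrightarrow>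
    \<bar>unfold w b (x + y) - w (bpt b x)\<bar> \<le> \<epsilon> / 2 + K * (y\<^sup>2 * exp (rate * \<bar>y\<bar>))"
    by (rule unfold_osc[OF C(2) half_gt_zero[OF \<epsilon>]]) blast
  define c where "c = 2 * K * gauss_const rate + 1"
  have c: "0 < c" using K(1) gauss_const_nonneg[of rate] by (simp add: c_def add_nonneg_pos)
  define d where "d = min (1/2) (\<epsilon> / 2 / c)"
  have d: "0 < d" using \<epsilon> c by (simp add: d_def)
  have "\<bar>(heat h u p - u p) / h - w p\<bar> \<le> \<epsilon>" if h: "0 < h" "h < d" for h p
  proof (cases "p \<in> points")
    case True
    have h': "0 \<le> h" "h \<le> 1/2" "h * c \<le> \<epsilon> / 2" using h c by (auto simp: d_def field_simps)
    define b x where "b = bond p" and "x = pos p"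
    have b: "b \<in> bonds" "0 \<le> x" "x \<le> blen b" "bpt b x = p"
      using bond_pos[OF True] by (auto simp: b_def x_def)
    obtain \<psi>' where \<psi>: "\<And>x. (unfold u b has_real_derivative \<psi>' x) (at x)"
      "\<And>x. (\<psi>' has_real_derivative unfold w b x) (at x)"
      by (rule kirchhoff_unfold_DERIV[OF uw b(1)]) blast
    have ux: "unfold u b x = u p" "unfold w b x = w p" using b by (simp_all add: unfold_on_edge)
    have "\<bar>convol (gauss h) (unfold u b) x - unfold u b x - h * unfold w b x\<bar>
        \<le> h * (\<epsilon> / 2) + 2 * K * gauss_const rate * h\<^sup>2"
      using \<epsilon> K(1) K(2)[OF b(1-3)] b(4) ux(2)
      by (intro convol_gauss_taylor[OF rate_nonneg h'(1,2) C0_exp_bounded[OF C(1) b(1)] \<psi>]) auto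
    also have "\<dots> \<le> h * (\<epsilon> / 2) + c * h\<^sup>2" by (simp add: c_def algebra_simps)
    also have "\<dots> = h * (\<epsilon> / 2 + h * c)" by (simp add: power2_eq_square algebra_simps)
    also have "\<dots> \<le> h * \<epsilon>" using h'(1,3) by (intro mult_left_mono) auto
    finally have "\<bar>heat h u p - u p - h * w p\<bar> \<le> h * \<epsilon>"
      using True ux by (simp add: heat_def conv_op_def fold_def b_def x_def)
    moreover have "(heat h u p - u p) / h - w p = (heat h u p - u p - h * w p) / h"
      using h(1) by (simp add: field_simps)
    ultimately show ?thesis using h(1) by (simp add: abs_divide pos_divide_le_eq mult.commute)
  next
    case False
    then show ?thesis using \<epsilon> C0_outside[OF C(1)] C0_outside[OF C(2)] by (simp add: heat_def conv_op_def fold_def)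
  qed
  then show "\<exists>d>0. \<forall>h. 0 < h \<and> h < d \<longrightarrow> (\<forall>p. \<bar>(heat h u p - u p) / h - w p\<bar> \<le> \<epsilon>)" using d by blast
qed

text \<open>The heat operators commute with the resolvent, whose range is the domain.\<close>

lemma heat_kirchhoff:
  assumes uw: "(u, w) \<in> kirchhoff_laplacian" and t: "0 \<le> t"
  shows "(heat t u, heat t w) \<in> kirchhoff_laplacian"
proof -
  define m where "m = rate + 2"
  have m: "rate + 1 < m" "m\<^sup>2 \<noteq> 0" using rate_nonneg by (auto simp: m_def)
  have C: "u \<in> C0" "w \<in> C0" using uw by (auto simp: kirchhoff_iff)
  let ?f = "\<lambda>p. u p - w p / m\<^sup>2"
  have f: "?f \<in> C0" using C0_linear[OF C, of 1 "- 1 / m\<^sup>2"] by simp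
  have "heat t u = heat t (resolv m ?f)" using resolv_unique[OF m(1) uw] by simp
  also have "\<dots> = resolv m (heat t ?f)"
    unfolding heat_def resolv_def by (rule conv_op_commute[OF sym_kernel_gauss[OF t] sym_kernel_lapl[OF rate_nonneg m(1)] f])
  finally have u: "heat t u = resolv m (heat t ?f)" .
  have "heat t ?f = (\<lambda>p. heat t u p - heat t w p / m\<^sup>2)"
    using semigroup_linear[OF heat_C0_semigroup t C, of 1 "- 1 / m\<^sup>2"] by simp
  then have "m\<^sup>2 * (heat t u p - heat t ?f p) = heat t w p" for p using m(2) by simp
  with resolv_kirchhoff[OF m(1) heat_C0[OF t f]] show ?thesis by (simp add: u[symmetric])
qed

lemma kirchhoff_dense:
  assumes f: "f \<in> C0" and \<epsilon>: "0 < \<epsilon>"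
  obtains u w where "(u, w) \<in> kirchhoff_laplacian" "\<And>p. \<bar>u p - f p\<bar> \<le> \<epsilon>"
proof -
  obtain K where K: "0 \<le> K" "\<And>b x y. b \<in> bonds \<Longrightarrow> 0 \<le> x \<Longrightarrow> x \<le> blen b \<Longrightarrow>
    \<bar>unfold f b (x + y) - f (bpt b x)\<bar> \<le> \<epsilon> / 2 + K * (y\<^sup>2 * exp (rate * \<bar>y\<bar>))"
    by (rule unfold_osc[OF f half_gt_zero[OF \<epsilon>]]) blast
  \<comment> \<open>The first two summands meet the hypotheses of \<open>lapl_power2_exp\<close>; as
    m \<ge> 1, the last one ensures 32 K / m^2 \<le> \<epsilon> / 2.\<close>
  define m where "m = 4 * rate + 2 + 64 * K / \<epsilon>"
  have Ke: "0 \<le> 64 * K / \<epsilon>" using K(1) \<epsilon> by simp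
  have m: "rate + 1 < m" "4 * rate \<le> m" "1 \<le> m" "64 * K / \<epsilon> \<le> m"
    using rate_nonneg Ke by (auto simp: m_def)
  have "\<bar>resolv m f p - f p\<bar> \<le> \<epsilon>" for p
  proof -
    have "\<bar>resolv m f p - f p\<bar> \<le> \<epsilon> / 2 + K * (\<integral>y. y\<^sup>2 * exp (rate * \<bar>y\<bar>) \<partial>lapl m)"
      unfolding resolv_def using \<epsilon> K(1)
      by (intro conv_op_near[OF sym_kernel_lapl[OF rate_nonneg m(1)] f K(2)]) auto
    also have "\<dots> \<le> \<epsilon> / 2 + K * (32 / m\<^sup>2)"
      by (intro add_left_mono mult_left_mono lapl_power2_exp rate_nonneg m K(1))
    also have "K * (32 / m\<^sup>2) \<le> \<epsilon> / 2"
    proof -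
      have "m * 1 \<le> m * m" using m(3) by (intro mult_left_mono) auto
      then have "64 * K / \<epsilon> \<le> m\<^sup>2" using m(4) by (simp add: power2_eq_square)
      then have "64 * K \<le> m\<^sup>2 * \<epsilon>" using \<epsilon> by (simp add: pos_divide_le_eq)
      then show ?thesis using m(3) by (simp add: field_simps)
    qed
    finally show ?thesis by simp
  qed
  then show ?thesis using that[OF resolv_kirchhoff[OF m(1) f]] by blast
qed

text \<open>The hypotheses are weak enough to cover both \<open>heat\<close>, before its generator is known, and an
  arbitrary semigroup with this generator.\<close>

lemma semigroup_min:
  assumes T: "C0_semigroup T" and gen: "kirchhoff_laplacian \<subseteq> generator T"
    and inv: "\<And>u w t. (u, w) \<in> kirchhoff_laplacian \<Longrightarrow> 0 \<le> t \<Longrightarrow> (T t u, T t w) \<in> kirchhoff_laplacian"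
    and f: "f \<in> C0" and B: "0 \<le> B" "\<And>p. - B \<le> f p" and t: "0 \<le> t"
  shows "- B \<le> T t f p"
proof (rule field_le_epsilon)
  fix e :: real assume e: "0 < e"
  obtain M where M: "0 \<le> M" "\<And>f B p. f \<in> C0 \<Longrightarrow> (\<And>p. \<bar>f p\<bar> \<le> B) \<Longrightarrow> \<bar>T t f p\<bar> \<le> M * B"
    by (rule semigroup_bound[OF T t]) blast
  \<comment> \<open>Replacing f by u costs \<epsilon> at time 0 and M \<epsilon> at time t, together
    e.\<close>
  define \<epsilon> where "\<epsilon> = e / (M + 1)"
  have "0 < \<epsilon>" "(M + 1) * \<epsilon> = e" using e M(1) by (auto simp: \<epsilon>_def)
  then have \<epsilon>: "0 < \<epsilon>" "M * \<epsilon> + \<epsilon> = e" by (auto simp: distrib_right)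
  obtain u w where uw: "(u, w) \<in> kirchhoff_laplacian" and near: "\<And>p. \<bar>u p - f p\<bar> \<le> \<epsilon>"
    by (rule kirchhoff_dense[OF f \<epsilon>(1)]) blast
  have uC: "u \<in> C0" using uw by (simp add: kirchhoff_iff)
  have g: "(u, w) \<in> generator T" using gen uw by blast
  have "- (B + \<epsilon>) \<le> T t u p"
  proof (rule flow_min[where w = "\<lambda>t. T t u" and v = "\<lambda>t. T t w"])
    show "(T t u, T t w) \<in> kirchhoff_laplacian" if "0 \<le> t" for t by (rule inv[OF uw that])
    show "\<exists>d>0. \<forall>s p. 0 \<le> s \<and> \<bar>s - t\<bar> < d \<longrightarrow> \<bar>T s u p - T t u p\<bar> \<le> \<epsilon>" if "0 \<le> t" "0 < \<epsilon>" for t \<epsilon>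
      by (rule semigroup_continuous[OF T uC that]) blast
    show "\<exists>d>0. \<forall>h p. 0 < h \<and> h < d \<and> h \<le> t \<longrightarrow> \<bar>(T t u p - T (t - h) u p) / h - T t w p\<bar> \<le> \<epsilon>"
      if "0 < t" "0 < \<epsilon>" for t \<epsilon>
      by (rule semigroup_left_deriv[OF T g that]) blast
    show "0 \<le> B + \<epsilon>" using B(1) \<epsilon>(1) by simp
    show "- (B + \<epsilon>) \<le> T 0 u p" for p
      using semigroup_0[OF T uC] near[of p] B(2)[of p] by simp
  qed (rule t)
  moreover have "\<bar>T t (\<lambda>p. u p - f p) p\<bar> \<le> M * \<epsilon>" by (rule M(2)[OF C0_diff[OF uC f] near])
  then have "\<bar>T t u p - T t f p\<bar> \<le> M * \<epsilon>" using semigroup_diff[OF T t uC f] by simp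
  ultimately show "- B \<le> T t f p + e" using \<epsilon>(2) by linarith
qed

lemma semigroup_feller:
  assumes T: "C0_semigroup T" and gen: "kirchhoff_laplacian \<subseteq> generator T"
    and inv: "\<And>u w t. (u, w) \<in> kirchhoff_laplacian \<Longrightarrow> 0 \<le> t \<Longrightarrow> (T t u, T t w) \<in> kirchhoff_laplacian"
  shows "feller_semigroup T"
  unfolding feller_semigroup_def
proof (intro conjI ballI allI impI)
  fix t :: real and f assume t: "0 \<le> t" and f: "f \<in> C0"
  show "0 \<le> T t f p" if "\<forall>p. 0 \<le> f p" for p
    using semigroup_min[OF T gen inv f order_refl _ t, of p] that by simp
  show "sup_norm (T t f) \<le> sup_norm f"
  proof (rule sup_norm_le)
    fix p
    have b: "- sup_norm f \<le> f p" "- sup_norm f \<le> -1 * f p" for p using sup_norm_ge[OF f, of p] by linarith+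
    have "- sup_norm f \<le> T t f p"
      by (rule semigroup_min[OF T gen inv f sup_norm_nonneg[OF f] b(1) t])
    moreover have "- sup_norm f \<le> T t (\<lambda>p. -1 * f p) p"
      by (rule semigroup_min[OF T gen inv C0_scale[OF f] sup_norm_nonneg[OF f] b(2) t])
    ultimately show "\<bar>T t f p\<bar> \<le> sup_norm f" using semigroup_scale[OF T t f, of "-1"] by simp
  qed
qed (rule T)

lemma heat_feller: "feller_semigroup heat"
  by (rule semigroup_feller[OF heat_C0_semigroup]) (auto intro: kirchhoff_in_generator heat_kirchhoff)

text \<open>For the converse inclusion, (f, g) is compared with the domain element v that has the
  same value of the operator 1 - A / m^2. Then z = f - v is an eigenvector of the generator for the
  positive eigenvalue m^2, which contractivity excludes unless z = 0.\<close>

lemma heat_generator: "generator heat = kirchhoff_laplacian"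
proof
  show "kirchhoff_laplacian \<subseteq> generator heat" using kirchhoff_in_generator by auto
  show "generator heat \<subseteq> kirchhoff_laplacian"
  proof
    fix fg assume "fg \<in> generator heat"
    then obtain f g where fg: "fg = (f, g)" "(f, g) \<in> generator heat" by (cases fg) auto
    have C: "f \<in> C0" "g \<in> C0" using fg(2) by (auto simp: generator_iff[OF heat_C0_semigroup])
    define m where "m = rate + 2"
    have m: "rate + 1 < m" "0 < m\<^sup>2" using rate_nonneg by (auto simp: m_def)
    let ?k = "\<lambda>p. f p - g p / m\<^sup>2"
    have k: "?k \<in> C0" using C0_linear[OF C, of 1 "- 1 / m\<^sup>2"] by simp
    let ?v = "resolv m ?k"
    note v = resolv_kirchhoff[OF m(1) k]
    define z where "z p = f p - ?v p" for p
    have zgen: "(z, \<lambda>p. m\<^sup>2 * z p) \<in> generator heat"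
    proof -
      have "(\<lambda>p. g p - m\<^sup>2 * (?v p - ?k p)) = (\<lambda>p. m\<^sup>2 * z p)"
        using m(2) by (auto simp: z_def fun_eq_iff field_simps)
      then show ?thesis
        using generator_linear[OF heat_C0_semigroup fg(2) kirchhoff_in_generator[OF v], of 1 "-1"]
        by (simp add: z_def[abs_def])
    qed
    have zC: "z \<in> C0" using zgen by (simp add: generator_iff[OF heat_C0_semigroup])
    \<comment> \<open>Dissipativity: \<open>heat h z\<close> is \<open>(1 + h m\<^sup>2) z\<close> up to \<open>o(h)\<close>, yet no larger than \<open>z\<close>.\<close>
    have "m\<^sup>2 * sup_norm z \<le> 0 + \<epsilon>" if \<epsilon>: "0 < \<epsilon>" for \<epsilon>
    proof -
      obtain d where d: "0 < d" "\<And>h p. 0 < h \<Longrightarrow> h < d \<Longrightarrow> \<bar>(heat h z p - z p) / h - m\<^sup>2 * z p\<bar> \<le> \<epsilon>"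
        by (rule generatorE[OF heat_C0_semigroup zgen \<epsilon>]) blast
      define h where "h = d / 2"
      have h: "0 < h" "h < d" using d(1) by (auto simp: h_def)
      define k where "k = 1 + h * m\<^sup>2"
      have pos: "0 < k" using h m(2) by (simp add: k_def add_pos_pos)
      have "\<bar>z p\<bar> \<le> (sup_norm z + h * \<epsilon>) / k" for p
      proof -
        have "\<bar>h * ((heat h z p - z p) / h - m\<^sup>2 * z p)\<bar> \<le> h * \<epsilon>"
          using d(2)[OF h] h(1) by (simp add: abs_mult)
        moreover have eq: "h * ((heat h z p - z p) / h - m\<^sup>2 * z p) = heat h z p - k * z p"
          using h(1) by (simp add: k_def field_simps)
        ultimately have "\<bar>heat h z p - k * z p\<bar> \<le> h * \<epsilon>" by (simp only:)
        moreover have "\<bar>heat h z p\<bar> \<le> sup_norm z"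
          using heat_feller sup_norm_ge[OF heat_C0[OF _ zC], of h p] h(1) zC
          unfolding feller_semigroup_def by (meson less_imp_le order_trans)
        ultimately have "\<bar>k * z p\<bar> \<le> sup_norm z + h * \<epsilon>" by linarith
        then have "k * \<bar>z p\<bar> \<le> sup_norm z + h * \<epsilon>" using pos by (simp add: abs_mult)
        then show ?thesis using pos by (simp add: pos_le_divide_eq mult.commute)
      qed
      then have "sup_norm z \<le> (sup_norm z + h * \<epsilon>) / k" by (rule sup_norm_le)
      then have "sup_norm z * k \<le> sup_norm z + h * \<epsilon>" using pos by (simp add: pos_le_divide_eq)
      then have "h * (m\<^sup>2 * sup_norm z) \<le> h * \<epsilon>" by (simp add: k_def algebra_simps)
      then show ?thesis using h(1) by simp
    qed
    then have "m\<^sup>2 * sup_norm z \<le> 0" by (rule field_le_epsilon)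
    then have "sup_norm z \<le> 0" using m(2) by (simp add: mult_le_0_iff)
    then have "f p = ?v p" for p using sup_norm_ge[OF zC, of p] unfolding z_def by linarith
    then have fv: "f = ?v" by (rule ext)
    have "m\<^sup>2 * (f p - ?k p) = g p" for p using m(2) by (simp add: field_simps)
    then have g: "(\<lambda>p. m\<^sup>2 * (f p - ?k p)) = g" by (rule ext)
    from v have "(f, \<lambda>p. m\<^sup>2 * (f p - ?k p)) \<in> kirchhoff_laplacian" by (simp only: fv[symmetric])
    then show "fg \<in> kirchhoff_laplacian" unfolding fg(1) g .
  qed
qed

text \<open>On the domain, the difference of the two orbits solves the heat equation with initial
  value 0, so \<open>flow_min\<close> applied to both signs annihilates it. Density of the domain
  and boundedness at the fixed time t extend this to \<open>C0\<close>.\<close>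

lemma heat_unique:
  assumes T: "heat_semigroup T" and t: "0 \<le> t" and f: "f \<in> C0"
  shows "T t f = heat t f"
proof -
  have sg: "C0_semigroup T" and gen: "generator T = kirchhoff_laplacian"
    using T by (auto simp: heat_semigroup_def)
  have inv: "(T t u, T t w) \<in> kirchhoff_laplacian" if "(u, w) \<in> kirchhoff_laplacian" "0 \<le> t" for u w t
    using generator_invariant[OF sg _ that(2)] that(1) gen by blast
  note hs = heat_C0_semigroup
  have dom: "T t u p = heat t u p" if uw: "(u, w) \<in> kirchhoff_laplacian" for u w p
  proof -
    have u: "u \<in> C0" using uw by (simp add: kirchhoff_iff)
    have gT: "(u, w) \<in> generator T" and gh: "(u, w) \<in> generator heat" using uw gen heat_generator by auto
    have "- 0 \<le> c * T t u p + - c * heat t u p" if c: "\<bar>c\<bar> = 1" for c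
    proof (rule flow_min[where w = "\<lambda>t p. c * T t u p + - c * heat t u p" and v = "\<lambda>t p. c * T t w p + - c * heat t w p"])
      show "(\<lambda>p. c * T t u p + - c * heat t u p, \<lambda>p. c * T t w p + - c * heat t w p) \<in> kirchhoff_laplacian"
        if "0 \<le> t" for t by (intro kirchhoff_linear inv heat_kirchhoff uw that)
      have split: "\<bar>c * A + - c * B\<bar> \<le> \<epsilon>" if "\<bar>A\<bar> \<le> \<epsilon> / 2" "\<bar>B\<bar> \<le> \<epsilon> / 2" for A B \<epsilon> :: real
      proof -
        have "\<bar>c * A + - c * B\<bar> = \<bar>c\<bar> * \<bar>A - B\<bar>" by (simp add: abs_mult[symmetric] algebra_simps)
        then show ?thesis using that c by simp
      qed
      show "\<exists>d>0. \<forall>s p. 0 \<le> s \<and> \<bar>s - t\<bar> < d \<longrightarrow>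
          \<bar>(c * T s u p + - c * heat s u p) - (c * T t u p + - c * heat t u p)\<bar> \<le> \<epsilon>" if t: "0 \<le> t" and \<epsilon>: "0 < \<epsilon>" for t \<epsilon>
      proof -
        obtain d where d: "0 < d" "\<And>s p. 0 \<le> s \<Longrightarrow> \<bar>s - t\<bar> < d \<Longrightarrow> \<bar>T s u p - T t u p\<bar> \<le> \<epsilon> / 2"
          by (rule semigroup_continuous[OF sg u t half_gt_zero[OF \<epsilon>]]) blast
        obtain d' where d': "0 < d'" "\<And>s p. 0 \<le> s \<Longrightarrow> \<bar>s - t\<bar> < d' \<Longrightarrow> \<bar>heat s u p - heat t u p\<bar> \<le> \<epsilon> / 2"
          by (rule semigroup_continuous[OF hs u t half_gt_zero[OF \<epsilon>]]) blast
        have "\<bar>(c * T s u p + - c * heat s u p) - (c * T t u p + - c * heat t u p)\<bar> \<le> \<epsilon>"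
          if "0 \<le> s" "\<bar>s - t\<bar> < min d d'" for s p
          using split[OF d(2)[of s p] d'(2)[of s p]] that by (simp add: algebra_simps)
        then show ?thesis using d(1) d'(1) by (intro exI[of _ "min d d'"]) auto
      qed
      show "\<exists>d>0. \<forall>h p. 0 < h \<and> h < d \<and> h \<le> t \<longrightarrow>
          \<bar>((c * T t u p + - c * heat t u p) - (c * T (t - h) u p + - c * heat (t - h) u p)) / h
            - (c * T t w p + - c * heat t w p)\<bar> \<le> \<epsilon>" if t: "0 < t" and \<epsilon>: "0 < \<epsilon>" for t \<epsilon>
      proof -
        obtain d where d: "0 < d" "\<And>h p. 0 < h \<Longrightarrow> h < d \<Longrightarrow> h \<le> t \<Longrightarrow> \<bar>(T t u p - T (t - h) u p) / h - T t w p\<bar> \<le> \<epsilon> / 2"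
          by (rule semigroup_left_deriv[OF sg gT t half_gt_zero[OF \<epsilon>]]) blast
        obtain d' where d': "0 < d'" "\<And>h p. 0 < h \<Longrightarrow> h < d' \<Longrightarrow> h \<le> t \<Longrightarrow> \<bar>(heat t u p - heat (t - h) u p) / h - heat t w p\<bar> \<le> \<epsilon> / 2"
          by (rule semigroup_left_deriv[OF hs gh t half_gt_zero[OF \<epsilon>]]) blast
        have "\<bar>((c * T t u p + - c * heat t u p) - (c * T (t - h) u p + - c * heat (t - h) u p)) / h
            - (c * T t w p + - c * heat t w p)\<bar> \<le> \<epsilon>"
          if h: "0 < h" "h < min d d'" "h \<le> t" for h p
        proof -
          have "((c * T t u p + - c * heat t u p) - (c * T (t - h) u p + - c * heat (t - h) u p)) / h
            - (c * T t w p + - c * heat t w p)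
            = c * ((T t u p - T (t - h) u p) / h - T t w p) + - c * ((heat t u p - heat (t - h) u p) / h - heat t w p)"
            using h(1) by (simp add: field_simps)
          then show ?thesis using split[OF d(2)[of h p] d'(2)[of h p]] h by simp
        qed
        then show ?thesis using d(1) d'(1) by (intro exI[of _ "min d d'"]) auto
      qed
      show "- 0 \<le> c * T 0 u p + - c * heat 0 u p" for p
        by (simp add: semigroup_0[OF sg u] heat_0[OF u])
    qed (use t in auto)
    from this[of 1] this[of "-1"] show ?thesis by simp
  qed
  show ?thesis
  proof
    fix p
    obtain M where M: "0 \<le> M" "\<And>f B p. f \<in> C0 \<Longrightarrow> (\<And>p. \<bar>f p\<bar> \<le> B) \<Longrightarrow> \<bar>T t f p\<bar> \<le> M * B"
      by (rule semigroup_bound[OF sg t]) blast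
    obtain M' where M': "0 \<le> M'" "\<And>f B p. f \<in> C0 \<Longrightarrow> (\<And>p. \<bar>f p\<bar> \<le> B) \<Longrightarrow> \<bar>heat t f p\<bar> \<le> M' * B"
      by (rule semigroup_bound[OF hs t]) blast
    have "\<bar>T t f p - heat t f p\<bar> \<le> 0 + e" if e: "0 < e" for e
    proof -
      define \<epsilon> where "\<epsilon> = e / (M + M' + 1)"
      have \<epsilon>: "0 < \<epsilon>" "(M + M' + 1) * \<epsilon> = e" using e M(1) M'(1) by (auto simp: \<epsilon>_def)
      obtain u w where uw: "(u, w) \<in> kirchhoff_laplacian" and near: "\<And>p. \<bar>u p - f p\<bar> \<le> \<epsilon>"
        by (rule kirchhoff_dense[OF f \<epsilon>(1)]) blast
      have u: "u \<in> C0" using uw by (simp add: kirchhoff_iff)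
      have "\<bar>T t u p - T t f p\<bar> \<le> M * \<epsilon>"
        using M(2)[OF C0_diff[OF u f] near, of p] by (simp add: semigroup_diff[OF sg t u f])
      moreover have "\<bar>heat t u p - heat t f p\<bar> \<le> M' * \<epsilon>"
        using M'(2)[OF C0_diff[OF u f] near, of p] by (simp add: semigroup_diff[OF hs t u f])
      moreover have "M * \<epsilon> + M' * \<epsilon> \<le> (M + M' + 1) * \<epsilon>" using \<epsilon>(1) by (simp add: distrib_right)
      ultimately show ?thesis using dom[OF uw, of p] \<epsilon>(2) by linarith
    qed
    then have "\<bar>T t f p - heat t f p\<bar> \<le> 0" by (rule field_le_epsilon)
    then show "T t f p = heat t f p" by simp
  qed
qed

end

subsection \<open>The Borel structure of the graph\<close>

context metric_graph
begin

lemma space_graph_borel [simp]: "space graph_borel = points"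
  by (simp add: graph_borel_def space_measure_of_conv)

lemma open_Pow_points: "{U. openin graph_topology U} \<subseteq> Pow points"
  using openin_subset[of graph_topology] by auto

lemma openin_graph_borel: "openin graph_topology U \<Longrightarrow> U \<in> sets graph_borel"
  unfolding graph_borel_def using open_Pow_points by (subst sets_measure_of) auto

definition open_edge :: "'e \<Rightarrow> ('v, 'e) point set" where
  "open_edge e = {Inner e x | x. 0 < x \<and> x < len e}"

definition coord :: "'e \<times> bool \<Rightarrow> ('v, 'e) point \<Rightarrow> real" where
  "coord b q = (if snd b then pos q else blen b - pos q)"

lemma inner_points:
  assumes "e \<in> arcs G" shows "open_edge e \<subseteq> points"
proof
  fix p assume "p \<in> open_edge e"
  then obtain x where "p = Inner e x" "0 < x" "x < len e" by (auto simp: open_edge_def)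
  then show "p \<in> points" using chart_in_points[OF assms, of x] by (simp add: chart_inner)
qed

lemma openin_inner:
  assumes e: "e \<in> arcs G" and V: "open V"
  shows "openin graph_topology {Inner e x | x. x \<in> V \<and> 0 < x \<and> x < len e}" (is "openin _ ?U")
  unfolding gm.openin_mtopology
proof (intro conjI allI impI)
  show "?U \<subseteq> points" using inner_points[OF e] by (auto simp: open_edge_def)
  fix p assume "p \<in> ?U"
  then obtain x where x: "p = Inner e x" "x \<in> V" "0 < x" "x < len e" by blast
  obtain \<delta> where \<delta>: "0 < \<delta>" "ball x \<delta> \<subseteq> V" using V x(2) by (auto simp: open_contains_ball)
  let ?r = "min \<delta> (min x (len e - x))"
  have "gm.mball p ?r \<subseteq> ?U"
  proof
    fix q assume "q \<in> gm.mball p ?r"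
    then have "q \<in> points" "path_dist (Inner e x) q < ?r" using x by (auto simp: gm.mball_def)
    from near_inner[OF e x(3,4) this min.cobounded2] obtain y where y: "q = Inner e y" "\<bar>x - y\<bar> < ?r" .
    then have "y \<in> ball x \<delta>" "0 < y" "y < len e" by (auto simp: dist_real_def)
    then show "q \<in> ?U" using y \<delta>(2) by blast
  qed
  then show "\<exists>r>0. gm.mball p r \<subseteq> ?U" using \<delta>(1) x by (intro exI[of _ ?r]) auto
qed

lemma inner_less_sets: "e \<in> arcs G \<Longrightarrow> {q \<in> open_edge e. pos q < a} \<in> sets graph_borel"
proof -
  assume e: "e \<in> arcs G"
  have "{q \<in> open_edge e. pos q < a} = {Inner e x | x. x \<in> {..<a} \<and> 0 < x \<and> x < len e}"
    by (auto simp: open_edge_def pos_def)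
  then show ?thesis using openin_graph_borel[OF openin_inner[OF e open_lessThan]] by simp
qed

lemma inner_sets: "e \<in> arcs G \<Longrightarrow> open_edge e \<in> sets graph_borel"
  using openin_graph_borel[OF openin_inner[OF _ open_UNIV]] by (simp add: open_edge_def)

lemma singleton_sets: "p \<in> points \<Longrightarrow> {p} \<in> sets graph_borel"
proof -
  assume p: "p \<in> points"
  have "openin graph_topology (points - {p})"
    unfolding gm.openin_mtopology
  proof (intro conjI allI impI)
    fix q assume q: "q \<in> points - {p}"
    then have "0 < path_dist q p" using p by (intro gm.mdist_pos_less) auto
    moreover have "gm.mball q (path_dist q p) \<subseteq> points - {p}" by (auto simp: gm.mball_def)
    ultimately show "\<exists>r>0. gm.mball q r \<subseteq> points - {p}" by blast
  qed auto
  from sets.compl_sets[OF openin_graph_borel[OF this]] show ?thesis using p by (simp add: Diff_Diff_Int)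
qed

lemma countable_bonds: "countable bonds"
  using countable_arcs by (auto simp: bonds_def)

lemma bond_vimage_sets:
  assumes b: "b \<in> bonds"
  shows "bond -` {b} \<inter> space graph_borel \<in> sets graph_borel"
proof -
  have v: "Vertex (org b) \<in> points" using bpt_points[OF b, of 0] blen_pos[OF b] by (simp add: bpt_0 b)
  have eq: "bond -` {b} \<inter> space graph_borel
      = (if snd b then open_edge (fst b) else {}) \<union> (if bond (Vertex (org b)) = b then {Vertex (org b)} else {})"
    (is "?L = ?R")
  proof (rule set_eqI)
    fix p
    show "p \<in> ?L \<longleftrightarrow> p \<in> ?R"
    proof (cases "p \<in> points")
      case True
      then show ?thesis
      proof (cases rule: points_cases)
        case (inner e x)
        then show ?thesis using True by (cases b) (auto simp: open_edge_def bond_def)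
      next
        case (vertex e x)
        then obtain w where w: "p = Vertex w" by blast
        have "bpt (bond p) (pos p) = Vertex (org (bond p))"
          using bpt_0[OF bond_pos(1)[OF True]] by (simp add: w pos_def)
        then have "org (bond p) = w" using bond_pos(4)[OF True] w by simp
        then show ?thesis using True w by (auto simp: open_edge_def)
      qed
    next
      case False
      then show ?thesis using v inner_points[OF bond_arc[OF b]] by auto
    qed
  qed
  show "bond -` {b} \<inter> space graph_borel \<in> sets graph_borel"
    unfolding eq using inner_sets[OF bond_arc[OF b]] singleton_sets[OF v] by (intro sets.Un) auto
qed

text \<open>Reduces measurability of the heat kernel in its first argument to countably many cases,
  one for each oriented edge.\<close>

lemma measurable_bond: "bond \<in> measurable graph_borel (count_space bonds)"
proof (rule measurableI)
  fix A assume "A \<in> sets (count_space bonds)"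
  then have A: "A \<subseteq> bonds" by simp
  have "bond -` A \<inter> space graph_borel = (\<Union>b\<in>A. bond -` {b} \<inter> space graph_borel)" by auto
  also have "\<dots> \<in> sets graph_borel"
    using A by (intro sets.countable_UN'' countable_subset[OF A countable_bonds] bond_vimage_sets) auto
  finally show "bond -` A \<inter> space graph_borel \<in> sets graph_borel" .
qed (simp add: bond_pos(1))

lemma measurable_pos: "pos \<in> borel_measurable graph_borel"
  unfolding borel_measurable_iff_less
proof
  fix a
  let ?I = "\<Union>e\<in>arcs G. open_edge e"
  have I: "?I \<in> sets graph_borel" by (intro sets.countable_UN'' countable_arcs inner_sets)
  have "{p \<in> space graph_borel. pos p < a}
      = (\<Union>e\<in>arcs G. {q \<in> open_edge e. pos q < a}) \<union> (if 0 < a then points - ?I else {})" (is "?L = ?R")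
  proof (rule set_eqI)
    fix p
    show "p \<in> ?L \<longleftrightarrow> p \<in> ?R"
    proof (cases "p \<in> points")
      case True
      then show ?thesis
      proof (cases rule: points_cases)
        case (inner e x)
        then have "p \<in> open_edge e" by (auto simp: open_edge_def)
        then show ?thesis using True inner(1) by auto
      next
        case (vertex e x)
        then have "p \<notin> open_edge e" "pos p = 0" for e by (auto simp: open_edge_def pos_def)
        then show ?thesis using True by auto
      qed
    next
      case False
      then show ?thesis using inner_points by auto
    qed
  qed
  moreover have "(\<Union>e\<in>arcs G. {q \<in> open_edge e. pos q < a}) \<in> sets graph_borel"
    by (intro sets.countable_UN'' countable_arcs inner_less_sets)
  ultimately show "{p \<in> space graph_borel. pos p < a} \<in> sets graph_borel"
    using I sets.compl_sets[OF I] by auto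
qed

lemma measurable_coord: "coord b \<in> borel_measurable graph_borel"
  unfolding coord_def[abs_def] using measurable_pos by (cases "snd b") auto

lemma coord_inner:
  assumes "q \<in> open_edge (fst b)"
  shows "0 < coord b q" "coord b q < blen b" "bpt b (coord b q) = q"
  using assms by (auto simp: open_edge_def coord_def pos_def blen_def bpt_def chart_inner)

text \<open>The retraction onto [0, l] turns the chart of a closed edge into a continuous map
  defined on the whole line.\<close>

definition clamp :: "real \<Rightarrow> real \<Rightarrow> real" where "clamp l x = max 0 (min x l)"

lemma measurable_chart_clamp:
  assumes e: "e \<in> arcs G"
  shows "(\<lambda>x. chart e (clamp (len e) x)) \<in> measurable borel graph_borel"
  unfolding graph_borel_def
proof (rule measurable_measure_of[OF open_Pow_points])
  have l: "0 < len e" by (rule len_pos[OF e])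
  show "(\<lambda>x. chart e (clamp (len e) x)) \<in> space borel \<rightarrow> points"
    using l by (auto simp: clamp_def intro!: chart_in_points[OF e])
  fix U assume "U \<in> {U. openin graph_topology U}"
  then have U: "openin graph_topology U" by simp
  have "continuous_map euclidean (top_of_set {0..len e}) (clamp (len e))"
    using l by (auto simp: continuous_map_in_subtopology clamp_def[abs_def] intro!: continuous_intros)
  from continuous_map_compose[OF this continuous_map_chart[OF e]]
  have "openin euclidean {x \<in> topspace euclidean. (chart e \<circ> clamp (len e)) x \<in> U}"
    using U by (rule openin_continuous_map_preimage)
  then show "(\<lambda>x. chart e (clamp (len e) x)) -` U \<inter> space borel \<in> sets borel"
    by (simp add: vimage_def)
qed

lemma edge_measurable_borel:
  assumes f: "f \<in> borel_measurable graph_borel"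
  shows "edge_measurable f"
  unfolding edge_measurable_def
proof
  fix b assume b: "b \<in> bonds"
  have [measurable]: "(\<lambda>x. f (chart (fst b) (clamp (len (fst b)) x))) \<in> borel_measurable borel"
    by (rule measurable_compose[OF measurable_chart_clamp[OF bond_arc[OF b]] f])
  have "(\<lambda>s. if 0 \<le> s \<and> s < blen b then f (bpt b s) else 0)
     = (\<lambda>s. if 0 \<le> s \<and> s < blen b then f (chart (fst b) (clamp (len (fst b)) (if snd b then s else len (fst b) - s))) else 0)"
    by (auto simp: fun_eq_iff bpt_def clamp_def blen_def)
  also have "\<dots> \<in> borel_measurable borel" by (cases "snd b") (simp_all, measurable)
  finally show "(\<lambda>s. if 0 \<le> s \<and> s < blen b then f (bpt b s) else 0) \<in> borel_measurable borel" .
qed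

text \<open>On functions carried by one open edge, \<open>volume\<close> acts as Lebesgue measure in
  the coordinate of either orientation.\<close>

lemma volume_bond:
  fixes \<phi> :: "real \<Rightarrow> real"
  assumes b: "b \<in> bonds" and [measurable]: "\<phi> \<in> borel_measurable borel"
    and int: "integrable lborel (\<lambda>s. indicator {0<..<blen b} s * \<phi> s)"
  shows "integrable volume (\<lambda>q. if q \<in> open_edge (fst b) then \<phi> (coord b q) else 0)"
    and "(\<integral>q. (if q \<in> open_edge (fst b) then \<phi> (coord b q) else 0) \<partial>volume)
       = (\<integral>s. indicator {0<..<blen b} s * \<phi> s \<partial>lborel)"
proof -
  let ?e = "fst b"
  let ?F = "\<lambda>q. if q \<in> open_edge ?e then \<phi> (coord b q) else (0::real)"
  let ?\<Omega> = "{(e, x). e \<in> arcs G \<and> 0 < x \<and> x < len e}"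
  let ?N = "count_space (arcs G) \<Otimes>\<^sub>M lborel"
  let ?P = "restrict_space ?N ?\<Omega>"
  let ?c = "\<lambda>(e, x). chart e x"
  have e: "?e \<in> arcs G" by (rule bond_arc[OF b])
  interpret count: sigma_finite_measure "count_space (arcs G)"
    by (rule sigma_finite_measure_count_space_countable[OF countable_arcs])
  interpret pair_sigma_finite "count_space (arcs G)" lborel ..
  have \<Omega>: "?\<Omega> \<inter> space ?N \<in> sets ?N"
  proof -
    have "?\<Omega> \<inter> space ?N = (\<Union>e\<in>arcs G. {e} \<times> {0<..<len e})" by (auto simp: space_pair_measure)
    also have "\<dots> \<in> sets ?N" by (intro sets.countable_UN'' countable_arcs pair_measureI) auto
    finally show ?thesis .
  qed
  have fst_P: "fst \<in> measurable ?P (count_space (arcs G))" by (intro measurable_restrict_space1) simp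
  have snd_P: "snd \<in> borel_measurable ?P" by (intro measurable_restrict_space1) simp
  have c: "?c \<in> measurable ?P graph_borel"
  proof -
    have "(\<lambda>\<omega>. chart (fst \<omega>) (clamp (len (fst \<omega>)) (snd \<omega>))) \<in> measurable ?P graph_borel"
      by (rule measurable_compose_countable'[OF _ fst_P countable_arcs, of "\<lambda>e \<omega>. chart e (clamp (len e) (snd \<omega>))"])
        (rule measurable_compose[OF snd_P measurable_chart_clamp])
    then show ?thesis
      by (rule measurable_cong[THEN iffD1, rotated]) (auto simp: space_restrict_space clamp_def)
  qed
  have F: "?F \<in> borel_measurable graph_borel"
  proof -
    have [measurable]: "coord b \<in> borel_measurable graph_borel" "open_edge ?e \<in> sets graph_borel"
      using measurable_coord inner_sets[OF e] by auto
    have "(\<lambda>q. \<phi> (coord b q)) \<in> borel_measurable graph_borel"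
      by (rule measurable_compose[OF measurable_coord]) simp
    moreover have "open_edge ?e \<inter> space graph_borel \<in> sets graph_borel" by (intro sets.Int inner_sets[OF e] sets.top)
    ultimately show ?thesis by (intro measurable_If_set) auto
  qed
  \<comment> \<open>The integrand in the chart coordinate, which runs from tail to head whatever the
    orientation of b.\<close>
  define g where "g x = indicator {0<..<len ?e} x * \<phi> (if snd b then x else blen b - x)" for x
  have g: "integrable lborel g \<and> integral\<^sup>L lborel g = (\<integral>s. indicator {0<..<blen b} s * \<phi> s \<partial>lborel)"
  proof (cases "snd b")
    case True
    then show ?thesis using int by (simp add: g_def[abs_def] blen_def)
  next
    case False
    have "g = (\<lambda>x. (\<lambda>s. indicator {0<..<blen b} s * \<phi> s) (blen b + (- 1) * x))"
      using False by (auto simp: g_def fun_eq_iff blen_def indicator_def)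
    then show ?thesis
      using lborel_integrable_real_affine[OF int, of "-1" "blen b"]
        lborel_integral_real_affine[of "-1" "\<lambda>s. indicator {0<..<blen b} s * \<phi> s" "blen b"] by simp
  qed
  have Fc: "indicator ?\<Omega> \<omega> *\<^sub>R ?F (?c \<omega>) = indicator {?e} (fst \<omega>) * g (snd \<omega>)" if "\<omega> \<in> space ?N" for \<omega>
  proof -
    obtain e' x where "\<omega> = (e', x)" by (cases \<omega>)
    with that have \<omega>: "\<omega> = (e', x)" "e' \<in> arcs G" by (auto simp: space_pair_measure)
    show ?thesis
    proof (cases "0 < x \<and> x < len e'")
      case True
      then have "chart e' x = Inner e' x" by (simp add: chart_inner)
      then show ?thesis using True \<omega> by (auto simp: open_edge_def g_def coord_def pos_def indicator_def)
    next
      case False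
      then show ?thesis using \<omega> by (auto simp: g_def indicator_def)
    qed
  qed
  have mg [measurable]: "g \<in> borel_measurable borel" using g by (auto dest: borel_measurable_integrable)
  have ie: "integrable (count_space (arcs G)) (\<lambda>e'. indicator {?e} e' :: real)"
    using e by (intro integrable_real_indicator) auto
  have i: "integrable ?N (\<lambda>(e', x). indicator {?e} e' * g x)"
  proof (rule Fubini_integrable)
    show "integrable (count_space (arcs G)) (\<lambda>e'. \<integral>x. norm (case (e', x) of (e', x) \<Rightarrow> indicator {?e} e' * g x) \<partial>lborel)"
      using ie by (simp add: abs_mult)
    show "AE e' in count_space (arcs G). integrable lborel (\<lambda>x. case (e', x) of (e', x) \<Rightarrow> indicator {?e} e' * g x)"
      using g by simp
    have "(\<lambda>\<omega>. indicator {?e} (fst \<omega>) * g (snd \<omega>)) \<in> borel_measurable ?N"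
      by (intro borel_measurable_times measurable_compose[OF measurable_fst] measurable_compose[OF measurable_snd])
        (use mg in auto)
    then show "(\<lambda>(e', x). indicator {?e} e' * g x) \<in> borel_measurable ?N" by (simp add: split_beta)
  qed
  have i': "integrable ?N (\<lambda>\<omega>. indicator ?\<Omega> \<omega> *\<^sub>R ?F (?c \<omega>))"
    by (rule Bochner_Integration.integrable_cong[THEN iffD2, OF refl _ i]) (use Fc in \<open>auto simp: split_beta\<close>)
  show "integrable volume ?F"
    unfolding volume_def integrable_distr_eq[OF c F] integrable_restrict_space[OF \<Omega>] by (rule i')
  have "(\<integral>q. ?F q \<partial>volume) = (\<integral>\<omega>. ?F (?c \<omega>) \<partial>?P)" unfolding volume_def by (rule integral_distr[OF c F])
  also have "\<dots> = (\<integral>\<omega>. indicator ?\<Omega> \<omega> *\<^sub>R ?F (?c \<omega>) \<partial>?N)" by (rule integral_restrict_space[OF \<Omega>])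
  also have "\<dots> = (\<integral>\<omega>. (case \<omega> of (e', x) \<Rightarrow> indicator {?e} e' * g x) \<partial>?N)"
    by (rule Bochner_Integration.integral_cong) (use Fc in \<open>auto simp: split_beta\<close>)
  also have "\<dots> = (\<integral>e'. (\<integral>x. indicator {?e} e' * g x \<partial>lborel) \<partial>count_space (arcs G))"
    using integral_fst'[OF i] by simp
  also have "\<dots> = (\<integral>e'. indicator {?e} e' * integral\<^sup>L lborel g \<partial>count_space (arcs G))" by simp
  also have "\<dots> = integral\<^sup>L lborel g"
  proof -
    have "{a \<in> arcs G. indicator {?e} a * integral\<^sup>L lborel g \<noteq> 0} \<subseteq> {?e}" by (auto simp: indicator_def)
    then have fin: "finite {a \<in> arcs G. indicator {?e} a * integral\<^sup>L lborel g \<noteq> 0}" by (rule finite_subset) simp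
    have "(\<integral>e'. indicator {?e} e' * integral\<^sup>L lborel g \<partial>count_space (arcs G))
      = (\<Sum>a | a \<in> arcs G \<and> indicator {?e} a * integral\<^sup>L lborel g \<noteq> 0. indicator {?e} a * integral\<^sup>L lborel g)"
      by (rule lebesgue_integral_count_space_finite_support[OF fin])
    also have "\<dots> = (\<Sum>a\<in>{?e}. indicator {?e} a * integral\<^sup>L lborel g)"
      using e by (intro sum.mono_neutral_cong_left) (auto simp: indicator_def)
    finally show ?thesis by simp
  qed
  finally show "(\<integral>q. ?F q \<partial>volume) = (\<integral>s. indicator {0<..<blen b} s * \<phi> s \<partial>lborel)" using g by simp
qed

lemma space_volume [simp]: "space volume = points"
  and sets_volume [measurable_cong, simp]: "sets volume = sets graph_borel"
  by (simp_all add: volume_def)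

subsection \<open>The kernel of the heat semigroup\<close>

text \<open>The transpose of \<open>piece\<close>: integrating \<open>piece n f b\<close> against \<open>h\<close> amounts to
  integrating \<open>f\<close> against \<open>copiece n b h\<close>.\<close>

primrec copiece :: "nat \<Rightarrow> 'e \<times> bool \<Rightarrow> (real \<Rightarrow> real) \<Rightarrow> ('v, 'e) point \<Rightarrow> real" where
  "copiece 0 b h q = (if q \<in> open_edge (fst b) then h (coord b q) else 0)"
| "copiece (Suc n) b h q = scatter b (\<lambda>b'. copiece n b' (\<lambda>s. h (s + blen b)) q)"

text \<open>The parameter x will be the position of the first argument of the heat kernel.\<close>

lemma measurable_copiece_joint:
  "b \<in> bonds \<Longrightarrow> (\<lambda>(x, s). H x s) \<in> borel_measurable (borel \<Otimes>\<^sub>M borel) \<Longrightarrow>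
    (\<lambda>(x, q). copiece n b (H x) q) \<in> borel_measurable ((borel :: real measure) \<Otimes>\<^sub>M graph_borel)"
proof (induction n arbitrary: b H)
  case 0
  have [measurable]: "coord b \<in> borel_measurable graph_borel" "open_edge (fst b) \<in> sets graph_borel"
    using measurable_coord inner_sets[OF bond_arc[OF 0(1)]] by auto
  have "(\<lambda>p. (fst p, coord b (snd p))) \<in> measurable (borel \<Otimes>\<^sub>M graph_borel) (borel \<Otimes>\<^sub>M borel)" by measurable
  from measurable_compose[OF this 0(2)]
  have [measurable]: "(\<lambda>p. H (fst p) (coord b (snd p))) \<in> borel_measurable (borel \<Otimes>\<^sub>M graph_borel)" by simp
  have "(\<lambda>p. if snd p \<in> open_edge (fst b) then H (fst p) (coord b (snd p)) else 0)
      \<in> borel_measurable (borel \<Otimes>\<^sub>M graph_borel)" by measurable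
  then show ?case by (simp add: split_beta)
next
  case (Suc n)
  have "(\<lambda>p. scatter b (\<lambda>b'. copiece n b' (\<lambda>s. H (fst p) (s + blen b)) (snd p)))
      \<in> borel_measurable (borel \<Otimes>\<^sub>M graph_borel)"
  proof (rule measurable_scatter[OF Suc.prems(1)])
    fix b' assume b': "b' \<in> out (org (flip b))"
    have "(\<lambda>p. (fst p, snd p + blen b)) \<in> measurable (borel \<Otimes>\<^sub>M borel) ((borel::real measure) \<Otimes>\<^sub>M borel)" by measurable
    from measurable_compose[OF this Suc.prems(2)]
    have "(\<lambda>(x, s). H x (s + blen b)) \<in> borel_measurable (borel \<Otimes>\<^sub>M borel)" by (simp add: split_beta)
    from Suc.IH[OF out_bonds[OF b'] this]
    show "(\<lambda>p. copiece n b' (\<lambda>s. H (fst p) (s + blen b)) (snd p)) \<in> borel_measurable (borel \<Otimes>\<^sub>M graph_borel)"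
      by (simp add: split_beta)
  qed
  then show ?case by (simp add: split_beta)
qed

lemma measurable_copiece:
  assumes b: "b \<in> bonds" and [measurable]: "h \<in> borel_measurable borel"
  shows "copiece n b h \<in> borel_measurable graph_borel"
proof -
  have "(\<lambda>(x::real, s). h s) \<in> borel_measurable (borel \<Otimes>\<^sub>M borel)" by measurable
  from measurable_copiece_joint[OF b this, of n]
  have m: "(\<lambda>(x, q). copiece n b h q) \<in> borel_measurable ((borel :: real measure) \<Otimes>\<^sub>M graph_borel)" .
  have "(\<lambda>q. (0::real, q)) \<in> measurable graph_borel (borel \<Otimes>\<^sub>M graph_borel)" by measurable
  from measurable_compose[OF this m] show ?thesis by simp
qed

lemma integral_scatter:
  assumes b: "b \<in> bonds" and X: "\<And>b'. b' \<in> out (org (flip b)) \<Longrightarrow> integrable M (X b')"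
  shows "integrable M (\<lambda>x. scatter b (\<lambda>b'. X b' x))"
    and "(\<integral>x. scatter b (\<lambda>b'. X b' x) \<partial>M) = scatter b (\<lambda>b'. \<integral>x. X b' x \<partial>M)"
proof -
  have i: "integrable M (\<lambda>x. avg (org (flip b)) (\<lambda>b'. X b' x))"
    unfolding avg_def using X by (intro integrable_divide_zero Bochner_Integration.integrable_sum) auto
  have a: "(\<integral>x. avg (org (flip b)) (\<lambda>b'. X b' x) \<partial>M) = avg (org (flip b)) (\<lambda>b'. \<integral>x. X b' x \<partial>M)"
    unfolding avg_def using X by (simp add: Bochner_Integration.integral_sum)
  show "integrable M (\<lambda>x. scatter b (\<lambda>b'. X b' x))"
    unfolding scatter_def using i X[OF flip_out[OF b]] by simp
  show "(\<integral>x. scatter b (\<lambda>b'. X b' x) \<partial>M) = scatter b (\<lambda>b'. \<integral>x. X b' x \<partial>M)"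
    unfolding scatter_def using i a X[OF flip_out[OF b]] by simp
qed

lemma avg_mono:
  assumes "\<And>b. b \<in> out v \<Longrightarrow> X b \<le> Y b"
  shows "avg v X \<le> avg v Y"
  unfolding avg_def using assms cond_out
  by (intro divide_right_mono sum_mono mult_left_mono sum_nonneg) (auto intro: less_imp_le)

lemma abs_scatter_le:
  "\<bar>scatter b X\<bar> \<le> 2 * avg (org (flip b)) (\<lambda>b'. \<bar>X b'\<bar>) + \<bar>X (flip b)\<bar>"
proof -
  have "avg (org (flip b)) X \<le> avg (org (flip b)) (\<lambda>b'. \<bar>X b'\<bar>)" by (rule avg_mono) simp
  moreover have "avg (org (flip b)) (\<lambda>b'. -1 * X b') \<le> avg (org (flip b)) (\<lambda>b'. \<bar>X b'\<bar>)" by (rule avg_mono) simp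
  then have "- avg (org (flip b)) X \<le> avg (org (flip b)) (\<lambda>b'. \<bar>X b'\<bar>)" unfolding avg_cmult by simp
  ultimately show ?thesis unfolding scatter_def by linarith
qed

lemma integrable_shift_Ici:
  fixes h :: "real \<Rightarrow> real"
  assumes "integrable lborel (\<lambda>s. indicator {0..} s * h s)" "0 \<le> l"
  shows "integrable lborel (\<lambda>s. indicator {0..} s * h (s + l))"
proof -
  have "integrable lborel (\<lambda>s. (indicator {0..} s * h s) * indicator {l..} s)"
    by (rule integrable_real_mult_indicator[OF _ assms(1)]) simp
  then have "integrable lborel (\<lambda>s. indicator {l..} s * (indicator {0..} s * h s))"
    by (simp only: mult.commute)
  from lborel_integrable_real_affine[OF this, of 1 l]
  have "integrable lborel (\<lambda>s. indicator {l..} (l + s) * (indicator {0..} (l + s) * h (l + s)))" by simp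
  moreover have "indicator {l..} (l + s) * (indicator {0..} (l + s) * h (l + s)) = indicator {0..} s * h (s + l)" for s
    using assms(2) by (auto simp: indicator_def add.commute)
  ultimately show ?thesis by simp
qed

lemma integrable_indicator_Ici:
  fixes h :: "real \<Rightarrow> real"
  assumes "integrable lborel (\<lambda>s. indicator {0..} s * h s)" "0 \<le> a"
  shows "integrable lborel (\<lambda>s. indicator {a..} s * \<bar>h s\<bar>)"
proof -
  have "integrable lborel (\<lambda>s. \<bar>indicator {0..} s * h s\<bar> * indicator {a..} s)"
    using assms(1) by (intro integrable_real_mult_indicator integrable_abs) auto
  moreover have "\<bar>indicator {0..} s * h s\<bar> * indicator {a..} s = indicator {a..} s * \<bar>h s\<bar>" for s
    using assms(2) by (auto simp: indicator_def)
  ultimately show ?thesis by simp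
qed

text \<open>A scattering costs a factor 3 in the L^1 norm too. Passing n vertices uses up at least n
  times \<open>min_len\<close>, so only the tail of h beyond that length contributes.\<close>

lemma copiece_integrable:
  "b \<in> bonds \<Longrightarrow> h \<in> borel_measurable borel \<Longrightarrow> integrable lborel (\<lambda>s. indicator {0..} s * h s) \<Longrightarrow>
    integrable volume (copiece n b h) \<and>
    (\<integral>q. \<bar>copiece n b h q\<bar> \<partial>volume) \<le> 3 ^ n * (\<integral>s. indicator {real n * min_len..} s * \<bar>h s\<bar> \<partial>lborel)"
proof (induction n arbitrary: b h)
  case 0
  note [measurable] = 0(2)
  have "integrable lborel (\<lambda>s. (indicator {0..} s * h s) * indicator {0<..<blen b} s)"
    using 0(3) by (intro integrable_real_mult_indicator) auto
  moreover have "(indicator {0..} s * h s) * indicator {0<..<blen b} s = indicator {0<..<blen b} s * h s" for s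
    by (auto simp: indicator_def)
  ultimately have i: "integrable lborel (\<lambda>s. indicator {0<..<blen b} s * h s)" by simp
  then have ia: "integrable lborel (\<lambda>s. indicator {0<..<blen b} s * \<bar>h s\<bar>)"
    using integrable_abs[OF i] by (simp add: abs_mult)
  have "(\<integral>q. \<bar>copiece 0 b h q\<bar> \<partial>volume) = (\<integral>q. (if q \<in> open_edge (fst b) then \<bar>h (coord b q)\<bar> else 0) \<partial>volume)"
    by (intro Bochner_Integration.integral_cong) auto
  also have "\<dots> = (\<integral>s. indicator {0<..<blen b} s * \<bar>h s\<bar> \<partial>lborel)"
    by (rule volume_bond(2)[OF 0(1) _ ia]) measurable
  also have "\<dots> \<le> (\<integral>s. indicator {0..} s * \<bar>h s\<bar> \<partial>lborel)"
    using integrable_indicator_Ici[OF 0(3), of 0] ia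
    by (intro integral_mono) (auto simp: indicator_def)
  finally show ?case using volume_bond(1)[OF 0(1,2) i] by simp
next
  case (Suc n)
  note [measurable] = Suc.prems(2)
  have l: "0 \<le> blen b" using blen_pos[OF Suc.prems(1)] by simp
  let ?h = "\<lambda>s. h (s + blen b)"
  let ?I = "\<integral>s. indicator {real (Suc n) * min_len..} s * \<bar>h s\<bar> \<partial>lborel"
  have h: "?h \<in> borel_measurable borel" "integrable lborel (\<lambda>s. indicator {0..} s * ?h s)"
    using integrable_shift_Ici[OF Suc.prems(3) l] by auto
  have n0: "0 \<le> real n * min_len" using min_len_pos by simp
  have "(\<integral>s. indicator {real n * min_len..} s * \<bar>?h s\<bar> \<partial>lborel)
      = (\<integral>s. indicator {real n * min_len..} (s - blen b) * \<bar>h s\<bar> \<partial>lborel)"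
    by (subst lborel_integral_real_affine[where c = 1 and t = "- blen b"]) auto
  also have "\<dots> \<le> ?I"
  proof (rule integral_mono')
    show "integrable lborel (\<lambda>s. indicator {real (Suc n) * min_len..} s * \<bar>h s\<bar>)"
      using min_len_pos by (intro integrable_indicator_Ici Suc.prems) simp
    fix s
    show "indicator {real n * min_len..} (s - blen b) * \<bar>h s\<bar> \<le> indicator {real (Suc n) * min_len..} s * \<bar>h s\<bar>"
      using blen_ge[OF Suc.prems(1)] by (auto simp: indicator_def algebra_simps)
  qed auto
  finally have le: "(\<integral>s. indicator {real n * min_len..} s * \<bar>?h s\<bar> \<partial>lborel) \<le> ?I" .
  have IH: "integrable volume (copiece n b' ?h)" "(\<integral>q. \<bar>copiece n b' ?h q\<bar> \<partial>volume) \<le> 3 ^ n * ?I"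
    if "b' \<in> out (org (flip b))" for b'
  proof -
    note IH = Suc.IH[OF out_bonds[OF that] h]
    show "integrable volume (copiece n b' ?h)" using IH by blast
    have "3 ^ n * (\<integral>s. indicator {real n * min_len..} s * \<bar>?h s\<bar> \<partial>lborel) \<le> 3 ^ n * ?I"
      by (rule mult_left_mono[OF le]) simp
    with IH show "(\<integral>q. \<bar>copiece n b' ?h q\<bar> \<partial>volume) \<le> 3 ^ n * ?I" by (meson order_trans)
  qed
  have int: "integrable volume (copiece (Suc n) b h)"
  proof -
    have "copiece (Suc n) b h = (\<lambda>q. scatter b (\<lambda>b'. copiece n b' ?h q))" by (simp add: fun_eq_iff)
    then show ?thesis using integral_scatter(1)[OF Suc.prems(1) IH(1)] by (simp only:)
  qed
  have ia: "integrable volume (\<lambda>q. avg (org (flip b)) (\<lambda>b'. \<bar>copiece n b' ?h q\<bar>))"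
    unfolding avg_def using IH by (intro integrable_divide_zero Bochner_Integration.integrable_sum) auto
  have "(\<integral>q. \<bar>copiece (Suc n) b h q\<bar> \<partial>volume)
      \<le> (\<integral>q. 2 * avg (org (flip b)) (\<lambda>b'. \<bar>copiece n b' ?h q\<bar>) + \<bar>copiece n (flip b) ?h q\<bar> \<partial>volume)"
  proof (rule integral_mono)
    show "integrable volume (\<lambda>q. \<bar>copiece (Suc n) b h q\<bar>)" by (rule integrable_abs[OF int])
    show "integrable volume (\<lambda>q. 2 * avg (org (flip b)) (\<lambda>b'. \<bar>copiece n b' ?h q\<bar>) + \<bar>copiece n (flip b) ?h q\<bar>)"
      using ia IH(1)[OF flip_out[OF Suc.prems(1)]] by simp
    show "\<bar>copiece (Suc n) b h q\<bar> \<le> 2 * avg (org (flip b)) (\<lambda>b'. \<bar>copiece n b' ?h q\<bar>) + \<bar>copiece n (flip b) ?h q\<bar>" for q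
      unfolding copiece.simps by (rule abs_scatter_le)
  qed
  also have "\<dots> = 2 * (\<integral>q. avg (org (flip b)) (\<lambda>b'. \<bar>copiece n b' ?h q\<bar>) \<partial>volume) + (\<integral>q. \<bar>copiece n (flip b) ?h q\<bar> \<partial>volume)"
    using ia IH(1)[OF flip_out[OF Suc.prems(1)]] by simp
  also have "(\<integral>q. avg (org (flip b)) (\<lambda>b'. \<bar>copiece n b' ?h q\<bar>) \<partial>volume)
      = avg (org (flip b)) (\<lambda>b'. \<integral>q. \<bar>copiece n b' ?h q\<bar> \<partial>volume)"
    unfolding avg_def using IH by (simp add: Bochner_Integration.integral_sum)
  also have "\<dots> \<le> avg (org (flip b)) (\<lambda>b'. 3 ^ n * ?I)" by (rule avg_mono) (rule IH(2))
  also have "\<dots> = 3 ^ n * ?I" using flip_out[OF Suc.prems(1)] by (intro avg_const) auto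
  finally have "(\<integral>q. \<bar>copiece (Suc n) b h q\<bar> \<partial>volume) \<le> 3 * (3 ^ n * ?I)"
    using IH(2)[OF flip_out[OF Suc.prems(1)]] by simp
  with int show ?case unfolding power_Suc mult.assoc by (rule conjI)
qed

lemma piece_bound:
  assumes B: "\<And>p. p \<in> points \<Longrightarrow> \<bar>f p\<bar> \<le> B" "0 \<le> B"
  shows "b \<in> bonds \<Longrightarrow> \<bar>piece n f b s\<bar> \<le> 3 ^ n * B"
proof (induction n arbitrary: b s)
  case 0
  then show ?case using B bpt_points[OF 0, of s] by simp
next
  case (Suc n)
  have "\<bar>scatter b (\<lambda>b'. piece n f b' (s - blen b))\<bar> \<le> 3 * (3 ^ n * B)"
    using Suc B(2) by (intro scatter_bound) (auto simp: out_def)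
  then show ?case by simp
qed

lemma piece_le:
  assumes B: "\<And>p. p \<in> points \<Longrightarrow> \<bar>f p\<bar> \<le> B" "0 \<le> B" and b: "b \<in> bonds"
  shows "\<bar>h s * piece n f b s\<bar> \<le> B * (3 ^ n * (indicator {real n * min_len..} s * \<bar>h s\<bar>))"
proof (cases "real n * min_len \<le> s")
  case True
  have "\<bar>h s\<bar> * \<bar>piece n f b s\<bar> \<le> \<bar>h s\<bar> * (3 ^ n * B)" by (intro mult_left_mono piece_bound B b) auto
  then show ?thesis using True by (simp add: abs_mult mult_ac)
next
  case False
  then show ?thesis using piece_zero[OF b, of s n f] B(2) by simp
qed

lemma integrable_piece:
  assumes f: "edge_measurable f" and B: "\<And>p. p \<in> points \<Longrightarrow> \<bar>f p\<bar> \<le> B" "0 \<le> B" and b: "b \<in> bonds"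
    and [measurable]: "h \<in> borel_measurable borel" and h: "integrable lborel (\<lambda>s. indicator {0..} s * h s)"
  shows "integrable lborel (\<lambda>s. h s * piece n f b s)"
proof (rule Bochner_Integration.integrable_bound)
  have [measurable]: "piece n f b \<in> borel_measurable borel" by (rule measurable_piece[OF f b])
  show "(\<lambda>s. h s * piece n f b s) \<in> borel_measurable lborel" by simp
  show "integrable lborel (\<lambda>s. B * (3 ^ n * (indicator {real n * min_len..} s * \<bar>h s\<bar>)))"
    using min_len_pos by (intro integrable_mult_right integrable_indicator_Ici h) simp
  show "AE s in lborel. norm (h s * piece n f b s) \<le> norm (B * (3 ^ n * (indicator {real n * min_len..} s * \<bar>h s\<bar>)))"
    using piece_le[OF B b, where h = h and n = n] by (intro AE_I2) (auto intro: order_trans[OF _ abs_ge_self])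
qed

text \<open>Both recursions scatter with the same finitely many coefficients, and translation
  invariance moves the shift by \<open>blen b\<close> from one factor to the other.\<close>

lemma copiece_piece:
  assumes f: "f \<in> borel_measurable graph_borel" and B: "\<And>p. p \<in> points \<Longrightarrow> \<bar>f p\<bar> \<le> B" "0 \<le> B"
  shows "b \<in> bonds \<Longrightarrow> h \<in> borel_measurable borel \<Longrightarrow> integrable lborel (\<lambda>s. indicator {0..} s * h s) \<Longrightarrow>
    (\<integral>q. copiece n b h q * f q \<partial>volume) = (\<integral>s. h s * piece n f b s \<partial>lborel)"
proof (induction n arbitrary: b h)
  case 0
  note [measurable] = 0(2)
  note fe = edge_measurable_borel[OF f]
  have [measurable]: "piece 0 f b \<in> borel_measurable borel" by (rule measurable_piece[OF fe 0(1)])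
  have int: "integrable lborel (\<lambda>s. h s * piece 0 f b s)" by (rule integrable_piece[OF fe B 0])
  then have int': "integrable lborel (\<lambda>s. indicator {0<..<blen b} s * (h s * piece 0 f b s))"
    using integrable_real_mult_indicator[of "{0<..<blen b}" lborel "\<lambda>s. h s * piece 0 f b s"] by (simp add: mult.commute)
  have "(\<integral>q. copiece 0 b h q * f q \<partial>volume)
      = (\<integral>q. (if q \<in> open_edge (fst b) then h (coord b q) * piece 0 f b (coord b q) else 0) \<partial>volume)"
    by (intro Bochner_Integration.integral_cong) (auto simp: coord_inner less_imp_le)
  also have "\<dots> = (\<integral>s. indicator {0<..<blen b} s * (h s * piece 0 f b s) \<partial>lborel)"
    by (rule volume_bond(2)[OF 0(1) _ int']) measurable
  \<comment> \<open>The interval in \<open>piece 0\<close> contains 0, the open edge does not; a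
    point is a null set.\<close>
  also have "\<dots> = (\<integral>s. h s * piece 0 f b s \<partial>lborel)"
  proof (rule integral_cong_AE)
    show "AE s in lborel. indicator {0<..<blen b} s * (h s * piece 0 f b s) = h s * piece 0 f b s"
      using AE_lborel_singleton[of 0] by eventually_elim (auto simp: indicator_def)
  qed measurable
  finally show ?case .
next
  case (Suc n)
  note [measurable] = Suc.prems(2)
  note fe = edge_measurable_borel[OF f]
  have l: "0 \<le> blen b" using blen_pos[OF Suc.prems(1)] by simp
  let ?h = "\<lambda>s. h (s + blen b)"
  have h: "?h \<in> borel_measurable borel" "integrable lborel (\<lambda>s. indicator {0..} s * ?h s)"
    using integrable_shift_Ici[OF Suc.prems(3) l] by auto
  have ci: "integrable volume (\<lambda>q. copiece n b' ?h q * f q)" if "b' \<in> bonds" for b'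
  proof (rule Bochner_Integration.integrable_bound)
    have c: "integrable volume (copiece n b' ?h)" using copiece_integrable[OF that h] by blast
    then show "integrable volume (\<lambda>q. B * copiece n b' ?h q)" by (rule integrable_mult_right)
    show "(\<lambda>q. copiece n b' ?h q * f q) \<in> borel_measurable volume"
      using f measurable_copiece[OF that h(1)] by measurable
    show "AE q in volume. norm (copiece n b' ?h q * f q) \<le> norm (B * copiece n b' ?h q)"
      using B by (intro AE_I2) (auto simp: abs_mult mult.commute[of "\<bar>copiece _ _ _ _\<bar>"] intro!: mult_right_mono)
  qed
  have shift: "(\<integral>s. ?h s * piece n f b' s \<partial>lborel) = (\<integral>s. h s * piece n f b' (s - blen b) \<partial>lborel)" for b'
    by (subst lborel_integral_real_affine[where c = 1 and t = "- blen b"]) auto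
  have si: "integrable lborel (\<lambda>s. h s * piece n f b' (s - blen b))" if "b' \<in> bonds" for b'
    using lborel_integrable_real_affine[OF integrable_piece[OF fe B that h], of 1 "- blen b"] by simp
  have pull: "scatter b (\<lambda>b'. X b' * c) = scatter b X * c" for X c
    using avg_cmult[of "org (flip b)" c X] by (simp add: scatter_def algebra_simps)
  have "(\<integral>q. copiece (Suc n) b h q * f q \<partial>volume) = (\<integral>q. scatter b (\<lambda>b'. copiece n b' ?h q * f q) \<partial>volume)"
    by (simp add: pull)
  also have "\<dots> = scatter b (\<lambda>b'. \<integral>q. copiece n b' ?h q * f q \<partial>volume)"
    by (rule integral_scatter(2)[OF Suc.prems(1) ci[OF out_bonds]])
  also have "\<dots> = scatter b (\<lambda>b'. \<integral>s. h s * piece n f b' (s - blen b) \<partial>lborel)"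
    using Suc.IH[OF out_bonds h] shift by (intro scatter_cong Suc.prems(1)) simp
  also have "\<dots> = (\<integral>s. scatter b (\<lambda>b'. h s * piece n f b' (s - blen b)) \<partial>lborel)"
    by (rule integral_scatter(2)[OF Suc.prems(1) si[OF out_bonds], symmetric])
  also have "\<dots> = (\<integral>s. h s * piece (Suc n) f b s \<partial>lborel)"
    using pull[of "\<lambda>b'. piece n f b' (_ - blen b)"] by (simp add: mult.commute[of "h _"])
  finally show ?case .
qed


text \<open>Twice the growth exponent needed for the number \<open>3\<^sup>n\<close> of weighted paths: it leaves
  room for a convergent geometric series.\<close>

definition rate6 :: real where "rate6 = ln 6 / min_len"

lemma rate6_nonneg: "0 \<le> rate6"
  using min_len_pos by (simp add: rate6_def)

lemma exp_rate6: "exp (rate6 * (real n * min_len)) = 6 ^ n"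
proof -
  have "rate6 * (real n * min_len) = real n * ln 6" using min_len_pos by (simp add: rate6_def)
  then have "exp (rate6 * (real n * min_len)) = exp (real n * ln 6)" by (simp only:)
  also have "\<dots> = exp (ln 6) ^ n" by (rule exp_of_nat_mult)
  finally show ?thesis by simp
qed

lemma exp_rate6_blen:
  assumes "b \<in> bonds" shows "6 \<le> exp (rate6 * blen b)"
proof -
  have "rate6 * (real 1 * min_len) \<le> rate6 * blen b"
    using blen_ge[OF assms] rate6_nonneg by (intro mult_left_mono) auto
  then have "exp (rate6 * (real 1 * min_len)) \<le> exp (rate6 * blen b)" by simp
  then show ?thesis unfolding exp_rate6 by simp
qed

text \<open>For each vertex the shift by \<open>blen b\<close> gains a factor of at most 1/6 and the
  scattering costs at most 3, which leaves 1/2.\<close>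

lemma copiece_bound:
  "b \<in> bonds \<Longrightarrow> 0 \<le> C \<Longrightarrow> (\<And>s. 0 \<le> s \<Longrightarrow> \<bar>h s\<bar> \<le> C * exp (- rate6 * s)) \<Longrightarrow> \<bar>copiece n b h q\<bar> \<le> C * (1/2) ^ n"
proof (induction n arbitrary: b h C)
  case 0
  have "\<bar>h (coord b q)\<bar> \<le> C" if "q \<in> open_edge (fst b)"
  proof -
    have "\<bar>h (coord b q)\<bar> \<le> C * exp (- rate6 * coord b q)"
      using coord_inner(1)[OF that] by (intro 0) simp
    also have "\<dots> \<le> C * 1"
      using 0(2) rate6_nonneg coord_inner(1)[OF that] by (intro mult_left_mono) auto
    finally show ?thesis by simp
  qed
  then show ?case using 0(2) by simp
next
  case (Suc n)
  have "\<bar>copiece n b' (\<lambda>s. h (s + blen b)) q\<bar> \<le> (C / 6) * (1/2) ^ n" if "b' \<in> out (org (flip b))" for b'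
  proof (rule Suc.IH[OF out_bonds[OF that]])
    show "0 \<le> C / 6" using Suc.prems by simp
    fix s :: real assume s: "0 \<le> s"
    have "\<bar>h (s + blen b)\<bar> \<le> C * exp (- rate6 * (s + blen b))"
      using s blen_pos[OF Suc.prems(1)] by (intro Suc.prems) simp
    also have "\<dots> = C * exp (- rate6 * s) * (1 / exp (rate6 * blen b))"
      by (simp add: exp_add[symmetric] exp_minus[symmetric] divide_inverse algebra_simps)
    also have "\<dots> \<le> C * exp (- rate6 * s) * (1 / 6)"
      using exp_rate6_blen[OF Suc.prems(1)] Suc.prems(2) by (intro mult_left_mono divide_left_mono) auto
    finally show "\<bar>h (s + blen b)\<bar> \<le> C / 6 * exp (- rate6 * s)" by simp
  qed
  then have "\<bar>scatter b (\<lambda>b'. copiece n b' (\<lambda>s. h (s + blen b)) q)\<bar> \<le> 3 * ((C / 6) * (1/2) ^ n)"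
    using Suc.prems by (intro scatter_bound) auto
  then show ?case by simp
qed

definition cosum :: "'e \<times> bool \<Rightarrow> (real \<Rightarrow> real) \<Rightarrow> ('v, 'e) point \<Rightarrow> real" where
  "cosum b h q = (\<Sum>n. copiece n b h q)"

text \<open>The pointwise bound on h makes the series converge at every q. The weighted
  integrability makes it converge in L^1, again with ratio 1/2, so that sum and integral may be
  exchanged on both sides of the duality.\<close>

lemma cosum:
  assumes b: "b \<in> bonds" and h: "h \<in> borel_measurable borel"
    and C: "0 \<le> C" "\<And>s. 0 \<le> s \<Longrightarrow> \<bar>h s\<bar> \<le> C * exp (- rate6 * s)"
    and int: "integrable lborel (\<lambda>s. indicator {0..} s * (exp (rate6 * s) * h s))"
  shows "integrable volume (cosum b h)"
    and "f \<in> borel_measurable graph_borel \<Longrightarrow> (\<And>p. p \<in> points \<Longrightarrow> \<bar>f p\<bar> \<le> B) \<Longrightarrow> 0 \<le> B \<Longrightarrow>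
      integrable volume (\<lambda>q. cosum b h q * f q)
      \<and> integrable lborel (\<lambda>s. h s * forward f b s)
      \<and> (\<integral>q. cosum b h q * f q \<partial>volume) = (\<integral>s. h s * forward f b s \<partial>lborel)"
proof -
  note [measurable] = h
  define E where "E = (\<integral>s. indicator {0..} s * (exp (rate6 * s) * \<bar>h s\<bar>) \<partial>lborel)"
  have intE: "integrable lborel (\<lambda>s. indicator {0..} s * (exp (rate6 * s) * \<bar>h s\<bar>))"
    using integrable_abs[OF int] by (simp add: abs_mult)
  have hint: "integrable lborel (\<lambda>s. indicator {0..} s * h s)"
  proof (rule Bochner_Integration.integrable_bound[OF intE])
    have "1 * \<bar>h s\<bar> \<le> exp (rate6 * s) * \<bar>h s\<bar>" if "0 \<le> s" for s
      using that rate6_nonneg by (intro mult_right_mono) auto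
    then show "AE s in lborel. norm (indicator {0..} s * h s) \<le> norm (indicator {0..} s * (exp (rate6 * s) * \<bar>h s\<bar>))"
      by (intro AE_I2) (auto simp: indicator_def abs_mult)
  qed simp
  \<comment> \<open>Beyond n times \<open>min_len\<close> the weight is at least 6^n; this pays for
    3^n and leaves (1/2)^n.\<close>
  have tail: "3 ^ n * (\<integral>s. indicator {real n * min_len..} s * \<bar>h s\<bar> \<partial>lborel) \<le> E * (1/2) ^ n" for n
  proof -
    have "3 ^ n * (\<integral>s. indicator {real n * min_len..} s * \<bar>h s\<bar> \<partial>lborel)
        = (\<integral>s. 3 ^ n * (indicator {real n * min_len..} s * \<bar>h s\<bar>) \<partial>lborel)" by simp
    also have "\<dots> \<le> (\<integral>s. (1/2) ^ n * (indicator {0..} s * (exp (rate6 * s) * \<bar>h s\<bar>)) \<partial>lborel)"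
    proof (rule integral_mono')
      show "integrable lborel (\<lambda>s. (1/2) ^ n * (indicator {0..} s * (exp (rate6 * s) * \<bar>h s\<bar>)))"
        using intE by (rule integrable_mult_right)
      fix s
      show "3 ^ n * (indicator {real n * min_len..} s * \<bar>h s\<bar>) \<le> (1/2) ^ n * (indicator {0..} s * (exp (rate6 * s) * \<bar>h s\<bar>))"
      proof (cases "real n * min_len \<le> s")
        case True
        have "rate6 * (real n * min_len) \<le> rate6 * s" by (rule mult_left_mono[OF True rate6_nonneg])
        then have "exp (rate6 * (real n * min_len)) \<le> exp (rate6 * s)" by simp
        then have "6 ^ n \<le> exp (rate6 * s)" by (simp only: exp_rate6)
        moreover have "(3::real) ^ n = (1/2) ^ n * 6 ^ n" by (simp add: power_mult_distrib[symmetric])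
        ultimately have "3 ^ n \<le> (1/2) ^ n * exp (rate6 * s)" by simp
        then have "3 ^ n * \<bar>h s\<bar> \<le> (1/2) ^ n * exp (rate6 * s) * \<bar>h s\<bar>" by (rule mult_right_mono) simp
        moreover have "0 \<le> real n * min_len" using min_len_pos by simp
        then have "0 \<le> s" using True by linarith
        ultimately show ?thesis using True by (simp add: mult.assoc)
      qed auto
    qed auto
    also have "\<dots> = E * (1/2) ^ n" using intE by (simp add: E_def)
    finally show ?thesis .
  qed
  have ci: "integrable volume (copiece n b h)" "(\<integral>q. \<bar>copiece n b h q\<bar> \<partial>volume) \<le> E * (1/2) ^ n" for n
    using copiece_integrable[OF b h hint, of n] tail[of n] by auto
  have half: "summable (\<lambda>n. K * (1/2) ^ n)" for K :: real
    by (intro summable_mult summable_geometric) simp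
  have cb: "\<bar>copiece n b h q\<bar> \<le> C * (1/2) ^ n" for n q by (rule copiece_bound[OF b C])
  have sc: "summable (\<lambda>n. \<bar>copiece n b h q\<bar>)" for q
    by (rule summable_comparison_test'[OF half[of C], of 0]) (simp add: cb)
  have si: "summable (\<lambda>n. \<integral>q. \<bar>copiece n b h q\<bar> \<partial>volume)"
    by (rule summable_comparison_test'[OF half[of E], of 0])
      (simp add: ci(2) Bochner_Integration.integral_nonneg)
  show "integrable volume (cosum b h)"
    unfolding cosum_def[abs_def]
    by (rule integrable_suminf) (use ci(1) sc si in auto)
  show "integrable volume (\<lambda>q. cosum b h q * f q)
      \<and> integrable lborel (\<lambda>s. h s * forward f b s)
      \<and> (\<integral>q. cosum b h q * f q \<partial>volume) = (\<integral>s. h s * forward f b s \<partial>lborel)"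
    if f: "f \<in> borel_measurable graph_borel" and B: "\<And>p. p \<in> points \<Longrightarrow> \<bar>f p\<bar> \<le> B" "0 \<le> B"
  proof -
    note fe = edge_measurable_borel[OF f]
    have le: "\<bar>copiece n b h q * f q\<bar> \<le> B * \<bar>copiece n b h q\<bar>" if "q \<in> points" for n q
      using mult_left_mono[OF B(1)[OF that], of "\<bar>copiece n b h q\<bar>"] by (simp add: abs_mult mult.commute)
    have cfi: "integrable volume (\<lambda>q. copiece n b h q * f q)" for n
    proof (rule Bochner_Integration.integrable_bound[OF integrable_mult_right[OF ci(1)[of n], of B]])
      show "(\<lambda>q. copiece n b h q * f q) \<in> borel_measurable volume"
        using f measurable_copiece[OF b h] by measurable
      show "AE q in volume. norm (copiece n b h q * f q) \<le> norm (B * copiece n b h q)"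
        using le B(2) by (intro AE_I2) (auto simp: abs_mult)
    qed
    have scf: "summable (\<lambda>n. norm (copiece n b h q * f q))" if "q \<in> points" for q
      by (rule summable_comparison_test'[OF summable_mult[OF sc[of q], of B], of 0]) (use le[OF that] in simp)
    have sif: "summable (\<lambda>n. \<integral>q. norm (copiece n b h q * f q) \<partial>volume)"
    proof (rule summable_comparison_test'[OF summable_mult[OF si, of B], of 0])
      fix n :: nat
      have "(\<integral>q. norm (copiece n b h q * f q) \<partial>volume) \<le> (\<integral>q. B * \<bar>copiece n b h q\<bar> \<partial>volume)"
        using cfi[of n] ci(1)[of n] le by (intro integral_mono) auto
      then show "norm (\<integral>q. norm (copiece n b h q * f q) \<partial>volume) \<le> B * (\<integral>q. \<bar>copiece n b h q\<bar> \<partial>volume)"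
        by (simp add: Bochner_Integration.integral_nonneg)
    qed
    have eq1: "(\<Sum>n. copiece n b h q * f q) = cosum b h q * f q" for q
      unfolding cosum_def by (rule suminf_mult2[symmetric]) (rule summable_rabs_cancel[OF sc])
    have pi: "integrable lborel (\<lambda>s. h s * piece n f b s)" for n
      by (rule integrable_piece[OF fe B b h hint])
    have sp: "summable (\<lambda>n. norm (h s * piece n f b s))" for s
    proof -
      obtain N where "s < real N * min_len" using ex_less_min_len by blast
      have "piece n f b s = 0" if "n \<notin> {..<N}" for n
      proof (rule piece_zero[OF b])
        have "real N * min_len \<le> real n * min_len" using that min_len_pos by simp
        with \<open>s < real N * min_len\<close> show "s < real n * min_len" by linarith
      qed
      then show ?thesis by (intro summable_finite[of "{..<N}"]) auto
    qed
    have spi: "summable (\<lambda>n. \<integral>s. norm (h s * piece n f b s) \<partial>lborel)"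
    proof (rule summable_comparison_test'[OF half[of "B * E"], of 0])
      fix n :: nat
      have i: "integrable lborel (\<lambda>s. indicator {real n * min_len..} s * \<bar>h s\<bar>)"
        using min_len_pos by (intro integrable_indicator_Ici hint) simp
      have "(\<integral>s. norm (h s * piece n f b s) \<partial>lborel)
          \<le> (\<integral>s. B * (3 ^ n * (indicator {real n * min_len..} s * \<bar>h s\<bar>)) \<partial>lborel)"
      proof (rule integral_mono)
        show "integrable lborel (\<lambda>s. norm (h s * piece n f b s))" by (rule integrable_norm[OF pi])
        show "integrable lborel (\<lambda>s. B * (3 ^ n * (indicator {real n * min_len..} s * \<bar>h s\<bar>)))"
          by (intro integrable_mult_right i)
        show "norm (h s * piece n f b s) \<le> B * (3 ^ n * (indicator {real n * min_len..} s * \<bar>h s\<bar>))" for s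
          unfolding real_norm_def by (rule piece_le[OF B b])
      qed
      also have "\<dots> = B * (3 ^ n * (\<integral>s. indicator {real n * min_len..} s * \<bar>h s\<bar> \<partial>lborel))" by simp
      also have "\<dots> \<le> B * (E * (1/2) ^ n)" by (rule mult_left_mono[OF tail B(2)])
      finally show "norm (\<integral>s. norm (h s * piece n f b s) \<partial>lborel) \<le> B * E * (1/2) ^ n"
        by (simp add: Bochner_Integration.integral_nonneg mult.assoc)
    qed
    have eq2: "(\<Sum>n. h s * piece n f b s) = h s * forward f b s" for s
      unfolding forward_def by (rule suminf_mult) (rule sums_summable[OF forward_sums[OF b]])
    have "integrable volume (\<lambda>q. \<Sum>n. copiece n b h q * f q)"
      by (rule integrable_suminf) (use cfi scf sif in auto)
    moreover have "integrable lborel (\<lambda>s. \<Sum>n. h s * piece n f b s)"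
      by (rule integrable_suminf) (use pi sp spi in auto)
    moreover have "(\<integral>q. (\<Sum>n. copiece n b h q * f q) \<partial>volume) = (\<integral>s. (\<Sum>n. h s * piece n f b s) \<partial>lborel)"
    proof -
      have "(\<integral>q. (\<Sum>n. copiece n b h q * f q) \<partial>volume) = (\<Sum>n. \<integral>q. copiece n b h q * f q \<partial>volume)"
        by (rule integral_suminf) (use cfi scf sif in auto)
      also have "\<dots> = (\<Sum>n. \<integral>s. h s * piece n f b s \<partial>lborel)"
        by (simp only: copiece_piece[OF f B b h hint])
      also have "\<dots> = (\<integral>s. (\<Sum>n. h s * piece n f b s) \<partial>lborel)"
        by (rule integral_suminf[symmetric]) (use pi sp spi in auto)
      finally show ?thesis .
    qed
    ultimately show ?thesis unfolding eq1 eq2 by blast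
  qed
qed

section \<open>Gaussian densities on the two half-lines\<close>

definition gd :: "real \<Rightarrow> real \<Rightarrow> real" where "gd t = normal_density 0 (sqrt (2 * t))"

lemma gd_integrable: "0 < t \<Longrightarrow> integrable lborel (\<lambda>u. gd t u * exp (a * \<bar>u\<bar>))"
  using gauss_exp_integrable[of t a] by (simp add: gd_def gauss_density integrable_density)

lemma gd_minus: "gd t (- u) = gd t u"
  by (simp add: gd_def normal_density_def)

text \<open>The exponent a u - u^2 / (4 t) is largest at u = 2 a t, with value a^2 t.\<close>

lemma gd_exp_le:
  assumes t: "0 < t"
  shows "gd t u * exp (a * u) \<le> 1 / sqrt (4 * pi * t) * exp (a\<^sup>2 * t)"
proof -
  have "a * u - u\<^sup>2 / (4 * t) \<le> a\<^sup>2 * t"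
  proof -
    have "0 \<le> (u - 2 * a * t)\<^sup>2 / (4 * t)" using t by simp
    also have "(u - 2 * a * t)\<^sup>2 / (4 * t) = u\<^sup>2 / (4 * t) - a * u + a\<^sup>2 * t"
      using t by (simp add: power2_eq_square field_simps)
    finally show ?thesis by linarith
  qed
  then have "exp (- u\<^sup>2 / (4 * t)) * exp (a * u) \<le> exp (a\<^sup>2 * t)" by (simp add: exp_add[symmetric])
  then have "1 / sqrt (4 * pi * t) * (exp (- u\<^sup>2 / (4 * t)) * exp (a * u)) \<le> 1 / sqrt (4 * pi * t) * exp (a\<^sup>2 * t)"
    using t by (intro mult_left_mono) auto
  moreover have "gd t u = 1 / sqrt (4 * pi * t) * exp (- u\<^sup>2 / (4 * t))"
    using t by (simp add: gd_def normal_density_def mult_ac)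
  ultimately show ?thesis by (simp add: mult.assoc)
qed

lemma gd_nonneg: "0 \<le> gd t u"
  by (simp add: gd_def)

lemma measurable_gd [measurable]: "gd t \<in> borel_measurable borel"
  by (simp add: gd_def)

text \<open>The two halves of the line as seen from the point at distance \<open>x\<close> along an oriented edge of
  length \<open>l\<close>: the half through the endpoint, and the half through the origin, which is run
  through along the reversed edge.\<close>

definition ahead :: "real \<Rightarrow> real \<Rightarrow> real \<Rightarrow> real" where
  "ahead t x s = (if 0 \<le> s then gd t (s - x) else 0)"

definition behind :: "real \<Rightarrow> real \<Rightarrow> real \<Rightarrow> real \<Rightarrow> real" where
  "behind t l x s = (if l < s then gd t (l - s - x) else 0)"

lemma ahead_bounds:
  assumes t: "0 < t"
  shows "ahead t x \<in> borel_measurable borel"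
    and "\<exists>C\<ge>0. \<forall>s\<ge>0. \<bar>ahead t x s\<bar> \<le> C * exp (- rate6 * s)"
    and "integrable lborel (\<lambda>s. indicator {0..} s * (exp (rate6 * s) * ahead t x s))"
proof -
  show [measurable]: "ahead t x \<in> borel_measurable borel" unfolding ahead_def[abs_def] by measurable
  let ?C = "1 / sqrt (4 * pi * t) * exp (rate6\<^sup>2 * t) * exp (rate6 * x)"
  have "\<bar>ahead t x s\<bar> \<le> ?C * exp (- rate6 * s)" for s
  proof -
    have "gd t (s - x) * exp (rate6 * (s - x)) * exp (rate6 * x) \<le> ?C"
      by (intro mult_right_mono gd_exp_le[OF t]) simp
    then have "gd t (s - x) * exp (rate6 * s) \<le> ?C"
      by (simp add: mult.assoc exp_add[symmetric] right_diff_distrib)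
    then have "gd t (s - x) * exp (rate6 * s) * exp (- rate6 * s) \<le> ?C * exp (- rate6 * s)"
      by (rule mult_right_mono) simp
    then have "gd t (s - x) \<le> ?C * exp (- rate6 * s)" by (simp add: mult.assoc exp_add[symmetric])
    then show ?thesis using gd_nonneg[of t "s - x"] t by (simp add: ahead_def)
  qed
  moreover have "0 \<le> ?C" using t by simp
  ultimately show "\<exists>C\<ge>0. \<forall>s\<ge>0. \<bar>ahead t x s\<bar> \<le> C * exp (- rate6 * s)" by blast
  have "integrable lborel (\<lambda>s. exp (rate6 * x) * (gd t (- x + 1 * s) * exp (rate6 * \<bar>- x + 1 * s\<bar>)))"
    by (intro integrable_mult_right lborel_integrable_real_affine[OF gd_integrable[OF t]]) simp
  then show "integrable lborel (\<lambda>s. indicator {0..} s * (exp (rate6 * s) * ahead t x s))"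
  proof (rule Bochner_Integration.integrable_bound)
    show "(\<lambda>s. indicator {0..} s * (exp (rate6 * s) * ahead t x s)) \<in> borel_measurable lborel" by measurable
    have "exp (rate6 * s) * gd t (s - x) \<le> exp (rate6 * x) * (gd t (s - x) * exp (rate6 * \<bar>s - x\<bar>))" for s
    proof -
      have "rate6 * s \<le> rate6 * x + rate6 * \<bar>s - x\<bar>"
        unfolding distrib_left[symmetric] using rate6_nonneg by (intro mult_left_mono) auto
      then have "exp (rate6 * s) \<le> exp (rate6 * x) * exp (rate6 * \<bar>s - x\<bar>)" by (simp add: exp_add[symmetric])
      from mult_right_mono[OF this gd_nonneg[of t "s - x"]] show ?thesis by (simp add: mult_ac)
    qed
    then show "AE s in lborel. norm (indicator {0..} s * (exp (rate6 * s) * ahead t x s))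
        \<le> norm (exp (rate6 * x) * (gd t (- x + 1 * s) * exp (rate6 * \<bar>- x + 1 * s\<bar>)))"
      by (intro AE_I2) (auto simp: indicator_def ahead_def abs_mult gd_nonneg)
  qed
qed

lemma behind_bounds:
  assumes t: "0 < t"
  shows "behind t l x \<in> borel_measurable borel"
    and "\<exists>C\<ge>0. \<forall>s\<ge>0. \<bar>behind t l x s\<bar> \<le> C * exp (- rate6 * s)"
    and "integrable lborel (\<lambda>s. indicator {0..} s * (exp (rate6 * s) * behind t l x s))"
proof -
  have eq: "gd t (l - s - x) = gd t (s - (l - x))" for s
    using gd_minus[of t "s - (l - x)"] by (simp add: algebra_simps)
  show m [measurable]: "behind t l x \<in> borel_measurable borel" unfolding behind_def[abs_def] by measurable
  have le: "\<bar>behind t l x s\<bar> \<le> \<bar>ahead t (l - x) s\<bar>" if "0 \<le> s" for s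
    using that by (auto simp: behind_def ahead_def eq)
  show "\<exists>C\<ge>0. \<forall>s\<ge>0. \<bar>behind t l x s\<bar> \<le> C * exp (- rate6 * s)"
    using ahead_bounds(2)[OF t, of "l - x"] le order_trans by meson
  show "integrable lborel (\<lambda>s. indicator {0..} s * (exp (rate6 * s) * behind t l x s))"
  proof (rule Bochner_Integration.integrable_bound[OF ahead_bounds(3)[OF t, of "l - x"]])
    show "(\<lambda>s. indicator {0..} s * (exp (rate6 * s) * behind t l x s)) \<in> borel_measurable lborel" by measurable
    show "AE s in lborel. norm (indicator {0..} s * (exp (rate6 * s) * behind t l x s))
        \<le> norm (indicator {0..} s * (exp (rate6 * s) * ahead t (l - x) s))"
      using le by (intro AE_I2) (auto simp: indicator_def abs_mult intro!: mult_left_mono)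
  qed
qed

definition heat_kernel :: "real \<Rightarrow> ('v, 'e) point \<Rightarrow> ('v, 'e) point \<Rightarrow> real" where
  "heat_kernel t p q = cosum (bond p) (ahead t (pos p)) q
     + cosum (flip (bond p)) (behind t (blen (bond p)) (pos p)) q"

lemma cosum_ahead:
  assumes t: "0 < t" and b: "b \<in> bonds"
  shows "integrable volume (cosum b (ahead t x))"
    and "f \<in> borel_measurable graph_borel \<Longrightarrow> (\<And>p. p \<in> points \<Longrightarrow> \<bar>f p\<bar> \<le> B) \<Longrightarrow> 0 \<le> B \<Longrightarrow>
      integrable volume (\<lambda>q. cosum b (ahead t x) q * f q)
      \<and> integrable lborel (\<lambda>s. ahead t x s * forward f b s)
      \<and> (\<integral>q. cosum b (ahead t x) q * f q \<partial>volume) = (\<integral>s. ahead t x s * forward f b s \<partial>lborel)"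
proof -
  obtain C where C: "0 \<le> C" "\<And>s. 0 \<le> s \<Longrightarrow> \<bar>ahead t x s\<bar> \<le> C * exp (- rate6 * s)"
    using ahead_bounds(2)[OF t, of x] by blast
  note c = cosum[OF b ahead_bounds(1)[OF t] C ahead_bounds(3)[OF t]]
  show "integrable volume (cosum b (ahead t x))" by (rule c(1))
  show "f \<in> borel_measurable graph_borel \<Longrightarrow> (\<And>p. p \<in> points \<Longrightarrow> \<bar>f p\<bar> \<le> B) \<Longrightarrow> 0 \<le> B \<Longrightarrow>
      integrable volume (\<lambda>q. cosum b (ahead t x) q * f q)
      \<and> integrable lborel (\<lambda>s. ahead t x s * forward f b s)
      \<and> (\<integral>q. cosum b (ahead t x) q * f q \<partial>volume) = (\<integral>s. ahead t x s * forward f b s \<partial>lborel)"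
    by (rule c(2))
qed

lemma cosum_behind:
  assumes t: "0 < t" and b: "b \<in> bonds"
  shows "integrable volume (cosum b (behind t l x))"
    and "f \<in> borel_measurable graph_borel \<Longrightarrow> (\<And>p. p \<in> points \<Longrightarrow> \<bar>f p\<bar> \<le> B) \<Longrightarrow> 0 \<le> B \<Longrightarrow>
      integrable volume (\<lambda>q. cosum b (behind t l x) q * f q)
      \<and> integrable lborel (\<lambda>s. behind t l x s * forward f b s)
      \<and> (\<integral>q. cosum b (behind t l x) q * f q \<partial>volume) = (\<integral>s. behind t l x s * forward f b s \<partial>lborel)"
proof -
  obtain C where C: "0 \<le> C" "\<And>s. 0 \<le> s \<Longrightarrow> \<bar>behind t l x s\<bar> \<le> C * exp (- rate6 * s)"
    using behind_bounds(2)[OF t, of l x] by blast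
  note c = cosum[OF b behind_bounds(1)[OF t] C behind_bounds(3)[OF t]]
  show "integrable volume (cosum b (behind t l x))" by (rule c(1))
  show "f \<in> borel_measurable graph_borel \<Longrightarrow> (\<And>p. p \<in> points \<Longrightarrow> \<bar>f p\<bar> \<le> B) \<Longrightarrow> 0 \<le> B \<Longrightarrow>
      integrable volume (\<lambda>q. cosum b (behind t l x) q * f q)
      \<and> integrable lborel (\<lambda>s. behind t l x s * forward f b s)
      \<and> (\<integral>q. cosum b (behind t l x) q * f q \<partial>volume) = (\<integral>s. behind t l x s * forward f b s \<partial>lborel)"
    by (rule c(2))
qed

lemma heat_kernel_integrable:
  assumes t: "0 < t" and p: "p \<in> points"
  shows "integrable volume (heat_kernel t p)"
  unfolding heat_kernel_def[abs_def]
  by (intro Bochner_Integration.integrable_add cosum_ahead cosum_behind t) (simp_all add: bond_pos(1)[OF p])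

text \<open>The duality turns the two summands of the kernel into integrals of
  \<open>forward\<close> along the edge and along its reversal. Reflecting the second integral at
  the edge glues both to one integral over the line.\<close>

lemma heat_kernel_integral:
  assumes t: "0 < t" and p: "p \<in> points"
    and f: "f \<in> borel_measurable graph_borel" and B: "\<And>p. p \<in> points \<Longrightarrow> \<bar>f p\<bar> \<le> B" "0 \<le> B"
  shows "(\<integral>q. heat_kernel t p q * f q \<partial>volume) = convol (gauss t) (unfold f (bond p)) (pos p)"
proof -
  define b x l where "b = bond p" and "x = pos p" and "l = blen b"
  have b: "b \<in> bonds" "flip b \<in> bonds" using bond_pos(1)[OF p] by (auto simp: b_def)
  note fe = edge_measurable_borel[OF f]
  have [measurable]: "unfold f b \<in> borel_measurable borel" "forward f (flip b) \<in> borel_measurable borel"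
    by (auto intro: measurable_unfold[OF fe b(1)] measurable_forward[OF fe b(2)])
  note A = cosum_ahead(2)[OF t b(1) f B, of x]
  note Bh = cosum_behind(2)[OF t b(2) f B, of l x]
  have "(\<integral>q. heat_kernel t p q * f q \<partial>volume)
      = (\<integral>q. cosum b (ahead t x) q * f q + cosum (flip b) (behind t l x) q * f q \<partial>volume)"
    by (simp add: heat_kernel_def b_def x_def l_def distrib_right)
  also have "\<dots> = (\<integral>s. ahead t x s * forward f b s \<partial>lborel) + (\<integral>s. behind t l x s * forward f (flip b) s \<partial>lborel)"
    using A Bh by simp
  also have "(\<integral>s. behind t l x s * forward f (flip b) s \<partial>lborel)
      = (\<integral>s. behind t l x (l - s) * forward f (flip b) (l - s) \<partial>lborel)"
    by (subst lborel_integral_real_affine[where c = "-1" and t = l]) auto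
  also have "(\<integral>s. ahead t x s * forward f b s \<partial>lborel) + \<dots>
      = (\<integral>s. ahead t x s * forward f b s + behind t l x (l - s) * forward f (flip b) (l - s) \<partial>lborel)"
    using A Bh lborel_integrable_real_affine[of "\<lambda>s. behind t l x s * forward f (flip b) s" "-1" l] by simp
  also have "\<dots> = (\<integral>s. gd t (s - x) * unfold f b s \<partial>lborel)"
    \<comment> \<open>After the reflection, the conditions in \<open>ahead\<close> and
      \<open>behind\<close> read 0 \<le> s and s < 0: exactly the case distinction in
      \<open>unfold\<close>.\<close>
    by (intro Bochner_Integration.integral_cong) (auto simp: ahead_def behind_def unfold_def l_def)
  also have "\<dots> = (\<integral>y. gd t y * unfold f b (x + y) \<partial>lborel)"
    by (subst lborel_integral_real_affine[where c = 1 and t = x]) auto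
  also have "\<dots> = convol (gauss t) (unfold f b) x"
    unfolding convol_def gauss_density[OF t] gd_def by (subst integral_density) auto
  finally show ?thesis by (simp add: b_def x_def)
qed

text \<open>For each of the countably many values of \<open>bond p\<close>, the kernel depends on p
  through \<open>pos p\<close> alone.\<close>

lemma heat_kernel_measurable:
  assumes t: "0 < t"
  shows "(\<lambda>(p, q). heat_kernel t p q) \<in> borel_measurable (graph_borel \<Otimes>\<^sub>M graph_borel)"
proof -
  let ?M = "graph_borel \<Otimes>\<^sub>M graph_borel"
  have shift: "(\<lambda>w. (pos (fst w), snd w)) \<in> measurable ?M (borel \<Otimes>\<^sub>M graph_borel)"
    using measurable_compose[OF measurable_fst measurable_pos] by (intro measurable_Pair) auto
  have part: "(\<lambda>w. cosum b (H (pos (fst w))) (snd w)) \<in> borel_measurable ?M"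
    if b: "b \<in> bonds" and H: "(\<lambda>(x, s). H x s) \<in> borel_measurable (borel \<Otimes>\<^sub>M borel)" for b H
  proof -
    have "(\<lambda>w. copiece n b (H (pos (fst w))) (snd w)) \<in> borel_measurable ?M" for n
      using measurable_compose[OF shift measurable_copiece_joint[OF b H, of n]] by simp
    then show ?thesis unfolding cosum_def by (intro borel_measurable_suminf)
  qed
  have H: "(\<lambda>(x, s). ahead t x s) \<in> borel_measurable (borel \<Otimes>\<^sub>M borel)"
    "(\<lambda>(x, s). behind t l x s) \<in> borel_measurable (borel \<Otimes>\<^sub>M borel)" for l
    unfolding ahead_def behind_def by measurable
  have "(\<lambda>w. (\<lambda>b w. cosum b (ahead t (pos (fst w))) (snd w) + cosum (flip b) (behind t (blen b) (pos (fst w))) (snd w))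
      (bond (fst w)) w) \<in> borel_measurable ?M"
  proof (rule measurable_compose_countable'[OF _ _ countable_bonds])
    fix b assume "b \<in> bonds"
    then show "(\<lambda>w. cosum b (ahead t (pos (fst w))) (snd w) + cosum (flip b) (behind t (blen b) (pos (fst w))) (snd w))
      \<in> borel_measurable ?M"
      by (intro borel_measurable_add part H) auto
  qed (rule measurable_compose[OF measurable_fst measurable_bond])
  then show ?thesis by (simp add: heat_kernel_def split_beta)
qed

lemma C0_borel:
  assumes f: "f \<in> C0" shows "f \<in> borel_measurable graph_borel"
proof (rule borel_measurableI)
  fix S :: "real set" assume "open S"
  moreover have "continuous_map graph_topology euclideanreal f" using f by (simp add: C0_def)
  ultimately have "openin graph_topology {p \<in> topspace graph_topology. f p \<in> S}"
    by (intro openin_continuous_map_preimage) auto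
  then have "{p \<in> points. f p \<in> S} \<in> sets graph_borel" by (intro openin_graph_borel) simp
  moreover have "f -` S \<inter> space graph_borel = {p \<in> points. f p \<in> S}" by auto
  ultimately show "f -` S \<inter> space graph_borel \<in> sets graph_borel" by simp
qed

lemma heat_integral_kernel:
  assumes T: "heat_semigroup T"
  shows "integral_kernel T heat_kernel"
  unfolding integral_kernel_def
proof (intro allI impI conjI ballI)
  fix t :: real assume t: "0 < t"
  show "(\<lambda>(p, q). heat_kernel t p q) \<in> borel_measurable (graph_borel \<Otimes>\<^sub>M graph_borel)"
    by (rule heat_kernel_measurable[OF t])
  fix p assume p: "p \<in> points"
  show "integrable volume (heat_kernel t p)" by (rule heat_kernel_integrable[OF t p])
  fix f assume f: "f \<in> C0"
  obtain B where B: "0 \<le> B" "\<And>p. \<bar>f p\<bar> \<le> B" using C0_bounded[OF f] by blast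
  have "T t f p = heat t f p" using heat_unique[OF T _ f, of t] t by simp
  also have "\<dots> = convol (gauss t) (unfold f (bond p)) (pos p)"
    using p by (simp add: heat_def conv_op_def fold_def)
  finally show "T t f p = (\<integral>q. heat_kernel t p q * f q \<partial>volume)"
    using heat_kernel_integral[OF t p C0_borel[OF f] B(2,1)] by simp
qed

text \<open>Continuity on each closed edge suffices. The convolved family is still compatible
  although f is only Borel; hence by \<open>fold_bpt\<close> a whole closed edge can be evaluated in
  one orientation, including endpoints that are represented by other edges.\<close>

lemma heat_strong_feller:
  assumes T: "heat_semigroup T"
  shows "strong_feller T"
  unfolding strong_feller_def
proof (intro exI[of _ heat_kernel] conjI allI impI ballI heat_integral_kernel[OF T])
  fix t :: real and f :: "('v, 'e) point \<Rightarrow> real"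
  assume t: "0 < t" and f: "f \<in> borel_measurable graph_borel" and bd: "bounded (f ` points)"
  obtain B0 where "\<And>p. p \<in> points \<Longrightarrow> \<bar>f p\<bar> \<le> B0" using bd by (auto simp: bounded_iff)
  then have B: "\<bar>f p\<bar> \<le> max 0 B0" if "p \<in> points" for p using that by (meson max.coboundedI2)
  have B0: "0 \<le> max 0 B0" by simp
  note fe = edge_measurable_borel[OF f]
  have eb: "exp_bounded rate (unfold f b)" if "b \<in> bonds" for b
    by (rule exp_bounded_unfold[OF fe B that])
  let ?\<psi> = "\<lambda>b. convol (gauss t) (unfold f b)"
  note M = sym_kernel_gauss[OF less_imp_le[OF t], of rate]
  have \<psi>: "compatible ?\<psi>" by (rule compatible_convol[OF compatible_unfold eb M])
  have val: "(\<integral>q. heat_kernel t p q * f q \<partial>volume) = fold ?\<psi> p" if "p \<in> points" for p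
    using heat_kernel_integral[OF t that f B B0] that by (simp add: fold_def)
  show "continuous_map graph_topology euclideanreal (\<lambda>p. \<integral>q. heat_kernel t p q * f q \<partial>volume)"
    unfolding graph_continuous_iff
  proof
    fix e assume e: "e \<in> arcs G"
    then have b: "(e, True) \<in> bonds" by (simp add: bonds_def)
    have "continuous_on {0..len e} (?\<psi> (e, True))"
      using isCont_convol_gauss[OF rate_nonneg t eb[OF b]] by (simp add: continuous_at_imp_continuous_on)
    moreover have "?\<psi> (e, True) x = (\<integral>q. heat_kernel t (chart e x) q * f q \<partial>volume)" if "x \<in> {0..len e}" for x
      using that fold_bpt[OF \<psi> b, of x] chart_in_points[OF e, of x] val[of "chart e x"]
      by (simp add: blen_def bpt_def)
    ultimately show "continuous_on {0..len e} (\<lambda>x. \<integral>q. heat_kernel t (chart e x) q * f q \<partial>volume)"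
      by (rule continuous_on_eq)
  qed
  have "\<bar>fold ?\<psi> p\<bar> \<le> 3 * max 0 B0 * (\<integral>y. exp (rate * \<bar>y\<bar>) \<partial>gauss t)" if p: "p \<in> points" for p
  proof -
    note bp = bond_pos[OF p]
    have "\<bar>convol (gauss t) (unfold f (bond p)) (pos p)\<bar> \<le> 3 * max 0 B0 * (\<integral>y. exp (rate * \<bar>y\<bar>) \<partial>gauss t)"
      by (rule convol_bound[OF rate_nonneg M eb[OF bp(1)]]) (rule unfold_bound[OF B bp(1-3)])
    then show ?thesis using p by (simp add: fold_def)
  qed
  then show "bounded ((\<lambda>p. \<integral>q. heat_kernel t p q * f q \<partial>volume) ` points)"
    using val by (auto simp: bounded_iff)
qed

section \<open>Existence, and the Feller property of every heat semigroup\<close>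

lemma heat_semigroup_heat: "heat_semigroup heat"
  by (simp add: heat_semigroup_def heat_C0_semigroup heat_generator)

lemma heat_semigroup_feller:
  assumes T: "heat_semigroup T"
  shows "feller_semigroup T"
proof -
  have "C0_semigroup T" using T by (simp add: heat_semigroup_def)
  moreover have "(\<forall>t\<ge>0. \<forall>f\<in>C0. (\<forall>p. 0 \<le> f p) \<longrightarrow> (\<forall>p. 0 \<le> T t f p))
      \<and> (\<forall>t\<ge>0. \<forall>f\<in>C0. sup_norm (T t f) \<le> sup_norm f)"
    using heat_feller heat_unique[OF T] unfolding feller_semigroup_def by simp
  ultimately show ?thesis unfolding feller_semigroup_def by blast
qed

end

theorem corollary5p4:
  fixes G :: "('v, 'e) pre_digraph" and len cond :: "'e \<Rightarrow> real"
  assumes "metric_graph G len cond"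
  shows "(\<exists>T. metric_graph.heat_semigroup G len cond T)
       \<and> (\<forall>T. metric_graph.heat_semigroup G len cond T \<longrightarrow>
              metric_graph.feller_semigroup G len T \<and> metric_graph.strong_feller G len T)"
proof -
  interpret metric_graph G len cond by fact
  show ?thesis
    using heat_semigroup_heat heat_semigroup_feller heat_strong_feller by blast
qed

end
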